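(* For every $\alpha>0$ there is a constant $C(\alpha)$, depending only on $\alpha$, such that the following holds. Let $n\ge2$ and let $K$ be an origin-symmetric convex body in $\mathbb{R}^n$. Assume that there exist isometries $U_1,\ldots,U_m\in\mathcal{O}_n(K)$ and coefficients $c_1,\ldots,c_m>0$ such that, setting $E_i=\mathrm{Fix}(U_i)^\perp$, $$\sum_{i=1}^m c_iP_{E_i}=P_E$$ for some subspace $E\subset\mathbb{R}^n$. If the codimension $d$ of $E$ verifies $d\le\alpha n/\log n$, then $$L_K\le C(\alpha)\max_i L\big(\dim(E_i)\big).$$
   Context: $\mathcal{O}_n$ is the group of linear isometries of $\mathbb{R}^n$, $\mathcal{O}_n(K)=\{R\in\mathcal{O}_n: RK=K\}$, $\mathrm{Fix}(U)=\{x:Ux=x\}$, and $P_F$ is the orthogonal projection onto a subspace $F$. The isotropy constant of a convex body $K\subset\mathbb{R}^n$ is the positive number $L_K$ defined by $$L_K^2=\inf_{T}\frac{1}{|TK|^{1+\frac2n}}\int_{TK}\frac{|x|^2}{n}\,dx,$$ where the infimum is over all invertible affine maps $T$ of $\mathbb{R}^n$ and $|\cdot|$ of a set denotes Lebesgue measure. $L(k)$ denotes the supremum of the isotropy constants of all convex bodies in $\mathbb{R}^k$. *)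

theory Defs
  imports "HOL-Analysis.Analysis" "HOL-Library.Function_Algebras"
begin

text \<open>
  The dimension \<open>n\<close> is quantified inside the statement, so \<open>\<real>\<^sup>n\<close> cannot be a type
  depending on \<open>n\<close>. It is the carrier of the library's \<^const>\<open>Euclidean_space\<close>: the
  sequences \<open>x :: nat \<Rightarrow> real\<close> with \<open>x i = 0\<close> for all \<open>i \<ge> n\<close>. The pointwise vector space
  structure makes the library's \<^const>\<open>convex\<close>, \<^const>\<open>subspace\<close> and \<^const>\<open>dim\<close>
  available for it.
\<close>

instantiation "fun" :: (type, real_vector) real_vector
begin

definition scaleR_fun_def: "scaleR c f = (\<lambda>x. scaleR c (f x))"

instance
  by standard (simp_all add: scaleR_fun_def fun_eq_iff scaleR_add_right scaleR_add_left)

end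

abbreviation Rn :: "nat \<Rightarrow> (nat \<Rightarrow> real) set" where
  "Rn n \<equiv> topspace (Euclidean_space n)"

definition dot :: "nat \<Rightarrow> (nat \<Rightarrow> real) \<Rightarrow> (nat \<Rightarrow> real) \<Rightarrow> real" where
  "dot n x y = (\<Sum>i<n. x i * y i)"

text \<open>
  Lebesgue measure on the Borel sets of \<open>\<real>\<^sup>n\<close>, extended by zero to the Borel sets of all
  sequences. The elements of the product space \<^term>\<open>Pi\<^sub>M {..<n} (\<lambda>_. lborel)\<close> are
  \<^const>\<open>undefined\<close> from index \<open>n\<close> on; the map replaces these entries by \<open>0\<close>.
\<close>

definition lebesgue_Rn :: "nat \<Rightarrow> (nat \<Rightarrow> real) measure" where
  "lebesgue_Rn n =
     distr (Pi\<^sub>M {..<n} (\<lambda>_. lborel :: real measure)) borel (\<lambda>x i. if i < n then x i else 0)"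

text \<open>Maps on \<open>\<real>\<^sup>n\<close> are constrained (and used) on the carrier only.\<close>

definition linear_Rn :: "nat \<Rightarrow> ((nat \<Rightarrow> real) \<Rightarrow> nat \<Rightarrow> real) \<Rightarrow> bool" where
  "linear_Rn n A \<longleftrightarrow>
     A \<in> Rn n \<rightarrow> Rn n \<and>
     (\<forall>x\<in>Rn n. \<forall>y\<in>Rn n. A (x + y) = A x + A y) \<and>
     (\<forall>c. \<forall>x\<in>Rn n. A (c *\<^sub>R x) = c *\<^sub>R A x)"

definition invertible_affine_Rn :: "nat \<Rightarrow> ((nat \<Rightarrow> real) \<Rightarrow> nat \<Rightarrow> real) \<Rightarrow> bool" where
  "invertible_affine_Rn n T \<longleftrightarrow>
     (\<exists>A. \<exists>b\<in>Rn n. linear_Rn n A \<and> bij_betw A (Rn n) (Rn n) \<and> (\<forall>x\<in>Rn n. T x = A x + b))"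

definition orthogonal_group :: "nat \<Rightarrow> ((nat \<Rightarrow> real) \<Rightarrow> nat \<Rightarrow> real) set" where
  "orthogonal_group n = {R. linear_Rn n R \<and> (\<forall>x\<in>Rn n. dot n (R x) (R x) = dot n x x)}"

definition isometry_group ::
    "nat \<Rightarrow> (nat \<Rightarrow> real) set \<Rightarrow> ((nat \<Rightarrow> real) \<Rightarrow> nat \<Rightarrow> real) set" where
  "isometry_group n K = {R \<in> orthogonal_group n. R ` K = K}"

definition Fix :: "nat \<Rightarrow> ((nat \<Rightarrow> real) \<Rightarrow> nat \<Rightarrow> real) \<Rightarrow> (nat \<Rightarrow> real) set" where
  "Fix n U = {x \<in> Rn n. U x = x}"

definition orth_complement :: "nat \<Rightarrow> (nat \<Rightarrow> real) set \<Rightarrow> (nat \<Rightarrow> real) set" where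
  "orth_complement n F = {x \<in> Rn n. \<forall>y\<in>F. dot n x y = 0}"

definition orth_proj :: "nat \<Rightarrow> (nat \<Rightarrow> real) set \<Rightarrow> (nat \<Rightarrow> real) \<Rightarrow> (nat \<Rightarrow> real)" where
  "orth_proj n F x = (THE y. y \<in> F \<and> x - y \<in> orth_complement n F)"

definition convex_body :: "nat \<Rightarrow> (nat \<Rightarrow> real) set \<Rightarrow> bool" where
  "convex_body n K \<longleftrightarrow>
     convex K \<and> compactin (Euclidean_space n) K \<and> (Euclidean_space n) interior_of K \<noteq> {}"

definition isotropy_constant :: "nat \<Rightarrow> (nat \<Rightarrow> real) set \<Rightarrow> real" where
  "isotropy_constant n K =
     sqrt (INF T\<in>{T. invertible_affine_Rn n T}.
       1 / measure (lebesgue_Rn n) (T ` K) powr (1 + 2 / real n) *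
       (LINT x:T ` K|lebesgue_Rn n. dot n x x / real n))"

text \<open>
  The isotropy constant is not defined for \<open>k = 0\<close>, but \<open>L 0\<close> occurs if one of the isometries
  is the identity. As the cube has isotropy constant \<open>1 / sqrt 12\<close> in every dimension
  \<open>k \<ge> 1\<close>, this value at \<open>0\<close> never changes a maximum involving some \<open>L k\<close> with \<open>k \<ge> 1\<close>.
\<close>

definition max_isotropy :: "nat \<Rightarrow> ereal" where
  "max_isotropy k =
     (if k = 0 then ereal (1 / sqrt 12)
      else (SUP K\<in>{K. convex_body k K}. ereal (isotropy_constant k K)))"

end

theory Submission
  imports Defs "HOL-Probability.Probability"
begin

text \<open>
  \<^bold>\<open>Why the theorem holds.\<close> Put \<open>K\<close> into isotropic position. An isometry \<open>U\<close> of \<open>K\<close> preserves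
  its covariance form, so \<open>Fix U\<close> and its orthogonal complement \<open>E\<close> are orthogonal for this form
  too (\<open>cov_Fix_orthogonal\<close>). Hence coordinates adapted to one such splitting and coordinates
  adapted to another both make \<open>K\<close> isotropic, and they differ by an orthogonal map. In particular
  the decomposition of \<open>P\<^sub>F\<close> survives as a decomposition of the isotropic image \<open>K'\<close>. Taking
  complements in it and adding the coordinates along \<open>F\<close> turns it into a decomposition of the
  identity by the projections onto the fixed spaces and onto \<open>F\<close>.

  To these projections the geometric Brascamp--Lieb inequality applies
  (\<open>geometric_brascamp_lieb\<close>): with \<open>\<sigma>\<close> the sum of the coefficients \<open>c i\<close>,
  \<open>|K'| powr \<sigma> \<le> (\<Prod>i. V i powr c i) * V 0\<close>,
  where \<open>V i\<close> is the volume of the projection of \<open>K'\<close> to the \<open>i\<close>-th fixed space and \<open>V 0\<close> the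
  volume of its projection to \<open>F\<close>. Three facts bound the right-hand side.

  \<^item> The projection to a fixed space is the section by it (\<open>fixed_part_in_body\<close>).
  \<^item> A section by a subspace of codimension \<open>k\<close> of an isotropic body has volume at most
    \<open>(200 * L) ^ k * |K'|\<close>, where \<open>L\<close> bounds the isotropy constants of bodies in dimension \<open>k\<close>
    (\<open>central_section_le\<close>). The reason is Ball's construction: the volumes of the fibres of \<open>K'\<close>
    over the complementary space form a log-concave density, and from it one builds a convex body
    there whose covariance is a multiple of the identity (\<open>convex_body_ball_body\<close>,
    \<open>ball_body_moment\<close>). The volume of this body is bounded in terms of the volumes of the section
    and of \<open>K'\<close>, so its isotropy constant bounds their ratio.
  \<^item> The projection to \<open>F\<close> is at most \<open>9 * n powr (3 * d / 2)\<close> times as large as \<open>K'\<close>, because \<open>K'\<close>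
    contains the unit ball (\<open>isotropic_projection\<close>).

  Taking traces gives \<open>(\<Sum>i. c i * dim (E i)) = dim F \<le> n\<close>. After cancelling, \<open>1 / |K'|\<close> is at
  most \<open>9 * n powr (3 * d / 2) * (200 * L) ^ n\<close>. Its \<open>n\<close>-th root bounds the isotropy constant,
  and \<open>d * ln n \<le> \<alpha> * n\<close> keeps the factor \<open>n powr (3 * d / (2 * n))\<close> below \<open>exp (3 * \<alpha> / 2)\<close>.
\<close>

abbreviation (input) borel_maps :: "('a::topological_space \<Rightarrow> 'b::topological_space) set" where
  "borel_maps \<equiv> borel_measurable borel"

abbreviation (input) lint1 :: "(real \<Rightarrow> ennreal) \<Rightarrow> ennreal" where
  "lint1 f \<equiv> nn_integral lborel f"

type_synonym vec = "nat \<Rightarrow> real"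

abbreviation (input) leb :: "nat \<Rightarrow> vec measure" where
  "leb \<equiv> lebesgue_Rn"

abbreviation (input) lint :: "nat \<Rightarrow> (vec \<Rightarrow> ennreal) \<Rightarrow> ennreal" where
  "lint n f \<equiv> nn_integral (leb n) f"

section \<open>Lebesgue measure on the space of sequences supported below n\<close>

lemma Rn_iff: "x \<in> Rn n \<longleftrightarrow> (\<forall>i\<ge>n. x i = 0)"
  by (simp add: topspace_Euclidean_space)

lemma subspace_Rn: "subspace (Rn n)"
  by (auto simp: subspace_def Rn_iff scaleR_fun_def)

lemmas Rn_zero = subspace_0[OF subspace_Rn] and Rn_add = subspace_add[OF subspace_Rn]
  and Rn_scaleR = subspace_scale[OF subspace_Rn] and Rn_diff = subspace_diff[OF subspace_Rn]
  and Rn_uminus = subspace_neg[OF subspace_Rn]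

lemma measurable_coord [measurable]: "(\<lambda>x::nat\<Rightarrow>real. x i) \<in> borel_maps"
  by (rule borel_measurable_continuous_onI) (auto intro: continuous_on_product_coordinates)

lemma measurable_vecI:
  fixes f :: "'a \<Rightarrow> vec"
  assumes "\<And>i. (\<lambda>x. f x i) \<in> borel_measurable M"
  shows "f \<in> borel_measurable M"
  using measurable_coordinatewise_then_product[of f M] assms by blast

lemma measurable_vec_add [measurable (raw)]:
  fixes f g :: "'a \<Rightarrow> vec"
  assumes [measurable]: "f \<in> borel_measurable M" "g \<in> borel_measurable M"
  shows "(\<lambda>x. f x + g x) \<in> borel_measurable M"
  by (rule measurable_vecI) (simp add: plus_fun_def)

lemma measurable_vec_diff [measurable (raw)]:
  fixes f g :: "'a \<Rightarrow> vec"
  assumes [measurable]: "f \<in> borel_measurable M" "g \<in> borel_measurable M"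
  shows "(\<lambda>x. f x - g x) \<in> borel_measurable M"
  by (rule measurable_vecI) simp

lemma measurable_vec_uminus [measurable (raw)]:
  fixes f g :: "'a \<Rightarrow> vec"
  assumes [measurable]: "f \<in> borel_measurable M"
  shows "(\<lambda>x. - f x) \<in> borel_measurable M"
  by (rule measurable_vecI) simp

lemma measurable_vec_scaleR [measurable (raw)]:
  fixes f :: "'a \<Rightarrow> vec"
  assumes [measurable]: "f \<in> borel_measurable M" "c \<in> borel_measurable M"
  shows "(\<lambda>x. c x *\<^sub>R f x) \<in> borel_measurable M"
  by (rule measurable_vecI) (simp add: scaleR_fun_def)

lemma measurable_vec_upd [measurable (raw)]:
  fixes f :: "'a \<Rightarrow> vec"
  assumes [measurable]: "f \<in> borel_measurable M" "c \<in> borel_measurable M"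
  shows "(\<lambda>x. (f x)(i := c x)) \<in> borel_measurable M"
proof (rule measurable_vecI)
  show "(\<lambda>x. ((f x)(i := c x)) j) \<in> borel_measurable M" for j
    by (cases "j = i") auto
qed

lemma measurable_dot [measurable (raw)]:
  assumes [measurable]: "f \<in> borel_measurable M" "g \<in> borel_measurable M"
  shows "(\<lambda>x. dot n (f x) (g x)) \<in> borel_measurable M"
  unfolding dot_def by measurable

definition pad :: "nat \<Rightarrow> vec \<Rightarrow> vec" where
  "pad n x = (\<lambda>i. if i < n then x i else 0)"

lemma pad_in_Rn [simp]: "pad n x \<in> Rn n"
  by (simp add: pad_def Rn_iff)

lemma pad_measurable_PiM [measurable]:
  "pad n \<in> measurable (Pi\<^sub>M {..<n} (\<lambda>_. lborel :: real measure)) borel"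
proof (rule measurable_vecI)
  show "(\<lambda>x. pad n x i) \<in> borel_measurable (Pi\<^sub>M {..<n} (\<lambda>_. lborel))" for i
    by (cases "i < n") (auto simp: pad_def intro!: measurable_compose[OF measurable_component_singleton])
qed

lemma pad_measurable [measurable]: "pad n \<in> borel_maps"
proof (rule measurable_vecI)
  show "(\<lambda>x. pad n x i) \<in> borel_maps" for i
    by (cases "i < n") (auto simp: pad_def)
qed

lemma lebesgue_Rn_alt: "leb n = distr (Pi\<^sub>M {..<n} (\<lambda>_. lborel :: real measure)) borel (pad n)"
  by (simp add: lebesgue_Rn_def pad_def[abs_def])

lemma sets_lebesgue_Rn [simp, measurable_cong]: "sets (leb n) = sets borel"
  and space_lebesgue_Rn [simp]: "space (leb n) = UNIV"
  by (simp_all add: lebesgue_Rn_alt)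

lemma Rn_borel [measurable]: "Rn n \<in> sets borel"
proof -
  have "Rn n = {x\<in>space borel. \<forall>i\<in>{n..}. x i = 0}"
    by (auto simp: Rn_iff)
  also have "... \<in> sets borel"
    by measurable
  finally show ?thesis .
qed

lemma AE_Rn: "AE x in leb n. x \<in> Rn n"
  unfolding lebesgue_Rn_alt by (subst AE_distr_iff) auto

lemma nn_integral_Rn_0: "f \<in> borel_maps \<Longrightarrow> lint 0 (\<lambda>x. f x) = f (\<lambda>_. 0)"
proof -
  interpret product_sigma_finite "\<lambda>_::nat. lborel :: real measure" ..
  assume [measurable]: "f \<in> borel_maps"
  have [measurable]: "pad 0 \<in> measurable (Pi\<^sub>M {} (\<lambda>_::nat. lborel :: real measure)) borel"
    using pad_measurable_PiM[of 0] by simp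
  have "lint 0 (\<lambda>x. f x) = (\<integral>\<^sup>+x. f (pad 0 x) \<partial>Pi\<^sub>M {} (\<lambda>_. lborel :: real measure))"
    unfolding lebesgue_Rn_alt by (subst nn_integral_distr) auto
  also have "... = f (pad 0 (\<lambda>_. undefined))"
    by (simp add: PiM_empty nn_integral_count_space_finite)
  finally show ?thesis by (simp add: pad_def)
qed

lemma nn_integral_Rn_Suc:
  assumes [measurable]: "f \<in> borel_maps"
  shows "lint (Suc n) (\<lambda>x. f x) = lint n (\<lambda>x. lint1 (\<lambda>s. f (x(n := s))))"
proof -
  interpret product_sigma_finite "\<lambda>_::nat. lborel :: real measure" ..
  have [measurable]: "pad (Suc n) \<in> measurable (Pi\<^sub>M (insert n {..<n}) (\<lambda>_. lborel :: real measure)) borel"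
    using pad_measurable_PiM[of "Suc n"] by (simp add: lessThan_Suc)
  have "lint (Suc n) (\<lambda>x. f x) = (\<integral>\<^sup>+x. f (pad (Suc n) x) \<partial>Pi\<^sub>M (insert n {..<n}) (\<lambda>_. lborel :: real measure))"
    unfolding lebesgue_Rn_alt by (subst nn_integral_distr) (auto simp: lessThan_Suc)
  also have "... = (\<integral>\<^sup>+x. \<integral>\<^sup>+s. f (pad (Suc n) (x(n := s))) \<partial>lborel \<partial>Pi\<^sub>M {..<n} (\<lambda>_. lborel :: real measure))"
    by (subst product_nn_integral_insert) auto
  also have "... = (\<integral>\<^sup>+x. \<integral>\<^sup>+s. f ((pad n x)(n := s)) \<partial>lborel \<partial>Pi\<^sub>M {..<n} (\<lambda>_. lborel :: real measure))"
    by (intro nn_integral_cong arg_cong[where f=f]) (auto simp: pad_def fun_eq_iff)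
  also have "... = lint n (\<lambda>x. lint1 (\<lambda>s. f (x(n := s))))"
    unfolding lebesgue_Rn_alt by (subst nn_integral_distr) auto
  finally show ?thesis .
qed

lemma nn_integral_Rn_prod:
  fixes f :: "nat \<Rightarrow> real \<Rightarrow> ennreal"
  assumes [measurable]: "\<And>i. f i \<in> borel_maps"
  shows "lint n (\<lambda>x. (\<Prod>i<n. f i (x i))) = (\<Prod>i<n. lint1 (\<lambda>s. f i s))"
proof (induction n)
  case 0
  then show ?case using nn_integral_Rn_0[of "\<lambda>_. 1"] by simp
next
  case (Suc n)
  have "(\<Prod>i<n. f i (if i = n then s else x i)) = (\<Prod>i<n. f i (x i))" for x s
    by (rule prod.cong) auto
  then show ?case
    by (simp add: nn_integral_Rn_Suc nn_integral_cmult nn_integral_multc Suc)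
qed

definition cube :: "nat \<Rightarrow> real \<Rightarrow> vec set" where
  "cube n r = {x. \<forall>i<n. \<bar>x i\<bar> \<le> r}"

lemma cube_borel [measurable]: "cube n r \<in> sets borel"
proof -
  have "cube n r = {x\<in>space borel. \<forall>i\<in>{..<n}. \<bar>x i\<bar> \<le> r}"
    by (auto simp: cube_def)
  also have "... \<in> sets borel"
    by measurable
  finally show ?thesis .
qed

lemma emeasure_cube: "r \<ge> 0 \<Longrightarrow> emeasure (leb n) (cube n r) = ennreal ((2 * r) ^ n)"
proof -
  assume r: "r \<ge> 0"
  have "indicator (cube n r) x = (\<Prod>i<n. indicator {-r..r} (x i) :: ennreal)" for x
  proof (cases "x \<in> cube n r")
    case True
    then have "(\<Prod>i<n. indicator {-r..r} (x i) :: ennreal) = (\<Prod>i<n. 1)"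
      by (intro prod.cong) (auto simp: cube_def indicator_def abs_le_iff)
    with True show ?thesis by simp
  next
    case False
    then obtain i where "i < n" "\<not> \<bar>x i\<bar> \<le> r" by (auto simp: cube_def)
    then have "(\<Prod>i<n. indicator {-r..r} (x i) :: ennreal) = 0"
      by (intro prod_zero) (auto intro!: bexI[of _ i] simp: indicator_def)
    with False show ?thesis by simp
  qed
  then have "lint n (\<lambda>x. indicator (cube n r) x) = (\<Prod>i<n. lint1 (\<lambda>s. indicator {-r..r} s))"
    by (simp only:, intro nn_integral_Rn_prod) auto
  then have "emeasure (leb n) (cube n r) = (\<Prod>i<n. lint1 (\<lambda>s. indicator {-r..r} s))"
    by (simp only: nn_integral_indicator cube_borel sets_lebesgue_Rn)
  also have "... = ennreal ((2 * r) ^ n)"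
    using r by (simp add: ennreal_power)
  finally show ?thesis .
qed

interpretation Rn: sigma_finite_measure "leb n" for n
proof
  show "\<exists>A. countable A \<and> A \<subseteq> sets (leb n) \<and> \<Union>A = space (leb n) \<and>
      (\<forall>a\<in>A. emeasure (leb n) a \<noteq> \<infinity>)"
  proof (intro exI[of _ "range (\<lambda>m::nat. cube n (real m))"] conjI ballI)
    have "\<exists>m::nat. x \<in> cube n (real m)" for x
    proof -
      obtain m :: nat where m: "(\<Sum>i<n. \<bar>x i\<bar>) \<le> real m"
        using real_arch_simple by blast
      have "\<bar>x i\<bar> \<le> (\<Sum>i<n. \<bar>x i\<bar>)" if "i < n" for i
        by (rule member_le_sum) (use that in auto)
      then have "x \<in> cube n (real m)" using m by (force simp: cube_def)
      then show ?thesis ..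
    qed
    then show "\<Union> (range (\<lambda>m::nat. cube n (real m))) = space (leb n)" by auto
  qed (auto simp: emeasure_cube)
qed

interpretation RnRn: pair_sigma_finite "leb n" "leb m" for n m
  by standard

interpretation Rnborel: pair_sigma_finite "leb n" "lborel :: real measure" for n
  by standard

lemma nn_integral_Rn_translate:
  fixes f :: "vec \<Rightarrow> ennreal"
  assumes [measurable]: "f \<in> borel_maps" and "b \<in> Rn n"
  shows "lint n (\<lambda>x. f (x + b)) = lint n (\<lambda>x. f x)"
  using assms
proof (induction n arbitrary: f b)
  case 0
  then have "b = (\<lambda>_. 0)" by (auto simp: Rn_iff)
  then show ?case by (simp add: plus_fun_def)
next
  case (Suc n)
  note [measurable] = Suc.prems(1)
  define b' where "b' = b(n := 0)"
  have b': "b' \<in> Rn n" using Suc.prems by (auto simp: Rn_iff b'_def)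
  have eq: "x(n := s) + b = (x + b')(n := s + b n)" for x :: vec and s
    by (auto simp: b'_def fun_eq_iff)
  have "lint (Suc n) (\<lambda>x. f (x + b)) = lint n (\<lambda>x. lint1 (\<lambda>s. f (x(n := s) + b)))"
    by (rule nn_integral_Rn_Suc) measurable
  also have "... = lint n (\<lambda>x. lint1 (\<lambda>s. f ((x + b')(n := b n + 1 * s))))"
    unfolding eq by (simp add: add.commute)
  also have "... = lint n (\<lambda>x. lint1 (\<lambda>s. f ((x + b')(n := s))))"
  proof (rule nn_integral_cong)
    show "(lint1 (\<lambda>s. f ((x + b')(n := b n + 1 * s)))) = (lint1 (\<lambda>s. f ((x + b')(n := s))))" for x
      using nn_integral_real_affine[where c=1 and t="b n" and f="\<lambda>s. f ((x + b')(n := s))"] by simp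
  qed
  also have "... = lint n (\<lambda>x. lint1 (\<lambda>s. f (x(n := s))))"
    using Suc.IH[OF _ b', of "\<lambda>x. \<integral>\<^sup>+s. f (x(n := s)) \<partial>lborel"] by (simp add: plus_fun_def)
  also have "... = lint (Suc n) (\<lambda>x. f x)"
    by (rule nn_integral_Rn_Suc[symmetric]) measurable
  finally show ?case by (simp add: plus_fun_def)
qed

lemma nn_integral_Rn_scaleR:
  fixes f :: "vec \<Rightarrow> ennreal"
  assumes [measurable]: "f \<in> borel_maps" and c: "c > 0"
  shows "ennreal (c ^ n) * lint n (\<lambda>x. f (c *\<^sub>R x)) = lint n (\<lambda>x. f x)"
  using assms(1)
proof (induction n arbitrary: f)
  case 0
  note [measurable] = 0
  show ?case
  proof -
    have "lint 0 (\<lambda>x. f (c *\<^sub>R x)) = f (c *\<^sub>R (\<lambda>_. 0))"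
      by (rule nn_integral_Rn_0) measurable
    then show ?thesis
      using nn_integral_Rn_0[of f] by (simp add: scaleR_fun_def)
  qed
next
  case (Suc n)
  note [measurable] = Suc.prems(1)
  have eq: "c *\<^sub>R (x(n := s)) = (c *\<^sub>R x)(n := 0 + c * s)" for x :: vec and s
    by (auto simp: scaleR_fun_def fun_eq_iff)
  have "ennreal (c ^ Suc n) * lint (Suc n) (\<lambda>x. f (c *\<^sub>R x)) =
      ennreal (c ^ n) * lint n (\<lambda>x. ennreal \<bar>c\<bar> * (lint1 (\<lambda>s. f ((c *\<^sub>R x)(n := 0 + c * s)))))"
    using c by (simp add: nn_integral_Rn_Suc eq ennreal_mult' nn_integral_cmult mult.assoc mult.left_commute)
  also have "... = ennreal (c ^ n) * lint n (\<lambda>x. (lint1 (\<lambda>s. f ((c *\<^sub>R x)(n := s)))))"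
    by (intro arg_cong[where f="\<lambda>u. ennreal (c ^ n) * u"] nn_integral_cong,
        rule nn_integral_real_affine[symmetric]) (use c in auto)
  also have "... = lint n (\<lambda>x. (lint1 (\<lambda>s. f (x(n := s)))))"
    by (rule Suc.IH) measurable
  finally show ?case by (simp add: nn_integral_Rn_Suc)
qed

definition join :: "nat \<Rightarrow> vec \<Rightarrow> vec \<Rightarrow> vec" where
  "join k x z = (\<lambda>i. if i < k then x i else z (i - k))"

lemma measurable_join [measurable (raw)]:
  assumes [measurable]: "f \<in> borel_measurable M" "g \<in> borel_measurable M"
  shows "(\<lambda>x. join k (f x) (g x)) \<in> borel_measurable M"
proof (rule measurable_vecI)
  show "(\<lambda>x. join k (f x) (g x) i) \<in> borel_measurable M" for i
    by (cases "i < k") (auto simp: join_def)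
qed

lemma nn_integral_Rn_join:
  fixes f :: "vec \<Rightarrow> ennreal"
  assumes [measurable]: "f \<in> borel_maps"
  shows "lint (k + d) (\<lambda>x. f x) =
    lint k (\<lambda>x. lint d (\<lambda>z. f (join k x z)))"
  using assms
proof (induction d arbitrary: f)
  case 0
  note [measurable] = 0
  have *: "join k x (\<lambda>_. 0) = x" if "x \<in> Rn k" for x
    using that by (auto simp: join_def Rn_iff)
  have "lint k (\<lambda>x. lint 0 (\<lambda>z. f (join k x z))) = lint k (\<lambda>x. f (join k x (\<lambda>_. 0)))"
    by (simp add: nn_integral_Rn_0)
  also have "... = lint k (\<lambda>x. f x)"
    by (intro nn_integral_cong_AE) (use AE_Rn[of k] in \<open>eventually_elim, simp add: *\<close>)
  finally show ?case by simp
next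
  case (Suc d)
  note [measurable] = Suc.prems
  have *: "(join k x z)(k + d := s) = join k x (z(d := s))" for x z s
    by (auto simp: join_def fun_eq_iff)
  show ?case
    by (simp add: nn_integral_Rn_Suc Suc.IH *)
qed

lemma join_in_Rn: "x \<in> Rn k \<Longrightarrow> z \<in> Rn d \<Longrightarrow> join k x z \<in> Rn (k + d)"
  by (auto simp: join_def Rn_iff)

lemma dot_join: "dot (k + d) (join k x z) (join k x' z') = dot k x x' + dot d z z'"
proof (induction d)
  case 0
  show ?case by (auto simp: dot_def join_def)
next
  case (Suc d)
  then show ?case by (simp add: dot_def join_def)
qed

subsection \<open>Algebra of the inner product\<close>

lemma dot_add_left: "dot n (x + y) z = dot n x z + dot n y z"
  and dot_add_right: "dot n z (x + y) = dot n z x + dot n z y"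
  and dot_diff_left: "dot n (x - y) z = dot n x z - dot n y z"
  and dot_diff_right: "dot n z (x - y) = dot n z x - dot n z y"
  and dot_scaleR_left: "dot n (c *\<^sub>R x) z = c * dot n x z"
  and dot_scaleR_right: "dot n z (c *\<^sub>R x) = c * dot n z x"
  and dot_uminus_left: "dot n (- x) z = - dot n x z"
  and dot_uminus_right: "dot n z (- x) = - dot n z x"
  by (simp_all add: dot_def algebra_simps sum.distrib sum_subtractf sum_negf scaleR_fun_def sum_distrib_left)

lemmas dot_simps = dot_add_left dot_add_right dot_diff_left dot_diff_right dot_scaleR_left
  dot_scaleR_right dot_uminus_left dot_uminus_right

lemma dot_zero [simp]: "dot n 0 x = 0" "dot n x 0 = 0"
  by (simp_all add: dot_def)

lemma dot_commute: "dot n x y = dot n y x"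
  by (simp add: dot_def mult.commute)

lemma dot_nonneg [simp]: "dot n x x \<ge> 0"
  by (auto simp: dot_def intro: sum_nonneg)

lemma dot_eq_0_iff: "x \<in> Rn n \<Longrightarrow> dot n x x = 0 \<longleftrightarrow> x = 0"
proof
  assume x: "x \<in> Rn n" "dot n x x = 0"
  then have "\<forall>i\<in>{..<n}. x i * x i = 0"
    unfolding dot_def by (subst (asm) sum_nonneg_eq_0_iff) auto
  with x show "x = 0" by (auto simp: Rn_iff fun_eq_iff not_less[symmetric])
qed auto

lemma sum_fun_apply: "(\<Sum>i\<in>I. f i) x = (\<Sum>i\<in>I. f i x)" for f :: "'b \<Rightarrow> 'a \<Rightarrow> 'c::comm_monoid_add"
  by (induction I rule: infinite_finite_induct) auto

lemma dot_sum_left: fixes f :: "'b \<Rightarrow> vec" shows "dot n (\<Sum>i\<in>I. f i) y = (\<Sum>i\<in>I. dot n (f i) y)"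
  unfolding dot_def sum_fun_apply sum_distrib_right by (rule sum.swap)

lemma dot_sum_right: fixes f :: "'b \<Rightarrow> vec" shows "dot n y (\<Sum>i\<in>I. f i) = (\<Sum>i\<in>I. dot n y (f i))"
  by (simp add: dot_commute[of n y] dot_sum_left)

lemma dot_Cauchy_Schwarz: "(dot n x y)\<^sup>2 \<le> dot n x x * dot n y y"
  unfolding dot_def using Cauchy_Schwarz_ineq_sum[of x y "{..<n}"] by (simp add: power2_eq_square)

definition unit_vec :: "nat \<Rightarrow> vec" where
  "unit_vec i = (\<lambda>j. if j = i then 1 else 0)"

lemma unit_vec_in_Rn: "i < n \<Longrightarrow> unit_vec i \<in> Rn n"
  by (auto simp: unit_vec_def Rn_iff)

lemma dot_unit_vec: "i < n \<Longrightarrow> dot n x (unit_vec i) = x i" "i < n \<Longrightarrow> dot n (unit_vec i) x = x i"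
  by (simp_all add: dot_def unit_vec_def if_distrib if_distribR cong: if_cong)

lemma Rn_expand: "x \<in> Rn n \<Longrightarrow> x = (\<Sum>i<n. x i *\<^sub>R unit_vec i)"
  by (auto simp: fun_eq_iff sum_fun_apply scaleR_fun_def unit_vec_def Rn_iff if_distrib not_less cong: if_cong)

section \<open>Linear maps\<close>

lemma linear_RnD:
  assumes "linear_Rn n A"
  shows linear_Rn_in: "x \<in> Rn n \<Longrightarrow> A x \<in> Rn n"
    and linear_Rn_add: "x \<in> Rn n \<Longrightarrow> y \<in> Rn n \<Longrightarrow> A (x + y) = A x + A y"
    and linear_Rn_scaleR: "x \<in> Rn n \<Longrightarrow> A (c *\<^sub>R x) = c *\<^sub>R A x"
  using assms by (auto simp: linear_Rn_def Pi_iff)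

lemma linear_Rn_zero: "linear_Rn n A \<Longrightarrow> A 0 = 0"
  using linear_Rn_scaleR[of n A 0 0] Rn_zero by simp

lemma linear_Rn_uminus: "linear_Rn n A \<Longrightarrow> x \<in> Rn n \<Longrightarrow> A (- x) = - A x"
  using linear_Rn_scaleR[of n A x "-1"] by simp

lemma linear_Rn_diff: "linear_Rn n A \<Longrightarrow> x \<in> Rn n \<Longrightarrow> y \<in> Rn n \<Longrightarrow> A (x - y) = A x - A y"
  using linear_Rn_add[of n A x "- y"] linear_Rn_uminus[of n A y] subspace_neg[OF subspace_Rn, of y n]
  by simp

lemma Rn_sum: "(\<And>i. i \<in> I \<Longrightarrow> f i \<in> Rn n) \<Longrightarrow> (\<Sum>i\<in>I. f i) \<in> Rn n"
  using subspace_sum[OF subspace_Rn] by blast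

lemma linear_Rn_sum:
  fixes f :: "'a \<Rightarrow> vec"
  assumes A: "linear_Rn n A" and "finite I" "\<And>i. i \<in> I \<Longrightarrow> f i \<in> Rn n"
  shows "A (\<Sum>i\<in>I. f i) = (\<Sum>i\<in>I. A (f i))"
  using assms(2,3)
proof (induction I rule: finite_induct)
  case empty
  then show ?case using linear_Rn_zero[OF A] by (simp add: zero_fun_def)
next
  case (insert i I)
  have "A (\<Sum>j\<in>insert i I. f j) = A (f i + (\<Sum>j\<in>I. f j))"
    using insert by simp
  also have "... = A (f i) + A (\<Sum>j\<in>I. f j)"
    using insert by (intro linear_Rn_add[OF A] Rn_sum) auto
  finally have "A (\<Sum>j\<in>insert i I. f j) = (\<Sum>j\<in>insert i I. A (f j))"
    using insert by simp
  then show ?case by simp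
qed

text \<open>Extends a linear map of the carrier to a linear map of all sequences.\<close>

text \<open>
  The library notions of linearity and measurability concern total functions; this is the linear
  extension by zero of a map that is specified on the carrier only.
\<close>

definition ext :: "nat \<Rightarrow> (vec \<Rightarrow> vec) \<Rightarrow> vec \<Rightarrow> vec" where
  "ext n A x = (\<Sum>i<n. x i *\<^sub>R A (unit_vec i))"

lemma ext_eq: "linear_Rn n A \<Longrightarrow> x \<in> Rn n \<Longrightarrow> ext n A x = A x"
proof -
  assume A: "linear_Rn n A" and x: "x \<in> Rn n"
  have "A x = A (\<Sum>i<n. x i *\<^sub>R unit_vec i)"
    using Rn_expand[OF x] by simp
  also have "... = (\<Sum>i<n. A (x i *\<^sub>R unit_vec i))"
    by (rule linear_Rn_sum[OF A]) (simp_all add: Rn_scaleR unit_vec_in_Rn)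
  also have "... = ext n A x"
    unfolding ext_def by (rule sum.cong) (auto simp: linear_Rn_scaleR[OF A] unit_vec_in_Rn)
  finally show ?thesis by simp
qed

lemma ext_in_Rn: "linear_Rn n A \<Longrightarrow> ext n A x \<in> Rn n"
  unfolding ext_def
  by (rule Rn_sum, rule Rn_scaleR) (simp add: linear_Rn_in unit_vec_in_Rn)

lemma linear_ext: "linear (ext n A)"
  by (intro linearI)
     (simp_all add: ext_def scaleR_left_distrib sum.distrib scaleR_sum_right, simp add: scaleR_fun_def)

lemma ext_measurable [measurable]: "ext n A \<in> borel_maps"
proof (rule measurable_vecI)
  show "(\<lambda>x. ext n A x i) \<in> borel_maps" for i
    unfolding ext_def sum_fun_apply scaleR_fun_def by measurable
qed

lemma continuous_ext: "continuous_on S (ext n A)"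
  unfolding continuous_on_coordinatewise_iff ext_def sum_fun_apply scaleR_fun_def
  by (auto intro!: continuous_intros continuous_on_subset[OF continuous_on_product_coordinates])

lemma linear_Rn_ext: "linear_Rn n A \<Longrightarrow> linear_Rn n (ext n A)"
  using linear_ext[of n A] ext_in_Rn[of n A]
  by (auto simp: linear_Rn_def linear_add linear_scale)

lemma linear_Rn_bij:
  assumes A: "linear_Rn n A" and inj: "\<And>x. x \<in> Rn n \<Longrightarrow> A x = 0 \<Longrightarrow> x = 0"
  shows "bij_betw A (Rn n) (Rn n)"
proof -
  let ?e = "unit_vec ` {..<n} :: vec set"
  have span: "Rn n = span ?e"
  proof
    show "Rn n \<subseteq> span ?e"
    proof
      fix x :: vec assume "x \<in> Rn n"
      then have "x = (\<Sum>i<n. x i *\<^sub>R unit_vec i)" by (rule Rn_expand)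
      also have "... \<in> span ?e"
        by (intro span_sum span_scale span_base) auto
      finally show "x \<in> span ?e" .
    qed
    show "span ?e \<subseteq> Rn n"
      by (rule span_minimal[OF _ subspace_Rn]) (auto intro: unit_vec_in_Rn)
  qed
  have inj_e: "inj_on unit_vec {..<n}"
    by (auto simp: inj_on_def unit_vec_def fun_eq_iff split: if_splits)
  have ind_e: "independent ?e"
  proof (rule independent_if_scalars_zero)
    fix f x assume s: "(\<Sum>x\<in>?e. f x *\<^sub>R x) = 0" and x: "x \<in> ?e"
    then obtain i where i: "i < n" "x = unit_vec i" by auto
    have "(\<Sum>j<n. f (unit_vec j) *\<^sub>R unit_vec j) = 0"
      using s by (subst (asm) sum.reindex[OF inj_e]) simp
    then have "dot n (\<Sum>j<n. f (unit_vec j) *\<^sub>R unit_vec j) (unit_vec i) = 0" by simp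
    then have "(\<Sum>j<n. f (unit_vec j) * unit_vec j i) = 0"
      using i by (simp add: dot_sum_left dot_scaleR_left dot_unit_vec)
    moreover have "(\<Sum>j<n. f (unit_vec j) * unit_vec j i) = (\<Sum>j<n. if j = i then f (unit_vec j) else 0)"
      by (rule sum.cong) (auto simp: unit_vec_def)
    ultimately show "f x = 0" using i by simp
  qed auto
  let ?L = "ext n A"
  have injL: "inj_on ?L (Rn n)"
  proof (rule inj_onI)
    fix x y assume xy: "x \<in> Rn n" "y \<in> Rn n" "?L x = ?L y"
    then have "A (x - y) = 0"
      using linear_Rn_diff[OF A] by (simp add: ext_eq[OF A])
    with inj[of "x - y"] Rn_diff xy show "x = y" by auto
  qed
  have "y \<in> ?L ` Rn n" if y: "y \<in> Rn n" for y
  proof (rule ccontr)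
    assume n: "y \<notin> ?L ` Rn n"
    have im: "?L ` Rn n = span (?L ` ?e)"
      using linear_span_image[OF linear_ext] span by metis
    have "independent (?L ` ?e)"
      using linear_independent_injective_image[OF linear_ext ind_e] injL span by simp
    then have "independent (insert y (?L ` ?e))"
      using n im by (intro independent_insertI) auto
    moreover have "insert y (?L ` ?e) \<subseteq> span ?e"
      using y span ext_in_Rn[OF A] by auto
    ultimately have "card (insert y (?L ` ?e)) \<le> card ?e"
      using independent_span_bound[of ?e] by auto
    moreover have "y \<notin> ?L ` ?e"
      using n im span_base by metis
    moreover have "card (?L ` ?e) = card ?e"
      using injL span by (intro card_image inj_on_subset[OF injL]) (auto intro: unit_vec_in_Rn)
    ultimately show False by simp
  qed
  then have "bij_betw ?L (Rn n) (Rn n)"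
    using injL ext_in_Rn[OF A] by (auto simp: bij_betw_def)
  then show ?thesis
    by (rule bij_betw_cong[THEN iffD1, rotated]) (simp add: ext_eq[OF A])
qed

lemma linear_Rn_inv:
  assumes A: "linear_Rn n A" and bij: "bij_betw A (Rn n) (Rn n)"
  obtains B where "linear_Rn n B" "\<And>x. x \<in> Rn n \<Longrightarrow> B (A x) = x" "\<And>x. x \<in> Rn n \<Longrightarrow> A (B x) = x"
    "B \<in> borel_maps"
proof -
  define B0 where "B0 = inv_into (Rn n) A"
  have B: "B0 x \<in> Rn n" "A (B0 x) = x" if "x \<in> Rn n" for x
    using that bij by (auto simp: B0_def bij_betw_def f_inv_into_f inv_into_into)
  have BA: "B0 (A x) = x" if "x \<in> Rn n" for x
    using that bij by (auto simp: B0_def bij_betw_def)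
  have lin: "linear_Rn n B0"
    unfolding linear_Rn_def
  proof (intro conjI ballI allI)
    fix x y assume xy: "x \<in> Rn n" "y \<in> Rn n"
    have "B0 (x + y) = B0 (A (B0 x + B0 y))"
      using xy B linear_Rn_add[OF A] by simp
    then show "B0 (x + y) = B0 x + B0 y"
      using BA[of "B0 x + B0 y"] B xy Rn_add by auto
  next
    fix c :: real and x :: vec assume x: "x \<in> Rn n"
    have "B0 (c *\<^sub>R x) = B0 (A (c *\<^sub>R B0 x))"
      using x B linear_Rn_scaleR[OF A] by simp
    then show "B0 (c *\<^sub>R x) = c *\<^sub>R B0 x"
      using BA[of "c *\<^sub>R B0 x"] B x Rn_scaleR by auto
  qed (use B in auto)
  show ?thesis
  proof
    show "linear_Rn n (ext n B0)" using linear_Rn_ext[OF lin] .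
    show "ext n B0 (A x) = x" if "x \<in> Rn n" for x
      using that ext_eq[OF lin] BA linear_Rn_in[OF A] by simp
    show "A (ext n B0 x) = x" if "x \<in> Rn n" for x
      using that ext_eq[OF lin] B by simp
  qed measurable
qed

section \<open>Linear changes of variables\<close>

lemma nn_integral_Rn_cong:
  assumes "\<And>x. x \<in> Rn n \<Longrightarrow> f x = g x"
  shows "lint n (\<lambda>x. f x) = lint n (\<lambda>x. g x)"
  by (rule nn_integral_cong_AE, rule eventually_mono[OF AE_Rn]) (rule assms)

text \<open>
  Evaluating \<open>\<integral>\<integral> g (x - A y) * h x\<close> in both orders is the
  classical proof that a translation invariant measure is unique up to a factor. It yields the
  Jacobian of a linear map as an unspecified positive constant, without determinants.
\<close>

lemma nn_integral_Rn_linear_aux: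
  fixes g h :: "vec \<Rightarrow> ennreal"
  assumes A: "linear_Rn n A" and [measurable]: "A \<in> borel_maps"
    and bij: "bij_betw A (Rn n) (Rn n)"
    and [measurable]: "g \<in> borel_maps" "h \<in> borel_maps"
  shows "lint n (\<lambda>x. g x) * lint n (\<lambda>y. h (A y)) =
    lint n (\<lambda>x. h x) * lint n (\<lambda>y. g (- A y))"
proof -
  let ?L = "leb n"
  have shift: "(\<integral>\<^sup>+y. f (A y + x) \<partial>?L) = (\<integral>\<^sup>+y. f (A y) \<partial>?L)"
    if [measurable]: "f \<in> borel_maps" and x: "x \<in> Rn n" for f :: "vec \<Rightarrow> ennreal" and x
  proof -
    obtain y0 where y0: "y0 \<in> Rn n" "A y0 = x"
      using bij_betw_imp_surj_on[OF bij] x by (metis imageE)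
    have "(\<integral>\<^sup>+y. f (A y + x) \<partial>?L) = (\<integral>\<^sup>+y. f (A (y + y0)) \<partial>?L)"
      by (rule nn_integral_Rn_cong) (simp add: y0 linear_Rn_add[OF A])
    also have "... = (\<integral>\<^sup>+y. f (A y) \<partial>?L)"
      by (rule nn_integral_Rn_translate[OF _ y0(1), of "\<lambda>y. f (A y)"]) measurable
    finally show ?thesis .
  qed
  have "(\<integral>\<^sup>+x. g x \<partial>?L) * (\<integral>\<^sup>+y. h (A y) \<partial>?L) = (\<integral>\<^sup>+x. (\<integral>\<^sup>+y. g x * h (A y) \<partial>?L) \<partial>?L)"
    by (simp add: nn_integral_cmult nn_integral_multc)
  also have "... = (\<integral>\<^sup>+x. (\<integral>\<^sup>+y. g x * h (A y + x) \<partial>?L) \<partial>?L)"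
    by (rule nn_integral_Rn_cong) (simp add: nn_integral_cmult shift)
  also have "... = (\<integral>\<^sup>+y. (\<integral>\<^sup>+x. g x * h (A y + x) \<partial>?L) \<partial>?L)"
    by (rule RnRn.Fubini') measurable
  also have "... = (\<integral>\<^sup>+y. (\<integral>\<^sup>+x. g (x - A y) * h x \<partial>?L) \<partial>?L)"
  proof (rule nn_integral_Rn_cong)
    fix y :: vec assume y: "y \<in> Rn n"
    have "(\<integral>\<^sup>+x. g ((x + A y) - A y) * h (x + A y) \<partial>?L) = (\<integral>\<^sup>+x. g (x - A y) * h x \<partial>?L)"
      by (rule nn_integral_Rn_translate[of "\<lambda>x. g (x - A y) * h x", OF _ linear_Rn_in[OF A y]]) measurable
    then show "(\<integral>\<^sup>+x. g x * h (A y + x) \<partial>?L) = (\<integral>\<^sup>+x. g (x - A y) * h x \<partial>?L)"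
      by (simp add: add.commute)
  qed
  also have "... = (\<integral>\<^sup>+x. (\<integral>\<^sup>+y. g (x - A y) * h x \<partial>?L) \<partial>?L)"
    by (rule RnRn.Fubini') measurable
  also have "... = (\<integral>\<^sup>+x. (\<integral>\<^sup>+y. g (- A y) \<partial>?L) * h x \<partial>?L)"
  proof (rule nn_integral_Rn_cong)
    fix x :: vec assume x: "x \<in> Rn n"
    have "(\<integral>\<^sup>+y. g (- (A y + (- x))) \<partial>?L) = (\<integral>\<^sup>+y. g (- A y) \<partial>?L)"
      by (rule shift[of "\<lambda>w. g (- w)"]) (use x Rn_uminus in auto)
    moreover have "- (A y + (- x)) = x - A y" for y by (simp add: fun_eq_iff)
    ultimately show "(\<integral>\<^sup>+y. g (x - A y) * h x \<partial>?L) = (\<integral>\<^sup>+y. g (- A y) \<partial>?L) * h x"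
      by (simp add: nn_integral_multc)
  qed
  also have "... = (\<integral>\<^sup>+x. h x \<partial>?L) * (\<integral>\<^sup>+y. g (- A y) \<partial>?L)"
    by (subst nn_integral_cmult) (simp_all add: mult.commute)
  finally show ?thesis .
qed

lemma nn_integral_Rn_linear:
  assumes A: "linear_Rn n A" and [measurable]: "A \<in> borel_maps"
    and bij: "bij_betw A (Rn n) (Rn n)"
  obtains c :: real where "c > 0"
    "\<And>h :: vec \<Rightarrow> ennreal. h \<in> borel_maps \<Longrightarrow>
      lint n (\<lambda>y. h y) = ennreal c * lint n (\<lambda>x. h (A x))"
proof -
  let ?L = "leb n"
  define g :: "vec \<Rightarrow> ennreal" where "g = indicator (cube n (1/2))"
  have [measurable]: "g \<in> borel_maps" unfolding g_def by measurable
  have g1: "(\<integral>\<^sup>+x. g x \<partial>?L) = 1" by (simp add: g_def emeasure_cube)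
  define k where "k = (\<integral>\<^sup>+y. g (- A y) \<partial>?L)"
  have key: "(\<integral>\<^sup>+y. h (A y) \<partial>?L) = (\<integral>\<^sup>+x. h x \<partial>?L) * k"
    if [measurable]: "h \<in> borel_maps" for h :: "vec \<Rightarrow> ennreal"
    using nn_integral_Rn_linear_aux[OF A _ bij, of g h] g1 by (simp add: k_def)
  obtain B where B: "linear_Rn n B" "\<And>x. x \<in> Rn n \<Longrightarrow> B (A x) = x" "B \<in> borel_maps"
    using linear_Rn_inv[OF A bij] by metis
  note [measurable] = B(3)
  have "(\<integral>\<^sup>+y. g (B (A y)) \<partial>?L) = (\<integral>\<^sup>+y. g y \<partial>?L)"
    by (rule nn_integral_Rn_cong) (simp add: B(2))
  then have "1 = (\<integral>\<^sup>+y. g (B y) \<partial>?L) * k"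
    using key[of "\<lambda>y. g (B y)"] g1 by simp
  then have k: "k \<noteq> 0" "k \<noteq> \<infinity>"
    by (auto simp: ennreal_mult_top top_unique split: if_splits)
  show ?thesis
  proof
    define c where "c = 1 / enn2real k"
    have ek: "ennreal (enn2real k) = k" "enn2real k > 0"
      using k by (auto simp: less_top enn2real_positive_iff zero_less_iff_neq_zero)
    show "c > 0" using ek by (simp add: c_def)
    fix h :: "vec \<Rightarrow> ennreal" assume [measurable]: "h \<in> borel_maps"
    have "ennreal c * (\<integral>\<^sup>+x. h (A x) \<partial>?L) = (\<integral>\<^sup>+x. h x \<partial>?L) * (ennreal (enn2real k) * ennreal c)"
      by (simp add: key ek mult_ac)
    also have "ennreal (enn2real k) * ennreal c = 1"
      using ek(2) by (simp add: c_def ennreal_mult'[symmetric])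
    finally show "(\<integral>\<^sup>+y. h y \<partial>?L) = ennreal c * (\<integral>\<^sup>+x. h (A x) \<partial>?L)" by simp
  qed
qed

section \<open>The standard Gaussian measure\<close>

definition gauss_density :: "nat \<Rightarrow> vec \<Rightarrow> real" where
  "gauss_density n x = (\<Prod>i<n. std_normal_density (x i))"

lemma gauss_density_eq: "gauss_density n x = (2 * pi) powr (- real n / 2) * exp (- dot n x x / 2)"
proof -
  have "(2 * pi) powr (- 1 / 2) = 1 / sqrt (2 * pi)"
    by (simp add: powr_minus powr_half_sqrt divide_simps)
  moreover have "(2 * pi) powr (- real n / 2) = ((2 * pi) powr (- 1 / 2)) ^ n"
    by (subst powr_realpow[symmetric]) (auto simp: powr_powr)
  moreover have "exp (- dot n x x / 2) = (\<Prod>i<n. exp (- (x i)\<^sup>2 / 2))"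
    by (simp add: exp_sum[symmetric] dot_def sum_negf sum_divide_distrib power2_eq_square)
  ultimately show ?thesis
    by (simp add: gauss_density_def std_normal_density_def prod.distrib prod_dividef power_divide)
qed

lemma gauss_density_pos: "gauss_density n x > 0"
  by (simp add: gauss_density_eq)

lemma gauss_density_measurable [measurable]: "gauss_density n \<in> borel_maps"
  unfolding gauss_density_def by measurable

definition gauss :: "nat \<Rightarrow> vec measure" where
  "gauss n = density (leb n) (\<lambda>x. ennreal (gauss_density n x))"

abbreviation (input) gint :: "nat \<Rightarrow> (vec \<Rightarrow> ennreal) \<Rightarrow> ennreal" where
  "gint n f \<equiv> nn_integral (gauss n) f"

abbreviation (input) gmean :: "nat \<Rightarrow> (vec \<Rightarrow> real) \<Rightarrow> real" where
  "gmean n f \<equiv> integral\<^sup>L (gauss n) f"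

lemma sets_gauss [simp, measurable_cong]: "sets (gauss n) = sets borel"
  and space_gauss [simp]: "space (gauss n) = UNIV"
  by (simp_all add: gauss_def)

lemma nn_integral_gauss:
  "f \<in> borel_maps \<Longrightarrow>
    gint n (\<lambda>x. f x) = lint n (\<lambda>x. ennreal (gauss_density n x) * f x)"
  unfolding gauss_def by (subst nn_integral_density) auto

lemma nn_integral_gauss_prod:
  fixes f :: "nat \<Rightarrow> real \<Rightarrow> ennreal"
  assumes [measurable]: "\<And>i. f i \<in> borel_maps"
  shows "gint n (\<lambda>x. (\<Prod>i<n. f i (x i))) = (\<Prod>i<n. lint1 (\<lambda>s. ennreal (std_normal_density s) * f i s))"
  by (simp add: nn_integral_gauss gauss_density_def prod_ennreal[symmetric] prod.distrib[symmetric]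
      nn_integral_Rn_prod[of "\<lambda>i s. ennreal (std_normal_density s) * f i s"])

lemma nn_integral_std_normal: "(lint1 (\<lambda>s. ennreal (std_normal_density s))) = 1"
  by (subst nn_integral_eq_integral) auto

lemma prob_space_gauss: "prob_space (gauss n)"
proof
  have "emeasure (gauss n) (space (gauss n)) = gint n (\<lambda>x. (\<Prod>i<n. (\<lambda>_ _. 1) i (x i)))"
    by simp
  also have "... = 1"
    by (subst nn_integral_gauss_prod) (auto simp: nn_integral_std_normal)
  finally show "emeasure (gauss n) (space (gauss n)) = 1" .
qed

interpretation gauss: prob_space "gauss n" for n
  by (rule prob_space_gauss)

interpretation gauss2: pair_sigma_finite "gauss n" "gauss m" for n m
  by standard

lemma AE_gauss_Rn: "AE x in gauss n. x \<in> Rn n"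
  unfolding gauss_def by (subst AE_density) (use AE_Rn[of n] in auto)

lemma nn_integral_gauss_cong:
  assumes "\<And>x. x \<in> Rn n \<Longrightarrow> f x = g x"
  shows "gint n (\<lambda>x. f x) = gint n (\<lambda>x. g x)"
  by (rule nn_integral_cong_AE, rule eventually_mono[OF AE_gauss_Rn]) (rule assms)

lemma orthogonal_group_linear: "R \<in> orthogonal_group n \<Longrightarrow> linear_Rn n R"
  and orthogonal_group_norm: "R \<in> orthogonal_group n \<Longrightarrow> x \<in> Rn n \<Longrightarrow> dot n (R x) (R x) = dot n x x"
  by (auto simp: orthogonal_group_def)

lemma orthogonal_group_dot:
  assumes R: "R \<in> orthogonal_group n" and x: "x \<in> Rn n" and y: "y \<in> Rn n"
  shows "dot n (R x) (R y) = dot n x y"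
proof -
  have "dot n (R (x + y)) (R (x + y)) = dot n (x + y) (x + y)"
    using R x y Rn_add by (auto intro: orthogonal_group_norm)
  then show ?thesis
    using orthogonal_group_norm[OF R x] orthogonal_group_norm[OF R y]
    by (simp add: linear_Rn_add[OF orthogonal_group_linear[OF R] x y] dot_simps dot_commute)
qed

lemma orthogonal_group_bij: "R \<in> orthogonal_group n \<Longrightarrow> bij_betw R (Rn n) (Rn n)"
  by (rule linear_Rn_bij) (auto simp: orthogonal_group_linear dest: orthogonal_group_norm simp flip: dot_eq_0_iff)

lemma nn_integral_Rn_orthogonal:
  fixes h :: "vec \<Rightarrow> ennreal"
  assumes R: "R \<in> orthogonal_group n" and [measurable]: "R \<in> borel_maps"
    and [measurable]: "h \<in> borel_maps"
  shows "lint n (\<lambda>x. h (R x)) = lint n (\<lambda>x. h x)"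
proof -
  let ?L = "leb n"
  obtain c where c: "c > 0" "\<And>h :: vec \<Rightarrow> ennreal. h \<in> borel_maps \<Longrightarrow>
      (\<integral>\<^sup>+y. h y \<partial>?L) = ennreal c * (\<integral>\<^sup>+x. h (R x) \<partial>?L)"
    using nn_integral_Rn_linear[OF orthogonal_group_linear[OF R] _ orthogonal_group_bij[OF R]] by auto
  have 1: "(\<integral>\<^sup>+x. ennreal (gauss_density n x) \<partial>?L) = 1"
    using nn_integral_gauss[of "\<lambda>_. 1" n] gauss.emeasure_space_1[of n] by simp
  have "(\<integral>\<^sup>+x. ennreal (gauss_density n (R x)) \<partial>?L) = (\<integral>\<^sup>+x. ennreal (gauss_density n x) \<partial>?L)"
    by (rule nn_integral_Rn_cong) (simp add: gauss_density_eq orthogonal_group_norm[OF R])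
  then have "ennreal c = 1"
    using c(2)[of "\<lambda>x. ennreal (gauss_density n x)"] 1 by simp
  then show ?thesis using c(2)[of h] by simp
qed

lemma nn_integral_gauss_orthogonal:
  fixes h :: "vec \<Rightarrow> ennreal"
  assumes R: "R \<in> orthogonal_group n" and [measurable]: "R \<in> borel_maps"
    and [measurable]: "h \<in> borel_maps"
  shows "gint n (\<lambda>x. h (R x)) = gint n (\<lambda>x. h x)"
proof -
  have "gint n (\<lambda>x. h (R x)) = lint n (\<lambda>x. ennreal (gauss_density n (R x)) * h (R x))"
    by (subst nn_integral_gauss, measurable, rule nn_integral_Rn_cong)
       (simp add: gauss_density_eq orthogonal_group_norm[OF R])
  also have "... = gint n (\<lambda>x. h x)"
    by (subst nn_integral_Rn_orthogonal[OF R, of "\<lambda>x. ennreal (gauss_density n x) * h x"])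
       (auto simp: nn_integral_gauss)
  finally show ?thesis .
qed

lemma nn_integral_gauss_join:
  fixes f :: "vec \<Rightarrow> ennreal"
  assumes [measurable]: "f \<in> borel_maps"
  shows "gint (k + d) (\<lambda>x. f x) = gint k (\<lambda>x. gint d (\<lambda>z. f (join k x z)))"
proof -
  have g: "gauss_density (k + d) (join k x z) = gauss_density k x * gauss_density d z" for x z
  proof -
    have "- (real (k + d)) / 2 = - real k / 2 + - real d / 2"
      "- (dot k x x + dot d z z) / 2 = - dot k x x / 2 + - dot d z z / 2" by auto
    then show ?thesis
      by (simp only: gauss_density_eq dot_join powr_add exp_add) simp
  qed
  have nn: "0 \<le> gauss_density k x" for k x using gauss_density_pos[of k x] by simp
  show ?thesis
    by (simp add: nn_integral_gauss nn_integral_Rn_join g ennreal_mult nn mult.assoc nn_integral_cmult)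
qed

text \<open>The rotation of the product space by the angle with cosine \<open>a\<close> and sine \<open>b\<close>.\<close>

definition rotation :: "nat \<Rightarrow> real \<Rightarrow> real \<Rightarrow> vec \<Rightarrow> vec" where
  "rotation n a b w = join n (\<lambda>i. a * w i + b * w (n + i)) (pad n (\<lambda>i. b * w i - a * w (n + i)))"

text \<open>
  Rotation invariance of the product of two Gaussian measures.
\<close>

lemma gauss_sum:
  fixes f :: "vec \<Rightarrow> ennreal"
  assumes [measurable]: "f \<in> borel_maps"
  shows "gint n (\<lambda>x. gint n (\<lambda>y. f (s *\<^sub>R x + u *\<^sub>R y))) = gint n (\<lambda>x. f (sqrt (s\<^sup>2 + u\<^sup>2) *\<^sub>R x))"
proof (cases "s = 0 \<and> u = 0")
  case True
  then show ?thesis by (simp add: gauss.emeasure_space_1[simplified])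
next
  case False
  define r where "r = sqrt (s\<^sup>2 + u\<^sup>2)"
  have r: "r > 0" using False by (auto simp: r_def sum_power2_gt_zero_iff)
  define a b where "a = s / r" and "b = u / r"
  have ab: "a\<^sup>2 + b\<^sup>2 = 1"
    using r by (simp add: a_def b_def power_divide add_divide_distrib[symmetric]) (simp add: r_def)
  let ?R = "rotation n a b"
  have [measurable]: "?R \<in> borel_maps"
  proof (rule measurable_vecI)
    show "(\<lambda>x. ?R x i) \<in> borel_maps" for i
      unfolding rotation_def join_def pad_def by (cases "i < n"; cases "i - n < n") auto
  qed
  have inR: "?R w \<in> Rn (n + n)" for w
    by (auto simp: rotation_def join_def Rn_iff pad_def)
  have lin: "linear_Rn (n + n) ?R"
    unfolding linear_Rn_def
    using inR by (auto simp: rotation_def join_def pad_def fun_eq_iff algebra_simps scaleR_fun_def)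
  have split: "dot (n + n) w w = (\<Sum>i<n. w i * w i + w (n + i) * w (n + i))" for w
  proof -
    have "(\<Sum>i<n + m. w i * w i) = (\<Sum>i<n. w i * w i) + (\<Sum>i<m. w (n + i) * w (n + i))" for m
      by (induction m) auto
    then show ?thesis by (simp add: dot_def sum.distrib)
  qed
  have orth: "?R \<in> orthogonal_group (n + n)"
  proof -
    have "(a * p + b * q) * (a * p + b * q) + (b * p - a * q) * (b * p - a * q) = p * p + q * q" for p q :: real
    proof -
      have "(a * p + b * q) * (a * p + b * q) + (b * p - a * q) * (b * p - a * q) = (a\<^sup>2 + b\<^sup>2) * (p * p + q * q)"
        by (simp add: power2_eq_square algebra_simps)
      then show ?thesis using ab by simp
    qed
    then show ?thesis
      by (auto simp: orthogonal_group_def lin split rotation_def join_def pad_def)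
  qed
  let ?F = "\<lambda>w. f (r *\<^sub>R pad n w)"
  have 1: "f (r *\<^sub>R pad n (?R (join n x y))) = f (s *\<^sub>R x + u *\<^sub>R y)" if "x \<in> Rn n" "y \<in> Rn n" for x y
  proof -
    have "r *\<^sub>R pad n (?R (join n x y)) = s *\<^sub>R x + u *\<^sub>R y"
      using that r by (auto simp: fun_eq_iff scaleR_fun_def pad_def rotation_def join_def Rn_iff a_def b_def field_simps)
    then show ?thesis by simp
  qed
  have "gint n (\<lambda>x. gint n (\<lambda>y. f (s *\<^sub>R x + u *\<^sub>R y))) =
      gint n (\<lambda>x. gint n (\<lambda>y. ?F (?R (join n x y))))"
  proof (rule nn_integral_gauss_cong)
    fix x :: vec assume "x \<in> Rn n"
    then show "gint n (\<lambda>y. f (s *\<^sub>R x + u *\<^sub>R y)) = gint n (\<lambda>y. ?F (?R (join n x y)))"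
      by (intro nn_integral_gauss_cong) (simp add: 1)
  qed
  also have "... = gint (n + n) (\<lambda>w. ?F (?R w))"
    by (rule nn_integral_gauss_join[symmetric]) measurable
  also have "... = gint (n + n) (\<lambda>w. ?F w)"
    by (rule nn_integral_gauss_orthogonal[OF orth]) measurable
  also have "... = gint n (\<lambda>x. gint n (\<lambda>y. ?F (join n x y)))"
    by (rule nn_integral_gauss_join) measurable
  also have "... = gint n (\<lambda>x. f (r *\<^sub>R x))"
  proof (rule nn_integral_gauss_cong)
    fix x :: vec assume x: "x \<in> Rn n"
    have "pad n (join n x y) = x" for y
      using x by (auto simp: pad_def join_def Rn_iff fun_eq_iff)
    then show "gint n (\<lambda>y. ?F (join n x y)) = f (r *\<^sub>R x)"
      by (simp add: gauss.emeasure_space_1[simplified])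
  qed
  finally show ?thesis by (simp add: r_def)
qed

section \<open>The Borell--Brascamp--Lieb inequality\<close>

lemma emeasure_lborel_translate:
  assumes [measurable]: "A \<in> sets borel"
  shows "emeasure lborel {x::real. x - b \<in> A} = emeasure lborel A"
proof -
  have "emeasure lborel {x::real. x - b \<in> A} = (lint1 (\<lambda>x. indicator {x::real. x - b \<in> A} x))"
    by (subst nn_integral_indicator) auto
  also have "... = (lint1 (\<lambda>x. indicator A (- b + 1 * x)))"
    by (intro nn_integral_cong) (auto simp: indicator_def)
  also have "... = (lint1 (\<lambda>x. indicator A x))"
    using nn_integral_real_affine[of "indicator A" 1 "-b"] by simp
  finally show ?thesis by simp
qed

text \<open>
  The one-dimensional Brunn--Minkowski inequality: the sumset contains a translate of
  \<open>A\<close> and one of \<open>B\<close> that overlap in arbitrarily little, namely near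
  \<open>Sup A + Inf B\<close>.
\<close>

lemma emeasure_sumset:
  fixes A B S :: "real set"
  assumes [measurable]: "A \<in> sets borel" "B \<in> sets borel" "S \<in> sets borel"
    and ne: "A \<noteq> {}" "B \<noteq> {}" and bdd: "bdd_above A" "bdd_below B"
    and S: "\<And>s t. s \<in> A \<Longrightarrow> t \<in> B \<Longrightarrow> s + t \<in> S"
  shows "emeasure lborel A + emeasure lborel B \<le> emeasure lborel S"
proof (rule ennreal_le_epsilon)
  fix e :: real assume e: "e > 0"
  obtain a where a: "a \<in> A" "Sup A - e / 2 < a"
    using less_cSup_iff[OF ne(1) bdd(1), of "Sup A - e/2"] e by auto
  obtain b where b: "b \<in> B" "b < Inf B + e / 2"
    using cInf_less_iff[OF ne(2) bdd(2), of "Inf B + e/2"] e by auto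
  let ?A = "{x. x - b \<in> A}" and ?B = "{x. x - a \<in> B}"
  have "emeasure lborel A + emeasure lborel B = emeasure lborel ?A + emeasure lborel ?B"
    by (simp add: emeasure_lborel_translate)
  also have "... = emeasure lborel (?A \<union> ?B) + emeasure lborel (?A \<inter> ?B)"
    by (rule emeasure_Un_Int) auto
  also have "... \<le> emeasure lborel S + emeasure lborel {a + Inf B .. Sup A + b}"
  proof (intro add_mono emeasure_mono)
    show "?A \<union> ?B \<subseteq> S"
      using S[OF _ b(1)] S[OF a(1)] by (auto, metis diff_add_cancel, metis add.commute diff_add_cancel)
    show "?A \<inter> ?B \<subseteq> {a + Inf B .. Sup A + b}"
      using cSup_upper[OF _ bdd(1)] cInf_lower[OF _ bdd(2)] by (auto simp: algebra_simps) (smt (verit))+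
  qed auto
  also have "... \<le> emeasure lborel S + ennreal e"
  proof (intro add_mono order_refl)
    show "emeasure lborel {a + Inf B .. Sup A + b} \<le> ennreal e"
      using a b e by (cases "a + Inf B \<le> Sup A + b") (auto intro!: ennreal_leI)
  qed
  finally show "emeasure lborel A + emeasure lborel B \<le> emeasure lborel S + ennreal e" .
qed

text \<open>
  The right-hand side is least at \<open>l = u / (u + v)\<close>, where equality holds.
\<close>

lemma radon_inequality:
  fixes u v l :: real
  assumes "u > 0" "v > 0" "0 \<le> l" "l \<le> 1"
  shows "1 / (u + v) ^ Q \<le> l ^ (Q + 1) / u ^ Q + (1 - l) ^ (Q + 1) / v ^ Q"
proof -
  let ?w = "u + v"
  have w: "?w > 0" using assms by simp
  have b1: "1 + real Q * (l * ?w / u - 1) \<le> (l * ?w / u) ^ Q"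
    using Bernoulli_inequality[of "l * ?w / u - 1" Q] assms w by simp
  have b2: "1 + real Q * ((1 - l) * ?w / v - 1) \<le> ((1 - l) * ?w / v) ^ Q"
    using Bernoulli_inequality[of "(1 - l) * ?w / v - 1" Q] assms w by simp
  have cs: "l * (l * ?w / u - 1) + (1 - l) * ((1 - l) * ?w / v - 1) \<ge> 0"
  proof -
    have "l * (l * ?w / u - 1) + (1 - l) * ((1 - l) * ?w / v - 1) = (l * v - (1 - l) * u)\<^sup>2 / (u * v)"
      using assms by (simp add: field_simps power2_eq_square)
    then show ?thesis using assms by simp
  qed
  have e: "p * (p * w / q) ^ Q = w ^ Q * (p ^ (Q + 1) / q ^ Q)" for p w q :: real
    by (simp add: power_mult_distrib power_divide)
  have "1 \<le> l * (1 + real Q * (l * ?w / u - 1)) + (1 - l) * (1 + real Q * ((1 - l) * ?w / v - 1))"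
  proof -
    have "l * (1 + real Q * (l * ?w / u - 1)) + (1 - l) * (1 + real Q * ((1 - l) * ?w / v - 1))
      = 1 + real Q * (l * (l * ?w / u - 1) + (1 - l) * ((1 - l) * ?w / v - 1))"
      by (simp add: algebra_simps)
    then show ?thesis using cs by simp
  qed
  also have "... \<le> l * (l * ?w / u) ^ Q + (1 - l) * ((1 - l) * ?w / v) ^ Q"
    using b1 b2 assms by (intro add_mono mult_left_mono) auto
  also have "... = ?w ^ Q * (l ^ (Q + 1) / u ^ Q + (1 - l) ^ (Q + 1) / v ^ Q)"
    unfolding e by (simp add: distrib_left)
  finally show ?thesis
    using w by (simp add: divide_le_eq mult.commute)
qed

text \<open>
  For \<open>Q \<ge> 2\<close> and positive finite numbers, minimising over \<open>l\<close> shows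
  that \<open>h\<close> is at least \<open>(f powr q + g powr q) powr (1 / q)\<close> with
  \<open>q = - 1 / (Q - 1)\<close>. The form with a witness \<open>l\<close> needs neither roots
  nor conventions for zero and infinity.
\<close>

definition bbl_at :: "nat \<Rightarrow> ennreal \<Rightarrow> ennreal \<Rightarrow> ennreal \<Rightarrow> bool" where
  "bbl_at Q f g h \<longleftrightarrow> (\<exists>l::real. 0 \<le> l \<and> l \<le> 1 \<and> ennreal (l ^ Q) * f + ennreal ((1 - l) ^ Q) * g \<le> h)"

lemma layer_cake_bounded:
  fixes f :: "real \<Rightarrow> ennreal" and a :: real
  assumes [measurable]: "f \<in> borel_maps" and a: "a > 0" and fa: "\<And>x. f x \<le> ennreal a"
  shows "(lint1 (\<lambda>x. f x)) = ennreal a * (lint1 (\<lambda>y. indicator {0<..<1} y * emeasure lborel {x. ennreal (a * y) < f x}))"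
proof -
  have inner: "(lint1 (\<lambda>y. indicator {0<..<1} y * indicator {x. ennreal (a * y) < f x} x)) = f x / ennreal a" for x
  proof -
    obtain r where r: "f x = ennreal r" "0 \<le> r" "r \<le> a"
      using fa[of x] a by (cases "f x") (auto simp: top_unique)
    have lt1: "y < 1" if "y * a < r" for y
    proof (rule ccontr)
      assume "\<not> y < 1"
      then have "1 * a \<le> y * a" using a by (intro mult_right_mono) auto
      with that r show False by simp
    qed
    have "(lint1 (\<lambda>y. indicator {0<..<1} y * indicator {x. ennreal (a * y) < f x} x)) = (lint1 (\<lambda>y. indicator {0<..<r / a} y))"
      using r a lt1 by (intro nn_integral_cong) (auto simp: indicator_def ennreal_less_iff field_simps)
    also have "... = f x / ennreal a"
      using r a by (simp add: divide_ennreal)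
    finally show ?thesis .
  qed
  have "(lint1 (\<lambda>x. f x)) = (lint1 (\<lambda>x. ennreal a * (f x / ennreal a)))"
  proof (rule nn_integral_cong)
    fix x
    obtain r where "f x = ennreal r" "0 \<le> r"
      using fa[of x] by (cases "f x") (auto simp: top_unique)
    then show "f x = ennreal a * (f x / ennreal a)"
      using a by (simp add: divide_ennreal ennreal_mult'[symmetric])
  qed
  also have "... = ennreal a * (\<integral>\<^sup>+x. (lint1 (\<lambda>y. indicator {0<..<1} y * indicator {x. ennreal (a * y) < f x} x)) \<partial>lborel)"
    by (simp add: nn_integral_cmult inner)
  also have "(\<integral>\<^sup>+x. (lint1 (\<lambda>y. indicator {0<..<1} y * indicator {x. ennreal (a * y) < f x} x)) \<partial>lborel)
     = (\<integral>\<^sup>+y. (lint1 (\<lambda>x. indicator {0<..<1} y * indicator {x. ennreal (a * y) < f x} x)) \<partial>lborel)"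
    by (rule lborel_pair.Fubini') measurable
  also have "... = (lint1 (\<lambda>y. indicator {0<..<1} y * emeasure lborel {x. ennreal (a * y) < f x}))"
    by (intro nn_integral_cong, subst nn_integral_cmult) auto
  finally show ?thesis .
qed

lemma layer_cake_ge:
  fixes f :: "real \<Rightarrow> ennreal" and a :: real
  assumes [measurable]: "f \<in> borel_maps" and a: "a > 0"
  shows "(lint1 (\<lambda>x. f x)) \<ge> ennreal a * (lint1 (\<lambda>y. indicator {0<..<1} y * emeasure lborel {x. ennreal (a * y) \<le> f x}))"
proof -
  have inner: "ennreal a * (lint1 (\<lambda>y. indicator {0<..<1} y * indicator {x. ennreal (a * y) \<le> f x} x)) \<le> f x" for x
  proof (cases "f x")
    case (real r)
    have "(lint1 (\<lambda>y. indicator {0<..<1} y * indicator {x. ennreal (a * y) \<le> f x} x)) \<le> (lint1 (\<lambda>y. indicator {0..r / a} y))"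
      using real a by (intro nn_integral_mono) (auto simp: indicator_def ennreal_le_iff field_simps)
    also have "... = ennreal (r / a)"
      using real a by simp
    finally have "ennreal a * (lint1 (\<lambda>y. indicator {0<..<1} y * indicator {x. ennreal (a * y) \<le> f x} x)) \<le> ennreal a * ennreal (r / a)"
      by (rule mult_left_mono) simp
    also have "... = f x" using real a by (simp add: ennreal_mult'[symmetric])
    finally show ?thesis .
  qed simp
  have "ennreal a * (lint1 (\<lambda>y. indicator {0<..<1} y * emeasure lborel {x. ennreal (a * y) \<le> f x}))
    = ennreal a * (\<integral>\<^sup>+y. (lint1 (\<lambda>x. indicator {0<..<1} y * indicator {x. ennreal (a * y) \<le> f x} x)) \<partial>lborel)"
    by (intro arg_cong[where f="\<lambda>u. ennreal a * u"] nn_integral_cong, subst nn_integral_cmult) auto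
  also have "(\<integral>\<^sup>+y. (lint1 (\<lambda>x. indicator {0<..<1} y * indicator {x. ennreal (a * y) \<le> f x} x)) \<partial>lborel)
     = (\<integral>\<^sup>+x. (lint1 (\<lambda>y. indicator {0<..<1} y * indicator {x. ennreal (a * y) \<le> f x} x)) \<partial>lborel)"
    by (rule lborel_pair.Fubini') measurable
  also have "ennreal a * ... = (\<integral>\<^sup>+x. ennreal a * (lint1 (\<lambda>y. indicator {0<..<1} y * indicator {x. ennreal (a * y) \<le> f x} x)) \<partial>lborel)"
    by (subst nn_integral_cmult) auto
  also have "... \<le> (lint1 (\<lambda>x. f x))"
    by (intro nn_integral_mono inner)
  finally show ?thesis .
qed

text \<open>
  Superlevel sets of \<open>f\<close>, \<open>g\<close> and \<open>h\<close>, at heights in a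
  fixed ratio to the suprema, are compared by the one-dimensional Brunn--Minkowski inequality.
  Integrating over the heights lowers the exponent by one.
\<close>

lemma bbl_1d:
  fixes f g h :: "real \<Rightarrow> ennreal"
  assumes [measurable]: "f \<in> borel_maps" "g \<in> borel_maps" "h \<in> borel_maps"
    and Q: "Q \<ge> 1"
    and cond: "\<And>s t. bbl_at (Suc Q) (f s) (g t) (h (s + t))"
    and bound: "\<And>s. f s \<le> ennreal B" "\<And>s. g s \<le> ennreal B"
    and supp: "\<And>s. \<bar>s\<bar> > R \<Longrightarrow> f s = 0" "\<And>s. \<bar>s\<bar> > R \<Longrightarrow> g s = 0"
  shows "bbl_at Q (lint1 (\<lambda>s. f s)) (lint1 (\<lambda>s. g s)) (lint1 (\<lambda>s. h s))"
proof -
  obtain a where a: "(SUP s. f s) = ennreal a" "a \<ge> 0"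
    using SUP_least[of UNIV f "ennreal B"] bound by (cases "SUP s. f s") (auto simp: top_unique)
  obtain b where b: "(SUP s. g s) = ennreal b" "b \<ge> 0"
    using SUP_least[of UNIV g "ennreal B"] bound by (cases "SUP s. g s") (auto simp: top_unique)
  have fa: "f s \<le> ennreal a" for s using a SUP_upper[of s UNIV f] by simp
  have gb: "g s \<le> ennreal b" for s using b SUP_upper[of s UNIV g] by simp
  consider "a = 0" | "b = 0" | "a > 0" "b > 0" using a b by linarith
  then show ?thesis
  proof cases
    case 1
    then have "f s = 0" for s using fa[of s] by simp
    then have "f = (\<lambda>_. 0)" by auto
    then show ?thesis unfolding bbl_at_def using Q by (intro exI[of _ 1]) (auto simp: power_0_left)
  next
    case 2
    then have "g s = 0" for s using gb[of s] by simp
    then have "g = (\<lambda>_. 0)" by auto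
    then show ?thesis unfolding bbl_at_def using Q by (intro exI[of _ 0]) (auto simp: power_0_left)
  next
    case 3
    define u v where "u = (1 / a) powr (1 / real Q)" and "v = (1 / b) powr (1 / real Q)"
    have uv: "u > 0" "v > 0" using 3 by (auto simp: u_def v_def)
    have au: "1 / u ^ Q = a" and bv: "1 / v ^ Q = b"
      using 3 Q by (auto simp: u_def v_def powr_realpow[symmetric] powr_powr)
    define c where "c = 1 / (u + v) ^ Q"
    have c: "c > 0" using uv by (simp add: c_def)
    have lev: "emeasure lborel {s. ennreal (a * y) < f s} + emeasure lborel {s. ennreal (b * y) < g s}
        \<le> emeasure lborel {s. ennreal (c * y) \<le> h s}" if y: "0 < y" "y < 1" for y
    proof (rule emeasure_sumset)
      show "{s. ennreal (a * y) < f s} \<noteq> {}"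
      proof -
        have "ennreal (a * y) < (SUP s. f s)" using a 3 y by (simp add: ennreal_less_iff)
        then show ?thesis by (auto simp: less_SUP_iff)
      qed
      show "{s. ennreal (b * y) < g s} \<noteq> {}"
      proof -
        have "ennreal (b * y) < (SUP s. g s)" using b 3 y by (simp add: ennreal_less_iff)
        then show ?thesis by (auto simp: less_SUP_iff)
      qed
      show "bdd_above {s. ennreal (a * y) < f s}"
        using supp(1) by (intro bdd_aboveI[of _ R]) (auto, metis abs_le_D1 not_less not_less_zero)
      show "bdd_below {s. ennreal (b * y) < g s}"
        using supp(2) by (intro bdd_belowI[of _ "-R"]) (auto, metis abs_le_iff minus_le_iff not_less not_less_zero)
      fix s t assume s: "s \<in> {s. ennreal (a * y) < f s}" and t: "t \<in> {s. ennreal (b * y) < g s}"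
      obtain l where l: "0 \<le> l" "l \<le> 1" "ennreal (l ^ Suc Q) * f s + ennreal ((1 - l) ^ Suc Q) * g t \<le> h (s + t)"
        using cond[of s t] unfolding bbl_at_def by auto
      have "c \<le> l ^ Suc Q * a + (1 - l) ^ Suc Q * b"
        using radon_inequality[OF uv l(1,2), of Q] au bv by (simp add: c_def divide_inverse)
      then have "c * y \<le> l ^ Suc Q * (a * y) + (1 - l) ^ Suc Q * (b * y)"
        using y mult_right_mono[of c "l ^ Suc Q * a + (1 - l) ^ Suc Q * b" y] by (simp add: algebra_simps)
      then have "ennreal (c * y) \<le> ennreal (l ^ Suc Q * (a * y) + (1 - l) ^ Suc Q * (b * y))"
        by (rule ennreal_leI)
      also have "... = ennreal (l ^ Suc Q) * ennreal (a * y) + ennreal ((1 - l) ^ Suc Q) * ennreal (b * y)"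
        using l y 3 by (simp add: ennreal_plus ennreal_mult del: power_Suc)
      also have "... \<le> ennreal (l ^ Suc Q) * f s + ennreal ((1 - l) ^ Suc Q) * g t"
        using s t by (intro add_mono mult_left_mono) auto
      also note l(3)
      finally show "s + t \<in> {s. ennreal (c * y) \<le> h s}" by simp
    qed simp_all
    define l where "l = u / (u + v)"
    have l: "0 \<le> l" "l \<le> 1" "1 - l = v / (u + v)" using uv by (auto simp: l_def field_simps)
    let ?I = "\<lambda>f c. \<integral>\<^sup>+y. indicator {0<..<1} y * emeasure lborel {s. ennreal (c * y) < f s} \<partial>lborel"
    have "ennreal (l ^ Q) * (lint1 (\<lambda>s. f s)) + ennreal ((1 - l) ^ Q) * (lint1 (\<lambda>s. g s))
       = ennreal (l ^ Q) * (ennreal a * ?I f a) + ennreal ((1 - l) ^ Q) * (ennreal b * ?I g b)"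
      using layer_cake_bounded[OF _ 3(1) fa] layer_cake_bounded[OF _ 3(2) gb] by simp
    also have "... = ennreal c * ?I f a + ennreal c * ?I g b"
    proof -
      have "l ^ Q * a = c" "(1 - l) ^ Q * b = c"
        unfolding l(3) unfolding l_def c_def au[symmetric] bv[symmetric] using uv by (simp_all add: power_divide)
      then show ?thesis
        using l 3 by (simp add: mult.assoc[symmetric] ennreal_mult'[symmetric])
    qed
    also have "... = ennreal c * (lint1 (\<lambda>y. indicator {0<..<1} y * emeasure lborel {s. ennreal (a * y) < f s}
       + indicator {0<..<1} y * emeasure lborel {s. ennreal (b * y) < g s}))"
      by (subst nn_integral_add) (auto simp: distrib_left)
    also have "... \<le> ennreal c * (lint1 (\<lambda>y. indicator {0<..<1} y * emeasure lborel {s. ennreal (c * y) \<le> h s}))"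
      using lev by (intro mult_left_mono nn_integral_mono) (auto simp: indicator_def)
    also have "... \<le> (lint1 (\<lambda>s. h s))"
      by (rule layer_cake_ge[OF _ c]) measurable
    finally show ?thesis unfolding bbl_at_def using l by blast
  qed
qed

text \<open>
  The dimension is quantified inside so that the inequality can be proved by induction: the
  coordinates are integrated out one at a time, and each of them lowers the exponent by one.
\<close>

definition bbl_dim :: "nat \<Rightarrow> bool" where
  "bbl_dim d \<longleftrightarrow> (\<forall>Q f g h B R. Q \<ge> 1 \<longrightarrow> f \<in> borel_maps \<longrightarrow> g \<in> borel_maps \<longrightarrow>
    h \<in> borel_maps \<longrightarrow> (\<forall>s\<in>Rn d. \<forall>t\<in>Rn d. bbl_at (Q + d) (f s) (g t) (h (s + t))) \<longrightarrow>
    (\<forall>s. f s \<le> ennreal B \<and> g s \<le> ennreal B) \<longrightarrow> (\<forall>s. s \<notin> cube d R \<longrightarrow> f s = 0 \<and> g s = 0) \<longrightarrow>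
    bbl_at Q (lint d (\<lambda>s. f s)) (lint d (\<lambda>s. g s)) (lint d (\<lambda>s. h s)))"

lemma bbl_dim: "bbl_dim d"
proof (induction d)
  case 0
  show ?case
    unfolding bbl_dim_def
  proof (intro allI impI)
    fix Q f g h
    assume m: "f \<in> borel_maps" "g \<in> borel_maps" "h \<in> borel_maps"
      and c: "\<forall>s\<in>Rn 0. \<forall>t\<in>Rn 0. bbl_at (Q + 0) (f s) (g t) (h (s + t))"
    have "(\<lambda>_. 0) \<in> Rn 0" by (simp add: Rn_iff)
    with c have "bbl_at (Q + 0) (f (\<lambda>_. 0)) (g (\<lambda>_. 0)) (h ((\<lambda>_. 0) + (\<lambda>_. 0)))" by blast
    then show "bbl_at Q (lint 0 (\<lambda>s. f s)) (lint 0 (\<lambda>s. g s)) (lint 0 (\<lambda>s. h s))"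
      using m by (simp add: nn_integral_Rn_0 plus_fun_def)
  qed
next
  case (Suc d)
  show ?case
    unfolding bbl_dim_def
  proof (intro allI impI)
    fix Q B R and f g h :: "vec \<Rightarrow> ennreal"
    assume Q: "Q \<ge> 1" and m[measurable]: "f \<in> borel_maps" "g \<in> borel_maps" "h \<in> borel_maps"
      and c: "\<forall>s\<in>Rn (Suc d). \<forall>t\<in>Rn (Suc d). bbl_at (Q + Suc d) (f s) (g t) (h (s + t))"
      and b: "\<forall>s. f s \<le> ennreal B \<and> g s \<le> ennreal B" and s: "\<forall>s. s \<notin> cube (Suc d) R \<longrightarrow> f s = 0 \<and> g s = 0"
    have up: "x(d := r) \<in> Rn (Suc d)" if "x \<in> Rn d" for x :: vec and r
      using that by (auto simp: Rn_iff)
    have cu: "x(d := r) \<notin> cube (Suc d) R" if "x \<notin> cube d R \<or> \<bar>r\<bar> > R" for x :: vec and r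
      using that by (auto simp: cube_def)
    have bd: "(lint1 (\<lambda>r. f (x(d := r)))) \<le> ennreal (\<bar>B\<bar> * (2 * \<bar>R\<bar>))" if "\<forall>s. f s \<le> ennreal B" "\<forall>s. s \<notin> cube (Suc d) R \<longrightarrow> f s = 0"
      for f x
    proof -
      have "(lint1 (\<lambda>r. f (x(d := r)))) \<le> (lint1 (\<lambda>r. ennreal \<bar>B\<bar> * indicator {-\<bar>R\<bar>..\<bar>R\<bar>} r))"
      proof (rule nn_integral_mono)
        fix r
        show "f (x(d := r)) \<le> ennreal \<bar>B\<bar> * indicator {-\<bar>R\<bar>..\<bar>R\<bar>} r"
        proof (cases "\<bar>r\<bar> > R")
          case True
          then have "f (x(d := r)) = 0" using cu[of x r] that(2) by blast
          then show ?thesis by simp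
        next
          case False
          then have "r \<in> {-\<bar>R\<bar>..\<bar>R\<bar>}" by auto
          moreover have "f (x(d := r)) \<le> ennreal \<bar>B\<bar>"
            using that(1) ennreal_leI[of B "\<bar>B\<bar>"] by (meson abs_ge_self order_trans)
          ultimately show ?thesis by simp
        qed
      qed
      also have "... = ennreal (\<bar>B\<bar> * (2 * \<bar>R\<bar>))"
        by (subst nn_integral_cmult) (auto simp: ennreal_mult)
      finally show ?thesis .
    qed
    let ?F = "\<lambda>x. \<integral>\<^sup>+r. f (x(d := r)) \<partial>lborel" and ?G = "\<lambda>x. \<integral>\<^sup>+r. g (x(d := r)) \<partial>lborel"
    let ?H = "\<lambda>x. \<integral>\<^sup>+r. h (x(d := r)) \<partial>lborel"
    have "bbl_at Q (lint d (\<lambda>x. ?F x)) (lint d (\<lambda>x. ?G x)) (lint d (\<lambda>x. ?H x))"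
    proof (rule Suc.IH[unfolded bbl_dim_def, rule_format, OF Q])
      fix x y :: vec assume xy: "x \<in> Rn d" "y \<in> Rn d"
      show "bbl_at (Q + d) (?F x) (?G y) (?H (x + y))"
      proof (rule bbl_1d[where B=B and R=R])
        fix p q :: real
        have "(x + y)(d := p + q) = x(d := p) + y(d := q)" by (auto simp: fun_eq_iff)
        then show "bbl_at (Suc (Q + d)) (f (x(d := p))) (g (y(d := q))) (h ((x + y)(d := p + q)))"
          using c up[OF xy(1)] up[OF xy(2)] by simp
      qed (use Q b s cu in auto)
    next
      show "?F x \<le> ennreal (\<bar>B\<bar> * (2 * \<bar>R\<bar>)) \<and> ?G x \<le> ennreal (\<bar>B\<bar> * (2 * \<bar>R\<bar>))" for x
        using bd b s by auto
      show "?F x = 0 \<and> ?G x = 0" if "x \<notin> cube d R" for x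
        using that s cu by simp
    qed simp_all
    then show "bbl_at Q (lint (Suc d) (\<lambda>s. f s)) (lint (Suc d) (\<lambda>s. g s)) (lint (Suc d) (\<lambda>s. h s))"
      by (simp add: nn_integral_Rn_Suc)
  qed
qed

lemma borell_brascamp_lieb:
  fixes f g h :: "vec \<Rightarrow> ennreal"
  assumes "Q \<ge> 1" "f \<in> borel_maps" "g \<in> borel_maps" "h \<in> borel_maps"
    and "\<And>s t. s \<in> Rn d \<Longrightarrow> t \<in> Rn d \<Longrightarrow> bbl_at (Q + d) (f s) (g t) (h (s + t))"
    and "\<And>s. f s \<le> ennreal B" "\<And>s. g s \<le> ennreal B"
    and "\<And>s. s \<notin> cube d R \<Longrightarrow> f s = 0" "\<And>s. s \<notin> cube d R \<Longrightarrow> g s = 0"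
  shows "bbl_at Q (lint d (\<lambda>s. f s)) (lint d (\<lambda>s. g s)) (lint d (\<lambda>s. h s))"
  using bbl_dim[unfolded bbl_dim_def, rule_format, of Q f g h d B R] assms by blast

lemma brunn_minkowski:
  assumes [measurable]: "A \<in> sets borel" "B \<in> sets borel" "S \<in> sets borel"
    and cube: "A \<subseteq> cube d R" "B \<subseteq> cube d R"
    and S: "\<And>s t. s \<in> A \<Longrightarrow> t \<in> B \<Longrightarrow> s \<in> Rn d \<Longrightarrow> t \<in> Rn d \<Longrightarrow> s + t \<in> S"
    and a: "a > 0" "emeasure (leb d) A = ennreal (a ^ d)"
    and b: "b > 0" "emeasure (leb d) B = ennreal (b ^ d)"
  shows "emeasure (leb d) S \<ge> ennreal ((a + b) ^ d)"
proof -
  define f where "f = (\<lambda>s. ennreal (1 / a ^ d) * indicator A s)"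
  define g where "g = (\<lambda>s. ennreal (1 / b ^ d) * indicator B s)"
  define h where "h = (\<lambda>s. ennreal (1 / (a + b) ^ d) * indicator S s)"
  have [measurable]: "f \<in> borel_maps" "g \<in> borel_maps" "h \<in> borel_maps"
    unfolding f_def g_def h_def by measurable
  have "bbl_at 1 (lint d (\<lambda>s. f s)) (lint d (\<lambda>s. g s)) (lint d (\<lambda>s. h s))"
  proof (rule borell_brascamp_lieb[where B="max (1 / a ^ d) (1 / b ^ d)" and R=R])
    fix s t :: vec assume st: "s \<in> Rn d" "t \<in> Rn d"
    consider "s \<notin> A" | "t \<notin> B" | "s \<in> A" "t \<in> B" by blast
    then show "bbl_at (1 + d) (f s) (g t) (h (s + t))"
    proof cases
      case 3
      define l where "l = a / (a + b)"
      have l: "0 \<le> l" "l \<le> 1" "1 - l = b / (a + b)" using a b by (auto simp: l_def field_simps)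
      have "l ^ (1 + d) * (1 / a ^ d) + (1 - l) ^ (1 + d) * (1 / b ^ d) = 1 / (a + b) ^ d"
        using a b unfolding l(3) by (simp add: l_def power_divide divide_simps)
      then have "ennreal (l ^ (1 + d)) * ennreal (1 / a ^ d) + ennreal ((1 - l) ^ (1 + d)) * ennreal (1 / b ^ d) = ennreal (1 / (a + b) ^ d)"
        using l a b by (subst (1 2) ennreal_mult'[symmetric], simp, simp, subst ennreal_plus[symmetric]) auto
      then show ?thesis
        unfolding bbl_at_def using l 3 S[OF 3 st] by (intro exI[of _ l]) (simp add: f_def g_def h_def)
    next
      case 1
      then show ?thesis unfolding bbl_at_def by (intro exI[of _ 1]) (auto simp: f_def power_0_left)
    next
      case 2
      then show ?thesis unfolding bbl_at_def by (intro exI[of _ 0]) (auto simp: g_def power_0_left)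
    qed
  next
    show "f s \<le> ennreal (max (1 / a ^ d) (1 / b ^ d))" "g s \<le> ennreal (max (1 / a ^ d) (1 / b ^ d))" for s
      by (auto simp: f_def g_def indicator_def intro!: ennreal_leI)
  qed (use cube in \<open>auto simp: f_def g_def indicator_def\<close>)
  moreover have "lint d (\<lambda>s. f s) = 1" "lint d (\<lambda>s. g s) = 1"
    using a b by (auto simp: f_def g_def nn_integral_cmult ennreal_mult'[symmetric])
  ultimately obtain l where "0 \<le> l" "l \<le> 1" "ennreal l + ennreal (1 - l) \<le> lint d (\<lambda>s. h s)"
    unfolding bbl_at_def by auto
  then have "1 \<le> ennreal (1 / (a + b) ^ d) * emeasure (leb d) S"
    by (simp add: h_def nn_integral_cmult ennreal_plus[symmetric] del: ennreal_plus)
  then have "ennreal ((a + b) ^ d) * 1 \<le> ennreal ((a + b) ^ d) * (ennreal (1 / (a + b) ^ d) * emeasure (leb d) S)"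
    by (rule mult_left_mono) simp
  also have "... = emeasure (leb d) S"
    using a b by (simp add: mult.assoc[symmetric] ennreal_mult'[symmetric])
  finally show ?thesis by simp
qed

section \<open>Gaussian moments\<close>

lemma gauss_prob_UNIV [simp]: "measure (gauss n) UNIV = 1"
  using gauss.prob_space[of n] by simp

lemma nn_integral_gauss_coord:
  fixes f :: "real \<Rightarrow> ennreal"
  assumes [measurable]: "f \<in> borel_maps" and i: "i < n"
  shows "gint n (\<lambda>x. f (x i)) = (lint1 (\<lambda>s. ennreal (std_normal_density s) * f s))"
proof -
  define g where "g = (\<lambda>j. if j = i then f else (\<lambda>_. 1))"
  have [measurable]: "g j \<in> borel_maps" for j by (simp add: g_def)
  have "gint n (\<lambda>x. f (x i)) = gint n (\<lambda>x. (\<Prod>j<n. g j (x j)))"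
    using i by (intro nn_integral_cong) (simp add: g_def if_distribR prod.delta)
  also have "... = (\<Prod>j<n. lint1 (\<lambda>s. ennreal (std_normal_density s) * g j s))"
    by (rule nn_integral_gauss_prod) measurable
  also have "... = (\<Prod>j<n. if j = i then (lint1 (\<lambda>s. ennreal (std_normal_density s) * f s)) else 1)"
    by (intro prod.cong) (auto simp: g_def nn_integral_std_normal)
  finally show ?thesis using i by (simp add: prod.delta)
qed

lemma distr_gauss_coord: "i < n \<Longrightarrow> distr (gauss n) borel (\<lambda>x. x i) = density lborel (\<lambda>s. ennreal (std_normal_density s))"
proof (rule measure_eqI)
  fix A :: "real set" assume i: "i < n" and "A \<in> sets (distr (gauss n) borel (\<lambda>x. x i))"
  then have [measurable]: "A \<in> sets borel" by simp
  have "emeasure (distr (gauss n) borel (\<lambda>x. x i)) A = gint n (\<lambda>x. indicator A (x i))"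
    by (subst nn_integral_distr[of "\<lambda>x. x i" "gauss n" borel "indicator A", symmetric]) (auto)
  also have "... = emeasure (density lborel (\<lambda>s. ennreal (std_normal_density s))) A"
    by (subst nn_integral_gauss_coord[OF _ i]) (auto simp: emeasure_density)
  finally show "emeasure (distr (gauss n) borel (\<lambda>x. x i)) A = emeasure (density lborel (\<lambda>s. ennreal (std_normal_density s))) A" .
qed simp

lemma gauss_coord_square: "i < n \<Longrightarrow> (gmean n (\<lambda>x. x i * x i)) = 1"
proof -
  assume i: "i < n"
  have "(gmean n (\<lambda>x. x i * x i)) = (\<integral>s. s * s \<partial>distr (gauss n) borel (\<lambda>x. x i))"
    by (subst integral_distr) auto
  also have "... = (\<integral>s. std_normal_density s * s ^ (2 * 1) \<partial>lborel)"
    unfolding distr_gauss_coord[OF i] by (subst integral_density) (auto simp: power2_eq_square)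
  also have "... = 1"
    by (subst integral_std_normal_moment_even) (simp add: fact_numeral)
  finally show ?thesis .
qed

lemma distr_gauss_orthogonal:
  assumes R: "R \<in> orthogonal_group n" and [measurable]: "R \<in> borel_maps"
  shows "distr (gauss n) borel R = gauss n"
proof (rule measure_eqI)
  fix A assume "A \<in> sets (distr (gauss n) borel R)"
  then have [measurable]: "A \<in> sets borel" by simp
  have "emeasure (distr (gauss n) borel R) A = gint n (\<lambda>x. indicator A (R x))"
    by (subst nn_integral_distr[of R "gauss n" borel "indicator A", symmetric]) auto
  also have "... = emeasure (gauss n) A"
    by (subst nn_integral_gauss_orthogonal[OF R]) auto
  finally show "emeasure (distr (gauss n) borel R) A = emeasure (gauss n) A" .
qed simp

lemma gauss_flip:
  fixes h :: "vec \<Rightarrow> real"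
  assumes [measurable]: "h \<in> borel_maps"
  shows "(gmean n (\<lambda>x. h (x(i := - x i)))) = (gmean n (\<lambda>x. h x))"
proof -
  let ?R = "\<lambda>x::nat \<Rightarrow> real. x(i := - x i)"
  have "?R \<in> orthogonal_group n"
    by (auto simp: orthogonal_group_def linear_Rn_def Rn_iff fun_eq_iff scaleR_fun_def dot_def intro!: sum.cong)
  then have "distr (gauss n) borel ?R = gauss n"
    by (rule distr_gauss_orthogonal) measurable
  then have "(gmean n (\<lambda>x. h x)) = (\<integral>x. h x \<partial>distr (gauss n) borel ?R)" by simp
  also have "... = (gmean n (\<lambda>x. h (?R x)))"
    by (rule integral_distr) measurable
  finally show ?thesis by simp
qed

lemma gauss_coord_mean: "(gmean n (\<lambda>x. x i)) = 0"
  using gauss_flip[where h="\<lambda>x. x i" and i=i and n=n] by simp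

lemma gauss_coord_mixed: "i \<noteq> j \<Longrightarrow> (gmean n (\<lambda>x. x i * x j)) = 0"
  using gauss_flip[where h="\<lambda>x. x i * x j" and i=i and n=n] by simp

text \<open>A product weight that dominates all polynomials that occur and has finite moments.\<close>

definition weight :: "nat \<Rightarrow> vec \<Rightarrow> real" where
  "weight n x = (real n + 1) * (\<Prod>i<n. 1 + x i * x i)"

lemma weight_measurable [measurable]: "weight n \<in> borel_maps"
  unfolding weight_def by measurable

lemma weight_ge: "real n + 1 + dot n x x \<le> weight n x"
proof -
  have *: "1 + (\<Sum>i<m. x i * x i) \<le> (\<Prod>i<m. 1 + x i * x i)" for m
  proof (induction m)
    case (Suc m)
    have "1 * (x m * x m) \<le> (\<Prod>i<m. 1 + x i * x i) * (x m * x m)"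
      by (intro mult_right_mono prod_ge_1) auto
    with Suc show ?case by (simp add: algebra_simps)
  qed simp
  have "real n + 1 + dot n x x \<le> (real n + 1) * (1 + dot n x x)"
    by (simp add: algebra_simps)
  also have "... \<le> weight n x"
    unfolding weight_def dot_def by (intro mult_left_mono *) auto
  finally show ?thesis .
qed

lemma weight_ge_1: "1 \<le> weight n x"
  using weight_ge[of n x] dot_nonneg[of n x] by linarith

lemma integrable_weight: "integrable (gauss n) (\<lambda>x. weight n x ^ 3)"
proof (rule integrableI_nonneg)
  have 1: "integrable lborel (\<lambda>s. std_normal_density s * (1 + s * s) ^ 3)"
  proof -
    have "(\<lambda>s. std_normal_density s * (1 + s * s) ^ 3) =
      (\<lambda>s. std_normal_density s * s ^ 0 + 3 * (std_normal_density s * s ^ 2) + 3 * (std_normal_density s * s ^ 4) + std_normal_density s * s ^ 6)"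
      by (simp add: fun_eq_iff power_numeral_reduce algebra_simps)
    then show ?thesis
      by (simp only:) (intro Bochner_Integration.integrable_add integrable_mult_right integrable_std_normal_moment)
  qed
  have 2: "(lint1 (\<lambda>s. ennreal (std_normal_density s) * ennreal ((1 + s * s) ^ 3))) < \<infinity>"
  proof -
    have "(lint1 (\<lambda>s. ennreal (std_normal_density s) * ennreal ((1 + s * s) ^ 3))) = (lint1 (\<lambda>s. ennreal (std_normal_density s * (1 + s * s) ^ 3)))"
      by (intro nn_integral_cong) (simp add: ennreal_mult)
    also have "... = ennreal (\<integral>s. std_normal_density s * (1 + s * s) ^ 3 \<partial>lborel)"
      by (rule nn_integral_eq_integral[OF 1]) auto
    finally show ?thesis by simp
  qed
  have "gint n (\<lambda>x. ennreal (weight n x ^ 3)) = gint n (\<lambda>x. ennreal ((real n + 1) ^ 3) * (\<Prod>i<n. ennreal ((1 + x i * x i) ^ 3)))"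
    by (intro nn_integral_cong) (simp add: weight_def power_mult_distrib ennreal_mult prod_ennreal prod_power_distrib prod_nonneg)
  also have "... = ennreal ((real n + 1) ^ 3) * (\<Prod>i<n. lint1 (\<lambda>s. ennreal (std_normal_density s) * ennreal ((1 + s * s) ^ 3)))"
    by (subst nn_integral_cmult, measurable, subst nn_integral_gauss_prod[of "\<lambda>i s. ennreal ((1 + s * s) ^ 3)"]) auto
  also have "... < \<infinity>"
    using 2 by (auto intro!: ennreal_mult_less_top[THEN iffD2] simp: power_less_top_ennreal)
  finally show "gint n (\<lambda>x. ennreal (weight n x ^ 3)) < \<infinity>" .
qed (use weight_ge_1 in \<open>auto intro!: AE_I2 zero_le_power order_trans[OF zero_le_one]\<close>)

lemma integrable_gauss_weight:
  fixes f :: "vec \<Rightarrow> real"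
  assumes [measurable]: "f \<in> borel_maps" and "\<And>x. \<bar>f x\<bar> \<le> C * weight n x ^ 3"
  shows "integrable (gauss n) f"
  by (rule Bochner_Integration.integrable_bound[of "gauss n" "\<lambda>x. C * weight n x ^ 3"])
     (use integrable_weight assms(2) in \<open>auto intro!: AE_I2 order_trans[OF assms(2) abs_ge_self]\<close>)

lemma weight_le_cube: "weight n x \<le> weight n x ^ 3"
  using weight_ge_1[of n x] by (simp add: self_le_power)

lemma abs_dot_le: "\<bar>dot n b x\<bar> \<le> (dot n b b + dot n x x) / 2"
proof -
  have "0 \<le> dot n (b - x) (b - x)" "0 \<le> dot n (b + x) (b + x)" by auto
  then show ?thesis by (simp add: dot_simps dot_commute[of n x b])
qed

lemma integrable_gauss_dot: "integrable (gauss n) (\<lambda>x. dot n b x)"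
proof (rule integrable_gauss_weight)
  show "\<bar>dot n b x\<bar> \<le> (dot n b b + 1) * weight n x ^ 3" for x
  proof -
    have "(dot n b b + dot n x x) / 2 \<le> dot n b b + dot n x x"
      using add_nonneg_nonneg[OF dot_nonneg dot_nonneg, of n b n x] by simp
    with abs_dot_le have "\<bar>dot n b x\<bar> \<le> dot n b b + dot n x x"
      by (rule order_trans)
    also have "... \<le> dot n b b * weight n x + weight n x"
      using weight_ge[of n x] mult_left_mono[OF weight_ge_1 dot_nonneg, of n b n x] by simp
    also have "... \<le> (dot n b b + 1) * weight n x ^ 3"
      using mult_left_mono[OF weight_le_cube, of "dot n b b + 1" n x] dot_nonneg[of n b] by (simp add: algebra_simps)
    finally show ?thesis .
  qed
qed measurable

lemma integrable_gauss_dot_square: "integrable (gauss n) (\<lambda>x. (dot n b x)\<^sup>2)"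
proof (rule integrable_gauss_weight)
  show "\<bar>(dot n b x)\<^sup>2\<bar> \<le> dot n b b * weight n x ^ 3" for x
  proof -
    have "(dot n b x)\<^sup>2 \<le> dot n b b * dot n x x" by (rule dot_Cauchy_Schwarz)
    also have "... \<le> dot n b b * weight n x ^ 3"
      using weight_ge[of n x] weight_le_cube[of n x] by (intro mult_left_mono) auto
    finally show ?thesis by simp
  qed
qed measurable

lemma gauss_dot_mean: "(gmean n (\<lambda>x. dot n b x)) = 0"
proof -
  have i: "integrable (gauss n) (\<lambda>x. x i)" if "i < n" for i
    using integrable_gauss_dot[of n "unit_vec i"] that by (simp add: dot_unit_vec)
  show ?thesis
    unfolding dot_def by (subst Bochner_Integration.integral_sum) (auto simp: i gauss_coord_mean)
qed

lemma gauss_dot_square: "(gmean n (\<lambda>x. (dot n b x)\<^sup>2)) = dot n b b"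
proof -
  have i: "integrable (gauss n) (\<lambda>x. x i * x j)" if "i < n" "j < n" for i j
  proof -
    have "integrable (gauss n) (\<lambda>x. ((dot n (unit_vec i + unit_vec j) x)\<^sup>2 - (dot n (unit_vec i - unit_vec j) x)\<^sup>2) / 4)"
      by (intro integrable_divide_zero Bochner_Integration.integrable_diff integrable_gauss_dot_square)
    then show ?thesis using that by (simp add: dot_simps dot_unit_vec power2_eq_square algebra_simps)
  qed
  have "(gmean n (\<lambda>x. (dot n b x)\<^sup>2)) = (gmean n (\<lambda>x. (\<Sum>i<n. \<Sum>j<n. (b i * b j) * (x i * x j))))"
    unfolding power2_eq_square dot_def sum_product by (simp add: mult_ac)
  also have "... = (\<Sum>i<n. \<Sum>j<n. (b i * b j) * (gmean n (\<lambda>x. x i * x j)))"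
    by (subst Bochner_Integration.integral_sum) (auto simp: i intro!: sum.cong Bochner_Integration.integrable_sum)
  also have "... = (\<Sum>i<n. \<Sum>j<n. if i = j then b i * b j else 0)"
    by (intro sum.cong refl) (auto simp: gauss_coord_mixed gauss_coord_square)
  finally show ?thesis by (simp add: dot_def)
qed

lemma integrable_gauss_bounded:
  fixes f :: "vec \<Rightarrow> real"
  assumes [measurable]: "f \<in> borel_maps" and "\<And>x. \<bar>f x\<bar> \<le> C"
  shows "integrable (gauss n) f"
  by (rule gauss.integrable_const_bound[where B=C]) (use assms(2) in auto)

lemma gauss_sum_real:
  fixes f :: "vec \<Rightarrow> real"
  assumes [measurable]: "f \<in> borel_maps" and f: "\<And>x. 0 \<le> f x" "\<And>x. f x \<le> C"
  shows "(\<integral>x. (gmean n (\<lambda>y. f (s *\<^sub>R x + u *\<^sub>R y))) \<partial>gauss n) = (gmean n (\<lambda>x. f (sqrt (s\<^sup>2 + u\<^sup>2) *\<^sub>R x)))"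
proof -
  have i: "integrable (gauss n) (\<lambda>y. f (s *\<^sub>R x + u *\<^sub>R y))" for x
    by (rule integrable_gauss_bounded[where C=C]) (use f in \<open>auto simp: abs_le_iff intro: order_trans[of _ 0]\<close>)
  have m: "(\<lambda>x. gmean n (\<lambda>y. f (s *\<^sub>R x + u *\<^sub>R y))) \<in> borel_maps"
    by (rule gauss.borel_measurable_lebesgue_integral) measurable
  have C: "C \<ge> 0" using order_trans[OF f(1) f(2)] .
  have b: "0 \<le> (gmean n (\<lambda>y. f (s *\<^sub>R x + u *\<^sub>R y)))" "(gmean n (\<lambda>y. f (s *\<^sub>R x + u *\<^sub>R y))) \<le> C" for x
    using f by (auto intro!: integral_nonneg_AE gauss.integral_le_const i)
  have "ennreal (\<integral>x. (gmean n (\<lambda>y. f (s *\<^sub>R x + u *\<^sub>R y))) \<partial>gauss n) = gint n (\<lambda>x. ennreal (gmean n (\<lambda>y. f (s *\<^sub>R x + u *\<^sub>R y))))"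
    by (rule nn_integral_eq_integral[symmetric], rule integrable_gauss_bounded[where C=C, OF m]) (use b in auto)
  also have "... = gint n (\<lambda>x. gint n (\<lambda>y. ennreal (f (s *\<^sub>R x + u *\<^sub>R y))))"
    by (intro nn_integral_cong nn_integral_eq_integral[symmetric] i) (use f in auto)
  also have "... = gint n (\<lambda>x. ennreal (f (sqrt (s\<^sup>2 + u\<^sup>2) *\<^sub>R x)))"
    by (rule gauss_sum[of "\<lambda>w. ennreal (f w)"]) measurable
  also have "... = ennreal (gmean n (\<lambda>x. f (sqrt (s\<^sup>2 + u\<^sup>2) *\<^sub>R x)))"
    by (rule nn_integral_eq_integral, rule integrable_gauss_bounded[where C=C])
       (use f in \<open>auto simp: abs_le_iff intro: order_trans[of _ 0]\<close>)
  finally show ?thesis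
    using b f by (subst (asm) ennreal_inj) (auto intro!: integral_nonneg_AE)
qed

section \<open>Gaussian smoothing\<close>

lemma gauss_translate:
  fixes f :: "vec \<Rightarrow> ennreal"
  assumes [measurable]: "f \<in> borel_maps" and k: "k \<in> Rn n"
  shows "gint n (\<lambda>y. f (y + k)) = gint n (\<lambda>y. ennreal (exp (dot n k y - dot n k k / 2)) * f y)"
proof -
  have d: "gauss_density n (y - k) = gauss_density n y * exp (dot n k y - dot n k k / 2)" for y
    by (simp add: gauss_density_eq dot_simps dot_commute[of n y k] exp_add[symmetric] field_simps)
  have "gint n (\<lambda>y. f (y + k)) = lint n (\<lambda>y. ennreal (gauss_density n ((y + k) - k)) * f (y + k))"
    by (simp add: nn_integral_gauss)
  also have "... = lint n (\<lambda>y. ennreal (gauss_density n (y - k)) * f y)"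
    by (rule nn_integral_Rn_translate[OF _ k, of "\<lambda>y. ennreal (gauss_density n (y - k)) * f y"]) measurable
  also have "... = gint n (\<lambda>y. ennreal (exp (dot n k y - dot n k k / 2)) * f y)"
    using gauss_density_pos[of n] by (simp add: nn_integral_gauss d ennreal_mult less_imp_le mult.assoc)
  finally show ?thesis .
qed

lemma gauss_exp:
  assumes "k \<in> Rn n"
  shows "integrable (gauss n) (\<lambda>y. exp (dot n k y - dot n k k / 2))"
    and "(gmean n (\<lambda>y. exp (dot n k y - dot n k k / 2))) = 1"
proof -
  have 1: "gint n (\<lambda>y. ennreal (exp (dot n k y - dot n k k / 2))) = 1"
    using gauss_translate[OF _ assms, of "\<lambda>_. 1"] gauss.emeasure_space_1[of n] by simp
  show "integrable (gauss n) (\<lambda>y. exp (dot n k y - dot n k k / 2))"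
    by (rule integrableI_nonneg) (auto simp: 1)
  then have "ennreal (gmean n (\<lambda>y. exp (dot n k y - dot n k k / 2))) = 1"
    using 1 by (subst nn_integral_eq_integral[symmetric]) auto
  then show "(gmean n (\<lambda>y. exp (dot n k y - dot n k k / 2))) = 1"
    by simp
qed

definition smoothing :: "nat \<Rightarrow> (vec \<Rightarrow> real) \<Rightarrow> vec \<Rightarrow> real \<Rightarrow> real \<Rightarrow> vec \<Rightarrow> real" where
  "smoothing n \<psi> x0 t s x = (gmean n (\<lambda>y. \<psi> (x0 + t *\<^sub>R x + s *\<^sub>R y)))"

context
  fixes \<psi> :: "vec \<Rightarrow> real"
  assumes psi_measurable [measurable]: "\<psi> \<in> borel_maps"
    and psi_bounds: "\<And>x. 0 \<le> \<psi> x" "\<And>x. \<psi> x \<le> 1"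
begin

lemma smoothing_measurable: "smoothing n \<psi> x0 t s \<in> borel_maps"
  unfolding smoothing_def by (rule gauss.borel_measurable_lebesgue_integral) measurable

lemma integrable_psi: "f \<in> borel_maps \<Longrightarrow> integrable (gauss n) (\<lambda>y. \<psi> (f y))"
  by (rule integrable_gauss_bounded[where C=1]) (use psi_bounds in \<open>auto simp: abs_le_iff intro: order_trans[of _ 0]\<close>)

lemma smoothing_bounds: "0 \<le> smoothing n \<psi> x0 t s x" "smoothing n \<psi> x0 t s x \<le> 1"
  unfolding smoothing_def using psi_bounds
  by (auto intro!: integral_nonneg_AE gauss.integral_le_const integrable_psi)

text \<open>
  Translating the Gaussian measure moves the dependence on \<open>x\<close> from
  \<open>\<psi>\<close> into an exponential density (Cameron--Martin). Hence the smoothing is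
  nearly affine at scales well below \<open>s\<close>, whatever the regularity of
  \<open>\<psi>\<close>.
\<close>

lemma smoothing_taylor:
  assumes s: "s > 0"
  obtains b where "b \<in> Rn n" "dot n b b \<le> real n * (t / s)\<^sup>2"
    "\<And>x. x \<in> Rn n \<Longrightarrow> \<bar>smoothing n \<psi> x0 t s x - smoothing n \<psi> x0 t s 0 - dot n b x\<bar> \<le> (t / s)\<^sup>2 * dot n x x"
proof -
  let ?p = "\<lambda>y. \<psi> (x0 + s *\<^sub>R y)"
  have [measurable]: "?p \<in> borel_maps" by measurable
  have p1: "\<bar>?p y * r\<bar> \<le> \<bar>r\<bar>" for y r
    using psi_bounds[of "x0 + s *\<^sub>R y"] by (simp add: abs_mult mult_left_le_one_le)
  have int: "integrable (gauss n) (\<lambda>y. ?p y * f y)" if "integrable (gauss n) f" for f :: "vec \<Rightarrow> real"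
    by (rule Bochner_Integration.integrable_bound[OF that]) (use that p1 in \<open>auto intro!: AE_I2\<close>)
  define b where "b = pad n (\<lambda>i. (t / s) * (gmean n (\<lambda>y. ?p y * y i)))"
  have bi: "(b i)\<^sup>2 \<le> (t / s)\<^sup>2" if i: "i < n" for i
  proof -
    have in1: "integrable (gauss n) (\<lambda>y. y i)"
      using integrable_gauss_dot[of n "unit_vec i"] i by (simp add: dot_unit_vec)
    have in2: "integrable (gauss n) (\<lambda>y. y i * y i)"
      using integrable_gauss_dot_square[of n "unit_vec i"] i by (simp add: dot_unit_vec power2_eq_square)
    have "\<bar>\<integral>y. ?p y * y i \<partial>gauss n\<bar> \<le> (gmean n (\<lambda>y. (1 + y i * y i) / 2))"
    proof (rule integral_abs_bound[THEN order_trans], rule integral_mono)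
      show "\<bar>?p y * y i\<bar> \<le> (1 + y i * y i) / 2" for y
      proof -
        have "0 \<le> (\<bar>y i\<bar> - 1)\<^sup>2" by simp
        then have "\<bar>y i\<bar> \<le> (1 + y i * y i) / 2" by (simp add: power2_eq_square algebra_simps)
        then show ?thesis using p1[of y "y i"] by linarith
      qed
    qed (use int[OF in1] in2 in auto)
    also have "... = 1" using in2 gauss_coord_square[OF i] by simp
    finally have "(gmean n (\<lambda>y. ?p y * y i))\<^sup>2 \<le> 1"
      by (simp add: abs_square_le_1)
    then have "(t / s)\<^sup>2 * (gmean n (\<lambda>y. ?p y * y i))\<^sup>2 \<le> (t / s)\<^sup>2 * 1"
      by (rule mult_left_mono) simp
    then show ?thesis using i by (simp add: b_def pad_def power_mult_distrib power_divide)
  qed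
  show ?thesis
  proof
    show "b \<in> Rn n" by (simp add: b_def)
    have "dot n b b \<le> (\<Sum>i<n. (t / s)\<^sup>2)"
      unfolding dot_def by (intro sum_mono) (use bi in \<open>auto simp: power2_eq_square\<close>)
    then show "dot n b b \<le> real n * (t / s)\<^sup>2" by simp
    fix x :: vec assume x: "x \<in> Rn n"
    define k where "k = (t / s) *\<^sub>R x"
    have k: "k \<in> Rn n" unfolding k_def using x by (rule Rn_scaleR)
    let ?e = "\<lambda>y. exp (dot n k y - dot n k k / 2)"
    have eq1: "x0 + t *\<^sub>R x + s *\<^sub>R y = x0 + s *\<^sub>R (y + k)" for y
      using s by (simp add: k_def scaleR_fun_def fun_eq_iff algebra_simps)
    have "ennreal (smoothing n \<psi> x0 t s x) = gint n (\<lambda>y. ennreal (?p (y + k)))"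
      unfolding smoothing_def eq1
      by (rule nn_integral_eq_integral[symmetric]) (use psi_bounds in \<open>auto intro!: integrable_psi\<close>)
    also have "... = gint n (\<lambda>y. ennreal (?e y) * ennreal (?p y))"
      by (rule gauss_translate[OF _ k]) measurable
    also have "... = gint n (\<lambda>y. ennreal (?p y * ?e y))"
      using psi_bounds by (intro nn_integral_cong) (simp add: ennreal_mult mult.commute)
    also have "... = ennreal (gmean n (\<lambda>y. ?p y * ?e y))"
      by (rule nn_integral_eq_integral) (use psi_bounds int[OF gauss_exp(1)[OF k]] in auto)
    finally have sx: "smoothing n \<psi> x0 t s x = (gmean n (\<lambda>y. ?p y * ?e y))"
      using smoothing_bounds psi_bounds by (subst (asm) ennreal_inj) (auto intro!: integral_nonneg_AE)
    have s0: "smoothing n \<psi> x0 t s 0 = (gmean n (\<lambda>y. ?p y))"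
      by (simp add: smoothing_def)
    have bx: "dot n b x = (gmean n (\<lambda>y. ?p y * dot n k y))"
    proof -
      have i: "integrable (gauss n) (\<lambda>y. ?p y * y i)" if "i < n" for i
        using int[OF integrable_gauss_dot[of n "unit_vec i"]] that by (simp add: dot_unit_vec)
      have "(gmean n (\<lambda>y. ?p y * dot n k y)) = (gmean n (\<lambda>y. (\<Sum>i<n. k i * (?p y * y i))))"
        by (simp add: dot_def sum_distrib_left mult_ac)
      also have "... = (\<Sum>i<n. k i * (gmean n (\<lambda>y. ?p y * y i)))"
        by (subst Bochner_Integration.integral_sum) (auto simp: i)
      also have "... = dot n b x"
        unfolding dot_def by (intro sum.cong) (auto simp: b_def pad_def k_def scaleR_fun_def)
      finally show ?thesis by simp
    qed
    have i1: "integrable (gauss n) (\<lambda>y. ?p y * ?e y)" by (rule int[OF gauss_exp(1)[OF k]])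
    have i2: "integrable (gauss n) (\<lambda>y. ?p y * dot n k y)" by (rule int[OF integrable_gauss_dot])
    have i3: "integrable (gauss n) ?p" by (rule integrable_psi) measurable
    have "smoothing n \<psi> x0 t s x - smoothing n \<psi> x0 t s 0 - dot n b x = (gmean n (\<lambda>y. ?p y * (?e y - 1 - dot n k y)))"
      unfolding sx s0 bx using i1 i2 i3 by (simp add: right_diff_distrib)
    then have "\<bar>smoothing n \<psi> x0 t s x - smoothing n \<psi> x0 t s 0 - dot n b x\<bar> =
        \<bar>\<integral>y. ?p y * (?e y - 1 - dot n k y) \<partial>gauss n\<bar>"
      by (rule arg_cong)
    also have "... \<le> (gmean n (\<lambda>y. ?e y - 1 - dot n k y + dot n k k))"
    proof (rule integral_abs_bound[THEN order_trans], rule integral_mono)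
      fix y
      have "1 + (dot n k y - dot n k k / 2) \<le> ?e y" by (rule exp_ge_add_one_self)
      then have "\<bar>?e y - 1 - dot n k y\<bar> \<le> ?e y - 1 - dot n k y + dot n k k"
        using dot_nonneg[of n k] by (intro abs_leI) linarith+
      then show "\<bar>?p y * (?e y - 1 - dot n k y)\<bar> \<le> ?e y - 1 - dot n k y + dot n k k"
        using p1[of y "?e y - 1 - dot n k y"] by linarith
    next
      have "integrable (gauss n) (\<lambda>y. ?p y * ?e y - ?p y - ?p y * dot n k y)"
        by (intro Bochner_Integration.integrable_diff i1 i2 i3)
      then show "integrable (gauss n) (\<lambda>y. \<bar>?p y * (?e y - 1 - dot n k y)\<bar>)"
        by (intro integrable_abs) (simp add: right_diff_distrib)
      show "integrable (gauss n) (\<lambda>y. ?e y - 1 - dot n k y + dot n k k)"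
        by (intro Bochner_Integration.integrable_add Bochner_Integration.integrable_diff
            gauss_exp(1)[OF k] integrable_gauss_dot gauss.integrable_const)
    qed
    also have "... = (gmean n (\<lambda>y. ?e y - 1 - dot n k y)) + (gmean n (\<lambda>y. dot n k k))"
      by (intro Bochner_Integration.integral_add Bochner_Integration.integrable_diff
          gauss_exp(1)[OF k] integrable_gauss_dot gauss.integrable_const)
    also have "(gmean n (\<lambda>y. ?e y - 1 - dot n k y)) = (gmean n (\<lambda>y. ?e y - 1)) - (gmean n (\<lambda>y. dot n k y))"
      by (intro Bochner_Integration.integral_diff Bochner_Integration.integrable_diff
          gauss_exp(1)[OF k] integrable_gauss_dot gauss.integrable_const)
    also have "(gmean n (\<lambda>y. ?e y - 1)) = (gmean n (\<lambda>y. ?e y)) - (gmean n (\<lambda>y. 1))"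
      by (intro Bochner_Integration.integral_diff gauss_exp(1)[OF k] gauss.integrable_const)
    also have "(gmean n (\<lambda>y. ?e y)) - (gmean n (\<lambda>y. 1)) - (gmean n (\<lambda>y. dot n k y)) + (gmean n (\<lambda>y. dot n k k)) = dot n k k"
      unfolding gauss_exp(2)[OF k] gauss_dot_mean by simp
    also have "... = (t / s)\<^sup>2 * dot n x x"
      by (simp add: k_def dot_simps power2_eq_square)
    finally show "\<bar>smoothing n \<psi> x0 t s x - smoothing n \<psi> x0 t s 0 - dot n b x\<bar> \<le> (t / s)\<^sup>2 * dot n x x" .
  qed
qed

end

section \<open>The geometric Brascamp--Lieb inequality\<close>

lemma ln_one_plus_le_cubic:
  fixes r :: real
  assumes "r > - 1"
  shows "ln (1 + r) \<le> r - r\<^sup>2 / 2 + \<bar>r\<bar> ^ 3"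
proof -
  let ?f = "\<lambda>r::real. r - r\<^sup>2 / 2 + r ^ 3 / 3 - ln (1 + r)"
  have d: "(?f has_real_derivative x ^ 3 / (1 + x)) (at x)" if "x > -1" for x
  proof -
    have "(?f has_real_derivative (1 - x + x\<^sup>2 - 1 / (1 + x))) (at x)"
      using that by (auto intro!: derivative_eq_intros simp: field_simps power2_eq_square)
    moreover have "1 - x + x\<^sup>2 - 1 / (1 + x) = x ^ 3 / (1 + x)"
      using that by (simp add: field_simps power2_eq_square power3_eq_cube)
    ultimately show ?thesis by simp
  qed
  have "?f r \<ge> 0"
  proof (cases "r \<ge> 0")
    case True
    have "?f 0 \<le> ?f r"
    proof (rule DERIV_nonneg_imp_nondecreasing[where f="?f", OF True])
      fix x assume "0 \<le> x" "x \<le> r"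
      then show "\<exists>y. (?f has_real_derivative y) (at x) \<and> 0 \<le> y"
        using d[of x] by (intro exI[of _ "x ^ 3 / (1 + x)"]) auto
    qed
    then show ?thesis by simp
  next
    case False
    have "?f 0 \<le> ?f r"
    proof (rule DERIV_nonpos_imp_nonincreasing[where f="?f"])
      show "r \<le> 0" using False by simp
    next
      fix x assume "r \<le> x" "x \<le> 0"
      moreover have "x ^ 3 \<le> 0" if "x \<le> 0" using that by (simp add: power3_eq_cube mult_nonneg_nonpos)
      ultimately show "\<exists>y. (?f has_real_derivative y) (at x) \<and> y \<le> 0"
        using d[of x] assms by (intro exI[of _ "x ^ 3 / (1 + x)"]) (auto simp: divide_nonpos_pos)
    qed
    then show ?thesis by simp
  qed
  moreover have "r ^ 3 / 3 \<le> \<bar>r\<bar> ^ 3"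
    using abs_ge_self[of "r ^ 3"] zero_le_power[OF abs_ge_zero[of r], of 3] unfolding power_abs by linarith
  ultimately show ?thesis by linarith
qed

lemma ln_one_plus_bounds:
  fixes r M :: real
  assumes M: "M \<ge> 1" and r: "1 / M \<le> 1 + r"
  shows "ln (1 + r) \<le> r" "r - M * r\<^sup>2 \<le> ln (1 + r)" "\<bar>ln (1 + r)\<bar> \<le> M * \<bar>r\<bar>"
proof -
  have p: "1 + r > 0" using r M by (smt (verit) divide_pos_pos)
  show 1: "ln (1 + r) \<le> r" using ln_le_minus_one[OF p] by simp
  have q: "1 / (1 + r) \<le> M" using r M p by (simp add: field_simps)
  have "ln (1 / (1 + r)) \<le> 1 / (1 + r) - 1" by (rule ln_le_minus_one) (use p in simp)
  then have 2: "r / (1 + r) \<le> ln (1 + r)" using p by (simp add: ln_div field_simps)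
  have "r / (1 + r) = r - r\<^sup>2 * (1 / (1 + r))" using p by (simp add: field_simps power2_eq_square)
  moreover have "r\<^sup>2 * (1 / (1 + r)) \<le> r\<^sup>2 * M" using q by (rule mult_left_mono) simp
  ultimately show "r - M * r\<^sup>2 \<le> ln (1 + r)" using 2 by (simp add: mult.commute)
  have "- (M * \<bar>r\<bar>) \<le> r / (1 + r)"
  proof -
    have "\<bar>r / (1 + r)\<bar> = \<bar>r\<bar> * (1 / (1 + r))" using p by simp
    also have "... \<le> \<bar>r\<bar> * M" using q by (rule mult_left_mono) simp
    finally have "\<bar>r / (1 + r)\<bar> \<le> \<bar>r\<bar> * M" .
    then have "- (\<bar>r\<bar> * M) \<le> r / (1 + r)" by linarith
    then show ?thesis by (simp only: mult.commute)
  qed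
  moreover have "r \<le> M * \<bar>r\<bar>" using mult_right_mono[OF M, of "\<bar>r\<bar>"] by simp
  ultimately show "\<bar>ln (1 + r)\<bar> \<le> M * \<bar>r\<bar>" using 1 2 by (simp add: abs_le_iff)
qed

lemma square_diff_bound:
  fixes x y p q :: real
  assumes "\<bar>x - y\<bar> \<le> p" "\<bar>x\<bar> + \<bar>y\<bar> \<le> q"
  shows "\<bar>x\<^sup>2 - y\<^sup>2\<bar> \<le> p * q"
proof -
  have "x\<^sup>2 - y\<^sup>2 = (x - y) * (x + y)" by (simp add: power2_eq_square algebra_simps)
  then have "\<bar>x\<^sup>2 - y\<^sup>2\<bar> = \<bar>x - y\<bar> * \<bar>x + y\<bar>" by (simp add: abs_mult)
  also have "... \<le> p * q" using assms by (intro mult_mono) auto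
  finally show ?thesis .
qed

lemma exp_le_quadratic:
  fixes z B :: real
  assumes "\<bar>z\<bar> \<le> B"
  shows "exp z \<le> 1 + z + z\<^sup>2 / 2 + exp B * \<bar>z\<bar> ^ 3"
proof -
  obtain t where t: "\<bar>t\<bar> \<le> \<bar>z\<bar>" "exp z = (\<Sum>m<3. z ^ m / fact m) + exp t / fact 3 * z ^ 3"
    using Maclaurin_exp_le[of z 3] by blast
  have "exp t / fact 3 * z ^ 3 \<le> \<bar>exp t / fact 3 * z ^ 3\<bar>" by (rule abs_ge_self)
  also have "... = exp t / fact 3 * \<bar>z\<bar> ^ 3" by (simp add: abs_mult power_abs)
  also have "... \<le> exp B * \<bar>z\<bar> ^ 3"
  proof (rule mult_right_mono)
    have "exp t / fact 3 \<le> exp t / 1" by (rule divide_left_mono) (auto simp: fact_numeral)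
    also have "... \<le> exp B" using t(1) assms by simp
    finally show "exp t / fact 3 \<le> exp B" .
  qed simp
  finally show ?thesis using t(2) by (simp add: numeral_3_eq_3 power2_eq_square)
qed

text \<open>
  Second order expansion of a weighted geometric mean of numbers close to \<open>1\<close>. The quadratic
  part is the quantity whose Gaussian mean is controlled by the frame condition.
\<close>

lemma weighted_product_expansion:
  fixes J :: "'j set" and a r l :: "'j \<Rightarrow> real" and M \<tau> :: real
  defines "\<sigma> \<equiv> \<Sum>j\<in>J. a j"
  defines "C \<equiv> 8 * \<sigma> + 2 * \<sigma> + 2 * \<sigma>\<^sup>2 + 4 * \<sigma>\<^sup>2 * M * (M + 1) + exp (\<sigma> * ln M) * (2 * \<sigma> * M) ^ 3"
  assumes fin: "finite J" and a: "\<And>j. j \<in> J \<Longrightarrow> a j \<ge> 0" and M: "M \<ge> 1" and tau: "\<tau> \<ge> 0"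
    and l: "\<And>j. j \<in> J \<Longrightarrow> \<bar>l j\<bar> \<le> \<tau>" and rl: "\<And>j. j \<in> J \<Longrightarrow> \<bar>r j - l j\<bar> \<le> \<tau>\<^sup>2"
    and r: "\<And>j. j \<in> J \<Longrightarrow> \<bar>r j\<bar> \<le> 2 * \<tau>" and rM: "\<And>j. j \<in> J \<Longrightarrow> 1 / M \<le> 1 + r j" "\<And>j. j \<in> J \<Longrightarrow> 1 + r j \<le> M"
  shows "exp (\<Sum>j\<in>J. a j * ln (1 + r j)) \<le>
    1 + (\<Sum>j\<in>J. a j * r j) - (\<Sum>j\<in>J. a j * (l j)\<^sup>2) / 2 + (\<Sum>j\<in>J. a j * l j)\<^sup>2 / 2 + C * \<tau> ^ 3"
proof -
  let ?z = "\<Sum>j\<in>J. a j * ln (1 + r j)" and ?S = "\<Sum>j\<in>J. a j * r j" and ?T = "\<Sum>j\<in>J. a j * l j"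
  have s0: "\<sigma> \<ge> 0" unfolding \<sigma>_def using a by (intro sum_nonneg) auto
  have wsum: "\<bar>\<Sum>j\<in>J. a j * p j\<bar> \<le> \<sigma> * q" if "\<And>j. j \<in> J \<Longrightarrow> \<bar>p j\<bar> \<le> q" for p :: "'j \<Rightarrow> real" and q
  proof -
    have "\<bar>\<Sum>j\<in>J. a j * p j\<bar> \<le> (\<Sum>j\<in>J. \<bar>a j * p j\<bar>)" by (rule sum_abs)
    also have "... \<le> (\<Sum>j\<in>J. a j * q)"
      using a that by (intro sum_mono) (auto simp: abs_mult intro: mult_left_mono)
    finally show ?thesis by (simp add: \<sigma>_def sum_distrib_right)
  qed
  have zB: "\<bar>?z\<bar> \<le> \<sigma> * ln M"
  proof (rule wsum)
    fix j assume j: "j \<in> J"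
    have "ln (1 + r j) \<le> ln M" using rM[OF j] M by (subst ln_le_cancel_iff) (auto, smt (verit) divide_pos_pos)
    moreover have "ln (1 / M) \<le> ln (1 + r j)" using rM[OF j] M by (subst ln_le_cancel_iff) (auto, smt (verit) divide_pos_pos)
    ultimately show "\<bar>ln (1 + r j)\<bar> \<le> ln M" using M by (auto simp: abs_le_iff ln_div)
  qed
  have z1: "\<bar>?z\<bar> \<le> 2 * \<sigma> * M * \<tau>"
  proof -
    have "\<bar>?z\<bar> \<le> \<sigma> * (M * (2 * \<tau>))"
    proof (rule wsum)
      fix j assume j: "j \<in> J"
      show "\<bar>ln (1 + r j)\<bar> \<le> M * (2 * \<tau>)"
        using ln_one_plus_bounds(3)[OF M rM(1)[OF j]] mult_left_mono[OF r[OF j], of M] M by linarith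
    qed
    then show ?thesis by (simp add: mult_ac)
  qed
  have S1: "\<bar>?S\<bar> \<le> 2 * \<sigma> * \<tau>" using wsum[of r "2 * \<tau>"] r by (simp add: mult_ac)
  have T1: "\<bar>?T\<bar> \<le> \<sigma> * \<tau>" using wsum[of l \<tau>] l by simp
  have zS: "\<bar>?z - ?S\<bar> \<le> \<sigma> * (M * (4 * \<tau>\<^sup>2))"
  proof -
    have "?z - ?S = (\<Sum>j\<in>J. a j * (ln (1 + r j) - r j))"
      by (simp add: sum_subtractf right_diff_distrib)
    then have "\<bar>?z - ?S\<bar> = \<bar>\<Sum>j\<in>J. a j * (ln (1 + r j) - r j)\<bar>"
      by (rule arg_cong)
    also have "... \<le> \<sigma> * (M * (4 * \<tau>\<^sup>2))"
    proof (rule wsum)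
      fix j assume j: "j \<in> J"
      have "(r j)\<^sup>2 \<le> (2 * \<tau>)\<^sup>2" using r[OF j] tau abs_le_square_iff[of "r j" "2 * \<tau>"] by simp
      then have "M * (r j)\<^sup>2 \<le> M * (4 * \<tau>\<^sup>2)" using M by (intro mult_left_mono) (auto simp: power_mult_distrib)
      then show "\<bar>ln (1 + r j) - r j\<bar> \<le> M * (4 * \<tau>\<^sup>2)"
        using ln_one_plus_bounds(1,2)[OF M rM(1)[OF j]] by (simp add: abs_le_iff)
    qed
    finally show ?thesis .
  qed
  have ST: "\<bar>?S - ?T\<bar> \<le> \<sigma> * \<tau>\<^sup>2"
  proof -
    have "?S - ?T = (\<Sum>j\<in>J. a j * (r j - l j))" by (simp add: sum_subtractf right_diff_distrib)
    then show ?thesis using wsum[of "\<lambda>j. r j - l j" "\<tau>\<^sup>2"] rl by simp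
  qed
  have e1: "?z\<^sup>2 \<le> ?S\<^sup>2 + 8 * \<sigma>\<^sup>2 * M * (M + 1) * \<tau> ^ 3"
  proof -
    have "\<bar>?z\<^sup>2 - ?S\<^sup>2\<bar> \<le> (\<sigma> * (M * (4 * \<tau>\<^sup>2))) * (2 * \<sigma> * M * \<tau> + 2 * \<sigma> * \<tau>)"
      by (rule square_diff_bound[OF zS]) (use z1 S1 in linarith)
    also have "... = 8 * \<sigma>\<^sup>2 * M * (M + 1) * \<tau> ^ 3" by (simp add: power2_eq_square power3_eq_cube algebra_simps)
    finally show ?thesis by linarith
  qed
  have e2: "?S\<^sup>2 \<le> ?T\<^sup>2 + 3 * \<sigma>\<^sup>2 * \<tau> ^ 3"
  proof -
    have "\<bar>?S\<^sup>2 - ?T\<^sup>2\<bar> \<le> (\<sigma> * \<tau>\<^sup>2) * (3 * \<sigma> * \<tau>)"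
      by (rule square_diff_bound[OF ST]) (use S1 T1 in linarith)
    also have "... = 3 * \<sigma>\<^sup>2 * \<tau> ^ 3" by (simp add: power2_eq_square power3_eq_cube algebra_simps)
    finally show ?thesis by linarith
  qed
  have e3: "?z \<le> ?S - (\<Sum>j\<in>J. a j * (l j)\<^sup>2) / 2 + (8 * \<sigma> + 2 * \<sigma>) * \<tau> ^ 3"
  proof -
    have "?z \<le> (\<Sum>j\<in>J. a j * (r j - (l j)\<^sup>2 / 2 + 10 * \<tau> ^ 3))"
    proof (intro sum_mono mult_left_mono a)
      fix j assume j: "j \<in> J"
      have p: "r j > - 1" using rM(1)[OF j] M by (smt (verit) divide_pos_pos)
      have "\<bar>r j\<bar> ^ 3 \<le> (2 * \<tau>) ^ 3" using r[OF j] by (intro power_mono) auto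
      moreover have "\<bar>(r j)\<^sup>2 - (l j)\<^sup>2\<bar> \<le> \<tau>\<^sup>2 * (3 * \<tau>)"
        by (rule square_diff_bound[OF rl[OF j]]) (use r[OF j] l[OF j] in linarith)
      moreover have "\<tau>\<^sup>2 * (3 * \<tau>) = 3 * \<tau> ^ 3" "(2 * \<tau>) ^ 3 = 8 * \<tau> ^ 3" by (auto simp: power2_eq_square power3_eq_cube)
      moreover have "0 \<le> \<tau> ^ 3" using tau by simp
      ultimately show "ln (1 + r j) \<le> r j - (l j)\<^sup>2 / 2 + 10 * \<tau> ^ 3"
        using ln_one_plus_le_cubic[OF p] by linarith
    qed
    also have "... = ?S - (\<Sum>j\<in>J. a j * (l j)\<^sup>2) / 2 + (8 * \<sigma> + 2 * \<sigma>) * \<tau> ^ 3"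
      by (simp add: \<sigma>_def ring_distribs sum.distrib sum_subtractf sum_divide_distrib sum_distrib_left sum_distrib_right mult_ac)
         (simp add: sum_distrib_left[symmetric] sum_distrib_right[symmetric])
    finally show ?thesis .
  qed
  have e4: "\<bar>?z\<bar> ^ 3 \<le> (2 * \<sigma> * M) ^ 3 * \<tau> ^ 3"
    using power_mono[OF z1, of 3] by (simp add: power_mult_distrib)
  have "exp ?z \<le> 1 + ?z + ?z\<^sup>2 / 2 + exp (\<sigma> * ln M) * \<bar>?z\<bar> ^ 3"
    by (rule exp_le_quadratic[OF zB])
  also have "... \<le> 1 + (?S - (\<Sum>j\<in>J. a j * (l j)\<^sup>2) / 2 + (8 * \<sigma> + 2 * \<sigma>) * \<tau> ^ 3)
      + (?T\<^sup>2 + 3 * \<sigma>\<^sup>2 * \<tau> ^ 3 + 8 * \<sigma>\<^sup>2 * M * (M + 1) * \<tau> ^ 3) / 2 + exp (\<sigma> * ln M) * ((2 * \<sigma> * M) ^ 3 * \<tau> ^ 3)"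
  proof -
    have "1 + z + z2 / 2 + X \<le> 1 + A + (T2 + E2 + E1) / 2 + Y"
      if "z \<le> A" "z2 \<le> S2 + E1" "S2 \<le> T2 + E2" "X \<le> Y" for z z2 X A T2 S2 E1 E2 Y :: real
    proof -
      have "z2 / 2 \<le> (T2 + E2 + E1) / 2"
        using order_trans[OF that(2) add_right_mono[OF that(3)]] by (rule divide_right_mono) simp
      then show ?thesis by (intro add_mono order_refl that)
    qed
    from this[OF e3 e1 e2 mult_left_mono[OF e4 exp_ge_zero]] show ?thesis .
  qed
  also have "... \<le> 1 + ?S - (\<Sum>j\<in>J. a j * (l j)\<^sup>2) / 2 + ?T\<^sup>2 / 2 + C * \<tau> ^ 3"
  proof -
    have "0 \<le> \<sigma>\<^sup>2 * \<tau> ^ 3" using tau by simp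
    then show ?thesis by (simp add: C_def algebra_simps)
  qed
  finally show ?thesis .
qed

locale bl_frame =
  fixes n :: nat and J :: "'j set" and a :: "'j \<Rightarrow> real" and R :: "'j \<Rightarrow> vec \<Rightarrow> vec"
  assumes fin: "finite J" and a_pos: "\<And>j. j \<in> J \<Longrightarrow> a j > 0"
    and R_meas [measurable]: "\<And>j. R j \<in> borel_maps"
    and R_linear: "\<And>j. j \<in> J \<Longrightarrow> linear_Rn n (R j)"
    and R_sym: "\<And>j x y. j \<in> J \<Longrightarrow> x \<in> Rn n \<Longrightarrow> y \<in> Rn n \<Longrightarrow> dot n (R j x) y = dot n x (R j y)"
    and R_idem: "\<And>j x. j \<in> J \<Longrightarrow> x \<in> Rn n \<Longrightarrow> R j (R j x) = R j x"
    and frame: "\<And>x. x \<in> Rn n \<Longrightarrow> (\<Sum>j\<in>J. a j * dot n (R j x) (R j x)) = dot n x x"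
begin

lemma R_in: "j \<in> J \<Longrightarrow> x \<in> Rn n \<Longrightarrow> R j x \<in> Rn n"
  using linear_Rn_in[OF R_linear] by blast

lemma R_contract: "j \<in> J \<Longrightarrow> x \<in> Rn n \<Longrightarrow> dot n (R j x) (R j x) \<le> dot n x x"
proof -
  assume j: "j \<in> J" and x: "x \<in> Rn n"
  have "dot n (x - R j x) (R j x) = 0"
    using R_sym[OF j x R_in[OF j x]] R_idem[OF j x] by (simp add: dot_simps)
  moreover have "0 \<le> dot n (x - R j x) (x - R j x)" by simp
  ultimately show ?thesis by (simp add: dot_simps dot_commute[of n x "R j x"])
qed

text \<open>
  The frame condition says that \<open>x \<mapsto> (R j x)\<^sub>j\<close> is an isometry into the
  weighted sum of the ranges; the weighted summation is its adjoint and therefore a contraction.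
\<close>

lemma frame_sum:
  assumes v: "\<And>j. j \<in> J \<Longrightarrow> v j \<in> Rn n" "\<And>j. j \<in> J \<Longrightarrow> R j (v j) = v j"
  shows "dot n (\<Sum>j\<in>J. a j *\<^sub>R v j) (\<Sum>j\<in>J. a j *\<^sub>R v j) \<le> (\<Sum>j\<in>J. a j * dot n (v j) (v j))"
proof -
  let ?y = "\<Sum>j\<in>J. a j *\<^sub>R v j"
  have y: "?y \<in> Rn n" by (rule Rn_sum, rule Rn_scaleR) (rule v)
  have "2 * dot n ?y ?y = (\<Sum>j\<in>J. a j * (2 * dot n (v j) (R j ?y)))"
  proof -
    have "dot n ?y ?y = (\<Sum>j\<in>J. a j * dot n (v j) ?y)"
      by (subst dot_sum_left) (simp add: dot_scaleR_left)
    also have "... = (\<Sum>j\<in>J. a j * dot n (v j) (R j ?y))"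
    proof (rule sum.cong[OF refl])
      fix j assume j: "j \<in> J"
      show "a j * dot n (v j) ?y = a j * dot n (v j) (R j ?y)"
        using R_sym[OF j v(1)[OF j] y] v(2)[OF j] by simp
    qed
    finally show ?thesis by (simp add: sum_distrib_left mult_ac)
  qed
  also have "... \<le> (\<Sum>j\<in>J. a j * (dot n (v j) (v j) + dot n (R j ?y) (R j ?y)))"
  proof (intro sum_mono mult_left_mono)
    fix j assume "j \<in> J"
    have "0 \<le> dot n (v j - R j ?y) (v j - R j ?y)" by simp
    then show "2 * dot n (v j) (R j ?y) \<le> dot n (v j) (v j) + dot n (R j ?y) (R j ?y)"
      by (simp add: dot_simps dot_commute[of n "R j ?y" "v j"])
  qed (use a_pos less_imp_le in blast)
  also have "... = (\<Sum>j\<in>J. a j * dot n (v j) (v j)) + dot n ?y ?y"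
    using frame[OF y] by (simp add: distrib_left sum.distrib)
  finally show ?thesis by linarith
qed

end

locale bl_data = bl_frame n J a R
    for n and J :: "'j set" and a :: "'j \<Rightarrow> real" and R +
  fixes \<psi> :: "'j \<Rightarrow> vec \<Rightarrow> real" and e s0 :: real
  assumes psi_meas [measurable]: "\<And>j. \<psi> j \<in> borel_maps"
    and psi_bounds: "\<And>j x. 0 \<le> \<psi> j x" "\<And>j x. \<psi> j x \<le> 1"
    and psi_R: "\<And>j x. j \<in> J \<Longrightarrow> x \<in> Rn n \<Longrightarrow> \<psi> j (R j x) = \<psi> j x"
    and e: "0 < e" "e \<le> 1" and s0: "0 < s0" "s0 \<le> 1"
begin

definition F :: "'j \<Rightarrow> vec \<Rightarrow> real \<Rightarrow> real \<Rightarrow> vec \<Rightarrow> real" where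
  "F j x0 t s x = e + smoothing n (\<psi> j) x0 t s x"

lemma F_meas [measurable]: "F j x0 t s \<in> borel_maps"
  unfolding F_def using smoothing_measurable[OF psi_meas psi_bounds] by measurable

lemma F_bounds: "e \<le> F j x0 t s x" "F j x0 t s x \<le> 1 + e" "0 < F j x0 t s x"
  using smoothing_bounds[OF psi_meas psi_bounds, of n j x0 t s x] e by (auto simp: F_def)

lemma F_integrable: "integrable (gauss n) (F j x0 t s)"
proof (rule integrable_gauss_bounded[where C="1 + e"])
  show "\<bar>F j x0 t s x\<bar> \<le> 1 + e" for x
    using F_bounds(2,3)[of j x0 t s x] by simp
qed measurable

lemma F_mean_bounds: "e \<le> (gmean n (\<lambda>x. F j x0 t s x))" "(gmean n (\<lambda>x. F j x0 t s x)) \<le> 1 + e"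
  by (auto intro!: gauss.integral_ge_const gauss.integral_le_const F_integrable F_bounds)

lemma prod_meas [measurable]:
  "(\<And>j. f j \<in> borel_measurable M) \<Longrightarrow> (\<lambda>x. \<Prod>j\<in>J. f j x powr a j) \<in> borel_measurable M"
  for f :: "'j \<Rightarrow> 'x \<Rightarrow> real"
  by (rule borel_measurable_prod, rule powr_real_measurable[where f="f _"], simp, rule measurable_const) simp

lemma smoothing_R:
  assumes j: "j \<in> J" and x0: "x0 \<in> Rn n" and x: "x \<in> Rn n"
  shows "smoothing n (\<psi> j) x0 t s (R j x) = smoothing n (\<psi> j) x0 t s x"
  unfolding smoothing_def
proof (rule integral_cong_AE)
  show "AE y in gauss n. \<psi> j (x0 + t *\<^sub>R R j x + s *\<^sub>R y) = \<psi> j (x0 + t *\<^sub>R x + s *\<^sub>R y)"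
  proof (rule eventually_mono[OF AE_gauss_Rn])
    fix y :: vec assume y: "y \<in> Rn n"
    note sub = Rn_add Rn_scaleR
    have m: "t *\<^sub>R R j x \<in> Rn n" "t *\<^sub>R x \<in> Rn n" "s *\<^sub>R y \<in> Rn n" "R j x \<in> Rn n"
      using x0 x y R_in[OF j x] sub(2) by blast+
    have m2: "x0 + t *\<^sub>R R j x \<in> Rn n" "x0 + t *\<^sub>R x \<in> Rn n"
      using sub(1)[OF x0 m(1)] sub(1)[OF x0 m(2)] .
    have "R j (x0 + t *\<^sub>R R j x + s *\<^sub>R y) = R j (x0 + t *\<^sub>R x + s *\<^sub>R y)"
      using linear_Rn_add[OF R_linear[OF j] m2(1) m(3)] linear_Rn_add[OF R_linear[OF j] m2(2) m(3)]
        linear_Rn_add[OF R_linear[OF j] x0 m(1)] linear_Rn_add[OF R_linear[OF j] x0 m(2)]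
        linear_Rn_scaleR[OF R_linear[OF j] m(4)] linear_Rn_scaleR[OF R_linear[OF j] x] R_idem[OF j x]
      by metis
    moreover have "x0 + t *\<^sub>R R j x + s *\<^sub>R y \<in> Rn n" "x0 + t *\<^sub>R x + s *\<^sub>R y \<in> Rn n"
      using sub(1)[OF m2(1) m(3)] sub(1)[OF m2(2) m(3)] .
    ultimately show "\<psi> j (x0 + t *\<^sub>R R j x + s *\<^sub>R y) = \<psi> j (x0 + t *\<^sub>R x + s *\<^sub>R y)"
      using psi_R[OF j] by metis
  qed
qed measurable

text \<open>
  The inequality at scale \<open>t\<close> with constant \<open>D\<close>. Centres and smoothing
  parameters are quantified here because halving the variance changes both, see
  \<open>doubling\<close>.
\<close>

definition holds_with :: "real \<Rightarrow> real \<Rightarrow> bool" where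
  "holds_with t D \<longleftrightarrow> (\<forall>x0 s. (\<forall>j. x0 j \<in> Rn n \<and> s0 \<le> s j) \<longrightarrow>
    (gmean n (\<lambda>x. (\<Prod>j\<in>J. F j (x0 j) t (s j) x powr a j))) \<le> D * (\<Prod>j\<in>J. (gmean n (\<lambda>x. F j (x0 j) t (s j) x)) powr a j))"

lemma prod_F_bound: "\<bar>\<Prod>j\<in>J. F j (x0 j) t (s j) x powr a j\<bar> \<le> (\<Prod>j\<in>J. (1 + e) powr a j)"
proof -
  have "\<bar>\<Prod>j\<in>J. F j (x0 j) t (s j) x powr a j\<bar> = (\<Prod>j\<in>J. F j (x0 j) t (s j) x powr a j)"
    by (intro abs_of_nonneg prod_nonneg) auto
  also have "... \<le> (\<Prod>j\<in>J. (1 + e) powr a j)"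
    by (intro prod_mono conjI powr_mono2) (auto intro!: F_bounds less_imp_le a_pos)
  finally show ?thesis .
qed

lemma prod_F_integrable: "integrable (gauss n) (\<lambda>x. \<Prod>j\<in>J. F j (x0 j) t (s j) x powr a j)"
  by (rule integrable_gauss_bounded[OF _ prod_F_bound]) measurable

text \<open>
  At small scales all factors are nearly affine. By \<open>weighted_product_expansion\<close> the
  second order terms have the Gaussian mean \<open>(|\<Sum>j. a j * b j|\<^sup>2 - (\<Sum>j. a j *
  |b j|\<^sup>2)) / 2\<close>, where \<open>b j\<close> are the gradients, and this is not
  positive by \<open>frame_sum\<close>. What remains is of third order.
\<close>

lemma small_scale:
  obtains C where "C \<ge> 0" "\<And>t. 0 \<le> t \<Longrightarrow> t \<le> 1 \<Longrightarrow> holds_with t (1 + C * t ^ 3)"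
proof -
  define \<sigma> where "\<sigma> = (\<Sum>j\<in>J. a j)"
  define M where "M = (1 + e) / e"
  have M: "M \<ge> 1" using e by (simp add: M_def)
  define K where "K = (real n + 2) / (e * s0\<^sup>2)"
  have es: "0 < e * s0\<^sup>2" "e * s0\<^sup>2 \<le> 1" "s0\<^sup>2 \<le> 1"
    using e s0 by (auto simp: mult_le_one power_le_one)
  have K: "K \<ge> 1" "K > 0" using es by (auto simp: K_def field_simps intro: add_pos_nonneg)
  define C0 where "C0 = 8 * \<sigma> + 2 * \<sigma> + 2 * \<sigma>\<^sup>2 + 4 * \<sigma>\<^sup>2 * M * (M + 1) + exp (\<sigma> * ln M) * (2 * \<sigma> * M) ^ 3"
  have s0': "\<sigma> \<ge> 0" unfolding \<sigma>_def using a_pos by (intro sum_nonneg) (auto intro: less_imp_le)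
  have C0: "C0 \<ge> 0" unfolding C0_def using s0' M by (intro add_nonneg_nonneg mult_nonneg_nonneg) auto
  define W where "W = (gmean n (\<lambda>x. weight n x ^ 3))"
  have W: "W \<ge> 0" unfolding W_def
    using weight_ge_1 by (intro integral_nonneg_AE AE_I2 zero_le_power) (auto intro: order_trans[OF zero_le_one])
  show ?thesis
  proof
    show "C0 * K ^ 3 * W \<ge> 0" using C0 K W by simp
    fix t :: real assume t: "0 \<le> t" "t \<le> 1"
    show "holds_with t (1 + C0 * K ^ 3 * W * t ^ 3)"
      unfolding holds_with_def
    proof (intro allI impI)
      fix x0 :: "'j \<Rightarrow> vec" and s :: "'j \<Rightarrow> real"
      assume xs: "\<forall>j. x0 j \<in> Rn n \<and> s0 \<le> s j"
      define f where "f j = F j (x0 j) t (s j)" for j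
      define m where "m j = (gmean n (\<lambda>x. f j x))" for j
      have fb: "e \<le> f j x" "f j x \<le> 1 + e" "0 < f j x" for j x using F_bounds by (auto simp: f_def)
      have mb: "e \<le> m j" "m j \<le> 1 + e" "0 < m j" for j
        using F_mean_bounds[of j "x0 j" t "s j"] e by (auto simp: m_def f_def)
      have [measurable]: "f j \<in> borel_maps" for j by (simp add: f_def)
      have fint: "integrable (gauss n) (f j)" for j using F_integrable by (simp add: f_def)
      have "\<exists>b. b \<in> Rn n \<and> dot n b b \<le> real n * (t / s0)\<^sup>2 \<and>
        (\<forall>x\<in>Rn n. \<bar>f j x - f j 0 - dot n b x\<bar> \<le> (t / s0)\<^sup>2 * dot n x x)" for j
      proof -
        have sj: "s j > 0" "s0 \<le> s j" using xs s0 by (auto intro: less_le_trans)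
        obtain b where b: "b \<in> Rn n" "dot n b b \<le> real n * (t / s j)\<^sup>2"
          "\<And>x. x \<in> Rn n \<Longrightarrow> \<bar>smoothing n (\<psi> j) (x0 j) t (s j) x - smoothing n (\<psi> j) (x0 j) t (s j) 0 - dot n b x\<bar> \<le> (t / s j)\<^sup>2 * dot n x x"
          using smoothing_taylor[OF psi_meas psi_bounds sj(1)] by blast
        have ts: "(t / s j)\<^sup>2 \<le> (t / s0)\<^sup>2"
          using sj s0 t by (intro power_mono divide_left_mono) auto
        have "dot n b b \<le> real n * (t / s0)\<^sup>2"
          using b(2) mult_left_mono[OF ts, of "real n"] by simp
        moreover have "\<bar>f j x - f j 0 - dot n b x\<bar> \<le> (t / s0)\<^sup>2 * dot n x x" if "x \<in> Rn n" for x
          using b(3)[OF that] mult_right_mono[OF ts dot_nonneg[of n x]] by (simp add: f_def F_def)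
        ultimately show ?thesis using b(1) by blast
      qed
      then obtain b where b: "\<And>j. b j \<in> Rn n" "\<And>j. dot n (b j) (b j) \<le> real n * (t / s0)\<^sup>2"
        "\<And>j x. x \<in> Rn n \<Longrightarrow> \<bar>f j x - f j 0 - dot n (b j) x\<bar> \<le> (t / s0)\<^sup>2 * dot n x x"
        by metis
      define \<beta> where "\<beta> j = (1 / m j) *\<^sub>R R j (b j)" for j
      have beta_in: "\<beta> j \<in> Rn n" if "j \<in> J" for j
        unfolding \<beta>_def using R_in[OF that b(1)] by (rule Rn_scaleR)
      have beta_R: "R j (\<beta> j) = \<beta> j" if "j \<in> J" for j
        unfolding \<beta>_def using linear_Rn_scaleR[OF R_linear[OF that] R_in[OF that b(1)]] R_idem[OF that b(1)] by simp
      have exp_f: "\<bar>f j x - f j 0 - dot n (R j (b j)) x\<bar> \<le> (t / s0)\<^sup>2 * dot n x x" if j: "j \<in> J" and x: "x \<in> Rn n" for j x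
      proof -
        have "f j (R j x) = f j x"
          using smoothing_R[OF j _ x] xs by (simp add: f_def F_def)
        moreover have "dot n (b j) (R j x) = dot n (R j (b j)) x"
          using R_sym[OF j b(1) x] by simp
        moreover have "(t / s0)\<^sup>2 * dot n (R j x) (R j x) \<le> (t / s0)\<^sup>2 * dot n x x"
          using R_contract[OF j x] by (rule mult_left_mono) simp
        ultimately show ?thesis using b(3)[OF R_in[OF j x], of j] by simp
      qed
      have f0m: "\<bar>f j 0 - m j\<bar> \<le> (t / s0)\<^sup>2 * real n" if j: "j \<in> J" for j
      proof -
        have i: "integrable (gauss n) (\<lambda>x. f j x - f j 0 - dot n (R j (b j)) x)"
          using fint integrable_gauss_dot by auto
        have i2: "integrable (gauss n) (\<lambda>x. dot n x x)"
          by (rule integrable_gauss_weight[where C=1])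
             (use weight_ge weight_le_cube in \<open>auto intro!: order_trans[OF _ weight_le_cube] order_trans[OF _ weight_ge]\<close>)
        have ii: "integrable (gauss n) (\<lambda>x. x i * x i)" if "i < n" for i
          using integrable_gauss_dot_square[of n "unit_vec i"] that by (simp add: dot_unit_vec power2_eq_square)
        have "(gmean n (\<lambda>x. dot n x x)) = (\<Sum>i<n. gmean n (\<lambda>x. x i * x i))"
          unfolding dot_def by (rule Bochner_Integration.integral_sum) (use ii in auto)
        then have n2: "(gmean n (\<lambda>x. dot n x x)) = real n" by (simp add: gauss_coord_square)
        have "m j - f j 0 = (gmean n (\<lambda>x. f j x - f j 0 - dot n (R j (b j)) x))"
          using fint integrable_gauss_dot[of n "R j (b j)"] gauss_dot_mean[of n "R j (b j)"] by (simp add: m_def)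
        then have "\<bar>m j - f j 0\<bar> = \<bar>\<integral>x. f j x - f j 0 - dot n (R j (b j)) x \<partial>gauss n\<bar>"
          by (rule arg_cong)
        also have "... \<le> (gmean n (\<lambda>x. (t / s0)\<^sup>2 * dot n x x))"
        proof (rule integral_abs_bound[THEN order_trans], rule integral_mono_AE)
          show "AE x in gauss n. \<bar>f j x - f j 0 - dot n (R j (b j)) x\<bar> \<le> (t / s0)\<^sup>2 * dot n x x"
            by (rule eventually_mono[OF AE_gauss_Rn]) (rule exp_f[OF j])
        qed (use i i2 in auto)
        also have "... = (t / s0)\<^sup>2 * real n" by (simp add: n2)
        finally show ?thesis by (simp add: abs_minus_commute)
      qed
      have point: "(\<Prod>j\<in>J. f j x powr a j) \<le> (\<Prod>j\<in>J. m j powr a j) *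
        (1 + (\<Sum>j\<in>J. a j * ((f j x - m j) / m j)) - (\<Sum>j\<in>J. a j * (dot n (\<beta> j) x)\<^sup>2) / 2
          + (\<Sum>j\<in>J. a j * dot n (\<beta> j) x)\<^sup>2 / 2 + C0 * (K * t * weight n x) ^ 3)" if x: "x \<in> Rn n" for x
      proof -
        define w where "w = weight n x"
        have w: "w \<ge> 1" "real n + dot n x x \<le> w" "dot n x x \<le> w"
          using weight_ge_1[of n x] weight_ge[of n x] by (auto simp: w_def)
        define \<tau> where "\<tau> = K * t * w"
        have tau: "\<tau> \<ge> 0" using K t w by (simp add: \<tau>_def)
        define r where "r j = (f j x - m j) / m j" for j
        have r1: "1 + r j = f j x / m j" for j using mb(3)[of j] by (simp add: r_def field_simps)
        have l1: "\<bar>dot n (\<beta> j) x\<bar> \<le> \<tau>" if j: "j \<in> J" for j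
        proof -
          have "(dot n (\<beta> j) x)\<^sup>2 \<le> dot n (\<beta> j) (\<beta> j) * dot n x x" by (rule dot_Cauchy_Schwarz)
          also have "... \<le> ((real n + 2)\<^sup>2 * t\<^sup>2 / (e * s0\<^sup>2)\<^sup>2) * w\<^sup>2"
          proof (rule mult_mono)
            have "dot n (\<beta> j) (\<beta> j) = dot n (R j (b j)) (R j (b j)) / (m j)\<^sup>2"
              by (simp add: \<beta>_def dot_simps power2_eq_square)
            also have "... \<le> (real n * (t / s0)\<^sup>2) / e\<^sup>2"
              using R_contract[OF j b(1)] b(2)[of j] mb[of j] e
              by (intro frac_le power_mono) (auto intro: order_trans)
            also have "... = (real n * t\<^sup>2 * s0\<^sup>2) / (e * s0\<^sup>2)\<^sup>2"
              using s0 e by (simp add: field_simps power2_eq_square)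
            also have "... \<le> ((real n + 2)\<^sup>2 * t\<^sup>2) / (e * s0\<^sup>2)\<^sup>2"
            proof (rule divide_right_mono)
              have "real n * t\<^sup>2 * s0\<^sup>2 \<le> real n * t\<^sup>2 * 1" using es by (intro mult_left_mono) auto
              also have "... \<le> (real n + 2)\<^sup>2 * t\<^sup>2"
                unfolding mult_1_right by (rule mult_right_mono) (auto simp: power2_eq_square algebra_simps)
              finally show "real n * t\<^sup>2 * s0\<^sup>2 \<le> (real n + 2)\<^sup>2 * t\<^sup>2" .
            qed simp
            finally show "dot n (\<beta> j) (\<beta> j) \<le> (real n + 2)\<^sup>2 * t\<^sup>2 / (e * s0\<^sup>2)\<^sup>2" .
            have "w * 1 \<le> w * w" using w by (intro mult_left_mono) auto
            then show "dot n x x \<le> w\<^sup>2" using w(3) unfolding power2_eq_square by linarith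
          qed auto
          also have "... = \<tau>\<^sup>2" by (simp add: \<tau>_def K_def power_mult_distrib power_divide)
          finally show ?thesis using tau abs_le_square_iff[of "dot n (\<beta> j) x" \<tau>] by simp
        qed
        have rl: "\<bar>r j - dot n (\<beta> j) x\<bar> \<le> K * t\<^sup>2 * w" if j: "j \<in> J" for j
        proof -
          have "r j - dot n (\<beta> j) x = ((f j x - f j 0 - dot n (R j (b j)) x) + (f j 0 - m j)) / m j"
            by (simp add: r_def \<beta>_def dot_simps diff_divide_distrib add_divide_distrib)
          then have "\<bar>r j - dot n (\<beta> j) x\<bar> = \<bar>(f j x - f j 0 - dot n (R j (b j)) x) + (f j 0 - m j)\<bar> / m j"
            using mb(3)[of j] by simp
          also have "... \<le> ((t / s0)\<^sup>2 * w) / e"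
          proof (rule frac_le)
            have "\<bar>(f j x - f j 0 - dot n (R j (b j)) x) + (f j 0 - m j)\<bar> \<le> (t / s0)\<^sup>2 * dot n x x + (t / s0)\<^sup>2 * real n"
              using exp_f[OF j x] f0m[OF j] by linarith
            also have "... \<le> (t / s0)\<^sup>2 * w"
              unfolding distrib_left[symmetric] by (rule mult_left_mono) (use w in auto)
            finally show "\<bar>(f j x - f j 0 - dot n (R j (b j)) x) + (f j 0 - m j)\<bar> \<le> (t / s0)\<^sup>2 * w" .
          qed (use e mb w in auto)
          also have "... = 1 * t\<^sup>2 * w / (e * s0\<^sup>2)" by (simp add: power_divide mult.commute)
          also have "... \<le> (real n + 2) * t\<^sup>2 * w / (e * s0\<^sup>2)"
            using es w by (intro divide_right_mono mult_right_mono) auto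
          finally show ?thesis by (simp add: K_def)
        qed
        have q1: "K * t\<^sup>2 * w \<le> \<tau>\<^sup>2" "K * t\<^sup>2 * w \<le> \<tau>"
        proof -
          have "1 * (K * t\<^sup>2 * w) \<le> (K * w) * (K * t\<^sup>2 * w)"
            using K w t mult_mono[of 1 K 1 w] by (intro mult_right_mono) auto
          then show "K * t\<^sup>2 * w \<le> \<tau>\<^sup>2" by (simp add: \<tau>_def power2_eq_square mult_ac)
          have "t * (K * t * w) \<le> 1 * (K * t * w)" using t K w by (intro mult_right_mono) auto
          then show "K * t\<^sup>2 * w \<le> \<tau>" by (simp add: \<tau>_def power2_eq_square mult_ac)
        qed
        have "(\<Prod>j\<in>J. f j x powr a j) = (\<Prod>j\<in>J. m j powr a j * exp (a j * ln (1 + r j)))"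
        proof (rule prod.cong[OF refl])
          fix j
          have "f j x powr a j = (m j * (1 + r j)) powr a j" using mb(3)[of j] by (simp add: r1)
          also have "... = m j powr a j * (1 + r j) powr a j"
            using mb(3)[of j] fb(3)[of j x] by (intro powr_mult)
          also have "(1 + r j) powr a j = exp (a j * ln (1 + r j))"
            using r1[of j] mb(3)[of j] fb(3)[of j x] by (simp add: powr_def)
          finally show "f j x powr a j = m j powr a j * exp (a j * ln (1 + r j))" .
        qed
        also have "... = (\<Prod>j\<in>J. m j powr a j) * exp (\<Sum>j\<in>J. a j * ln (1 + r j))"
          by (simp add: prod.distrib exp_sum[OF fin])
        also have "... \<le> (\<Prod>j\<in>J. m j powr a j) * (1 + (\<Sum>j\<in>J. a j * r j) - (\<Sum>j\<in>J. a j * (dot n (\<beta> j) x)\<^sup>2) / 2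
          + (\<Sum>j\<in>J. a j * dot n (\<beta> j) x)\<^sup>2 / 2 + C0 * \<tau> ^ 3)"
        proof (rule mult_left_mono)
          show "exp (\<Sum>j\<in>J. a j * ln (1 + r j)) \<le> 1 + (\<Sum>j\<in>J. a j * r j) - (\<Sum>j\<in>J. a j * (dot n (\<beta> j) x)\<^sup>2) / 2
              + (\<Sum>j\<in>J. a j * dot n (\<beta> j) x)\<^sup>2 / 2 + C0 * \<tau> ^ 3"
            unfolding C0_def \<sigma>_def
          proof (rule weighted_product_expansion[OF fin _ M tau l1])
            fix j assume j: "j \<in> J"
            show "0 \<le> a j" using a_pos[OF j] by simp
            show "\<bar>r j - dot n (\<beta> j) x\<bar> \<le> \<tau>\<^sup>2" using rl[OF j] q1 by linarith
            show "\<bar>r j\<bar> \<le> 2 * \<tau>" using rl[OF j] q1 l1[OF j] by linarith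
            show "1 / M \<le> 1 + r j" unfolding r1 M_def using mb[of j] fb[of j x] e by (simp add: frac_le)
            show "1 + r j \<le> M" unfolding r1 M_def using mb[of j] fb[of j x] e by (simp add: frac_le)
          qed
        qed (simp add: prod_nonneg)
        finally show ?thesis by (simp add: r_def \<tau>_def w_def)
      qed
      let ?P = "\<Prod>j\<in>J. m j powr a j"
      have iS: "integrable (gauss n) (\<lambda>x. \<Sum>j\<in>J. a j * ((f j x - m j) / m j))"
        using fint by (intro Bochner_Integration.integrable_sum) auto
      have S0: "(gmean n (\<lambda>x. (\<Sum>j\<in>J. a j * ((f j x - m j) / m j)))) = 0"
        by (subst Bochner_Integration.integral_sum) (use fint in \<open>auto simp: m_def[symmetric]\<close>)
      have iL: "integrable (gauss n) (\<lambda>x. \<Sum>j\<in>J. a j * (dot n (\<beta> j) x)\<^sup>2)"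
        by (intro Bochner_Integration.integrable_sum integrable_mult_right integrable_gauss_dot_square)
      have L0: "(gmean n (\<lambda>x. (\<Sum>j\<in>J. a j * (dot n (\<beta> j) x)\<^sup>2))) = (\<Sum>j\<in>J. a j * dot n (\<beta> j) (\<beta> j))"
        by (subst Bochner_Integration.integral_sum)
           (auto simp: gauss_dot_square intro!: integrable_mult_right integrable_gauss_dot_square)
      have eT: "(\<Sum>j\<in>J. a j * dot n (\<beta> j) x) = dot n (\<Sum>j\<in>J. a j *\<^sub>R \<beta> j) x" for x
        by (subst dot_sum_left) (simp add: dot_scaleR_left)
      have iT: "integrable (gauss n) (\<lambda>x. (\<Sum>j\<in>J. a j * dot n (\<beta> j) x)\<^sup>2)"
        unfolding eT by (rule integrable_gauss_dot_square)
      have T0: "(gmean n (\<lambda>x. (\<Sum>j\<in>J. a j * dot n (\<beta> j) x)\<^sup>2)) \<le> (\<Sum>j\<in>J. a j * dot n (\<beta> j) (\<beta> j))"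
        unfolding eT gauss_dot_square by (rule frame_sum) (auto simp: beta_in beta_R)
      have iW: "integrable (gauss n) (\<lambda>x. C0 * (K * t * weight n x) ^ 3)"
        unfolding power_mult_distrib by (intro integrable_mult_right integrable_weight)
      have "(gmean n (\<lambda>x. (\<Prod>j\<in>J. f j x powr a j))) \<le> (gmean n (\<lambda>x. ?P *
        (1 + (\<Sum>j\<in>J. a j * ((f j x - m j) / m j)) - (\<Sum>j\<in>J. a j * (dot n (\<beta> j) x)\<^sup>2) / 2
          + (\<Sum>j\<in>J. a j * dot n (\<beta> j) x)\<^sup>2 / 2 + C0 * (K * t * weight n x) ^ 3)))"
      proof (rule integral_mono_AE)
        show "integrable (gauss n) (\<lambda>x. \<Prod>j\<in>J. f j x powr a j)"
          using prod_F_integrable by (simp add: f_def)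
        show "AE x in gauss n. (\<Prod>j\<in>J. f j x powr a j) \<le> ?P *
        (1 + (\<Sum>j\<in>J. a j * ((f j x - m j) / m j)) - (\<Sum>j\<in>J. a j * (dot n (\<beta> j) x)\<^sup>2) / 2
          + (\<Sum>j\<in>J. a j * dot n (\<beta> j) x)\<^sup>2 / 2 + C0 * (K * t * weight n x) ^ 3)"
          by (rule eventually_mono[OF AE_gauss_Rn]) (rule point)
      qed (intro integrable_mult_right Bochner_Integration.integrable_add Bochner_Integration.integrable_diff
          integrable_divide_zero iS iL iT iW gauss.integrable_const)
      also have "... = ?P * (1 + 0 - (\<Sum>j\<in>J. a j * dot n (\<beta> j) (\<beta> j)) / 2
          + (gmean n (\<lambda>x. (\<Sum>j\<in>J. a j * dot n (\<beta> j) x)\<^sup>2)) / 2 + C0 * ((K * t) ^ 3 * W))"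
        using iS iL iT iW integrable_weight[of n] by (simp add: S0[unfolded times_divide_eq_right] L0 W_def power_mult_distrib)
      also have "... \<le> ?P * (1 + C0 * K ^ 3 * W * t ^ 3)"
        using T0 by (intro mult_left_mono) (auto simp: power_mult_distrib mult_ac prod_nonneg)
      finally show "(gmean n (\<lambda>x. (\<Prod>j\<in>J. F j (x0 j) t (s j) x powr a j))) \<le>
        (1 + C0 * K ^ 3 * W * t ^ 3) * (\<Prod>j\<in>J. (gmean n (\<lambda>x. F j (x0 j) t (s j) x)) powr a j)"
        by (simp add: f_def m_def mult.commute)
    qed
  qed
qed

end

context bl_data
begin

lemma F_mean: "(gmean n (\<lambda>x. F j x0 t s x)) = e + (gmean n (\<lambda>y. \<psi> j (x0 + sqrt (t\<^sup>2 + s\<^sup>2) *\<^sub>R y)))"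
proof -
  have "integrable (gauss n) (smoothing n (\<psi> j) x0 t s)"
    by (rule integrable_gauss_bounded[OF smoothing_measurable, where C=1])
       (use psi_meas psi_bounds smoothing_bounds[OF psi_meas psi_bounds] in \<open>auto simp: abs_le_iff intro: order_trans[of _ 0]\<close>)
  then have "(gmean n (\<lambda>x. F j x0 t s x)) = e + (gmean n (\<lambda>x. smoothing n (\<psi> j) x0 t s x))"
    unfolding F_def by simp
  also have "(gmean n (\<lambda>x. smoothing n (\<psi> j) x0 t s x)) = (gmean n (\<lambda>y. \<psi> j (x0 + sqrt (t\<^sup>2 + s\<^sup>2) *\<^sub>R y)))"
    unfolding smoothing_def add.assoc
    by (rule gauss_sum_real[of "\<lambda>w. \<psi> j (x0 + w)" 1]) (use psi_bounds in auto)
  finally show ?thesis .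
qed

text \<open>
  A Gaussian vector is \<open>(X + Y) / sqrt 2\<close> with independent Gaussian \<open>X\<close>
  and \<open>Y\<close>. For fixed \<open>X\<close> the inequality at the smaller scale applies in
  the variable \<open>Y\<close>. The means that it produces are smoothings again, with larger
  parameters, so it applies to them in the variable \<open>X\<close>.
\<close>

lemma doubling:
  assumes h: "holds_with (t * (1 / sqrt 2)) D" and D: "D \<ge> 0"
  shows "holds_with t (D\<^sup>2)"
  unfolding holds_with_def
proof (intro allI impI)
  fix x0 :: "'j \<Rightarrow> vec" and s :: "'j \<Rightarrow> real"
  assume xs: "\<forall>j. x0 j \<in> Rn n \<and> s0 \<le> s j"
  define q where "q = 1 / sqrt (2::real)"
  have q2: "q\<^sup>2 + q\<^sup>2 = 1" by (simp add: q_def power_divide)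
  define G where "G x = (\<Prod>j\<in>J. F j (x0 j) t (s j) x powr a j)" for x
  have Gm [measurable]: "G \<in> borel_maps" unfolding G_def by measurable
  define B where "B = (\<Prod>j\<in>J. (1 + e) powr a j)"
  have G0: "0 \<le> G x" "G x \<le> B" for x
    using prod_F_bound[of x0 t s x] by (auto simp: G_def B_def intro!: prod_nonneg)
  define s' where "s' j = sqrt ((t * q)\<^sup>2 + (s j)\<^sup>2)" for j
  have s's: "s0 \<le> s' j" for j
  proof -
    have "s0 \<le> s j" using xs by simp
    also have "s j \<le> s' j" unfolding s'_def by (rule real_le_rsqrt) simp
    finally show ?thesis .
  qed
  have inner: "(gmean n (\<lambda>y. G (q *\<^sub>R x + q *\<^sub>R y))) \<le> D * (\<Prod>j\<in>J. F j (x0 j) (t * q) (s' j) x powr a j)"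
    if x: "x \<in> Rn n" for x
  proof -
    define x1 where "x1 j = x0 j + (t * q) *\<^sub>R x" for j
    have x1: "x1 j \<in> Rn n" for j
      unfolding x1_def using xs x Rn_add Rn_scaleR by blast
    have eq: "F j (x0 j) t (s j) (q *\<^sub>R x + q *\<^sub>R y) = F j (x1 j) (t * q) (s j) y" for j y
    proof -
      have "x0 j + t *\<^sub>R (q *\<^sub>R x + q *\<^sub>R y) = x1 j + (t * q) *\<^sub>R y"
        by (simp add: x1_def scaleR_add_right add.assoc)
      then show ?thesis by (simp add: F_def smoothing_def)
    qed
    have mean: "(gmean n (\<lambda>y. F j (x1 j) (t * q) (s j) y)) = F j (x0 j) (t * q) (s' j) x" for j
      unfolding F_mean by (simp add: F_def smoothing_def x1_def s'_def)
    have "(gmean n (\<lambda>y. G (q *\<^sub>R x + q *\<^sub>R y))) = (gmean n (\<lambda>y. (\<Prod>j\<in>J. F j (x1 j) (t * q) (s j) y powr a j)))"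
      unfolding G_def eq ..
    also have "... \<le> D * (\<Prod>j\<in>J. (gmean n (\<lambda>y. F j (x1 j) (t * q) (s j) y)) powr a j)"
      using h x1 xs unfolding holds_with_def q_def by blast
    finally show ?thesis unfolding mean .
  qed
  have iG: "integrable (gauss n) (\<lambda>x. gmean n (\<lambda>y. G (q *\<^sub>R x + q *\<^sub>R y)))"
  proof (rule integrable_gauss_bounded[where C=B])
    show "(\<lambda>x. gmean n (\<lambda>y. G (q *\<^sub>R x + q *\<^sub>R y))) \<in> borel_maps"
      by (rule gauss.borel_measurable_lebesgue_integral) measurable
    fix x
    have i: "integrable (gauss n) (\<lambda>y. G (q *\<^sub>R x + q *\<^sub>R y))"
      by (rule integrable_gauss_bounded[where C=B]) (use G0 in auto)
    have "0 \<le> (gmean n (\<lambda>y. G (q *\<^sub>R x + q *\<^sub>R y)))" using G0 by (auto intro!: integral_nonneg_AE)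
    moreover have "(gmean n (\<lambda>y. G (q *\<^sub>R x + q *\<^sub>R y))) \<le> B"
      by (rule gauss.integral_le_const[OF i]) (use G0 in auto)
    ultimately show "\<bar>\<integral>y. G (q *\<^sub>R x + q *\<^sub>R y) \<partial>gauss n\<bar> \<le> B" by simp
  qed
  have mean_eq: "(gmean n (\<lambda>x. F j (x0 j) (t * q) (s' j) x)) = (gmean n (\<lambda>x. F j (x0 j) t (s j) x))" for j
  proof -
    have "(t * q)\<^sup>2 + (s' j)\<^sup>2 = t\<^sup>2 * (q\<^sup>2 + q\<^sup>2) + (s j)\<^sup>2"
      by (simp add: s'_def power_mult_distrib algebra_simps)
    then show ?thesis unfolding F_mean q2 by simp
  qed
  have "(gmean n (\<lambda>x. G x)) = (\<integral>x. (gmean n (\<lambda>y. G (q *\<^sub>R x + q *\<^sub>R y))) \<partial>gauss n)"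
    using gauss_sum_real[OF Gm G0, where s=q and u=q] q2 by simp
  also have "... \<le> (gmean n (\<lambda>x. D * (\<Prod>j\<in>J. F j (x0 j) (t * q) (s' j) x powr a j)))"
  proof (rule integral_mono_AE)
    show "AE x in gauss n. (gmean n (\<lambda>y. G (q *\<^sub>R x + q *\<^sub>R y))) \<le> D * (\<Prod>j\<in>J. F j (x0 j) (t * q) (s' j) x powr a j)"
      by (rule eventually_mono[OF AE_gauss_Rn]) (rule inner)
  qed (intro iG integrable_mult_right prod_F_integrable)+
  also have "... = D * (gmean n (\<lambda>x. (\<Prod>j\<in>J. F j (x0 j) (t * q) (s' j) x powr a j)))"
    by simp
  also have "... \<le> D * (D * (\<Prod>j\<in>J. (gmean n (\<lambda>x. F j (x0 j) (t * q) (s' j) x)) powr a j))"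
    using h xs s's D unfolding holds_with_def q_def by (intro mult_left_mono) blast+
  finally show "(gmean n (\<lambda>x. (\<Prod>j\<in>J. F j (x0 j) t (s j) x powr a j)))
      \<le> D\<^sup>2 * (\<Prod>j\<in>J. (gmean n (\<lambda>x. F j (x0 j) t (s j) x)) powr a j)"
    unfolding mean_eq by (simp add: G_def power2_eq_square mult.assoc)
qed

lemma doubling_iterate:
  assumes "holds_with (t * (1 / sqrt 2) ^ N) D" "D \<ge> 0"
  shows "holds_with t (D ^ (2 ^ N))"
  using assms
proof (induction N arbitrary: D)
  case (Suc N)
  have "holds_with (t * (1 / sqrt 2) ^ N) (D\<^sup>2)"
    by (rule doubling[OF _ Suc.prems(2)]) (use Suc.prems(1) in \<open>simp add: mult.assoc mult.commute\<close>)
  then have "holds_with t ((D\<^sup>2) ^ 2 ^ N)" by (rule Suc.IH) simp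
  then show ?case by (simp add: power_mult[symmetric])
qed simp

text \<open>
  After \<open>N\<close> doublings the constant is \<open>(1 + C * 2 powr (- 3 * N / 2)) ^ 2 ^
  N\<close>, which tends to \<open>1\<close>: the cubic error wins against the number of factors.
\<close>

lemma gaussian_brascamp_lieb: "holds_with 1 1"
  unfolding holds_with_def
proof (intro allI impI)
  fix x0 :: "'j \<Rightarrow> vec" and s :: "'j \<Rightarrow> real"
  assume xs: "\<forall>j. x0 j \<in> Rn n \<and> s0 \<le> s j"
  obtain C where C: "C \<ge> 0" "\<And>t. 0 \<le> t \<Longrightarrow> t \<le> 1 \<Longrightarrow> holds_with t (1 + C * t ^ 3)"
    using small_scale by blast
  define q where "q = 1 / sqrt (2::real)"
  have q: "0 < q" "q < 1" "q\<^sup>2 * 2 = 1" by (auto simp: q_def power_divide)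
  let ?L = "\<integral>x. (\<Prod>j\<in>J. F j (x0 j) 1 (s j) x powr a j) \<partial>gauss n"
  let ?P = "\<Prod>j\<in>J. (gmean n (\<lambda>x. F j (x0 j) 1 (s j) x)) powr a j"
  have P0: "?P \<ge> 0" by (intro prod_nonneg) auto
  have "?L \<le> exp (C * q ^ N) * ?P" for N
  proof -
    have qN: "0 \<le> q ^ N" "q ^ N \<le> 1" using q by (auto simp: power_le_one)
    have D: "1 + C * (q ^ N) ^ 3 \<ge> 0" using C qN by (intro add_nonneg_nonneg mult_nonneg_nonneg) auto
    have "holds_with 1 ((1 + C * (q ^ N) ^ 3) ^ (2 ^ N))"
      by (rule doubling_iterate[OF _ D]) (use C(2)[OF qN] in \<open>simp add: q_def\<close>)
    then have "?L \<le> (1 + C * (q ^ N) ^ 3) ^ (2 ^ N) * ?P"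
      using xs unfolding holds_with_def by blast
    also have "... \<le> exp (C * q ^ N) * ?P"
    proof (rule mult_right_mono[OF _ P0])
      have "(1 + C * (q ^ N) ^ 3) ^ (2 ^ N) \<le> exp (C * (q ^ N) ^ 3) ^ (2 ^ N)"
        by (rule power_mono[OF _ D]) (rule exp_ge_add_one_self)
      also have "... = exp (C * ((q ^ N) ^ 3 * 2 ^ N))"
        by (simp add: exp_of_nat_mult[symmetric] mult_ac)
      also have "(q ^ N) ^ 3 * 2 ^ N = q ^ N * (q\<^sup>2 * 2) ^ N"
        by (simp add: power_mult_distrib power3_eq_cube power2_eq_square mult_ac)
      finally show "(1 + C * (q ^ N) ^ 3) ^ (2 ^ N) \<le> exp (C * q ^ N)" using q by simp
    qed
    finally show ?thesis .
  qed
  moreover have "(\<lambda>N. exp (C * q ^ N) * ?P) \<longlonglongrightarrow> exp (C * 0) * ?P"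
    using q by (intro tendsto_intros LIMSEQ_power_zero) auto
  ultimately have "?L \<le> exp (C * 0) * ?P"
    by (intro LIMSEQ_le_const) auto
  then show "?L \<le> 1 * ?P" by simp
qed

end

definition shift :: "nat \<Rightarrow> vec \<Rightarrow> vec" where
  "shift k x = (\<lambda>i. x (k + i))"

lemma shift_measurable [measurable]: "shift k \<in> borel_maps"
  unfolding shift_def by (rule measurable_vecI) simp

lemma shift_join [simp]: "shift k (join k x z) = z"
  by (simp add: shift_def join_def)

lemma dot_split: "k \<le> n \<Longrightarrow> dot n x y = (\<Sum>i<k. x i * y i) + dot (n - k) (shift k x) (shift k y)"
proof -
  have "(\<Sum>i<k + m. x i * y i) = (\<Sum>i<k. x i * y i) + (\<Sum>i<m. x (k + i) * y (k + i))" for m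
    by (induction m) auto
  from this[of "n - k"] show "k \<le> n \<Longrightarrow> ?thesis" by (simp add: dot_def shift_def)
qed

lemma nn_integral_gauss_shift:
  fixes f :: "vec \<Rightarrow> ennreal"
  assumes [measurable]: "f \<in> borel_maps" and k: "k \<le> n"
  shows "gint n (\<lambda>x. f (shift k x)) = gint (n - k) (\<lambda>z. f z)"
proof -
  have "(\<integral>\<^sup>+x. f (shift k x) \<partial>gauss (k + (n - k))) = gint k (\<lambda>x. gint (n - k) (\<lambda>z. f z))"
    by (subst nn_integral_gauss_join) auto
  then show ?thesis using k by (simp add: gauss.emeasure_space_1[simplified])
qed

lemma gauss_square_sum: "gint n (\<lambda>x. ennreal (dot n x x)) = ennreal (real n)"
proof -
  have i: "integrable (gauss n) (\<lambda>x. x i * x i)" if "i < n" for i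
    using integrable_gauss_dot_square[of n "unit_vec i"] that by (simp add: dot_unit_vec power2_eq_square)
  have "(gmean n (\<lambda>x. dot n x x)) = (\<Sum>i<n. gmean n (\<lambda>x. x i * x i))"
    unfolding dot_def by (rule Bochner_Integration.integral_sum) (use i in auto)
  then have "(gmean n (\<lambda>x. dot n x x)) = real n" by (simp add: gauss_coord_square)
  moreover have "integrable (gauss n) (\<lambda>x. dot n x x)"
    unfolding dot_def by (rule Bochner_Integration.integrable_sum) (use i in auto)
  ultimately show ?thesis by (subst nn_integral_eq_integral) auto
qed

lemma emeasure_gauss_scale_le:
  assumes [measurable]: "W \<in> sets borel" and c: "c > 0"
  shows "gint m (\<lambda>z. indicator W (c *\<^sub>R z)) \<le> ennreal ((2 * pi) powr (- real m / 2) * (1 / c) ^ m) * emeasure (leb m) W"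
proof -
  let ?p = "(2 * pi) powr (- real m / 2)"
  have "gint m (\<lambda>z. indicator W (c *\<^sub>R z)) \<le> lint m (\<lambda>z. ennreal ?p * indicator W (c *\<^sub>R z))"
    by (subst nn_integral_gauss, measurable, intro nn_integral_mono mult_right_mono ennreal_leI)
       (auto simp: gauss_density_eq mult_left_le)
  also have "... = ennreal ?p * lint m (\<lambda>z. indicator W (c *\<^sub>R z))"
    by (rule nn_integral_cmult) measurable
  also have "lint m (\<lambda>z. indicator W (c *\<^sub>R z)) = ennreal ((1 / c) ^ m) * (ennreal (c ^ m) * lint m (\<lambda>z. indicator W (c *\<^sub>R z)))"
    using c by (simp add: mult.assoc[symmetric] ennreal_mult'[symmetric] power_mult_distrib[symmetric])
  also have "ennreal (c ^ m) * lint m (\<lambda>z. indicator W (c *\<^sub>R z)) = emeasure (leb m) W"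
    using nn_integral_Rn_scaleR[of "indicator W" c m] c by simp
  finally show ?thesis using c by (simp add: ennreal_mult mult.assoc)
qed

lemma emeasure_gauss_scale_ge:
  assumes [measurable]: "K \<in> sets borel" and c: "0 < c" and K: "K \<subseteq> Rn n" "\<And>x. x \<in> K \<Longrightarrow> dot n x x \<le> \<rho>"
  shows "ennreal ((2 * pi) powr (- real n / 2) * exp (- c\<^sup>2 * \<rho> / 2) * c ^ n) * emeasure (leb n) K
    \<le> gint n (\<lambda>x. indicator K ((1 / c) *\<^sub>R x))"
proof -
  let ?p = "(2 * pi) powr (- real n / 2) * exp (- c\<^sup>2 * \<rho> / 2)"
  have "ennreal (?p * c ^ n) * emeasure (leb n) K = ennreal (c ^ n) * (ennreal ?p * lint n (\<lambda>x. indicator K x))"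
    using c by (simp add: ennreal_mult mult_ac)
  also have "... = ennreal (c ^ n) * lint n (\<lambda>x. ennreal ?p * indicator K x)"
    by (simp add: nn_integral_cmult)
  also have "... \<le> ennreal (c ^ n) * lint n (\<lambda>x. ennreal (gauss_density n (c *\<^sub>R x)) * indicator K ((1 / c) *\<^sub>R (c *\<^sub>R x)))"
  proof (intro mult_left_mono nn_integral_mono)
    fix x :: vec
    show "ennreal ?p * indicator K x \<le> ennreal (gauss_density n (c *\<^sub>R x)) * indicator K ((1 / c) *\<^sub>R (c *\<^sub>R x))"
    proof (cases "x \<in> K")
      case True
      have "c\<^sup>2 * dot n x x \<le> c\<^sup>2 * \<rho>" by (intro mult_left_mono K(2)[OF True]) simp
      then show ?thesis
        using c by (auto simp: gauss_density_eq dot_simps power2_eq_square mult.assoc intro!: mult_right_mono ennreal_leI)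
    qed simp
  qed simp
  also have "... = lint n (\<lambda>x. ennreal (gauss_density n x) * indicator K ((1 / c) *\<^sub>R x))"
    by (rule nn_integral_Rn_scaleR[of "\<lambda>x. ennreal (gauss_density n x) * indicator K ((1 / c) *\<^sub>R x)", OF _ c]) measurable
  also have "... = gint n (\<lambda>x. indicator K ((1 / c) *\<^sub>R x))"
    by (rule nn_integral_gauss[symmetric]) measurable
  finally show ?thesis .
qed

lemma gauss_ball_limit:
  assumes "c > 0"
  shows "(\<lambda>m. measure (gauss n) {y. dot n y y \<le> (c * real (Suc m))\<^sup>2}) \<longlonglongrightarrow> 1"
proof -
  let ?A = "\<lambda>m. {y. dot n y y \<le> (c * real (Suc m))\<^sup>2}"
  have "(\<lambda>m. measure (gauss n) (?A m)) \<longlonglongrightarrow> measure (gauss n) (\<Union>m. ?A m)"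
  proof (rule gauss.finite_Lim_measure_incseq)
    show "range ?A \<subseteq> sets (gauss n)" by auto
    show "incseq ?A"
    proof (rule incseq_SucI, rule subsetI)
      fix m x assume "x \<in> ?A m"
      moreover have "(c * real (Suc m))\<^sup>2 \<le> (c * real (Suc (Suc m)))\<^sup>2"
        using assms by (intro power_mono mult_left_mono) auto
      ultimately show "x \<in> ?A (Suc m)" by auto
    qed
  qed
  moreover have "(\<Union>m. ?A m) = UNIV"
  proof -
    have "\<exists>m. dot n x x \<le> (c * real (Suc m))\<^sup>2" for x
    proof -
      obtain m where m: "sqrt (dot n x x) / c < real m" using reals_Archimedean2 by blast
      then have "sqrt (dot n x x) \<le> c * real (Suc m)" using assms by (simp add: field_simps)
      then have "(sqrt (dot n x x))\<^sup>2 \<le> (c * real (Suc m))\<^sup>2" by (intro power_mono) auto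
      then show ?thesis by auto
    qed
    then show ?thesis by auto
  qed
  ultimately show ?thesis by simp
qed

text \<open>
  A small dilate of the body lives where the Gaussian density is nearly constant. The Gaussian
  inequality for smoothed indicator functions of the cylinders over the sets \<open>W j\<close>
  therefore becomes an inequality between volumes as the dilation factor tends to zero.
\<close>

theorem geometric_brascamp_lieb:
  fixes J :: "'j set" and a V :: "'j \<Rightarrow> real" and Or :: "'j \<Rightarrow> vec \<Rightarrow> vec"
  assumes fin: "finite J" and a: "\<And>j. j \<in> J \<Longrightarrow> a j > 0"
    and O: "\<And>j. Or j \<in> orthogonal_group n" "\<And>j. Or j \<in> borel_maps" and k: "\<And>j. k j \<le> n"
    and frame: "\<And>x. x \<in> Rn n \<Longrightarrow> (\<Sum>j\<in>J. a j * dot (n - k j) (shift (k j) (Or j x)) (shift (k j) (Or j x))) = dot n x x"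
    and K: "K \<in> sets borel" "K \<subseteq> Rn n" "convex K" "\<And>x. x \<in> K \<Longrightarrow> dot n x x \<le> \<rho>"
    and r: "r > 0" "\<And>x. x \<in> Rn n \<Longrightarrow> dot n x x \<le> r\<^sup>2 \<Longrightarrow> x \<in> K"
    and W: "\<And>j. W j \<in> sets borel" "\<And>j x. j \<in> J \<Longrightarrow> x \<in> K \<Longrightarrow> shift (k j) (Or j x) \<in> W j"
    and V: "\<And>j. V j \<ge> 0" "\<And>j. emeasure (leb (n - k j)) (W j) = ennreal (V j)"
    and vol: "emeasure (leb n) K = ennreal v"
  shows "v \<le> (\<Prod>j\<in>J. V j powr a j)"
proof -
  note [measurable] = O(2) K(1) W(1)
  have Olin: "linear_Rn n (Or j)" for j using O(1) by (rule orthogonal_group_linear)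
  have Oin: "Or j x \<in> Rn n" if "x \<in> Rn n" for j x using linear_Rn_in[OF Olin that] .
  text \<open>The exponents balance because the frame condition can be averaged over the Gaussian measure.\<close>
  have trace: "(\<Sum>j\<in>J. a j * real (n - k j)) = real n"
  proof -
    have "ennreal (real n) = gint n (\<lambda>x. ennreal (dot n x x))" by (simp add: gauss_square_sum)
    also have "... = gint n (\<lambda>x. (\<Sum>j\<in>J. ennreal (a j) * ennreal (dot (n - k j) (shift (k j) (Or j x)) (shift (k j) (Or j x)))))"
    proof (rule nn_integral_gauss_cong)
      fix x assume "x \<in> Rn n"
      then show "ennreal (dot n x x) = (\<Sum>j\<in>J. ennreal (a j) * ennreal (dot (n - k j) (shift (k j) (Or j x)) (shift (k j) (Or j x))))"
        using a by (subst frame[symmetric]) (auto simp: sum_ennreal[symmetric] ennreal_mult less_imp_le intro!: sum.cong)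
    qed
    also have "... = (\<Sum>j\<in>J. ennreal (a j) * gint n (\<lambda>x. ennreal (dot (n - k j) (shift (k j) (Or j x)) (shift (k j) (Or j x)))))"
      by (subst nn_integral_sum) (auto intro!: sum.cong nn_integral_cmult)
    also have "... = (\<Sum>j\<in>J. ennreal (a j) * ennreal (real (n - k j)))"
    proof (intro sum.cong refl arg_cong2[where f="(*)"])
      fix j
      have "gint n (\<lambda>x. ennreal (dot (n - k j) (shift (k j) (Or j x)) (shift (k j) (Or j x)))) =
          gint n (\<lambda>x. ennreal (dot (n - k j) (shift (k j) x) (shift (k j) x)))"
        by (rule nn_integral_gauss_orthogonal[OF O(1), of j "\<lambda>x. ennreal (dot (n - k j) (shift (k j) x) (shift (k j) x))"]) measurable
      also have "... = gint (n - k j) (\<lambda>z. ennreal (dot (n - k j) z z))"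
        by (rule nn_integral_gauss_shift[OF _ k, of "\<lambda>z. ennreal (dot (n - k j) z z)"]) measurable
      finally show "gint n (\<lambda>x. ennreal (dot (n - k j) (shift (k j) (Or j x)) (shift (k j) (Or j x)))) = ennreal (real (n - k j))"
        by (simp add: gauss_square_sum)
    qed
    also have "... = ennreal (\<Sum>j\<in>J. a j * real (n - k j))"
      using a by (subst sum_ennreal[symmetric]) (auto simp: ennreal_mult less_imp_le intro!: sum.cong)
    finally show ?thesis
      using a by (subst (asm) ennreal_inj) (auto intro!: sum_nonneg mult_nonneg_nonneg simp: less_imp_le)
  qed
  have "\<exists>B. linear_Rn n B \<and> (\<forall>x\<in>Rn n. B (Or j x) = x) \<and> (\<forall>x\<in>Rn n. Or j (B x) = x) \<and> B \<in> borel_maps" for j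
    using linear_Rn_inv[OF Olin orthogonal_group_bij[OF O(1)], of j] by metis
  then obtain Oi where Oi: "\<And>j. linear_Rn n (Oi j)" "\<And>j x. x \<in> Rn n \<Longrightarrow> Oi j (Or j x) = x"
      "\<And>j x. x \<in> Rn n \<Longrightarrow> Or j (Oi j x) = x" "\<And>j. Oi j \<in> borel_maps"
    by metis
  note [measurable] = Oi(4)
  define T where "T j x = (\<lambda>i. if i < k j then 0 else (x::nat \<Rightarrow> real) i)" for j x
  have [measurable]: "T j \<in> borel_maps" for j
  proof (rule measurable_vecI)
    show "(\<lambda>x. T j x i) \<in> borel_maps" for i by (cases "i < k j") (auto simp: T_def)
  qed
  have T: "T j x \<in> Rn n" "T j (T j x) = T j x" "shift (k j) (T j x) = shift (k j) x"
    "T j (x + y) = T j x + T j y" "T j (c *\<^sub>R x) = c *\<^sub>R T j x" if "x \<in> Rn n" for j x y c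
    using that by (auto simp: T_def Rn_iff shift_def fun_eq_iff scaleR_fun_def)
  have Tdot: "dot n (T j x) y = dot n x (T j y)" "dot n (T j x) (T j x) = dot (n - k j) (shift (k j) x) (shift (k j) x)" for j x y
  proof -
    show "dot n (T j x) y = dot n x (T j y)" by (auto simp: T_def dot_def intro!: sum.cong)
    have "shift (k j) (T j x) = shift (k j) x" by (simp add: shift_def T_def)
    then show "dot n (T j x) (T j x) = dot (n - k j) (shift (k j) x) (shift (k j) x)"
      using dot_split[OF k[of j], of "T j x" "T j x"] by (simp add: T_def)
  qed
  define R where "R j x = Oi j (T j (Or j x))" for j x
  have OR: "Or j (R j x) = T j (Or j x)" if "x \<in> Rn n" for j x
    unfolding R_def using Oi(3) T(1) Oin that by blast
  have Rin: "R j x \<in> Rn n" if "x \<in> Rn n" for j x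
    unfolding R_def using linear_Rn_in[OF Oi(1)] T(1) Oin that by blast
  have Rdot: "dot n (R j x) y = dot n (T j (Or j x)) (Or j y)" if "x \<in> Rn n" "y \<in> Rn n" for j x y
    using orthogonal_group_dot[OF O(1) Rin[OF that(1)] that(2), of j j] OR[OF that(1)] by simp
  interpret bl_frame n J a R
  proof
    show "R j \<in> borel_maps" for j unfolding R_def by measurable
    show "linear_Rn n (R j)" for j
      unfolding linear_Rn_def
    proof (intro conjI ballI allI)
      fix x y assume xy: "x \<in> Rn n" "y \<in> Rn n"
      show "R j (x + y) = R j x + R j y"
        unfolding R_def by (simp add: linear_Rn_add[OF Olin xy] T(4)[OF Oin[OF xy(1)]] linear_Rn_add[OF Oi(1) T(1)[OF Oin[OF xy(1)]] T(1)[OF Oin[OF xy(2)]]])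
    next
      fix c x assume x: "x \<in> Rn n"
      show "R j (c *\<^sub>R x) = c *\<^sub>R R j x"
        unfolding R_def by (simp add: linear_Rn_scaleR[OF Olin x] T(5)[OF Oin[OF x]] linear_Rn_scaleR[OF Oi(1) T(1)[OF Oin[OF x]]])
    qed (use Rin in auto)
    show "dot n (R j x) y = dot n x (R j y)" if "x \<in> Rn n" "y \<in> Rn n" for j x y
      using Rdot[OF that, of j] Rdot[OF that(2,1), of j] Tdot(1)[of j "Or j x" "Or j y"] by (metis dot_commute)
    show "R j (R j x) = R j x" if "x \<in> Rn n" for j x
      using OR[OF that, of j] T(2)[OF Oin[OF that], of j] by (simp add: R_def)
    show "(\<Sum>j\<in>J. a j * dot n (R j x) (R j x)) = dot n x x" if "x \<in> Rn n" for x
    proof -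
      have "dot n (R j x) (R j x) = dot (n - k j) (shift (k j) (Or j x)) (shift (k j) (Or j x))" for j
        using orthogonal_group_norm[OF O(1) Rin[OF that], of j j] OR[OF that, of j] Tdot(2)[of j "Or j x"] by simp
      then show ?thesis using frame[OF that] by simp
    qed
  qed (use fin a in auto)
  define \<sigma> where "\<sigma> = (\<Sum>j\<in>J. a j)"
  define vj where "vj \<tau> j = (2 * pi) powr (- real (n - k j) / 2) * \<tau> ^ (n - k j) * V j" for \<tau> j
  have vj0: "0 \<le> vj \<tau> j" if "\<tau> > 0" for \<tau> j using that V(1) by (simp add: vj_def)
  have v0: "v \<ge> 0 \<or> ennreal v = 0" by (auto simp: ennreal_eq_0_iff)
  text \<open>The Gaussian inequality for smoothed indicator functions of cylinders. Then \<open>e\<close>, the smoothing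
    parameter \<open>s\<close> and finally the scale tend to zero.\<close>
  have main1: "measure (gauss n) {y. dot n y y \<le> (\<eta> * \<tau> * r / s)\<^sup>2} powr \<sigma> *
      ((2 * pi) powr (- real n / 2) * exp (- ((1 - \<eta>) * \<tau>)\<^sup>2 * \<rho> / 2) * ((1 - \<eta>) * \<tau>) ^ n * v)
      \<le> (\<Prod>j\<in>J. (e + vj \<tau> j) powr a j)"
    if \<tau>: "\<tau> > 0" and \<eta>: "0 < \<eta>" "\<eta> < 1" and s: "0 < s" "s \<le> 1" and e: "0 < e" "e \<le> 1" for \<tau> \<eta> s e
  proof -
    define \<psi> where "\<psi> j x = (indicator (W j) ((1 / \<tau>) *\<^sub>R shift (k j) (Or j x)) :: real)" for j x
    interpret bl_data n J a R \<psi> e s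
    proof
      show "\<psi> j \<in> borel_maps" for j unfolding \<psi>_def by measurable
      show "\<psi> j (R j x) = \<psi> j x" if "x \<in> Rn n" for j x
        unfolding \<psi>_def OR[OF that] T(3)[OF Oin[OF that]] ..
    qed (use e s in \<open>auto simp: \<psi>_def indicator_def\<close>)
    have z: "(0 :: nat \<Rightarrow> real) \<in> Rn n" by (rule Rn_zero)
    let ?\<delta> = "measure (gauss n) {y. dot n y y \<le> (\<eta> * \<tau> * r / s)\<^sup>2}"
    define c where "c = (1 - \<eta>) * \<tau>"
    have c: "c > 0" using \<tau> \<eta> by (simp add: c_def)
    have mean: "(gmean n (\<lambda>x. F j 0 1 s x)) \<le> e + vj \<tau> j" for j
    proof -
      define \<beta> where "\<beta> = sqrt (1\<^sup>2 + s\<^sup>2)"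
      have \<beta>: "\<beta> \<ge> 1" by (simp add: \<beta>_def)
      have "ennreal (gmean n (\<lambda>y. \<psi> j (\<beta> *\<^sub>R y))) = gint n (\<lambda>y. ennreal (\<psi> j (\<beta> *\<^sub>R y)))"
        by (rule nn_integral_eq_integral[symmetric]) (use psi_bounds in \<open>auto intro!: integrable_psi[OF psi_meas psi_bounds]\<close>)
      also have "... = gint n (\<lambda>y. indicator (W j) ((\<beta> / \<tau>) *\<^sub>R shift (k j) (Or j y)))"
      proof (rule nn_integral_gauss_cong)
        fix y :: vec assume y: "y \<in> Rn n"
        have "(1 / \<tau>) *\<^sub>R shift (k j) (Or j (\<beta> *\<^sub>R y)) = (\<beta> / \<tau>) *\<^sub>R shift (k j) (Or j y)"
          unfolding linear_Rn_scaleR[OF Olin y] by (simp add: shift_def scaleR_fun_def)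
        then show "ennreal (\<psi> j (\<beta> *\<^sub>R y)) = indicator (W j) ((\<beta> / \<tau>) *\<^sub>R shift (k j) (Or j y))"
          by (simp add: \<psi>_def indicator_def)
      qed
      also have "... = gint n (\<lambda>y. indicator (W j) ((\<beta> / \<tau>) *\<^sub>R shift (k j) y))"
        by (rule nn_integral_gauss_orthogonal[OF O(1), of j "\<lambda>y. indicator (W j) ((\<beta> / \<tau>) *\<^sub>R shift (k j) y)"]) measurable
      also have "... = gint (n - k j) (\<lambda>z. indicator (W j) ((\<beta> / \<tau>) *\<^sub>R z))"
        by (rule nn_integral_gauss_shift[OF _ k, of "\<lambda>z. indicator (W j) ((\<beta> / \<tau>) *\<^sub>R z)"]) measurable
      also have "... \<le> ennreal ((2 * pi) powr (- real (n - k j) / 2) * (1 / (\<beta> / \<tau>)) ^ (n - k j)) * ennreal (V j)"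
        unfolding V(2)[symmetric] by (rule emeasure_gauss_scale_le) (use \<beta> \<tau> in auto)
      also have "... \<le> ennreal ((2 * pi) powr (- real (n - k j) / 2) * \<tau> ^ (n - k j)) * ennreal (V j)"
        using \<beta> \<tau> by (intro mult_right_mono ennreal_leI mult_left_mono power_mono) (auto simp: field_simps)
      also have "... = ennreal (vj \<tau> j)" using V(1) \<tau> by (simp add: vj_def ennreal_mult)
      finally have "(gmean n (\<lambda>y. \<psi> j (\<beta> *\<^sub>R y))) \<le> vj \<tau> j"
        using vj0[OF \<tau>] by (simp add: ennreal_le_iff)
      then show ?thesis unfolding F_mean by (simp add: \<beta>_def)
    qed
    have low: "?\<delta> \<le> F j 0 1 s x" if j: "j \<in> J" and x: "x \<in> Rn n" "(1 / c) *\<^sub>R x \<in> K" for j x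
    proof -
      have "?\<delta> = (gmean n (\<lambda>y. indicator {y. dot n y y \<le> (\<eta> * \<tau> * r / s)\<^sup>2} y))" by simp
      also have "... \<le> (gmean n (\<lambda>y. \<psi> j (0 + 1 *\<^sub>R x + s *\<^sub>R y)))"
      proof (rule integral_mono_AE)
        show "AE y in gauss n. indicator {y. dot n y y \<le> (\<eta> * \<tau> * r / s)\<^sup>2} y \<le> \<psi> j (0 + 1 *\<^sub>R x + s *\<^sub>R y)"
        proof (rule eventually_mono[OF AE_gauss_Rn])
          fix y :: vec assume y: "y \<in> Rn n"
          show "indicator {y. dot n y y \<le> (\<eta> * \<tau> * r / s)\<^sup>2} y \<le> \<psi> j (0 + 1 *\<^sub>R x + s *\<^sub>R y)"
          proof (cases "dot n y y \<le> (\<eta> * \<tau> * r / s)\<^sup>2")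
            case True
            define b where "b = (s / (\<eta> * \<tau>)) *\<^sub>R y"
            have "dot n b b = (s / (\<eta> * \<tau>))\<^sup>2 * dot n y y" by (simp add: b_def dot_simps power2_eq_square)
            also have "... \<le> (s / (\<eta> * \<tau>))\<^sup>2 * (\<eta> * \<tau> * r / s)\<^sup>2" using True by (rule mult_left_mono) simp
            also have "... = r\<^sup>2" using s \<eta> \<tau> by (simp add: power_mult_distrib[symmetric])
            finally have bK: "b \<in> K" using y by (intro r(2)) (auto simp: b_def intro: Rn_scaleR)
            define w where "w = (1 - \<eta>) *\<^sub>R ((1 / c) *\<^sub>R x) + \<eta> *\<^sub>R b"
            have wK: "w \<in> K" unfolding w_def using K(3) x(2) bK \<eta> by (intro convexD) auto
            have wR: "w \<in> Rn n" using wK K(2) by auto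
            have "x + s *\<^sub>R y = \<tau> *\<^sub>R w"
              using \<eta> \<tau> by (simp add: w_def b_def c_def scaleR_fun_def fun_eq_iff field_simps)
            then have "(1 / \<tau>) *\<^sub>R shift (k j) (Or j (x + s *\<^sub>R y)) = shift (k j) (Or j w)"
              using \<tau> by (simp only: linear_Rn_scaleR[OF Olin wR]) (simp add: shift_def scaleR_fun_def)
            then have "\<psi> j (x + s *\<^sub>R y) = 1" using W(2)[OF j wK] by (simp add: \<psi>_def)
            then show ?thesis by (simp add: indicator_def)
          qed (use psi_bounds in simp)
        qed
      qed (auto intro!: integrable_psi[OF psi_meas psi_bounds] gauss.integrable_const_bound[where B=1])
      also have "... \<le> F j 0 1 s x" using e by (simp add: F_def smoothing_def)
      finally show ?thesis .
    qed
    let ?C = "(2 * pi) powr (- real n / 2) * exp (- c\<^sup>2 * \<rho> / 2) * c ^ n"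
    have i: "integrable (gauss n) (\<lambda>x. indicator K ((1 / c) *\<^sub>R x) :: real)"
      by (rule integrable_gauss_bounded[where C=1]) (auto simp: indicator_def)
    have "ennreal (?C * v) = ennreal ?C * emeasure (leb n) K" using c by (simp add: vol ennreal_mult')
    also have "... \<le> gint n (\<lambda>x. indicator K ((1 / c) *\<^sub>R x))"
      by (rule emeasure_gauss_scale_ge[OF K(1) c K(2,4)])
    also have "... = gint n (\<lambda>x. ennreal (indicator K ((1 / c) *\<^sub>R x)))" by (simp add: ennreal_indicator)
    also have "... = ennreal (gmean n (\<lambda>x. indicator K ((1 / c) *\<^sub>R x)))"
      by (rule nn_integral_eq_integral[OF i]) auto
    finally have vK: "?C * v \<le> (gmean n (\<lambda>x. indicator K ((1 / c) *\<^sub>R x)))"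
      by (subst (asm) ennreal_le_iff) (auto intro!: integral_nonneg_AE)
    have "?\<delta> powr \<sigma> * (?C * v) \<le> ?\<delta> powr \<sigma> * (gmean n (\<lambda>x. indicator K ((1 / c) *\<^sub>R x)))"
      by (rule mult_left_mono[OF vK]) simp
    also have "... = (gmean n (\<lambda>x. ?\<delta> powr \<sigma> * indicator K ((1 / c) *\<^sub>R x)))" by simp
    also have "... \<le> (gmean n (\<lambda>x. (\<Prod>j\<in>J. F j 0 1 s x powr a j)))"
    proof (rule integral_mono_AE)
      show "AE x in gauss n. ?\<delta> powr \<sigma> * indicator K ((1 / c) *\<^sub>R x) \<le> (\<Prod>j\<in>J. F j 0 1 s x powr a j)"
      proof (rule eventually_mono[OF AE_gauss_Rn])
        fix x assume x: "x \<in> Rn n"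
        show "?\<delta> powr \<sigma> * indicator K ((1 / c) *\<^sub>R x) \<le> (\<Prod>j\<in>J. F j 0 1 s x powr a j)"
        proof (cases "(1 / c) *\<^sub>R x \<in> K")
          case True
          have "?\<delta> powr \<sigma> = (\<Prod>j\<in>J. ?\<delta> powr a j) \<or> ?\<delta> = 0"
            using powr_sum[of ?\<delta> a J] fin by (auto simp: \<sigma>_def)
          moreover have "(\<Prod>j\<in>J. ?\<delta> powr a j) \<le> (\<Prod>j\<in>J. F j 0 1 s x powr a j)"
            using low[OF _ x True] by (intro prod_mono conjI powr_mono2) (auto intro: less_imp_le a)
          moreover have "0 \<le> (\<Prod>j\<in>J. F j 0 1 s x powr a j)" by (intro prod_nonneg) auto
          ultimately show ?thesis using True by auto
        qed (simp add: prod_nonneg)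
      qed
    qed (use i in \<open>auto intro!: prod_F_integrable\<close>)
    also have "... \<le> 1 * (\<Prod>j\<in>J. (gmean n (\<lambda>x. F j 0 1 s x)) powr a j)"
      using gaussian_brascamp_lieb[unfolded holds_with_def, rule_format, of "\<lambda>_. 0" "\<lambda>_. s"] z by simp
    also have "... \<le> (\<Prod>j\<in>J. (e + vj \<tau> j) powr a j)"
      unfolding mult_1_left using mean F_mean_bounds e
      by (intro prod_mono conjI powr_mono2) (auto intro: less_imp_le a order_trans[of 0 e])
    finally show ?thesis unfolding c_def .
  qed
  have main2: "measure (gauss n) {y. dot n y y \<le> (\<eta> * \<tau> * r / s)\<^sup>2} powr \<sigma> *
      ((2 * pi) powr (- real n / 2) * exp (- ((1 - \<eta>) * \<tau>)\<^sup>2 * \<rho> / 2) * ((1 - \<eta>) * \<tau>) ^ n * v)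
      \<le> (\<Prod>j\<in>J. vj \<tau> j powr a j)"
    if \<tau>: "\<tau> > 0" and \<eta>: "0 < \<eta>" "\<eta> < 1" and s: "0 < s" "s \<le> 1" for \<tau> \<eta> s
  proof (rule LIMSEQ_le_const)
    have "(\<lambda>m. \<Prod>j\<in>J. (1 / real (Suc m) + vj \<tau> j) powr a j) \<longlonglongrightarrow> (\<Prod>j\<in>J. (0 + vj \<tau> j) powr a j)"
    proof (rule tendsto_prod)
      fix j assume j: "j \<in> J"
      show "(\<lambda>m. (1 / real (Suc m) + vj \<tau> j) powr a j) \<longlonglongrightarrow> (0 + vj \<tau> j) powr a j"
        using a[OF j] vj0[OF \<tau>, of j]
        by (intro tendsto_powr' tendsto_add tendsto_const LIMSEQ_Suc[OF lim_1_over_n]) (auto intro!: always_eventually)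
    qed
    then show "(\<lambda>m. \<Prod>j\<in>J. (1 / real (Suc m) + vj \<tau> j) powr a j) \<longlonglongrightarrow> (\<Prod>j\<in>J. vj \<tau> j powr a j)" by simp
    show "\<exists>N. \<forall>m\<ge>N. measure (gauss n) {y. dot n y y \<le> (\<eta> * \<tau> * r / s)\<^sup>2} powr \<sigma> *
      ((2 * pi) powr (- real n / 2) * exp (- ((1 - \<eta>) * \<tau>)\<^sup>2 * \<rho> / 2) * ((1 - \<eta>) * \<tau>) ^ n * v)
      \<le> (\<Prod>j\<in>J. (1 / real (Suc m) + vj \<tau> j) powr a j)"
      using main1[OF \<tau> \<eta> s] by auto
  qed
  have main3: "(2 * pi) powr (- real n / 2) * exp (- ((1 - \<eta>) * \<tau>)\<^sup>2 * \<rho> / 2) * ((1 - \<eta>) * \<tau>) ^ n * v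
      \<le> (\<Prod>j\<in>J. vj \<tau> j powr a j)"
    if \<tau>: "\<tau> > 0" and \<eta>: "0 < \<eta>" "\<eta> < 1" for \<tau> \<eta>
  proof (rule LIMSEQ_le_const2)
    let ?X = "(2 * pi) powr (- real n / 2) * exp (- ((1 - \<eta>) * \<tau>)\<^sup>2 * \<rho> / 2) * ((1 - \<eta>) * \<tau>) ^ n * v"
    have "(\<lambda>m. measure (gauss n) {y. dot n y y \<le> (\<eta> * \<tau> * r * real (Suc m))\<^sup>2} powr \<sigma> * ?X) \<longlonglongrightarrow> 1 powr \<sigma> * ?X"
      using \<tau> \<eta> r by (intro tendsto_intros gauss_ball_limit) auto
    then show "(\<lambda>m. measure (gauss n) {y. dot n y y \<le> (\<eta> * \<tau> * r / (1 / real (Suc m)))\<^sup>2} powr \<sigma> * ?X) \<longlonglongrightarrow> ?X"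
      by simp
    show "\<exists>N. \<forall>m\<ge>N. measure (gauss n) {y. dot n y y \<le> (\<eta> * \<tau> * r / (1 / real (Suc m)))\<^sup>2} powr \<sigma> * ?X \<le> (\<Prod>j\<in>J. vj \<tau> j powr a j)"
      using main2[OF \<tau> \<eta>, of "1 / real (Suc m)" for m] by auto
  qed
  have prodv: "(\<Prod>j\<in>J. vj \<tau> j powr a j) = (2 * pi) powr (- real n / 2) * \<tau> ^ n * (\<Prod>j\<in>J. V j powr a j)" if \<tau>: "\<tau> > 0" for \<tau>
  proof -
    have "(\<Prod>j\<in>J. vj \<tau> j powr a j) = (\<Prod>j\<in>J. (2 * pi) powr (- (a j * real (n - k j)) / 2) * \<tau> powr (a j * real (n - k j)) * V j powr a j)"
      using \<tau> V(1) by (intro prod.cong refl) (simp add: vj_def powr_mult powr_powr powr_realpow[symmetric] mult.commute)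
    also have "... = (2 * pi) powr (\<Sum>j\<in>J. - (a j * real (n - k j)) / 2) * \<tau> powr (\<Sum>j\<in>J. a j * real (n - k j)) * (\<Prod>j\<in>J. V j powr a j)"
      using \<tau> fin by (subst (1 2) powr_sum) (auto simp: prod.distrib)
    also have "(\<Sum>j\<in>J. - (a j * real (n - k j)) / 2) = - real n / 2"
      unfolding sum_divide_distrib[symmetric] sum_negf trace ..
    finally show ?thesis using \<tau> by (simp add: trace powr_realpow)
  qed
  have main4: "exp (- ((1 - \<eta>) * \<eta>)\<^sup>2 * \<rho> / 2) * (1 - \<eta>) ^ n * v \<le> (\<Prod>j\<in>J. V j powr a j)"
    if \<eta>: "0 < \<eta>" "\<eta> < 1" for \<eta>
  proof -
    have pos: "(2 * pi) powr (- real n / 2) * \<eta> ^ n > 0" using \<eta> by simp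
    have "((2 * pi) powr (- real n / 2) * \<eta> ^ n) * (exp (- ((1 - \<eta>) * \<eta>)\<^sup>2 * \<rho> / 2) * (1 - \<eta>) ^ n * v)
        \<le> ((2 * pi) powr (- real n / 2) * \<eta> ^ n) * (\<Prod>j\<in>J. V j powr a j)"
      using main3[OF \<eta>(1) \<eta>] unfolding prodv[OF \<eta>(1)] by (simp add: power_mult_distrib mult_ac)
    then show ?thesis using pos by (simp only: mult_le_cancel_left_pos)
  qed
  show ?thesis
  proof (rule LIMSEQ_le_const2)
    have l: "(\<lambda>m. 1 / real (Suc (Suc m))) \<longlonglongrightarrow> 0"
      using LIMSEQ_Suc[OF LIMSEQ_Suc[OF lim_1_over_n[where 'a=real]]] by simp
    have "(\<lambda>m. exp (- ((1 - 1 / real (Suc (Suc m))) * (1 / real (Suc (Suc m))))\<^sup>2 * \<rho> / 2) * (1 - 1 / real (Suc (Suc m))) ^ n * v)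
        \<longlonglongrightarrow> exp (- ((1 - 0) * 0)\<^sup>2 * \<rho> / 2) * (1 - 0) ^ n * v"
      by (intro tendsto_intros l) auto
    then show "(\<lambda>m. exp (- ((1 - 1 / real (Suc (Suc m))) * (1 / real (Suc (Suc m))))\<^sup>2 * \<rho> / 2) * (1 - 1 / real (Suc (Suc m))) ^ n * v) \<longlonglongrightarrow> v"
      by simp
    show "\<exists>N. \<forall>m\<ge>N. exp (- ((1 - 1 / real (Suc (Suc m))) * (1 / real (Suc (Suc m))))\<^sup>2 * \<rho> / 2) * (1 - 1 / real (Suc (Suc m))) ^ n * v
        \<le> (\<Prod>j\<in>J. V j powr a j)"
      using main4[of "1 / real (Suc (Suc m))" for m] by auto
  qed
qed

section \<open>Convex bodies\<close>

lemma tendsto_vec_iff: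
  fixes f :: "'a \<Rightarrow> vec"
  shows "(f \<longlongrightarrow> l) F \<longleftrightarrow> (\<forall>i. ((\<lambda>x. f x i) \<longlongrightarrow> l i) F)"
proof -
  have "limitin (product_topology (\<lambda>_. euclidean) UNIV) f l F \<longleftrightarrow> (\<forall>i. limitin euclidean (\<lambda>x. f x i) (l i) F)"
    by (simp add: limitin_componentwise)
  then show ?thesis by (simp add: euclidean_product_topology)
qed

lemma compactin_Rn_iff: "compactin (Euclidean_space n) K \<longleftrightarrow> compact K \<and> K \<subseteq> Rn n"
  by (simp add: Euclidean_space_def compactin_subtopology euclidean_product_topology)

lemma compact_cube: "compact (cube n R \<inter> Rn n)"
proof -
  let ?S = "\<lambda>i. if i < n then {-R..R} else {0::real}"
  have "cube n R \<inter> Rn n = PiE UNIV ?S"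
    by (auto simp: cube_def Rn_iff PiE_def Pi_def abs_le_iff not_less[symmetric] split: if_splits; force)
  moreover have "compactin (product_topology (\<lambda>_. euclidean) UNIV) (PiE UNIV ?S)"
    by (subst compactin_PiE) auto
  ultimately show ?thesis by (simp add: euclidean_product_topology)
qed

lemma closed_Rn: "closed (Rn n)"
  using closedin_Euclidean_space_iff[of n "Rn n"] by simp

lemma compact_Rn_bounded:
  assumes "compact K" "K \<subseteq> Rn n"
  obtains R where "R > 0" "K \<subseteq> cube n R"
proof -
  have "\<exists>B. \<forall>x\<in>K. \<bar>x i\<bar> \<le> B" for i
  proof -
    have "compact ((\<lambda>x. x i) ` K)"
      by (rule compact_continuous_image[OF continuous_on_subset[OF continuous_on_product_coordinates] assms(1)]) simp
    then show ?thesis using compact_imp_bounded by (force simp: bounded_iff)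
  qed
  then obtain B where B: "\<And>i x. x \<in> K \<Longrightarrow> \<bar>x i\<bar> \<le> B i" by metis
  have "\<bar>x i\<bar> \<le> 1 + (\<Sum>i<n. \<bar>B i\<bar>)" if "x \<in> K" "i < n" for x i
  proof -
    have "\<bar>x i\<bar> \<le> \<bar>B i\<bar>" using B[OF that(1), of i] by linarith
    also have "... \<le> (\<Sum>i<n. \<bar>B i\<bar>)" by (rule member_le_sum) (use that in auto)
    finally show ?thesis by linarith
  qed
  then have "K \<subseteq> cube n (1 + (\<Sum>i<n. \<bar>B i\<bar>))" by (auto simp: cube_def)
  moreover have "1 + (\<Sum>i<n. \<bar>B i\<bar>) > 0" by (intro add_pos_nonneg sum_nonneg) auto
  ultimately show ?thesis using that by blast
qed

lemma convex_body_iff: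
  "convex_body n K \<longleftrightarrow> convex K \<and> compact K \<and> K \<subseteq> Rn n \<and>
    (\<exists>x0\<in>Rn n. \<exists>e>0. \<forall>y\<in>Rn n. (\<forall>i<n. \<bar>y i - x0 i\<bar> < e) \<longrightarrow> y \<in> K)"
proof -
  have "(Euclidean_space n) interior_of K \<noteq> {} \<longleftrightarrow> (\<exists>x0\<in>Rn n. \<exists>e>0. \<forall>y\<in>Rn n. (\<forall>i<n. \<bar>y i - x0 i\<bar> < e) \<longrightarrow> y \<in> K)"
  proof
    assume "(Euclidean_space n) interior_of K \<noteq> {}"
    then obtain x0 where x0: "x0 \<in> (Euclidean_space n) interior_of K" by auto
    define I where "I = (Euclidean_space n) interior_of K"
    have "openin (Euclidean_space n) I" by (simp add: I_def)
    then obtain U where "open U" "I = U \<inter> Rn n"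
      unfolding Euclidean_space_def euclidean_product_topology openin_subtopology by auto
    then have U: "open U" "(Euclidean_space n) interior_of K = U \<inter> Rn n" by (auto simp: I_def)
    have x0R: "x0 \<in> Rn n" "x0 \<in> U" using x0 U by auto
    show "\<exists>x0\<in>Rn n. \<exists>e>0. \<forall>y\<in>Rn n. (\<forall>i<n. \<bar>y i - x0 i\<bar> < e) \<longrightarrow> y \<in> K"
    proof (rule ccontr)
      assume neg: "\<not> ?thesis"
      have "\<exists>y\<in>Rn n. (\<forall>i<n. \<bar>y i - x0 i\<bar> < 1 / real (Suc m)) \<and> y \<notin> K" for m
      proof -
        have "1 / real (Suc m) > 0" by simp
        then show ?thesis using neg x0R(1) by blast
      qed
      then obtain y where y: "\<And>m. y m \<in> Rn n" "\<And>m i. i < n \<Longrightarrow> \<bar>y m i - x0 i\<bar> < 1 / real (Suc m)" "\<And>m. y m \<notin> K"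
        by metis
      have "y \<longlonglongrightarrow> x0"
        unfolding tendsto_vec_iff
      proof
        fix i
        show "(\<lambda>m. y m i) \<longlonglongrightarrow> x0 i"
        proof (cases "i < n")
          case True
          have "(\<lambda>m. y m i - x0 i) \<longlonglongrightarrow> 0"
          proof (rule Lim_null_comparison)
            show "\<forall>\<^sub>F m in sequentially. norm (y m i - x0 i) \<le> 1 / real (Suc m)"
              using y(2)[OF True] by (intro always_eventually) (auto intro: less_imp_le)
            show "(\<lambda>m. 1 / real (Suc m)) \<longlonglongrightarrow> 0" by (rule LIMSEQ_Suc[OF lim_1_over_n])
          qed
          then show ?thesis by (simp add: LIM_zero_iff)
        next
          case False
          then show ?thesis using y(1) x0R by (simp add: Rn_iff)
        qed
      qed
      then have "\<forall>\<^sub>F m in sequentially. y m \<in> U"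
        using U(1) x0R(2) by (rule topological_tendstoD)
      then obtain m where "y m \<in> U" by (auto simp: eventually_sequentially)
      then have "y m \<in> (Euclidean_space n) interior_of K" using U(2) y(1) by blast
      then show False using y(3)[of m] subsetD[OF interior_of_subset[of "Euclidean_space n" K]] by simp
    qed
  next
    assume "\<exists>x0\<in>Rn n. \<exists>e>0. \<forall>y\<in>Rn n. (\<forall>i<n. \<bar>y i - x0 i\<bar> < e) \<longrightarrow> y \<in> K"
    then obtain x0 e where x0: "x0 \<in> Rn n" "e > 0" "\<And>y. y \<in> Rn n \<Longrightarrow> (\<forall>i<n. \<bar>y i - x0 i\<bar> < e) \<Longrightarrow> y \<in> K" by blast
    let ?U = "\<Inter>i\<in>{..<n}. {y :: nat \<Rightarrow> real. \<bar>y i - x0 i\<bar> < e}"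
    have "open ?U"
      by (intro open_INT ballI open_Collect_less) (auto intro!: continuous_intros continuous_on_product_coordinates)
    then have "openin (Euclidean_space n) (?U \<inter> Rn n)"
      by (auto simp: Euclidean_space_def openin_subtopology euclidean_product_topology)
    then have "?U \<inter> Rn n \<subseteq> (Euclidean_space n) interior_of K"
      by (rule interior_of_maximal[rotated]) (use x0(3) in auto)
    moreover have "x0 \<in> ?U \<inter> Rn n" using x0(1,2) by simp
    ultimately show "(Euclidean_space n) interior_of K \<noteq> {}" by blast
  qed
  then show ?thesis by (auto simp: convex_body_def compactin_Rn_iff)
qed

lemma convex_body_borel: "convex_body n K \<Longrightarrow> K \<in> sets borel"
  by (auto simp: convex_body_iff intro!: borel_closed compact_imp_closed)

section \<open>Sections of a symmetric convex body\<close>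

lemma join_add: "join k x z + join k x' z' = join k (x + x') (z + z')"
  and join_scaleR: "c *\<^sub>R join k x z = join k (c *\<^sub>R x) (c *\<^sub>R z)"
  and join_uminus: "- join k x z = join k (- x) (- z)"
  by (auto simp: join_def fun_eq_iff scaleR_fun_def)

lemma weighted_am_gm:
  fixes a b t :: real
  assumes "a > 0" "b > 0" "0 \<le> t" "t \<le> 1"
  shows "a powr t * b powr (1 - t) \<le> t * a + (1 - t) * b"
proof -
  let ?m = "t * a + (1 - t) * b"
  have m: "?m > 0" using assms by (cases "t = 0") (auto intro: add_pos_nonneg)
  have "t * ln (a / ?m) + (1 - t) * ln (b / ?m) \<le> t * (a / ?m - 1) + (1 - t) * (b / ?m - 1)"
    using assms m by (intro add_mono mult_left_mono ln_le_minus_one) auto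
  also have "... = (t * a + (1 - t) * b) / ?m - 1"
  proof -
    have "t * (a / c - 1) + (1 - t) * (b / c - 1) = (t * a + (1 - t) * b) / c - 1" if "c \<noteq> 0" for c
      using that by (simp add: field_simps)
    then show ?thesis using m by simp
  qed
  also have "... = 0" using m by simp
  finally have "t * ln a + (1 - t) * ln b \<le> ln ?m"
    using assms m by (simp add: ln_div algebra_simps)
  then have "exp (t * ln a + (1 - t) * ln b) \<le> ?m"
    using m by (simp add: ln_ge_iff)
  then show ?thesis using assms by (simp add: powr_def exp_add)
qed

lemma nn_integral_inverse_substitution:
  fixes h :: "real \<Rightarrow> ennreal"
  assumes [measurable]: "h \<in> borel_maps"
  shows "(lint1 (\<lambda>a. indicator {0<..} a * (ennreal (1 / a\<^sup>2) * h (1 / a)))) = (lint1 (\<lambda>r. indicator {0<..} r * h r))"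
proof -
  let ?I = "\<lambda>m::nat. {1 / real (Suc (Suc m)) .. real (Suc (Suc m))}"
  have inc: "incseq (\<lambda>m x. indicator (?I m) x * f x)" for f :: "real \<Rightarrow> ennreal"
  proof (rule incseq_SucI, rule le_funI)
    fix m x
    have "?I m \<subseteq> ?I (Suc m)" by (auto intro: order_trans[rotated] simp: field_simps)
    then show "indicator (?I m) x * f x \<le> indicator (?I (Suc m)) x * f x"
      by (intro mult_right_mono) (auto simp: indicator_def)
  qed
  have lim: "(SUP m. indicator (?I m) x * f x) = indicator {0<..} x * f x" for f :: "real \<Rightarrow> ennreal" and x
  proof (cases "x > 0")
    case True
    obtain m1 where m1: "x < real m1" using reals_Archimedean2 by blast
    obtain m2 where m2: "1 / x < real m2" using reals_Archimedean2 by blast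
    let ?m = "max m1 m2"
    have "x \<le> real (Suc (Suc ?m))" using m1 by linarith
    moreover have "1 / x \<le> real (Suc (Suc ?m))" using m2 by linarith
    ultimately have "x \<in> ?I ?m" using True by (auto simp: field_simps)
    then have "f x \<le> (SUP m. indicator (?I m) x * f x)"
      by (intro SUP_upper2[of ?m]) auto
    moreover have "(SUP m. indicator (?I m) x * f x) \<le> f x"
      by (intro SUP_least) (auto simp: indicator_def)
    ultimately show ?thesis using True by simp
  next
    case False
    then have "x \<notin> ?I m" for m by (auto simp: not_less intro: order.strict_trans2[of x 0] divide_pos_pos)
       (smt (verit) divide_pos_pos of_nat_0_le_iff)
    then show ?thesis using False by simp
  qed
  have SUP: "(lint1 (\<lambda>x. indicator {0<..} x * f x)) = (SUP m. lint1 (\<lambda>x. indicator (?I m) x * f x))"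
    if [measurable]: "f \<in> borel_maps" for f :: "real \<Rightarrow> ennreal"
    unfolding lim[symmetric] by (rule nn_integral_monotone_convergence_SUP[OF inc]) (unfold measurable_lborel2, measurable)
  have eq: "(lint1 (\<lambda>a. indicator (?I m) a * (ennreal (1 / a\<^sup>2) * h (1 / a)))) = (lint1 (\<lambda>r. indicator (?I m) r * h r))" for m
  proof -
    let ?N = "real (Suc (Suc m))"
    have N1: "?N > 1" by simp
    have "1 / ?N < 1" by simp
    with N1 have N: "?N > 1" "1 / ?N < ?N" by linarith+
    have "(lint1 (\<lambda>r. indicator (?I m) r * h r)) = (lint1 (\<lambda>r. indicator (?I m) (0 + (-1) * r) * h (0 + (-1) * r)))"
      using nn_integral_real_affine[of "\<lambda>r. indicator (?I m) r * h r" "-1" 0] by simp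
    also have "... = (lint1 (\<lambda>y. h (- y) * indicator {- 1 / (1 / ?N) .. - 1 / ?N} y))"
      by (intro nn_integral_cong) (auto simp: indicator_def mult.commute)
    also have "... = (lint1 (\<lambda>x. h (- (- 1 / x)) * ennreal (1 / x\<^sup>2) * indicator {1 / ?N .. ?N} x))"
    proof (rule nn_integral_substitution_aux[where f="\<lambda>y. h (- y)" and g="\<lambda>x. - 1 / x" and g'="\<lambda>x. 1 / x\<^sup>2" and a="1 / ?N" and b="?N"])
      fix x assume "x \<in> {1 / ?N .. ?N}"
      then have "x > 0" using N by (auto intro: less_le_trans[of 0 "1 / ?N"])
      then show "((\<lambda>x. - 1 / x) has_real_derivative 1 / x\<^sup>2) (at x)"
        by (auto intro!: derivative_eq_intros simp: power2_eq_square)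
    next
      show "continuous_on {1 / ?N .. ?N} (\<lambda>x. 1 / x\<^sup>2)"
      proof (intro continuous_intros ballI)
        fix x assume "x \<in> {1 / ?N .. ?N}"
        then have "x > 0" by (auto intro: less_le_trans[of 0 "1 / ?N"])
        then show "x\<^sup>2 \<noteq> 0" by simp
      qed
    qed (use N in auto)
    finally show ?thesis by (simp add: mult_ac)
  qed
  have m: "(\<lambda>a. ennreal (1 / a\<^sup>2) * h (1 / a)) \<in> borel_maps" by measurable
  show ?thesis unfolding SUP[OF m] SUP[OF assms] eq ..
qed

lemma nn_integral_power_Icc:
  assumes "b \<ge> 0"
  shows "(lint1 (\<lambda>r. indicator {0<..} r * (ennreal (r ^ q) * indicator {0..b} r))) = ennreal (b ^ (q + 1) / real (q + 1))"
proof -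
  have "(lint1 (\<lambda>r. indicator {0<..} r * (ennreal (r ^ q) * indicator {0..b} r))) = (lint1 (\<lambda>r. ennreal (r ^ q) * indicator {0..b} r))"
    by (intro nn_integral_cong_AE) (use AE_lborel_singleton[of "0::real"] in \<open>eventually_elim, auto simp: indicator_def\<close>)
  also have "... = ennreal (b ^ (q + 1) / real (q + 1) - 0 ^ (q + 1) / real (q + 1))"
  proof (rule nn_integral_FTC_Icc)
    show "((\<lambda>r. r ^ (q + 1) / real (q + 1)) has_real_derivative r ^ q) (at r within S)" for r S
      by (rule has_field_derivative_at_within, rule DERIV_cong[OF DERIV_cdivide[OF DERIV_pow[of "q + 1"]]]) simp
  qed (use assms in auto)
  finally show ?thesis by simp
qed

text \<open>
  The first \<open>k\<close> coordinates are those of a base space and the last \<open>d\<close>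
  those of the fibres, whose volume as a function of the base point is the object of study.
\<close>

locale sym_body =
  fixes k d :: nat and K :: "vec set" and R \<delta> :: real
  assumes K_borel [measurable]: "K \<in> sets borel" and K_Rn: "K \<subseteq> Rn (k + d)" and K_convex: "convex K"
    and K_sym: "\<And>x. x \<in> K \<Longrightarrow> - x \<in> K"
    and R: "R > 0" and K_cube: "K \<subseteq> cube (k + d) R"
    and delta: "\<delta> > 0" and cube_K: "cube (k + d) \<delta> \<inter> Rn (k + d) \<subseteq> K" and k: "k \<ge> 1"
begin

definition sec :: "vec \<Rightarrow> ennreal" where
  "sec x = lint d (\<lambda>z. indicator K (join k x z))"

definition p :: "vec \<Rightarrow> real" where "p x = enn2real (sec x)"

lemma sec_measurable [measurable]: "sec \<in> borel_maps"
  unfolding sec_def by measurable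

lemma p_measurable [measurable]: "p \<in> borel_maps"
  unfolding p_def by measurable

lemma sec_le: "sec x \<le> ennreal ((2 * R) ^ d)"
proof -
  have "sec x \<le> lint d (\<lambda>z. indicator (cube d R) z)"
    unfolding sec_def
  proof (rule nn_integral_mono)
    fix z
    have "z \<in> cube d R" if "join k x z \<in> K"
      unfolding cube_def
    proof (intro CollectI allI impI)
      fix i assume "i < d"
      then have "\<bar>join k x z (k + i)\<bar> \<le> R" using that K_cube by (auto simp: cube_def)
      then show "\<bar>z i\<bar> \<le> R" by (simp add: join_def)
    qed
    then show "indicator K (join k x z) \<le> (indicator (cube d R) z :: ennreal)" by (auto simp: indicator_def)
  qed
  then show ?thesis using R by (simp add: emeasure_cube)
qed

lemma sec_eq: "sec x = ennreal (p x)"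
  unfolding p_def by (rule ennreal_enn2real[symmetric]) (rule le_less_trans[OF sec_le ennreal_less_top])

lemma p_nonneg: "0 \<le> p x" by (simp add: p_def)

lemma p_le: "p x \<le> (2 * R) ^ d"
  using sec_le[of x] R by (simp add: sec_eq ennreal_le_iff)

lemma p_zero: "i < k \<Longrightarrow> \<bar>x i\<bar> > R \<Longrightarrow> p x = 0"
proof -
  assume i: "i < k" "\<bar>x i\<bar> > R"
  have "join k x z \<notin> K" for z
  proof
    assume "join k x z \<in> K"
    then have "\<bar>join k x z i\<bar> \<le> R" using K_cube i by (auto simp: cube_def)
    then show False using i by (simp add: join_def)
  qed
  then show ?thesis by (simp add: p_def sec_def)
qed

lemma p_lower: "x \<in> Rn k \<Longrightarrow> x \<in> cube k \<delta> \<Longrightarrow> (2 * \<delta>) ^ d \<le> p x"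
proof -
  assume x: "x \<in> Rn k" "x \<in> cube k \<delta>"
  have "ennreal ((2 * \<delta>) ^ d) = lint d (\<lambda>z. indicator (cube d \<delta>) z)"
    using delta by (simp add: emeasure_cube)
  also have "... \<le> sec x"
    unfolding sec_def
  proof (rule nn_integral_mono_AE, rule eventually_mono[OF AE_Rn])
    fix z :: vec assume z: "z \<in> Rn d"
    have "join k x z \<in> K" if "z \<in> cube d \<delta>"
      using x z that by (intro subsetD[OF cube_K] IntI join_in_Rn) (auto simp: cube_def join_def)
    then show "indicator (cube d \<delta>) z \<le> (indicator K (join k x z) :: ennreal)" by (auto simp: indicator_def)
  qed
  finally show ?thesis using delta p_nonneg by (simp add: sec_eq ennreal_le_iff)
qed

lemma p0_pos: "p 0 > 0"
  using p_lower[of 0] subspace_0[OF subspace_Rn, of k] delta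
  by (auto simp: cube_def intro: less_le_trans[of 0 "(2 * \<delta>) ^ d"])

lemma p_uminus: "p (- x) = p x"
proof -
  have m: "(\<lambda>z. - z) \<in> orthogonal_group d"
    by (auto simp: orthogonal_group_def linear_Rn_def Rn_iff dot_def fun_eq_iff scaleR_fun_def)
  have iff: "join k (- x) (- z) \<in> K \<longleftrightarrow> join k x z \<in> K" for z
    using K_sym[of "join k x z"] K_sym[of "join k (- x) (- z)"] by (auto simp: join_uminus)
  have "sec (- x) = lint d (\<lambda>z. indicator K (join k (- x) (- z)))"
    unfolding sec_def
    by (rule nn_integral_Rn_orthogonal[OF m, of "\<lambda>z. indicator K (join k (- x) z)", symmetric]) measurable
  also have "... = sec x" unfolding sec_def by (intro nn_integral_cong) (simp add: indicator_def iff)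
  finally show ?thesis by (simp add: p_def)
qed

text \<open>
  The Brunn--Minkowski inequality for the fibres; the arithmetic-geometric mean inequality removes
  the dependence on their dimension.
\<close>

lemma p_log_concave:
  assumes x: "x \<in> Rn k" and y: "y \<in> Rn k" and t: "0 < t" "t < 1"
  shows "p x powr t * p y powr (1 - t) \<le> p (t *\<^sub>R x + (1 - t) *\<^sub>R y)"
proof (cases "p x = 0 \<or> p y = 0")
  case True
  then show ?thesis using p_nonneg by auto
next
  case False
  then have pos: "p x > 0" "p y > 0" using p_nonneg[of x] p_nonneg[of y] by auto
  define al where "al x = (if d = 0 then 1 else p x powr (1 / real d))" for x
  have al: "al x > 0" "al x ^ d = p x" if "p x > 0" for x
  proof -
    show "al x > 0" using that by (simp add: al_def)
    show "al x ^ d = p x"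
    proof (cases "d = 0")
      case True
      have "sec x = 0 \<or> sec x = 1"
      proof -
        have "sec x = indicator K (join k x (\<lambda>_. 0))"
          unfolding sec_def using nn_integral_Rn_0[of "\<lambda>z. indicator K (join k x z)"] True by simp
        then show ?thesis by (auto simp: indicator_def split: if_splits)
      qed
      then have "p x = 0 \<or> p x = 1" by (auto simp: p_def)
      then show ?thesis using that True by simp
    next
      case False
      then show ?thesis using that by (simp add: al_def powr_realpow[symmetric] powr_powr)
    qed
  qed
  have scale: "emeasure (leb d) {z. join k x ((1 / s) *\<^sub>R z) \<in> K} = ennreal ((s * al x) ^ d)" if "s > 0" "p x > 0" for s x
  proof -
    have "emeasure (leb d) {z. join k x ((1 / s) *\<^sub>R z) \<in> K} = lint d (\<lambda>z. indicator K (join k x ((1 / s) *\<^sub>R z)))"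
      by (subst nn_integral_indicator[symmetric]) (auto intro!: nn_integral_cong simp: indicator_def simp del: nn_integral_indicator)
    also have "... = ennreal (s ^ d) * lint d (\<lambda>z. indicator K (join k x ((1 / s) *\<^sub>R (s *\<^sub>R z))))"
      by (rule nn_integral_Rn_scaleR[of "\<lambda>z. indicator K (join k x ((1 / s) *\<^sub>R z))", OF _ that(1), symmetric]) measurable
    also have "... = ennreal (s ^ d) * sec x" using that by (simp add: sec_def)
    also have "... = ennreal ((s * al x) ^ d)"
      using that al(2)[OF that(2)] by (simp add: sec_eq power_mult_distrib ennreal_mult' p_nonneg)
    finally show ?thesis .
  qed
  have cube: "{z. join k x ((1 / s) *\<^sub>R z) \<in> K} \<subseteq> cube d R" if s: "0 < s" "s < 1" for s x
  proof
    fix z assume "z \<in> {z. join k x ((1 / s) *\<^sub>R z) \<in> K}"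
    then have z: "join k x ((1 / s) *\<^sub>R z) \<in> cube (k + d) R" using K_cube by auto
    show "z \<in> cube d R"
      unfolding cube_def
    proof (intro CollectI allI impI)
      fix i assume "i < d"
      then have "\<bar>join k x ((1 / s) *\<^sub>R z) (k + i)\<bar> \<le> R" using z by (auto simp: cube_def)
      then have "\<bar>z i\<bar> \<le> s * R" using s by (simp add: join_def scaleR_fun_def abs_mult field_simps)
      also have "... \<le> 1 * R" using s R by (intro mult_right_mono) auto
      finally show "\<bar>z i\<bar> \<le> R" by simp
    qed
  qed
  have "emeasure (leb d) {z. join k (t *\<^sub>R x + (1 - t) *\<^sub>R y) z \<in> K} \<ge> ennreal ((t * al x + (1 - t) * al y) ^ d)"
  proof (rule brunn_minkowski[OF _ _ _ cube cube])
    fix z z' assume z: "z \<in> {z. join k x ((1 / t) *\<^sub>R z) \<in> K}" and z': "z' \<in> {z. join k y ((1 / (1 - t)) *\<^sub>R z) \<in> K}"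
    have "t *\<^sub>R join k x ((1 / t) *\<^sub>R z) + (1 - t) *\<^sub>R join k y ((1 / (1 - t)) *\<^sub>R z') \<in> K"
      using z z' t by (intro convexD[OF K_convex]) auto
    then show "z + z' \<in> {z. join k (t *\<^sub>R x + (1 - t) *\<^sub>R y) z \<in> K}"
      using t by (simp add: join_scaleR join_add)
  qed (use t al pos scale in auto)
  also have "emeasure (leb d) {z. join k (t *\<^sub>R x + (1 - t) *\<^sub>R y) z \<in> K} = sec (t *\<^sub>R x + (1 - t) *\<^sub>R y)"
    unfolding sec_def by (subst nn_integral_indicator[symmetric]) (auto intro!: nn_integral_cong simp: indicator_def simp del: nn_integral_indicator)
  finally have "(t * al x + (1 - t) * al y) ^ d \<le> p (t *\<^sub>R x + (1 - t) *\<^sub>R y)"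
    by (simp add: sec_eq ennreal_le_iff p_nonneg)
  moreover have "(al x powr t * al y powr (1 - t)) ^ d \<le> (t * al x + (1 - t) * al y) ^ d"
    using weighted_am_gm[OF al(1)[OF pos(1)] al(1)[OF pos(2)], of t] t by (intro power_mono) auto
  moreover have "(al x powr t * al y powr (1 - t)) ^ d = p x powr t * p y powr (1 - t)"
  proof -
    have "(b powr s) ^ d = (b ^ d) powr s" if "b > 0" for b s :: real
      using that by (simp add: powr_realpow[symmetric] powr_powr mult.commute)
    then show ?thesis using al pos by (simp add: power_mult_distrib)
  qed
  ultimately show ?thesis by simp
qed

lemma p_le_p0: "x \<in> Rn k \<Longrightarrow> p x \<le> p 0"
proof -
  assume x: "x \<in> Rn k"
  have "p x powr (1/2) * p (- x) powr (1 - 1/2) \<le> p ((1/2) *\<^sub>R x + (1 - 1/2) *\<^sub>R (- x))"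
    by (rule p_log_concave) (use x Rn_uminus in auto)
  moreover have "(1/2) *\<^sub>R x + (1 - 1/2) *\<^sub>R (- x) = 0" by (simp add: fun_eq_iff scaleR_fun_def)
  moreover have "p x powr (1/2) * p (- x) powr (1 - 1/2) = p x"
    using p_nonneg[of x] by (simp add: p_uminus powr_half_sqrt)
  ultimately show ?thesis by simp
qed

section \<open>The body of Ball\<close>

definition radial :: "nat \<Rightarrow> vec \<Rightarrow> ennreal" where
  "radial q x = (lint1 (\<lambda>r. indicator {0<..} r * (ennreal (r ^ q) * ennreal (p (r *\<^sub>R x)))))"

lemma radial_measurable [measurable]: "radial q \<in> borel_maps"
  unfolding radial_def by measurable

lemma radial_scaleR:
  assumes c: "c > 0"
  shows "ennreal (c ^ (q + 1)) * radial q (c *\<^sub>R x) = radial q x"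
proof -
  have "radial q x = ennreal \<bar>c\<bar> * (lint1 (\<lambda>r. indicator {0<..} (0 + c * r) * (ennreal ((0 + c * r) ^ q) * ennreal (p ((0 + c * r) *\<^sub>R x)))))"
    unfolding radial_def by (rule nn_integral_real_affine) (use c in auto)
  also have "... = ennreal c * (lint1 (\<lambda>r. ennreal (c ^ q) * (indicator {0<..} r * (ennreal (r ^ q) * ennreal (p (r *\<^sub>R c *\<^sub>R x))))))"
  proof -
    have "(lint1 (\<lambda>r. indicator {0<..} (0 + c * r) * (ennreal ((0 + c * r) ^ q) * ennreal (p ((0 + c * r) *\<^sub>R x))))) =
        (lint1 (\<lambda>r. ennreal (c ^ q) * (indicator {0<..} r * (ennreal (r ^ q) * ennreal (p (r *\<^sub>R c *\<^sub>R x))))))"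
    proof (rule nn_integral_cong)
    fix r :: real
    show "indicator {0<..} (0 + c * r) * (ennreal ((0 + c * r) ^ q) * ennreal (p ((0 + c * r) *\<^sub>R x))) =
        ennreal (c ^ q) * (indicator {0<..} r * (ennreal (r ^ q) * ennreal (p (r *\<^sub>R c *\<^sub>R x))))"
    proof (cases "r > 0")
      case True
      then show ?thesis using c by (simp add: power_mult_distrib ennreal_mult mult.assoc mult.commute[of c r] mult.left_commute)
    next
      case False
      then have "\<not> c * r > 0" using c by (simp add: zero_less_mult_iff)
      with False show ?thesis by simp
    qed
    qed
    then show ?thesis using c by (simp only: abs_of_pos)
  qed
  also have "... = ennreal c * (ennreal (c ^ q) * radial q (c *\<^sub>R x))"
    unfolding radial_def by (subst nn_integral_cmult) auto
  also have "... = ennreal (c ^ (q + 1)) * radial q (c *\<^sub>R x)"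
    using c by (simp add: mult.assoc[symmetric] ennreal_mult'[symmetric])
  finally show ?thesis by simp
qed

lemma radial_upper:
  assumes i: "i < k" "x i \<noteq> 0"
  shows "radial q x \<le> ennreal ((2 * R) ^ d * ((R / \<bar>x i\<bar>) ^ (q + 1) / real (q + 1)))"
proof -
  have "radial q x \<le> (lint1 (\<lambda>r. ennreal ((2 * R) ^ d) * (indicator {0<..} r * (ennreal (r ^ q) * indicator {0..R / \<bar>x i\<bar>} r))))"
    unfolding radial_def
  proof (rule nn_integral_mono)
    fix r :: real
    show "indicator {0<..} r * (ennreal (r ^ q) * ennreal (p (r *\<^sub>R x))) \<le> ennreal ((2 * R) ^ d) * (indicator {0<..} r * (ennreal (r ^ q) * indicator {0..R / \<bar>x i\<bar>} r))"
    proof (cases "0 < r \<and> r \<le> R / \<bar>x i\<bar>")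
      case True
      then show ?thesis using p_le[of "r *\<^sub>R x"] by (auto simp: mult.commute intro!: mult_left_mono ennreal_leI)
    next
      case False
      have "p (r *\<^sub>R x) = 0" if "r > 0"
        using False that i by (intro p_zero[OF i(1)]) (auto simp: scaleR_fun_def abs_mult field_simps)
      then show ?thesis by (cases "r > 0") auto
    qed
  qed
  also have "... = ennreal ((2 * R) ^ d) * ennreal ((R / \<bar>x i\<bar>) ^ (q + 1) / real (q + 1))"
    using R by (simp only: nn_integral_power_Icc[of "R / \<bar>x i\<bar>" q, symmetric] divide_nonneg_nonneg abs_ge_zero less_imp_le)
      (rule nn_integral_cmult, unfold measurable_lborel2, measurable)
  finally show ?thesis by (subst ennreal_mult') (use R in simp)
qed

lemma radial_lower:
  assumes x: "x \<in> Rn k" "x \<in> cube k \<epsilon>" and e: "\<epsilon> > 0"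
  shows "ennreal ((2 * \<delta>) ^ d * ((\<delta> / \<epsilon>) ^ (q + 1) / real (q + 1))) \<le> radial q x"
proof -
  have "ennreal ((2 * \<delta>) ^ d * ((\<delta> / \<epsilon>) ^ (q + 1) / real (q + 1))) = ennreal ((2 * \<delta>) ^ d) * ennreal ((\<delta> / \<epsilon>) ^ (q + 1) / real (q + 1))"
    by (rule ennreal_mult') (use delta in simp)
  also have "... = (lint1 (\<lambda>r. ennreal ((2 * \<delta>) ^ d) * (indicator {0<..} r * (ennreal (r ^ q) * indicator {0..\<delta> / \<epsilon>} r))))"
    using delta e by (simp only: nn_integral_power_Icc[of "\<delta> / \<epsilon>" q, symmetric] divide_nonneg_pos less_imp_le)
      (rule nn_integral_cmult[symmetric], unfold measurable_lborel2, measurable)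
  also have "... \<le> radial q x"
    unfolding radial_def
  proof (rule nn_integral_mono)
    fix r :: real
    show "ennreal ((2 * \<delta>) ^ d) * (indicator {0<..} r * (ennreal (r ^ q) * indicator {0..\<delta> / \<epsilon>} r)) \<le> indicator {0<..} r * (ennreal (r ^ q) * ennreal (p (r *\<^sub>R x)))"
    proof (cases "0 < r \<and> r \<le> \<delta> / \<epsilon>")
      case True
      have "r *\<^sub>R x \<in> cube k \<delta>"
        unfolding cube_def
      proof (intro CollectI allI impI)
        fix i assume "i < k"
        then have "\<bar>x i\<bar> \<le> \<epsilon>" using x by (auto simp: cube_def)
        then have "r * \<bar>x i\<bar> \<le> (\<delta> / \<epsilon>) * \<epsilon>" using True e by (intro mult_mono) auto
        then show "\<bar>(r *\<^sub>R x) i\<bar> \<le> \<delta>" using True e by (simp add: scaleR_fun_def abs_mult)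
      qed
      then have "(2 * \<delta>) ^ d \<le> p (r *\<^sub>R x)"
        by (intro p_lower Rn_scaleR x)
      then show ?thesis using True by (auto simp: mult.commute intro!: mult_left_mono ennreal_leI)
    qed (auto simp: indicator_def)
  qed
  finally show ?thesis .
qed

text \<open>
  The convex body of K. Ball: its radial function is the \<open>(k + 2)\<close>-th root of
  \<open>radial (k + 1)\<close>. With this exponent its second moments are those of the density
  \<open>p\<close>, up to a factor, see \<open>ball_body_moment\<close>.
\<close>

definition ball_body :: "vec set" where
  "ball_body = {x \<in> Rn k. 1 \<le> radial (k + 1) x}"

end

context sym_body
begin

text \<open>
  The cone functional: integrating over the dilates of \<open>K\<close> instead of over the ray turns the
  radial integral into an integral to which the Borell--Brascamp--Lieb inequality applies.
\<close>

definition cone :: "nat \<Rightarrow> vec \<Rightarrow> vec \<Rightarrow> ennreal" where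
  "cone N x w = (if 0 < w d \<and> w d \<le> real N \<and> (1 / w d) *\<^sub>R join k x (pad d w) \<in> K
    then ennreal (1 / w d ^ (k + d + 3)) else 0)"

lemma cone_measurable [measurable]: "cone N x \<in> borel_maps"
proof -
  have [measurable]: "(\<lambda>w. (1 / w d) *\<^sub>R join k x (pad d w)) \<in> borel_maps" by measurable
  show ?thesis unfolding cone_def by measurable
qed

lemma cone_integral:
  "(SUP N. lint (Suc d) (\<lambda>w. cone N x w)) = radial (k + 1) x"
proof -
  define V where "V a = lint d (\<lambda>z. indicator K ((1 / a) *\<^sub>R join k x z))" for a :: real
  have Vm [measurable]: "V \<in> borel_maps" unfolding V_def by measurable
  have V: "V a = ennreal (a ^ d) * ennreal (p ((1 / a) *\<^sub>R x))" if a: "a > 0" for a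
  proof -
    have "V a = ennreal (a ^ d) * lint d (\<lambda>z. indicator K ((1 / a) *\<^sub>R join k x (a *\<^sub>R z)))"
      unfolding V_def by (rule nn_integral_Rn_scaleR[of "\<lambda>z. indicator K ((1 / a) *\<^sub>R join k x z)", OF _ a, symmetric]) measurable
    also have "lint d (\<lambda>z. indicator K ((1 / a) *\<^sub>R join k x (a *\<^sub>R z))) = sec ((1 / a) *\<^sub>R x)"
      unfolding sec_def join_scaleR using a by simp
    finally show ?thesis by (simp add: sec_eq)
  qed
  have slice: "lint (Suc d) (\<lambda>w. cone N x w) =
      (lint1 (\<lambda>a. indicator {0<..real N} a * (ennreal (1 / a ^ (k + d + 3)) * V a)))" for N
  proof -
    have "lint (Suc d) (\<lambda>w. cone N x w) = lint d (\<lambda>z. lint1 (\<lambda>a. cone N x (z(d := a))))"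
      by (rule nn_integral_Rn_Suc) measurable
    also have "... = (\<integral>\<^sup>+a. \<integral>\<^sup>+z. cone N x (z(d := a)) \<partial>leb d \<partial>lborel)"
      by (rule Rnborel.Fubini'[symmetric]) measurable
    also have "... = (lint1 (\<lambda>a. indicator {0<..real N} a * (ennreal (1 / a ^ (k + d + 3)) * V a)))"
    proof (rule nn_integral_cong)
      fix a :: real
      have "lint d (\<lambda>z. cone N x (z(d := a))) = lint d (\<lambda>z. (indicator {0<..real N} a * ennreal (1 / a ^ (k + d + 3))) * indicator K ((1 / a) *\<^sub>R join k x z))"
      proof (rule nn_integral_Rn_cong)
        fix z :: vec assume "z \<in> Rn d"
        then have "pad d (z(d := a)) = z" by (auto simp: pad_def Rn_iff fun_eq_iff)
        then show "cone N x (z(d := a)) = (indicator {0<..real N} a * ennreal (1 / a ^ (k + d + 3))) * indicator K ((1 / a) *\<^sub>R join k x z)"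
          by (auto simp: cone_def indicator_def)
      qed
      also have "... = (indicator {0<..real N} a * ennreal (1 / a ^ (k + d + 3))) * V a"
        unfolding V_def by (rule nn_integral_cmult) measurable
      finally show "lint d (\<lambda>z. cone N x (z(d := a))) = indicator {0<..real N} a * (ennreal (1 / a ^ (k + d + 3)) * V a)"
        by (simp add: mult.assoc)
    qed
    finally show ?thesis .
  qed
  have "(SUP N. lint1 (\<lambda>a. indicator {0<..real N} a * (ennreal (1 / a ^ (k + d + 3)) * V a))) =
      (lint1 (\<lambda>a. (SUP N. indicator {0<..real N} a * (ennreal (1 / a ^ (k + d + 3)) * V a))))"
  proof (rule nn_integral_monotone_convergence_SUP[symmetric])
    show "incseq (\<lambda>N a. indicator {0<..real N} a * (ennreal (1 / a ^ (k + d + 3)) * V a))"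
      by (intro incseq_SucI le_funI mult_right_mono) (auto simp: indicator_def)
  qed (unfold measurable_lborel2, measurable)
  also have "... = (lint1 (\<lambda>a. indicator {0<..} a * (ennreal (1 / a\<^sup>2) * (ennreal ((1 / a) ^ (k + 1)) * ennreal (p ((1 / a) *\<^sub>R x))))))"
  proof (rule nn_integral_cong)
    fix a :: real
    show "(SUP N. indicator {0<..real N} a * (ennreal (1 / a ^ (k + d + 3)) * V a)) =
        indicator {0<..} a * (ennreal (1 / a\<^sup>2) * (ennreal ((1 / a) ^ (k + 1)) * ennreal (p ((1 / a) *\<^sub>R x))))"
    proof (cases "a > 0")
      case True
      obtain N where N: "a < real N" using reals_Archimedean2 by blast
      have "(SUP N. indicator {0<..real N} a * (ennreal (1 / a ^ (k + d + 3)) * V a)) = ennreal (1 / a ^ (k + d + 3)) * V a"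
      proof (rule antisym)
        show "ennreal (1 / a ^ (k + d + 3)) * V a \<le> (SUP N. indicator {0<..real N} a * (ennreal (1 / a ^ (k + d + 3)) * V a))"
          by (rule SUP_upper2[of N]) (use N True in auto)
      qed (intro SUP_least, auto simp: indicator_def)
      also have "... = ennreal (1 / a ^ (k + d + 3) * a ^ d) * ennreal (p ((1 / a) *\<^sub>R x))"
        unfolding V[OF True] mult.assoc[symmetric] by (subst ennreal_mult'[symmetric]) (use True in simp_all)
      also have "1 / a ^ (k + d + 3) * a ^ d = 1 / a\<^sup>2 * (1 / a) ^ (k + 1)"
        using True by (simp add: power_add power_one_over power2_eq_square power3_eq_cube field_simps)
      also have "ennreal (1 / a\<^sup>2 * (1 / a) ^ (k + 1)) = ennreal (1 / a\<^sup>2) * ennreal ((1 / a) ^ (k + 1))"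
        by (rule ennreal_mult') simp
      finally show ?thesis using True by (simp add: mult.assoc)
    qed (simp add: indicator_def)
  qed
  also have "... = radial (k + 1) x"
    unfolding radial_def
    by (rule nn_integral_inverse_substitution[of "\<lambda>r. ennreal (r ^ (k + 1)) * ennreal (p (r *\<^sub>R x))"]) measurable
  finally show ?thesis unfolding slice .
qed

lemma cone_bbl:
  fixes x y :: vec
  shows "bbl_at (k + 3 + Suc d) (cone N x s) (cone N y t) (cone (N + N) (x + y) (s + t))"
proof -
  consider "cone N x s = 0" | "cone N y t = 0" | "cone N x s \<noteq> 0" "cone N y t \<noteq> 0" by blast
  then show ?thesis
  proof cases
    case 1 then show ?thesis unfolding bbl_at_def by (intro exI[of _ 1]) (auto simp: power_0_left)
  next
    case 2 then show ?thesis unfolding bbl_at_def by (intro exI[of _ 0]) (auto simp: power_0_left)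
  next
    case 3
    define a b where "a = s d" and "b = t d"
    have a: "0 < a" "a \<le> real N" "(1 / a) *\<^sub>R join k x (pad d s) \<in> K"
      and ca: "cone N x s = ennreal (1 / a ^ (k + d + 3))"
      using 3(1) by (auto simp: cone_def a_def split: if_splits)
    have b: "0 < b" "b \<le> real N" "(1 / b) *\<^sub>R join k y (pad d t) \<in> K"
      and cb: "cone N y t = ennreal (1 / b ^ (k + d + 3))"
      using 3(2) by (auto simp: cone_def b_def split: if_splits)
    define l where "l = a / (a + b)"
    have l: "0 \<le> l" "l \<le> 1" "1 - l = b / (a + b)" using a b by (auto simp: l_def field_simps)
    have "l *\<^sub>R ((1 / a) *\<^sub>R join k x (pad d s)) + (1 - l) *\<^sub>R ((1 / b) *\<^sub>R join k y (pad d t)) \<in> K"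
      using a b l by (intro convexD[OF K_convex]) auto
    moreover have "l *\<^sub>R ((1 / a) *\<^sub>R join k x (pad d s)) + (1 - l) *\<^sub>R ((1 / b) *\<^sub>R join k y (pad d t)) = (1 / (a + b)) *\<^sub>R join k (x + y) (pad d (s + t))"
    proof -
      have "l * (1 / a) = 1 / (a + b)" "(1 - l) * (1 / b) = 1 / (a + b)"
        using a b unfolding l(3) by (simp_all add: l_def)
      moreover have "pad d s + pad d t = pad d (s + t)" by (auto simp: pad_def fun_eq_iff)
      ultimately show ?thesis
        by (simp only: scaleR_scaleR scaleR_add_right[symmetric] join_add)
    qed
    ultimately have c: "cone (N + N) (x + y) (s + t) = ennreal (1 / (a + b) ^ (k + d + 3))"
      using a b by (simp add: cone_def a_def b_def)
    let ?q = "k + d + 3"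
    have "l ^ (?q + 1) * (1 / a ^ ?q) + (1 - l) ^ (?q + 1) * (1 / b ^ ?q) = 1 / (a + b) ^ ?q"
    proof -
      have "l ^ (q + 1) * (1 / a ^ q) = l / (a + b) ^ q" "(1 - l) ^ (q + 1) * (1 / b ^ q) = (1 - l) / (a + b) ^ q" for q
        using a b unfolding l(3) by (simp_all add: l_def power_divide)
      then show ?thesis by (simp only: add_divide_distrib[symmetric]) simp
    qed
    then have "ennreal (l ^ (?q + 1)) * ennreal (1 / a ^ ?q) + ennreal ((1 - l) ^ (?q + 1)) * ennreal (1 / b ^ ?q) = ennreal (1 / (a + b) ^ ?q)"
      using l a b by (subst (1 2) ennreal_mult'[symmetric], simp, simp, subst ennreal_plus[symmetric]) auto
    moreover have "k + 3 + Suc d = ?q + 1" by simp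
    ultimately show ?thesis unfolding bbl_at_def ca cb c using l by (intro exI[of _ l]) simp
  qed
qed

text \<open>
  The triangle inequality for the gauge function of the body of Ball.
\<close>

lemma radial_bbl:
  assumes x: "x \<in> Rn k" "x \<noteq> 0" and y: "y \<in> Rn k" "y \<noteq> 0" and u: "u > 0" "v > 0"
    and ux: "ennreal (1 / u ^ (k + 2)) \<le> radial (k + 1) x" and vy: "ennreal (1 / v ^ (k + 2)) \<le> radial (k + 1) y"
  shows "ennreal (1 / (u + v) ^ (k + 2)) \<le> radial (k + 1) (x + y)"
proof -
  have lower: "\<exists>b>0. \<forall>N w. cone N x w \<noteq> 0 \<longrightarrow> b \<le> w d" if xk: "x \<in> Rn k" and x0: "x \<noteq> 0" for x :: vec
  proof -
    obtain i where i: "x i \<noteq> 0" using x0 by (auto simp: fun_eq_iff)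
    then have ik: "i < k" using xk by (auto simp: Rn_iff not_less[symmetric])
    have "\<bar>x i\<bar> / R \<le> w d" if "cone N x w \<noteq> 0" for N w
    proof -
      have w: "0 < w d" "(1 / w d) *\<^sub>R join k x (pad d w) \<in> cube (k + d) R"
        using that K_cube by (auto simp: cone_def split: if_splits)
      then have "\<bar>((1 / w d) *\<^sub>R join k x (pad d w)) i\<bar> \<le> R" using ik by (auto simp: cube_def)
      then show ?thesis using w(1) R ik by (simp add: join_def scaleR_fun_def abs_mult field_simps)
    qed
    then show ?thesis using i R by (intro exI[of _ "\<bar>x i\<bar> / R"]) auto
  qed
  obtain b where b: "b > 0" "\<forall>N w. cone N x w \<noteq> 0 \<longrightarrow> b \<le> w d" using lower[OF x] by blast
  obtain b' where b': "b' > 0" "\<forall>N w. cone N y w \<noteq> 0 \<longrightarrow> b' \<le> w d" using lower[OF y] by blast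
  define B where "B = max (1 / b ^ (k + d + 3)) (1 / b' ^ (k + d + 3))"
  have bound: "cone N x w \<le> ennreal (1 / b ^ (k + d + 3))" if b0: "b > 0" and bw: "\<forall>N w. cone N x w \<noteq> 0 \<longrightarrow> b \<le> w d" for N w x b
  proof (cases "cone N x w = 0")
    case False
    then have "cone N x w = ennreal (1 / w d ^ (k + d + 3))" by (auto simp: cone_def split: if_splits)
    moreover have "1 / w d ^ (k + d + 3) \<le> 1 / b ^ (k + d + 3)"
      using b0 bw[rule_format, OF False] by (intro divide_left_mono power_mono) auto
    ultimately show ?thesis by (simp add: ennreal_leI)
  qed simp
  have supp: "cone N x w = 0" if "w \<notin> cube (Suc d) (real N * (R + 1))" for N w and x :: vec
  proof (rule ccontr)
    assume "cone N x w \<noteq> 0"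
    then have w: "0 < w d" "w d \<le> real N" "(1 / w d) *\<^sub>R join k x (pad d w) \<in> cube (k + d) R"
      using K_cube by (auto simp: cone_def split: if_splits)
    have "\<bar>w i\<bar> \<le> real N * (R + 1)" if "i < Suc d" for i
    proof (cases "i = d")
      case True
      have "w d * 1 \<le> real N * (R + 1)" using w R by (intro mult_mono) auto
      then show ?thesis using True w by simp
    next
      case False
      then have i: "i < d" using that by simp
      then have "\<bar>((1 / w d) *\<^sub>R join k x (pad d w)) (k + i)\<bar> \<le> R" using w(3) by (auto simp: cube_def)
      then have "\<bar>w i\<bar> \<le> w d * R" using w(1) i by (simp add: join_def pad_def scaleR_fun_def abs_mult field_simps)
      also have "... \<le> real N * (R + 1)" using w R by (intro mult_mono) auto
      finally show ?thesis .
    qed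
    with that show False by (auto simp: cube_def)
  qed
  have stage: "bbl_at (k + 3) (lint (Suc d) (\<lambda>w. cone N x w)) (lint (Suc d) (\<lambda>w. cone N y w))
      (lint (Suc d) (\<lambda>w. cone (N + N) (x + y) w))" for N
  proof (rule borell_brascamp_lieb[where B=B and R="real N * (R + 1)"])
    show "cone N x s \<le> ennreal B" "cone N y s \<le> ennreal B" for s
      using bound[OF b, of N s] bound[OF b', of N s] ennreal_leI[of "1 / b ^ (k + d + 3)" B] ennreal_leI[of "1 / b' ^ (k + d + 3)" B]
      by (auto simp: B_def intro: order_trans)
    show "bbl_at (k + 3 + Suc d) (cone N x s) (cone N y t) (cone (N + N) (x + y) (s + t))" for s t
      by (rule cone_bbl)
  qed (use supp in auto)
  have approx: "ennreal (1 / (c * (u + v)) ^ (k + 2)) \<le> radial (k + 1) (x + y)" if c: "c > 1" for c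
  proof -
    have lt: "\<exists>N0. \<forall>N\<ge>N0. ennreal (1 / (c * u) ^ (k + 2)) \<le> lint (Suc d) (\<lambda>w. cone N x w)"
      if u: "u > 0" and ux: "ennreal (1 / u ^ (k + 2)) \<le> radial (k + 1) x" for u x
    proof -
      have "1 / (c * u) ^ (k + 2) < 1 / u ^ (k + 2)"
        using u c by (intro divide_strict_left_mono power_strict_mono) auto
      then have "ennreal (1 / (c * u) ^ (k + 2)) < ennreal (1 / u ^ (k + 2))" using u c by (simp add: ennreal_less_iff)
      also note ux
      finally obtain N0 where N0: "ennreal (1 / (c * u) ^ (k + 2)) < lint (Suc d) (\<lambda>w. cone N0 x w)"
        unfolding cone_integral[symmetric] less_SUP_iff by auto
      have "lint (Suc d) (\<lambda>w. cone N0 x w) \<le> lint (Suc d) (\<lambda>w. cone N x w)" if "N \<ge> N0" for N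
        using that by (intro nn_integral_mono) (auto simp: cone_def)
      then show ?thesis using N0 by (meson less_imp_le order_trans)
    qed
    obtain N1 where N1: "\<And>N. N \<ge> N1 \<Longrightarrow> ennreal (1 / (c * u) ^ (k + 2)) \<le> lint (Suc d) (\<lambda>w. cone N x w)"
      using lt[OF u(1) ux] by blast
    obtain N2 where N2: "\<And>N. N \<ge> N2 \<Longrightarrow> ennreal (1 / (c * v) ^ (k + 2)) \<le> lint (Suc d) (\<lambda>w. cone N y w)"
      using lt[OF u(2) vy] by blast
    define N where "N = max N1 N2"
    obtain l where l: "0 \<le> l" "l \<le> 1"
      "ennreal (l ^ (k + 3)) * lint (Suc d) (\<lambda>w. cone N x w) + ennreal ((1 - l) ^ (k + 3)) * lint (Suc d) (\<lambda>w. cone N y w)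
        \<le> lint (Suc d) (\<lambda>w. cone (N + N) (x + y) w)"
      using stage[of N] unfolding bbl_at_def by blast
    have "1 / (c * u + c * v) ^ (k + 2) \<le> l ^ (k + 2 + 1) / (c * u) ^ (k + 2) + (1 - l) ^ (k + 2 + 1) / (c * v) ^ (k + 2)"
      using u c l by (intro radon_inequality) auto
    then have "ennreal (1 / (c * (u + v)) ^ (k + 2)) \<le> ennreal (l ^ (k + 3) * (1 / (c * u) ^ (k + 2)) + (1 - l) ^ (k + 3) * (1 / (c * v) ^ (k + 2)))"
      by (intro ennreal_leI) (simp add: distrib_left numeral_3_eq_3)
    also have "... = ennreal (l ^ (k + 3)) * ennreal (1 / (c * u) ^ (k + 2)) + ennreal ((1 - l) ^ (k + 3)) * ennreal (1 / (c * v) ^ (k + 2))"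
      using l u c by (subst (1 2) ennreal_mult'[symmetric], simp, simp, subst ennreal_plus[symmetric]) auto
    also have "... \<le> ennreal (l ^ (k + 3)) * lint (Suc d) (\<lambda>w. cone N x w) + ennreal ((1 - l) ^ (k + 3)) * lint (Suc d) (\<lambda>w. cone N y w)"
      by (intro add_mono mult_left_mono N1 N2) (auto simp: N_def)
    also note l(3)
    also have "lint (Suc d) (\<lambda>w. cone (N + N) (x + y) w) \<le> radial (k + 1) (x + y)"
      unfolding cone_integral[symmetric] by (rule SUP_upper) simp
    finally show ?thesis .
  qed
  have lim: "(\<lambda>m. ennreal (1 / ((1 + 1 / real (Suc m)) * (u + v)) ^ (k + 2))) \<longlonglongrightarrow> ennreal (1 / ((1 + 0) * (u + v)) ^ (k + 2))"
    using u by (intro tendsto_ennrealI tendsto_intros LIMSEQ_Suc[OF lim_1_over_n]) auto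
  show ?thesis
    using LIMSEQ_le_const2[OF lim, of "radial (k + 1) (x + y)"] approx[of "1 + 1 / real (Suc m)" for m] by auto
qed

lemma radial_shrink:
  assumes "0 < c" "c \<le> 1"
  shows "radial (k + 1) x \<le> radial (k + 1) (c *\<^sub>R x)"
proof -
  have "radial (k + 1) x = ennreal (c ^ (k + 1 + 1)) * radial (k + 1) (c *\<^sub>R x)"
    by (rule radial_scaleR[OF assms(1), symmetric])
  also have "... \<le> 1 * radial (k + 1) (c *\<^sub>R x)"
  proof (rule mult_right_mono)
    have "c ^ (k + 1 + 1) \<le> 1" using assms by (intro power_le_one) auto
    then show "ennreal (c ^ (k + 1 + 1)) \<le> 1" by (simp only: ennreal_le_1)
  qed simp
  finally show ?thesis by simp
qed

lemma ball_body_cube: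
  obtains \<epsilon> where "\<epsilon> > 0" "cube k \<epsilon> \<inter> Rn k \<subseteq> ball_body"
proof -
  define c where "c = (2 * \<delta>) ^ d / real (k + 2)"
  have c: "c > 0" using delta by (simp add: c_def)
  define \<epsilon> where "\<epsilon> = \<delta> * min 1 c"
  have e: "\<epsilon> > 0" using delta c by (simp add: \<epsilon>_def)
  have "cube k \<epsilon> \<inter> Rn k \<subseteq> ball_body"
  proof
    fix x assume x: "x \<in> cube k \<epsilon> \<inter> Rn k"
    have "1 / min 1 c = \<delta> / \<epsilon>" using delta by (simp add: \<epsilon>_def)
    have m: "1 \<le> \<delta> / \<epsilon>" "1 / c \<le> \<delta> / \<epsilon>"
      using delta c by (auto simp: \<epsilon>_def min_def field_simps)
    have "1 \<le> c * (1 / c)" using c by simp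
    also have "... \<le> c * (\<delta> / \<epsilon>)" using m c by (intro mult_left_mono) auto
    also have "... \<le> c * (\<delta> / \<epsilon>) ^ (k + 1 + 1)"
      using m c by (intro mult_left_mono self_le_power) auto
    also have "... = (2 * \<delta>) ^ d * ((\<delta> / \<epsilon>) ^ (k + 1 + 1) / real (k + 1 + 1))"
      by (simp add: c_def)
    finally have "1 \<le> ennreal ((2 * \<delta>) ^ d * ((\<delta> / \<epsilon>) ^ (k + 1 + 1) / real (k + 1 + 1)))"
      by (simp only: ennreal_ge_1)
    also have "... \<le> radial (k + 1) x"
      using x e by (intro radial_lower) auto
    finally show "x \<in> ball_body" using x by (simp add: ball_body_def)
  qed
  with e show ?thesis using that by blast
qed

lemma ball_body_bounded:
  obtains R' where "R' > 0" "ball_body \<subseteq> cube k R'"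
proof -
  define P where "P = max 1 ((2 * R) ^ d)"
  have P: "P \<ge> 1" "(2 * R) ^ d \<le> P" by (auto simp: P_def)
  have "\<bar>x i\<bar> \<le> R * P" if x: "x \<in> ball_body" and i: "i < k" for x i
  proof (rule ccontr)
    assume n: "\<not> \<bar>x i\<bar> \<le> R * P"
    have RP: "R * P > 0" using R P by simp
    have q: "0 \<le> R / \<bar>x i\<bar>" "R / \<bar>x i\<bar> \<le> 1 / P"
    proof -
      show "0 \<le> R / \<bar>x i\<bar>" using R by simp
      have "R / \<bar>x i\<bar> \<le> R / (R * P)" using n R RP by (intro divide_left_mono) auto
      then show "R / \<bar>x i\<bar> \<le> 1 / P" using R by simp
    qed
    have "(R / \<bar>x i\<bar>) ^ (k + 1 + 1) \<le> (1 / P) ^ (k + 1 + 1)" using q by (intro power_mono) auto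
    also have "... \<le> (1 / P) ^ 1" using P by (intro power_decreasing) auto
    finally have "(2 * R) ^ d * ((R / \<bar>x i\<bar>) ^ (k + 1 + 1) / real (k + 1 + 1)) \<le> P * ((1 / P) / real (k + 1 + 1))"
      using P R by (intro mult_mono divide_right_mono) auto
    also have "... < 1" using P by simp
    finally have "ennreal ((2 * R) ^ d * ((R / \<bar>x i\<bar>) ^ (k + 1 + 1) / real (k + 1 + 1))) < 1"
      using R by (simp only: ennreal_less_one_iff)
    moreover have "radial (k + 1) x \<le> ennreal ((2 * R) ^ d * ((R / \<bar>x i\<bar>) ^ (k + 1 + 1) / real (k + 1 + 1)))"
      using n RP by (intro radial_upper[OF i]) auto
    moreover have "1 \<le> radial (k + 1) x" using x by (simp only: ball_body_def mem_Collect_eq)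
    ultimately show False by (meson leD order_trans)
  qed
  then have "ball_body \<subseteq> cube k (R * P)" by (auto simp: cube_def)
  moreover have "R * P > 0" using R P by simp
  ultimately show ?thesis using that by blast
qed

lemma ball_body_convex: "convex ball_body"
proof (rule convexI)
  fix x y :: vec and u v :: real
  assume x: "x \<in> ball_body" and y: "y \<in> ball_body" and uv: "0 \<le> u" "0 \<le> v" "u + v = 1"
  obtain \<epsilon> where e: "\<epsilon> > 0" "cube k \<epsilon> \<inter> Rn k \<subseteq> ball_body" using ball_body_cube by blast
  have z: "0 \<in> ball_body" using e subspace_0[OF subspace_Rn, of k] by (auto simp: cube_def)
  have sc: "c *\<^sub>R w \<in> ball_body" if "w \<in> ball_body" "0 \<le> c" "c \<le> 1" for c and w :: vec
  proof (cases "c = 0")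
    case False
    then show ?thesis using that radial_shrink[of c w] Rn_scaleR
      by (auto simp: ball_body_def intro: order_trans)
  qed (use z in simp)
  have xR: "x \<in> Rn k" "y \<in> Rn k" and x1: "1 \<le> radial (k + 1) x" "1 \<le> radial (k + 1) y"
    using x y by (auto simp: ball_body_def)
  consider "u = 0" | "v = 0" | "x = 0" | "y = 0" | "u > 0" "v > 0" "x \<noteq> 0" "y \<noteq> 0" using uv by fastforce
  then show "u *\<^sub>R x + v *\<^sub>R y \<in> ball_body"
  proof cases
    case 5
    have r: "ennreal (1 / u ^ (k + 2)) \<le> radial (k + 1) (u *\<^sub>R x)" if "u > 0" "1 \<le> radial (k + 1) x" for u x
    proof -
      have "ennreal (1 / u ^ (k + 2)) * 1 \<le> ennreal (1 / u ^ (k + 2)) * (ennreal (u ^ (k + 1 + 1)) * radial (k + 1) (u *\<^sub>R x))"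
        unfolding radial_scaleR[OF that(1)] using that by (intro mult_left_mono) auto
      also have "... = radial (k + 1) (u *\<^sub>R x)"
        using that by (simp add: mult.assoc[symmetric] ennreal_mult'[symmetric])
      finally show ?thesis by simp
    qed
    have "ennreal (1 / (u + v) ^ (k + 2)) \<le> radial (k + 1) (u *\<^sub>R x + v *\<^sub>R y)"
      using 5 xR x1 r by (intro radial_bbl) (auto intro: Rn_scaleR)
    then show ?thesis
      using uv xR by (auto simp: ball_body_def intro!: Rn_add Rn_scaleR)
  qed (use uv x y sc in auto)
qed

lemma ball_body_closed: "closed ball_body"
  unfolding closed_sequential_limits
proof (intro allI impI, elim conjE)
  fix X :: "nat \<Rightarrow> vec" and x assume X: "\<forall>n. X n \<in> ball_body" and lim: "X \<longlonglongrightarrow> x"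
  have XR: "X m \<in> Rn k" for m using X by (auto simp: ball_body_def)
  have xR: "x \<in> Rn k" using closed_sequentially[OF closed_Rn _ lim] XR by blast
  obtain \<epsilon> where e: "\<epsilon> > 0" "cube k \<epsilon> \<inter> Rn k \<subseteq> ball_body" using ball_body_cube by blast
  have inner: "(1 - t) *\<^sub>R x \<in> ball_body" if t: "0 < t" "t < 1" for t
  proof -
    have "\<forall>\<^sub>F m in sequentially. \<forall>i\<in>{..<k}. \<bar>X m i - x i\<bar> < t * \<epsilon>"
    proof (rule eventually_ball_finite)
      show "\<forall>i\<in>{..<k}. \<forall>\<^sub>F m in sequentially. \<bar>X m i - x i\<bar> < t * \<epsilon>"
      proof
        fix i
        have "(\<lambda>m. X m i) \<longlonglongrightarrow> x i" using lim by (simp add: tendsto_vec_iff)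
        then show "\<forall>\<^sub>F m in sequentially. \<bar>X m i - x i\<bar> < t * \<epsilon>"
          using t e by (auto dest!: tendstoD[where e="t * \<epsilon>"] simp: dist_real_def)
      qed
    qed simp
    then obtain m where m: "\<And>i. i < k \<Longrightarrow> \<bar>X m i - x i\<bar> < t * \<epsilon>" by (auto simp: eventually_sequentially)
    define w where "w = ((1 - t) / t) *\<^sub>R (x - X m)"
    have "w \<in> Rn k" unfolding w_def using xR XR by (intro Rn_scaleR Rn_diff)
    moreover have "w \<in> cube k \<epsilon>"
      unfolding cube_def
    proof (intro CollectI allI impI)
      fix i assume i: "i < k"
      have "\<bar>w i\<bar> = ((1 - t) / t) * \<bar>X m i - x i\<bar>" using t by (simp add: w_def scaleR_fun_def abs_mult abs_minus_commute)
      also have "... \<le> (1 / t) * (t * \<epsilon>)" using t m[OF i] by (intro mult_mono) (auto simp: field_simps)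
      finally show "\<bar>w i\<bar> \<le> \<epsilon>" using t by simp
    qed
    ultimately have "w \<in> ball_body" using e by blast
    then have "(1 - t) *\<^sub>R X m + t *\<^sub>R w \<in> ball_body"
      using X t by (intro convexD[OF ball_body_convex]) auto
    moreover have "(1 - t) *\<^sub>R X m + t *\<^sub>R w = (1 - t) *\<^sub>R x"
    proof -
      have "t *\<^sub>R w = (1 - t) *\<^sub>R (x - X m)" using t by (simp add: w_def)
      then show ?thesis by (simp add: scaleR_diff_right)
    qed
    ultimately show ?thesis by simp
  qed
  have "ennreal ((1 - 1 / real (Suc (Suc m))) ^ (k + 1 + 1)) \<le> radial (k + 1) x" for m
  proof -
    let ?c = "1 - 1 / real (Suc (Suc m))"
    have c: "?c > 0" "1 / real (Suc (Suc m)) < 1" by auto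
    have "ennreal (?c ^ (k + 1 + 1)) * 1 \<le> ennreal (?c ^ (k + 1 + 1)) * radial (k + 1) (?c *\<^sub>R x)"
      using inner[of "1 / real (Suc (Suc m))"] by (intro mult_left_mono) (auto simp: ball_body_def)
    also have "... = radial (k + 1) x" by (rule radial_scaleR[OF c(1)])
    finally show ?thesis by simp
  qed
  moreover have "(\<lambda>m. ennreal ((1 - 1 / real (Suc (Suc m))) ^ (k + 1 + 1))) \<longlonglongrightarrow> ennreal ((1 - 0) ^ (k + 1 + 1))"
    by (intro tendsto_ennrealI tendsto_intros LIMSEQ_Suc[OF LIMSEQ_Suc[OF lim_1_over_n]])
  ultimately have "ennreal ((1 - 0) ^ (k + 1 + 1)) \<le> radial (k + 1) x"
    by (intro LIMSEQ_le_const2) auto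
  then show "x \<in> ball_body" using xR by (simp add: ball_body_def)
qed

lemma convex_body_ball_body: "convex_body k ball_body"
proof -
  obtain R' where R': "R' > 0" "ball_body \<subseteq> cube k R'" using ball_body_bounded by blast
  have sub: "ball_body \<subseteq> Rn k" by (auto simp: ball_body_def)
  have "compact ((cube k R' \<inter> Rn k) \<inter> ball_body)"
    by (rule compact_Int_closed[OF compact_cube ball_body_closed])
  moreover have "(cube k R' \<inter> Rn k) \<inter> ball_body = ball_body" using R' sub by blast
  ultimately have "compact ball_body" by simp
  moreover obtain \<epsilon> where e: "\<epsilon> > 0" "cube k \<epsilon> \<inter> Rn k \<subseteq> ball_body" using ball_body_cube by blast
  have "\<exists>x0\<in>Rn k. \<exists>e>0. \<forall>y\<in>Rn k. (\<forall>i<k. \<bar>y i - x0 i\<bar> < e) \<longrightarrow> y \<in> ball_body"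
    by (intro bexI[of _ 0] exI[of _ \<epsilon>] conjI) (use e Rn_zero in \<open>auto simp: cube_def less_imp_le intro!: subsetD[OF e(2)]\<close>)
  ultimately show ?thesis using sub ball_body_convex by (simp add: convex_body_iff)
qed

lemma ball_body_uminus: "x \<in> ball_body \<Longrightarrow> - x \<in> ball_body"
proof -
  have "p (r *\<^sub>R (- x)) = p (r *\<^sub>R x)" for r using p_uminus[of "r *\<^sub>R x"] by simp
  then have "radial (k + 1) (- x) = radial (k + 1) x" by (simp add: radial_def)
  then show "x \<in> ball_body \<Longrightarrow> - x \<in> ball_body" by (simp add: ball_body_def Rn_uminus)
qed

end

section \<open>Lower bounds for the isotropy constant\<close>

text \<open>
  The square of the Frobenius norm.
\<close>

definition frob :: "nat \<Rightarrow> (vec \<Rightarrow> vec) \<Rightarrow> real" where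
  "frob n A = (\<Sum>i<n. dot n (A (unit_vec i)) (A (unit_vec i)))"

definition row :: "(vec \<Rightarrow> vec) \<Rightarrow> nat \<Rightarrow> vec" where
  "row A i = (\<lambda>j. A (unit_vec j) i)"

lemma linear_Rn_coord:
  assumes "linear_Rn n A" "x \<in> Rn n"
  shows "A x i = dot n (row A i) x"
  using ext_eq[OF assms] by (simp add: ext_def sum_fun_apply scaleR_fun_def dot_def row_def mult.commute fun_eq_iff)

lemma norm_linear_Rn:
  assumes "linear_Rn n A" "x \<in> Rn n"
  shows "dot n (A x) (A x) = (\<Sum>i<n. (dot n (row A i) x)\<^sup>2)"
  by (simp add: dot_def[of n "A x"] linear_Rn_coord[OF assms] power2_eq_square)

lemma frob_rows: "frob n A = (\<Sum>i<n. dot n (row A i) (row A i))"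
  unfolding frob_def dot_def row_def by (rule sum.swap)

lemma nn_integral_quadratic:
  fixes w :: "vec \<Rightarrow> ennreal"
  assumes A: "linear_Rn n A" and [measurable]: "w \<in> borel_maps" and s: "s \<ge> 0"
    and m: "\<And>\<theta>. lint n (\<lambda>x. ennreal ((dot n \<theta> x)\<^sup>2) * w x) = ennreal (s * dot n \<theta> \<theta>)"
  shows "lint n (\<lambda>x. ennreal (dot n (A x) (A x)) * w x) = ennreal (s * frob n A)"
proof -
  have "lint n (\<lambda>x. ennreal (dot n (A x) (A x)) * w x) = lint n (\<lambda>x. (\<Sum>i<n. ennreal ((dot n (row A i) x)\<^sup>2) * w x))"
  proof (rule nn_integral_Rn_cong)
    fix x :: vec assume x: "x \<in> Rn n"
    have "ennreal (dot n (A x) (A x)) = (\<Sum>i<n. ennreal ((dot n (row A i) x)\<^sup>2))"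
      unfolding norm_linear_Rn[OF A x] by (rule sum_ennreal[symmetric]) simp
    then show "ennreal (dot n (A x) (A x)) * w x = (\<Sum>i<n. ennreal ((dot n (row A i) x)\<^sup>2) * w x)"
      by (simp only: sum_distrib_right)
  qed
  also have "... = (\<Sum>i<n. ennreal (s * dot n (row A i) (row A i)))"
    by (subst nn_integral_sum, measurable) (simp only: m)
  also have "... = ennreal (s * frob n A)"
    unfolding frob_rows sum_distrib_left using s by (intro sum_ennreal mult_nonneg_nonneg) auto
  finally show ?thesis .
qed

text \<open>
  The arithmetic-geometric mean inequality between the Jacobian of a linear map and its
  Frobenius norm: integrate the tangent line inequality for the exponential function against
  the Gaussian measure.
\<close>

lemma jacobian_le_frob:
  assumes A: "linear_Rn n A" and [measurable]: "A \<in> borel_maps" and bij: "bij_betw A (Rn n) (Rn n)"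
    and n: "n \<ge> 1" and c: "c > 0"
    and cv: "\<And>h :: vec \<Rightarrow> ennreal. h \<in> borel_maps \<Longrightarrow>
      lint n (\<lambda>y. h y) = ennreal c * lint n (\<lambda>x. h (A x))"
  shows "c powr (2 / real n) \<le> frob n A / real n"
proof -
  have fpos: "frob n A > 0"
  proof -
    have e0: "unit_vec 0 \<in> Rn n" using n by (intro unit_vec_in_Rn) simp
    have "A (unit_vec 0) \<noteq> 0"
    proof
      assume "A (unit_vec 0) = 0"
      then have "A (unit_vec 0) = A 0" using linear_Rn_zero[OF A] by simp
      then have "unit_vec 0 = (0 :: nat \<Rightarrow> real)"
        using bij e0 Rn_zero by (auto simp: bij_betw_def inj_on_def)
      then show False by (metis unit_vec_def zero_fun_apply zero_neq_one)
    qed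
    then have "0 < dot n (A (unit_vec 0)) (A (unit_vec 0))"
      using dot_eq_0_iff[OF linear_Rn_in[OF A e0]] dot_nonneg[of n "A (unit_vec 0)"] by linarith
    also have "... \<le> frob n A" unfolding frob_def by (rule member_le_sum) (use n in auto)
    finally show ?thesis .
  qed
  define \<sigma> where "\<sigma> = sqrt (frob n A / real n)"
  have sg: "\<sigma> > 0" "\<sigma>\<^sup>2 = frob n A / real n" using fpos n by (auto simp: \<sigma>_def)
  define Y where "Y x = dot n x x / 2 - dot n (A x) (A x) / (2 * \<sigma>\<^sup>2)" for x
  have g: "gauss_density n ((1 / \<sigma>) *\<^sub>R A x) = gauss_density n x * exp (Y x)" for x
    using sg(1) by (simp add: gauss_density_eq Y_def dot_simps power2_eq_square exp_add[symmetric] mult.assoc)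
  have "ennreal (\<sigma> ^ n) = ennreal (\<sigma> ^ n) * lint n (\<lambda>y. ennreal (gauss_density n y))"
    using nn_integral_gauss[of "\<lambda>_. 1" n] gauss.emeasure_space_1[of n] by simp
  also have "... = ennreal (\<sigma> ^ n) * lint n (\<lambda>y. ennreal (gauss_density n ((1 / \<sigma>) *\<^sub>R (\<sigma> *\<^sub>R y))))"
    using sg by simp
  also have "... = lint n (\<lambda>y. ennreal (gauss_density n ((1 / \<sigma>) *\<^sub>R y)))"
    by (rule nn_integral_Rn_scaleR[of "\<lambda>y. ennreal (gauss_density n ((1 / \<sigma>) *\<^sub>R y))", OF _ sg(1)]) measurable
  also have "... = ennreal c * lint n (\<lambda>x. ennreal (gauss_density n ((1 / \<sigma>) *\<^sub>R A x)))"
    by (rule cv) measurable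
  also have "lint n (\<lambda>x. ennreal (gauss_density n ((1 / \<sigma>) *\<^sub>R A x))) = gint n (\<lambda>x. ennreal (exp (Y x)))"
    unfolding g Y_def using gauss_density_pos[of n] by (subst nn_integral_gauss) (auto simp: ennreal_mult less_imp_le)
  finally have eq: "ennreal (\<sigma> ^ n) = ennreal c * gint n (\<lambda>x. ennreal (exp (Y x)))" .
  have Ym [measurable]: "Y \<in> borel_maps" unfolding Y_def by measurable
  have "gint n (\<lambda>x. ennreal (exp (Y x))) \<noteq> \<infinity>"
  proof
    assume "gint n (\<lambda>x. ennreal (exp (Y x))) = \<infinity>"
    then show False using eq c by (simp add: ennreal_mult_top)
  qed
  then have iexp: "integrable (gauss n) (\<lambda>x. exp (Y x))"
    by (intro integrableI_nonneg) (auto simp: less_top)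
  have i1: "integrable (gauss n) (\<lambda>x. dot n x x)"
  proof -
    have "integrable (gauss n) (\<lambda>x. x i * x i)" if "i < n" for i
      using integrable_gauss_dot_square[of n "unit_vec i"] that by (simp add: dot_unit_vec power2_eq_square)
    then show ?thesis unfolding dot_def by (intro Bochner_Integration.integrable_sum) auto
  qed
  have m1: "(gmean n (\<lambda>x. dot n x x)) = real n"
    using gauss_square_sum[of n] i1 by (subst (asm) nn_integral_eq_integral) auto
  let ?S = "\<lambda>x. \<Sum>i<n. (dot n (row A i) x)\<^sup>2"
  have i2: "integrable (gauss n) ?S" by (intro Bochner_Integration.integrable_sum integrable_gauss_dot_square)
  have m2: "(gmean n (\<lambda>x. ?S x)) = frob n A"
    by (subst Bochner_Integration.integral_sum) (auto simp: integrable_gauss_dot_square gauss_dot_square frob_rows)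
  have "1 = (gmean n (\<lambda>x. 1 + (dot n x x / 2 - ?S x / (2 * \<sigma>\<^sup>2))))"
    using i1 i2 m1 m2 sg fpos n by simp
  also have "... \<le> (gmean n (\<lambda>x. exp (Y x)))"
  proof (rule integral_mono_AE)
    show "AE x in gauss n. 1 + (dot n x x / 2 - ?S x / (2 * \<sigma>\<^sup>2)) \<le> exp (Y x)"
    proof (rule eventually_mono[OF AE_gauss_Rn])
      fix x assume "x \<in> Rn n"
      then show "1 + (dot n x x / 2 - ?S x / (2 * \<sigma>\<^sup>2)) \<le> exp (Y x)"
        using exp_ge_add_one_self[of "Y x"] by (simp add: Y_def norm_linear_Rn[OF A])
    qed
  qed (use i1 i2 iexp in auto)
  finally have ge1: "1 \<le> (gmean n (\<lambda>x. exp (Y x)))" .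
  have "ennreal c * 1 \<le> ennreal c * ennreal (gmean n (\<lambda>x. exp (Y x)))"
    using ge1 by (intro mult_left_mono) auto
  also have "... = ennreal (\<sigma> ^ n)"
    unfolding eq by (subst nn_integral_eq_integral[OF iexp]) auto
  finally have "c \<le> \<sigma> ^ n" using sg by (simp add: ennreal_le_iff)
  then have le: "c powr (2 / real n) \<le> (\<sigma> ^ n) powr (2 / real n)" using c by (intro powr_mono2) simp_all
  have eq: "(\<sigma> ^ n) powr (2 / real n) = \<sigma>\<^sup>2"
  proof -
    have "(\<sigma> ^ n) powr (2 / real n) = \<sigma> powr (real n * (2 / real n))"
      using powr_realpow[OF sg(1), of n] powr_powr[of \<sigma> "real n" "2 / real n"] by simp
    also have "real n * (2 / real n) = real 2" using n by simp
    also have "\<sigma> powr (real 2) = \<sigma>\<^sup>2" by (rule powr_realpow[OF sg(1)])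
    finally show ?thesis .
  qed
  show ?thesis using le unfolding eq sg(2) .
qed

text \<open>
  By symmetry of \<open>M\<close> a translation only increases the second moment, and by
  \<open>jacobian_le_frob\<close> a linear map increases it at least as much as the volume
  normalisation allows. So no position of \<open>M\<close> is better than the given one, up to the
  constant \<open>\<kappa>\<close>.
\<close>

lemma isotropy_constant_ge:
  assumes n: "n \<ge> 1" and M [measurable]: "M \<in> sets borel" and MR: "M \<subseteq> Rn n" and cube: "M \<subseteq> cube n R"
    and sym: "\<And>x. x \<in> M \<Longrightarrow> - x \<in> M"
    and m: "m > 0" "emeasure (leb n) M = ennreal m" and \<kappa>: "\<kappa> \<ge> 0"
    and mom: "\<And>A. linear_Rn n A \<Longrightarrow> A \<in> borel_maps \<Longrightarrow>
      ennreal (\<kappa> * frob n A) \<le> lint n (\<lambda>x. ennreal (dot n (A x) (A x)) * indicator M x)"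
  shows "sqrt (\<kappa> / m powr (1 + 2 / real n)) \<le> isotropy_constant n M"
  unfolding isotropy_constant_def
proof (rule real_sqrt_le_mono, rule cINF_greatest)
  have "invertible_affine_Rn n (\<lambda>x. x)"
    unfolding invertible_affine_Rn_def
    by (intro exI[of _ "\<lambda>x. x"] bexI[of _ 0]) (auto simp: linear_Rn_def bij_betw_def Rn_zero)
  then show "{T. invertible_affine_Rn n T} \<noteq> {}" by blast
next
  fix T assume "T \<in> {T. invertible_affine_Rn n T}"
  then obtain A0 b where A0: "linear_Rn n A0" "bij_betw A0 (Rn n) (Rn n)" and b: "b \<in> Rn n"
    and T: "\<And>x. x \<in> Rn n \<Longrightarrow> T x = A0 x + b"
    unfolding invertible_affine_Rn_def by auto
  define A where "A = ext n A0"
  have A: "linear_Rn n A" unfolding A_def by (rule linear_Rn_ext[OF A0(1)])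
  have Am [measurable]: "A \<in> borel_maps" unfolding A_def by measurable
  have Abij: "bij_betw A (Rn n) (Rn n)"
    using A0(2) by (rule bij_betw_cong[THEN iffD1, rotated]) (simp add: A_def ext_eq[OF A0(1)])
  have T: "T x = A x + b" if "x \<in> Rn n" for x using T[OF that] ext_eq[OF A0(1) that] by (simp add: A_def)
  obtain B where B: "linear_Rn n B" "\<And>x. x \<in> Rn n \<Longrightarrow> B (A x) = x" "\<And>x. x \<in> Rn n \<Longrightarrow> A (B x) = x" "B \<in> borel_maps"
    using linear_Rn_inv[OF A Abij] by metis
  note [measurable] = B(4)
  obtain c where c: "c > 0" "\<And>h :: vec \<Rightarrow> ennreal. h \<in> borel_maps \<Longrightarrow>
      lint n (\<lambda>y. h y) = ennreal c * lint n (\<lambda>x. h (A x))"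
    using nn_integral_Rn_linear[OF A Am Abij] by metis
  define S where "S = T ` M"
  have Siff: "y \<in> S \<longleftrightarrow> y \<in> Rn n \<and> B (y - b) \<in> M" for y
  proof
    assume "y \<in> S"
    then obtain x where x: "x \<in> M" "y = A x + b" using T MR by (auto simp: S_def)
    then have xR: "x \<in> Rn n" using MR by auto
    then show "y \<in> Rn n \<and> B (y - b) \<in> M"
      using x B(2)[OF xR] linear_Rn_in[OF A xR] Rn_add b by auto
  next
    assume y: "y \<in> Rn n \<and> B (y - b) \<in> M"
    then have "y - b \<in> Rn n" using b Rn_diff by blast
    then have "y = T (B (y - b))" using y T[of "B (y - b)"] B(3)[of "y - b"] MR by auto
    then show "y \<in> S" using y by (auto simp: S_def)
  qed
  have Sm [measurable]: "S \<in> sets borel"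
  proof -
    have "S = Rn n \<inter> {y \<in> space borel. B (y - b) \<in> M}" by (auto simp: Siff)
    also have "... \<in> sets borel" by measurable
    finally show ?thesis .
  qed
  have AS: "A x + b \<in> S \<longleftrightarrow> x \<in> M" if "x \<in> Rn n" for x
    using that B(2)[OF that] linear_Rn_in[OF A that] Rn_add[OF _ b] by (auto simp: Siff)
  have cv: "lint n (\<lambda>y. h y * indicator S y) = ennreal c * lint n (\<lambda>x. h (A x + b) * indicator M x)"
    if [measurable]: "h \<in> borel_maps" for h :: "vec \<Rightarrow> ennreal"
  proof -
    have "lint n (\<lambda>y. h y * indicator S y) = lint n (\<lambda>y. h (y + b) * indicator S (y + b))"
      by (rule nn_integral_Rn_translate[of "\<lambda>y. h y * indicator S y", OF _ b, symmetric]) measurable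
    also have "... = ennreal c * lint n (\<lambda>x. h (A x + b) * indicator S (A x + b))"
      by (rule c(2)[of "\<lambda>y. h (y + b) * indicator S (y + b)"]) measurable
    also have "lint n (\<lambda>x. h (A x + b) * indicator S (A x + b)) = lint n (\<lambda>x. h (A x + b) * indicator M x)"
      by (rule nn_integral_Rn_cong) (simp add: AS indicator_def)
    finally show ?thesis .
  qed
  have volS: "measure (leb n) S = c * m"
  proof -
    have "emeasure (leb n) S = ennreal (c * m)"
      using cv[of "\<lambda>_. 1"] m c(1) by (simp add: ennreal_mult)
    then show ?thesis using c(1) m by (simp add: measure_def)
  qed
  define J where "J = lint n (\<lambda>x. ennreal (dot n (A x + b) (A x + b) / real n) * indicator M x)"
  have Jlow: "ennreal (\<kappa> * frob n A / real n) \<le> J"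
  proof -
    have um: "(\<lambda>x. - x) \<in> orthogonal_group n"
      by (auto simp: orthogonal_group_def linear_Rn_def Rn_iff dot_def fun_eq_iff scaleR_fun_def)
    have "lint n (\<lambda>x. ennreal (dot n (A (- x) + b) (A (- x) + b) / real n) * indicator M (- x)) = J"
      unfolding J_def by (rule nn_integral_Rn_orthogonal[OF um, of "\<lambda>x. ennreal (dot n (A x + b) (A x + b) / real n) * indicator M x"]) measurable
    then have J2: "2 * J = J + lint n (\<lambda>x. ennreal (dot n (A (- x) + b) (A (- x) + b) / real n) * indicator M (- x))"
      by (simp add: mult_2)
    have J3: "J + lint n (\<lambda>x. ennreal (dot n (A (- x) + b) (A (- x) + b) / real n) * indicator M (- x)) = lint n (\<lambda>x. ennreal (dot n (A x + b) (A x + b) / real n) * indicator M x + ennreal (dot n (A (- x) + b) (A (- x) + b) / real n) * indicator M (- x))"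
      unfolding J_def by (rule nn_integral_add[symmetric]) measurable
    have "lint n (\<lambda>x. ennreal (2 / real n) * (ennreal (dot n (A x) (A x)) * indicator M x)) \<le>
      lint n (\<lambda>x. ennreal (dot n (A x + b) (A x + b) / real n) * indicator M x + ennreal (dot n (A (- x) + b) (A (- x) + b) / real n) * indicator M (- x))"
    proof (rule nn_integral_mono_AE, rule eventually_mono[OF AE_Rn])
      fix x assume x: "x \<in> Rn n"
      show "ennreal (2 / real n) * (ennreal (dot n (A x) (A x)) * indicator M x) \<le>
        ennreal (dot n (A x + b) (A x + b) / real n) * indicator M x + ennreal (dot n (A (- x) + b) (A (- x) + b) / real n) * indicator M (- x)"
      proof (cases "x \<in> M")
        case True
        have "2 * dot n (A x) (A x) \<le> dot n (A x + b) (A x + b) + dot n (A (- x) + b) (A (- x) + b)"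
          unfolding linear_Rn_uminus[OF A x] by (simp add: dot_simps dot_commute[of n b "A x"])
        then have "2 * dot n (A x) (A x) / real n \<le> (dot n (A x + b) (A x + b) + dot n (A (- x) + b) (A (- x) + b)) / real n"
          by (rule divide_right_mono) simp
        then have "2 / real n * dot n (A x) (A x) \<le> dot n (A x + b) (A x + b) / real n + dot n (A (- x) + b) (A (- x) + b) / real n"
          by (simp add: add_divide_distrib)
        then have "ennreal (2 / real n * dot n (A x) (A x)) \<le> ennreal (dot n (A x + b) (A x + b) / real n) + ennreal (dot n (A (- x) + b) (A (- x) + b) / real n)"
          using n by (subst ennreal_plus[symmetric]) (auto simp del: ennreal_plus intro!: ennreal_leI)
        then show ?thesis using True sym[OF True] n by (simp add: ennreal_mult'[symmetric])
      qed simp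
    qed
    then have le: "lint n (\<lambda>x. ennreal (2 / real n) * (ennreal (dot n (A x) (A x)) * indicator M x)) \<le> 2 * J"
      unfolding trans[OF J2 J3] .
    have "lint n (\<lambda>x. ennreal (2 / real n) * (ennreal (dot n (A x) (A x)) * indicator M x)) =
      ennreal (2 / real n) * lint n (\<lambda>x. ennreal (dot n (A x) (A x)) * indicator M x)"
      by (rule nn_integral_cmult) measurable
    with le have "ennreal (2 / real n) * lint n (\<lambda>x. ennreal (dot n (A x) (A x)) * indicator M x) \<le> 2 * J" by (simp only:)
    moreover have "ennreal (2 / real n) * ennreal (\<kappa> * frob n A) \<le> ennreal (2 / real n) * lint n (\<lambda>x. ennreal (dot n (A x) (A x)) * indicator M x)"
      by (rule mult_left_mono[OF mom[OF A Am]]) simp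
    moreover have "ennreal (2 / real n) * ennreal (\<kappa> * frob n A) = ennreal (2 * (\<kappa> * frob n A / real n))"
      by (subst ennreal_mult'[symmetric]) auto
    ultimately have "ennreal (2 * (\<kappa> * frob n A / real n)) \<le> 2 * J" by (simp only: order_trans)
    moreover have "ennreal (2 * (\<kappa> * frob n A / real n)) = 2 * ennreal (\<kappa> * frob n A / real n)"
      by (subst ennreal_mult') simp_all
    ultimately have le2: "2 * ennreal (\<kappa> * frob n A / real n) \<le> 2 * J" by simp
    have half: "ennreal (1 / 2) * (2 * z) = z" for z
    proof -
      have "ennreal (1 / 2) * ennreal 2 = ennreal 1" by (subst ennreal_mult'[symmetric]) simp_all
      then show ?thesis by (simp add: mult.assoc[symmetric])
    qed
    show ?thesis using mult_left_mono[OF le2, of "ennreal (1 / 2)"] unfolding half by simp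
  qed
  have Jfin: "J < \<infinity>"
  proof -
    define Bd where "Bd = (\<Sum>i<n. (R * (\<Sum>j<n. \<bar>A (unit_vec j) i\<bar>) + \<bar>b i\<bar>)\<^sup>2) / real n"
    have "dot n (A x + b) (A x + b) / real n \<le> Bd" if x: "x \<in> M" for x
      unfolding Bd_def dot_def
    proof (intro divide_right_mono sum_mono)
      fix i
      have "\<bar>A x i\<bar> \<le> (\<Sum>j<n. \<bar>A (unit_vec j) i * x j\<bar>)"
        unfolding linear_Rn_coord[OF A subsetD[OF MR x]] dot_def row_def by (rule sum_abs)
      also have "... \<le> (\<Sum>j<n. \<bar>A (unit_vec j) i\<bar> * R)"
        using x cube by (intro sum_mono) (auto simp: abs_mult cube_def intro!: mult_left_mono)
      finally have "\<bar>(A x + b) i\<bar> \<le> R * (\<Sum>j<n. \<bar>A (unit_vec j) i\<bar>) + \<bar>b i\<bar>"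
        using abs_triangle_ineq[of "A x i" "b i"] by (simp add: sum_distrib_right[symmetric] mult.commute[of R])
      then have "\<bar>(A x + b) i\<bar>\<^sup>2 \<le> (R * (\<Sum>j<n. \<bar>A (unit_vec j) i\<bar>) + \<bar>b i\<bar>)\<^sup>2" by (rule power_mono) simp
      then show "(A x + b) i * (A x + b) i \<le> (R * (\<Sum>j<n. \<bar>A (unit_vec j) i\<bar>) + \<bar>b i\<bar>)\<^sup>2" by (simp add: power2_eq_square)
    qed simp
    then have "J \<le> lint n (\<lambda>x. ennreal Bd * indicator M x)"
      unfolding J_def by (intro nn_integral_mono) (auto simp: indicator_def intro: ennreal_leI)
    also have "... = ennreal Bd * ennreal m" by (simp add: nn_integral_cmult m)
    also have "... < \<infinity>" by (simp add: ennreal_mult_less_top)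
    finally show ?thesis .
  qed
  have LINT: "(LINT x:S|leb n. dot n x x / real n) = enn2real (ennreal c * J)"
  proof -
    have "(LINT x:S|leb n. dot n x x / real n) = enn2real (lint n (\<lambda>x. ennreal (indicator S x * (dot n x x / real n))))"
      unfolding set_lebesgue_integral_def by (subst integral_eq_nn_integral) (auto simp: indicator_def)
    also have "lint n (\<lambda>x. ennreal (indicator S x * (dot n x x / real n))) = lint n (\<lambda>x. ennreal (dot n x x / real n) * indicator S x)"
      by (intro nn_integral_cong) (auto simp: indicator_def)
    also have "... = ennreal c * J" unfolding J_def by (rule cv) measurable
    finally show ?thesis .
  qed
  have lin: "c * (\<kappa> * frob n A / real n) \<le> (LINT x:S|leb n. dot n x x / real n)"
  proof -
    obtain j where j: "J = ennreal j" "j \<ge> 0" using Jfin by (cases J) auto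
    then have "\<kappa> * frob n A / real n \<le> j" using Jlow by (simp add: ennreal_le_iff)
    then have "c * (\<kappa> * frob n A / real n) \<le> c * j" using c(1) by (intro mult_left_mono) auto
    then show ?thesis unfolding LINT j using c(1) j(2) by (simp add: ennreal_mult'[symmetric])
  qed
  have cm: "(c * m) powr (1 + 2 / real n) = c * c powr (2 / real n) * m powr (1 + 2 / real n)"
    using c(1) m(1) by (simp add: powr_mult powr_add)
  have "c powr (2 / real n) \<le> frob n A / real n"
    by (rule jacobian_le_frob[OF A Am Abij n c])
  then have "\<kappa> * c powr (2 / real n) \<le> \<kappa> * (frob n A / real n)" using \<kappa> by (rule mult_left_mono)
  then have "c * (\<kappa> * c powr (2 / real n)) \<le> (LINT x:S|leb n. dot n x x / real n)"
    using lin c(1) mult_left_mono[of "\<kappa> * c powr (2 / real n)" "\<kappa> * (frob n A / real n)" c] by simp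
  then have "c * (\<kappa> * c powr (2 / real n)) / (c * m) powr (1 + 2 / real n) \<le>
      (LINT x:S|leb n. dot n x x / real n) / (c * m) powr (1 + 2 / real n)"
    by (rule divide_right_mono) simp
  moreover have "c * (\<kappa> * c powr (2 / real n)) / (c * m) powr (1 + 2 / real n) = \<kappa> / m powr (1 + 2 / real n)"
    unfolding cm using c(1) by simp
  ultimately show "\<kappa> / m powr (1 + 2 / real n) \<le> 1 / measure (leb n) (T ` M) powr (1 + 2 / real n) *
      (LINT x:T ` M|leb n. dot n x x / real n)"
    unfolding S_def[symmetric] volS by (simp add: mult.commute)
qed

lemma nn_integral_square_segment:
  fixes a b :: real
  shows "(lint1 (\<lambda>s. ennreal ((a + b * s)\<^sup>2) * indicator {-1..1} s)) = ennreal (2 * a\<^sup>2 + 2 * b\<^sup>2 / 3)"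
proof -
  have "(lint1 (\<lambda>s. ennreal ((a + b * s)\<^sup>2) * indicator {-1..1} s)) =
    ennreal ((a\<^sup>2 * 1 + a * b * 1\<^sup>2 + b\<^sup>2 * 1 ^ 3 / 3) - (a\<^sup>2 * (-1) + a * b * (-1)\<^sup>2 + b\<^sup>2 * (-1) ^ 3 / 3))"
  proof (rule nn_integral_FTC_Icc[where F="\<lambda>s. a\<^sup>2 * s + a * b * s\<^sup>2 + b\<^sup>2 * s ^ 3 / 3"])
    show "((\<lambda>s. a\<^sup>2 * s + a * b * s\<^sup>2 + b\<^sup>2 * s ^ 3 / 3) has_real_derivative (a + b * x)\<^sup>2) (at x within S)" for x S
      by (auto intro!: derivative_eq_intros simp: power2_eq_square algebra_simps)
  qed auto
  then show ?thesis by simp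
qed

lemma cube_second_moment:
  "lint n (\<lambda>x. ennreal ((dot n \<theta> x)\<^sup>2) * indicator (cube n 1) x) = ennreal (2 ^ n / 3 * dot n \<theta> \<theta>)"
proof (induction n)
  case 0
  show ?case by (subst nn_integral_Rn_0) (auto simp: dot_def)
next
  case (Suc n)
  have "lint (Suc n) (\<lambda>x. ennreal ((dot (Suc n) \<theta> x)\<^sup>2) * indicator (cube (Suc n) 1) x) =
    lint n (\<lambda>x. lint1 (\<lambda>s. ennreal ((dot (Suc n) \<theta> (x(n := s)))\<^sup>2) * indicator (cube (Suc n) 1) (x(n := s))))"
    by (rule nn_integral_Rn_Suc) measurable
  also have "... = lint n (\<lambda>x. indicator (cube n 1) x * ennreal (2 * (dot n \<theta> x)\<^sup>2 + 2 * (\<theta> n)\<^sup>2 / 3))"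
  proof (rule nn_integral_cong)
    fix x :: vec
    have d: "dot (Suc n) \<theta> (x(n := s)) = dot n \<theta> x + \<theta> n * s" for s by (simp add: dot_def)
    have c: "indicator (cube (Suc n) 1) (x(n := s)) = (indicator (cube n 1) x * indicator {-1..1} s :: ennreal)" for s
      by (auto simp: indicator_def cube_def less_Suc_eq abs_le_iff)
    have "(lint1 (\<lambda>s. ennreal ((dot (Suc n) \<theta> (x(n := s)))\<^sup>2) * indicator (cube (Suc n) 1) (x(n := s)))) =
       (lint1 (\<lambda>s. indicator (cube n 1) x * (ennreal ((dot n \<theta> x + \<theta> n * s)\<^sup>2) * indicator {-1..1} s)))"
      unfolding d c by (simp add: mult_ac)
    also have "... = indicator (cube n 1) x * (lint1 (\<lambda>s. ennreal ((dot n \<theta> x + \<theta> n * s)\<^sup>2) * indicator {-1..1} s))"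
      by (rule nn_integral_cmult) (unfold measurable_lborel2, measurable)
    finally show "(lint1 (\<lambda>s. ennreal ((dot (Suc n) \<theta> (x(n := s)))\<^sup>2) * indicator (cube (Suc n) 1) (x(n := s)))) =
       indicator (cube n 1) x * ennreal (2 * (dot n \<theta> x)\<^sup>2 + 2 * (\<theta> n)\<^sup>2 / 3)"
      by (simp only: nn_integral_square_segment)
  qed
  also have "... = lint n (\<lambda>x. 2 * (ennreal ((dot n \<theta> x)\<^sup>2) * indicator (cube n 1) x) + ennreal (2 * (\<theta> n)\<^sup>2 / 3) * indicator (cube n 1) x)"
    by (intro nn_integral_cong) (auto simp: indicator_def ennreal_plus ennreal_mult)
  also have "... = 2 * ennreal (2 ^ n / 3 * dot n \<theta> \<theta>) + ennreal (2 * (\<theta> n)\<^sup>2 / 3) * ennreal (2 ^ n)"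
    by (subst nn_integral_add, measurable, subst (1 2) nn_integral_cmult, measurable) (simp add: Suc emeasure_cube)
  also have "... = ennreal (2 * (2 ^ n / 3 * dot n \<theta> \<theta>) + 2 * (\<theta> n)\<^sup>2 / 3 * 2 ^ n)"
  proof -
    have "2 * ennreal a + ennreal b * ennreal c = ennreal (2 * a + b * c)" if "a \<ge> 0" "b \<ge> 0" "c \<ge> 0" for a b c :: real
      using that by (simp add: ennreal_mult)
    note this[of "2 ^ n / 3 * dot n \<theta> \<theta>" "2 * (\<theta> n)\<^sup>2 / 3" "2 ^ n"]
    moreover have "0 \<le> 2 ^ n / 3 * dot n \<theta> \<theta>" by (intro mult_nonneg_nonneg) simp_all
    ultimately show ?thesis by (simp only: zero_le_power zero_le_numeral) simp
  qed
  also have "2 * (2 ^ n / 3 * dot n \<theta> \<theta>) + 2 * (\<theta> n)\<^sup>2 / 3 * 2 ^ n = 2 ^ Suc n / 3 * dot (Suc n) \<theta> \<theta>"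
    by (simp add: dot_def power2_eq_square algebra_simps)
  finally show ?case .
qed

lemma convex_cube: "convex (cube n R \<inter> Rn n)"
proof (rule convexI)
  fix x y :: vec and u v :: real
  assume x: "x \<in> cube n R \<inter> Rn n" and y: "y \<in> cube n R \<inter> Rn n" and uv: "0 \<le> u" "0 \<le> v" "u + v = 1"
  have "\<bar>u * x i + v * y i\<bar> \<le> R" if "i < n" for i
  proof -
    have "\<bar>u * x i + v * y i\<bar> \<le> u * \<bar>x i\<bar> + v * \<bar>y i\<bar>"
      using uv by (intro order_trans[OF abs_triangle_ineq]) (simp add: abs_mult)
    also have "... \<le> u * R + v * R" using x y uv that by (intro add_mono mult_left_mono) (auto simp: cube_def)
    also have "... = R" using uv by (simp add: distrib_right[symmetric])
    finally show ?thesis .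
  qed
  then have "u *\<^sub>R x + v *\<^sub>R y \<in> cube n R" by (auto simp: cube_def scaleR_fun_def)
  then show "u *\<^sub>R x + v *\<^sub>R y \<in> cube n R \<inter> Rn n"
    using x y by (auto intro!: Rn_add Rn_scaleR)
qed

text \<open>
  The cube is the witness. The bound makes \<open>200 * L\<close> at least \<open>1\<close>, so
  that its powers grow with the exponent.
\<close>

lemma max_isotropy_ge: "ereal (1 / sqrt 12) \<le> max_isotropy k"
proof (cases "k = 0")
  case False
  let ?M = "cube k 1 \<inter> Rn k"
  have [measurable]: "?M \<in> sets borel" by measurable
  have ind: "f x * indicator ?M x = f x * indicator (cube k 1) x" if "x \<in> Rn k" for f :: "vec \<Rightarrow> ennreal" and x
    using that by (simp add: indicator_def)
  have em: "emeasure (leb k) ?M = ennreal (2 ^ k)"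
  proof -
    have "emeasure (leb k) ?M = lint k (\<lambda>x. 1 * indicator ?M x)" by simp
    also have "... = lint k (\<lambda>x. 1 * indicator (cube k 1) x)" by (rule nn_integral_Rn_cong) (rule ind)
    finally show ?thesis by (simp add: emeasure_cube)
  qed
  have "sqrt ((2 ^ k / 3) / (2 ^ k) powr (1 + 2 / real k)) \<le> isotropy_constant k ?M"
  proof (rule isotropy_constant_ge[OF _ _ _ _ _ _ em])
    fix A assume A: "linear_Rn k A" "A \<in> borel_maps"
    have "lint k (\<lambda>x. ennreal (dot k (A x) (A x)) * indicator ?M x) = lint k (\<lambda>x. ennreal (dot k (A x) (A x)) * indicator (cube k 1) x)"
      by (rule nn_integral_Rn_cong) (rule ind)
    also have "... = ennreal (2 ^ k / 3 * frob k A)"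
      by (rule nn_integral_quadratic[OF A(1)]) (auto simp: cube_second_moment)
    finally show "ennreal (2 ^ k / 3 * frob k A) \<le> lint k (\<lambda>x. ennreal (dot k (A x) (A x)) * indicator ?M x)" by simp
  qed (use False in \<open>auto simp: cube_def Rn_iff\<close>)
  moreover have "sqrt ((2 ^ k / 3) / (2 ^ k) powr (1 + 2 / real k)) = 1 / sqrt 12"
  proof -
    have "((2::real) ^ k) powr (1 + 2 / real k) = 2 ^ k * 4"
    proof -
      have "((2::real) ^ k) powr (2 / real k) = 2 powr (real k * (2 / real k))"
        using powr_realpow[of 2 k] powr_powr[of 2 "real k" "2 / real k"] by simp
      also have "real k * (2 / real k) = real 2" using False by simp
      also have "(2::real) powr (real 2) = 2\<^sup>2" by (rule powr_realpow) simp
      finally show ?thesis by (simp add: powr_add)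
    qed
    then show ?thesis by (simp add: real_sqrt_divide)
  qed
  moreover have "convex_body k ?M"
    unfolding convex_body_iff
    by (intro conjI convex_cube compact_cube bexI[of _ 0] exI[of _ 1])
       (auto simp: Rn_zero cube_def less_imp_le)
  then have "ereal (isotropy_constant k ?M) \<le> max_isotropy k"
    using False by (auto simp: max_isotropy_def intro!: SUP_upper)
  ultimately show ?thesis by (metis ereal_less_eq(3) order_trans)
qed (simp add: max_isotropy_def)

section \<open>Comparing a section with the volume\<close>

context sym_body
begin

definition nz :: "vec \<Rightarrow> bool" where
  "nz x \<longleftrightarrow> x \<in> Rn k \<and> (\<exists>i<k. x i \<noteq> 0)"

lemma nz_scaleR: "nz x \<Longrightarrow> c > 0 \<Longrightarrow> nz (c *\<^sub>R x)"
  by (auto simp: nz_def scaleR_fun_def Rn_iff)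

lemma AE_nz: "AE x in leb k. nz x"
proof -
  define Z where "Z = {x :: nat \<Rightarrow> real. \<forall>i<k. x i = 0}"
  have Zm [measurable]: "Z \<in> sets borel"
  proof -
    have "{x \<in> space borel. \<forall>i<k. (x :: nat \<Rightarrow> real) i = 0} \<in> sets borel" by measurable
    then show ?thesis by (simp add: Z_def)
  qed
  have "emeasure (leb k) Z \<le> 0"
  proof (rule ennreal_le_epsilon)
    fix e :: real assume e: "0 < e"
    define r where "r = min e 1"
    have r: "0 < r" "r \<le> 1" "r \<le> e" using e by (auto simp: r_def)
    have "emeasure (leb k) Z \<le> emeasure (leb k) (cube k (r / 2))"
      using r by (intro emeasure_mono) (auto simp: Z_def cube_def)
    also have "... = ennreal (r ^ k)" using r by (subst emeasure_cube) auto
    also have "... \<le> ennreal e"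
    proof (rule ennreal_leI)
      have "r ^ k \<le> r ^ 1" using r k by (intro power_decreasing) auto
      then show "r ^ k \<le> e" using r by simp
    qed
    finally show "emeasure (leb k) Z \<le> 0 + ennreal e" by simp
  qed
  then have "AE x in leb k. x \<notin> Z" by (intro AE_not_in null_setsI) auto
  with AE_Rn show ?thesis by eventually_elim (auto simp: nz_def Z_def)
qed

lemma radial_positive_finite:
  assumes "nz x"
  obtains a where "a > 0" "radial q x = ennreal a"
proof -
  obtain i where i: "i < k" "x i \<noteq> 0" and x: "x \<in> Rn k" using assms by (auto simp: nz_def)
  define \<epsilon> where "\<epsilon> = (\<Sum>i<k. \<bar>x i\<bar>)"
  have xe: "\<bar>x j\<bar> \<le> \<epsilon>" if "j < k" for j unfolding \<epsilon>_def by (rule member_le_sum) (use that in auto)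
  have e: "\<epsilon> > 0" using xe[OF i(1)] i(2) by linarith
  have "0 < (2 * \<delta>) ^ d * ((\<delta> / \<epsilon>) ^ (q + 1) / real (q + 1))" using delta e by simp
  then have "0 < ennreal ((2 * \<delta>) ^ d * ((\<delta> / \<epsilon>) ^ (q + 1) / real (q + 1)))" by simp
  also have "... \<le> radial q x" by (rule radial_lower[OF x _ e]) (auto simp: cube_def xe)
  finally have "0 < radial q x" .
  moreover have "radial q x < \<infinity>" using radial_upper[of i x q, OF i] by (simp add: less_top[symmetric] top_unique) (metis ennreal_neq_top neq_top_trans)
  ultimately show ?thesis using that by (cases "radial q x") auto
qed

definition rho :: "vec \<Rightarrow> real" where
  "rho x = enn2real (radial (k + 1) x) powr (1 / real (k + 2))"

lemma rho_measurable [measurable]: "rho \<in> borel_maps"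
  unfolding rho_def by measurable

lemma rho:
  assumes "nz x"
  shows "rho x > 0" "radial (k + 1) x = ennreal (rho x ^ (k + 2))"
proof -
  obtain a where a: "a > 0" "radial (k + 1) x = ennreal a" by (rule radial_positive_finite[OF assms])
  have r: "rho x = a powr (1 / real (k + 2))" using a by (simp add: rho_def)
  show "rho x > 0" using a r by simp
  have "rho x ^ (k + 2) = rho x powr real (k + 2)" using \<open>rho x > 0\<close> by (rule powr_realpow[symmetric])
  also have "... = a" unfolding r using a by (simp add: powr_powr)
  finally show "radial (k + 1) x = ennreal (rho x ^ (k + 2))" using a by simp
qed

lemma rho_scaleR:
  assumes x: "nz x" and c: "c > 0"
  shows "rho (c *\<^sub>R x) = rho x / c"
proof -
  have cx: "nz (c *\<^sub>R x)" by (rule nz_scaleR[OF x c])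
  have "ennreal (c ^ (k + 2)) * ennreal (rho (c *\<^sub>R x) ^ (k + 2)) = ennreal (rho x ^ (k + 2))"
    using radial_scaleR[OF c, of "k + 1" x] unfolding rho(2)[OF x] rho(2)[OF cx] by (simp only: add.assoc one_add_one)
  then have "ennreal ((c * rho (c *\<^sub>R x)) ^ (k + 2)) = ennreal (rho x ^ (k + 2))"
    unfolding power_mult_distrib using c rho(1)[OF cx] by (subst ennreal_mult') simp_all
  then have "(c * rho (c *\<^sub>R x)) ^ (k + 2) = rho x ^ (k + 2)"
    using c rho(1)[OF x] rho(1)[OF cx] by (simp only: ennreal_inj zero_le_power less_imp_le mult_nonneg_nonneg)
  then have "c * rho (c *\<^sub>R x) = rho x"
    by (rule power_eq_imp_eq_base) (use c rho(1)[OF x] rho(1)[OF cx] in auto)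
  then show ?thesis using c by (simp add: field_simps)
qed

lemma ball_body_iff_rho:
  assumes x: "nz x"
  shows "x \<in> ball_body \<longleftrightarrow> 1 \<le> rho x"
proof -
  have "x \<in> ball_body \<longleftrightarrow> ennreal 1 \<le> ennreal (rho x ^ (k + 2))"
    using x unfolding ball_body_def nz_def rho(2)[OF x, symmetric] by simp
  also have "... \<longleftrightarrow> 1 ^ (k + 2) \<le> rho x ^ (k + 2)"
    using rho(1)[OF x] by (subst ennreal_le_iff) auto
  also have "... \<longleftrightarrow> 1 \<le> rho x"
    using rho(1)[OF x] by (subst power_mono_iff) auto
  finally show ?thesis .
qed

definition shell :: "vec \<Rightarrow> ennreal" where
  "shell x = indicator {1..exp 1} (rho x)"

lemma shell_measurable [measurable]: "shell \<in> borel_maps"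
  unfolding shell_def by measurable

lemma nn_integral_shell:
  assumes y: "nz y"
  shows "(lint1 (\<lambda>r. indicator {0<..} r * (ennreal (1 / r) * shell ((1 / r) *\<^sub>R y)))) = 1"
proof -
  have rp: "rho y > 0" by (rule rho(1)[OF y])
  have "(lint1 (\<lambda>r. indicator {0<..} r * (ennreal (1 / r) * shell ((1 / r) *\<^sub>R y)))) =
    (lint1 (\<lambda>r. ennreal (1 / r) * indicator {1 / rho y..exp 1 / rho y} r))"
  proof (rule nn_integral_cong)
    fix r :: real
    show "indicator {0<..} r * (ennreal (1 / r) * shell ((1 / r) *\<^sub>R y)) = ennreal (1 / r) * indicator {1 / rho y..exp 1 / rho y} r"
    proof (cases "r > 0")
      case True
      then have "rho ((1 / r) *\<^sub>R y) = rho y * r" using rho_scaleR[OF y, of "1 / r"] by simp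
      then show ?thesis using True rp by (simp add: shell_def indicator_def divide_le_eq le_divide_eq mult.commute)
    next
      case False
      then have "\<not> 1 / rho y \<le> r" using rp by (metis le_less_trans not_le zero_less_divide_1_iff)
      then show ?thesis using False by simp
    qed
  qed
  also have "... = ennreal (ln (exp 1 / rho y) - ln (1 / rho y))"
  proof (rule nn_integral_FTC_Icc[where F = ln])
    have r0: "r > 0" if "r \<in> {1 / rho y..exp 1 / rho y}" for r :: real
    proof -
      have "0 < 1 / rho y" using rp by simp
      also have "1 / rho y \<le> r" using that by simp
      finally show ?thesis .
    qed
    show "(ln has_real_derivative 1 / r) (at r)" if "r \<in> {1 / rho y..exp 1 / rho y}" for r :: real
      using r0[OF that] by (auto intro!: derivative_eq_intros)
    show "0 \<le> 1 / r" if "r \<in> {1 / rho y..exp 1 / rho y}" for r :: real using r0[OF that] by simp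
  qed (use rp in \<open>auto simp: divide_right_mono\<close>)
  also have "ln (exp 1 / rho y) - ln (1 / rho y) = 1" using rp by (simp add: ln_div)
  finally show ?thesis by simp
qed

text \<open>
  Integration in polar coordinates, with the sphere replaced by the shell
  \<open>1 \<le> rho \<le> e\<close>: every ray spends the measure \<open>dr / r\<close> of exactly one in it, up to scaling.
\<close>

lemma polar_integration:
  fixes P G :: "vec \<Rightarrow> ennreal"
  assumes Pm [measurable]: "P \<in> borel_maps" and Gm [measurable]: "G \<in> borel_maps"
    and hom: "\<And>r (f :: vec \<Rightarrow> ennreal). r > 0 \<Longrightarrow> f \<in> borel_maps \<Longrightarrow>
      ennreal (r ^ Suc s) * lint k (\<lambda>x. f (r *\<^sub>R x) * G x) = lint k (\<lambda>x. f x * G x)"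
  shows "lint k (\<lambda>x. G x * shell x * (lint1 (\<lambda>r. indicator {0<..} r * (ennreal (r ^ s) * P (r *\<^sub>R x))))) =
    lint k (\<lambda>x. G x * P x)"
proof -
  define h where "h x r = G x * shell x * (indicator {0<..} r * (ennreal (r ^ s) * P (r *\<^sub>R x)))" for x and r :: real
  define g where "g x r = G x * P x * (indicator {0<..} r * (ennreal (1 / r) * shell ((1 / r) *\<^sub>R x)))" for x and r :: real
  have hm [measurable]: "case_prod h \<in> borel_measurable (leb k \<Otimes>\<^sub>M lborel)"
    unfolding h_def by measurable
  have gm [measurable]: "case_prod g \<in> borel_measurable (leb k \<Otimes>\<^sub>M lborel)"
    unfolding g_def by measurable
  have slice: "lint k (\<lambda>x. h x r) = lint k (\<lambda>x. g x r)" for r :: real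
  proof (cases "r > 0")
    case r: True
    define f where "f y = shell ((1 / r) *\<^sub>R y) * P y" for y
    have fm [measurable]: "f \<in> borel_maps" unfolding f_def by measurable
    have "lint k (\<lambda>x. h x r) = lint k (\<lambda>x. ennreal (r ^ s) * (f (r *\<^sub>R x) * G x))"
      unfolding h_def f_def using r by (intro nn_integral_cong) (simp add: mult_ac)
    also have "... = ennreal (r ^ s) * lint k (\<lambda>x. f (r *\<^sub>R x) * G x)"
      by (rule nn_integral_cmult) measurable
    also have "ennreal (r ^ s) = ennreal (1 / r) * ennreal (r ^ Suc s)"
      using r by (subst ennreal_mult'[symmetric]) auto
    also have "ennreal (1 / r) * ennreal (r ^ Suc s) * lint k (\<lambda>x. f (r *\<^sub>R x) * G x) =
      ennreal (1 / r) * lint k (\<lambda>x. f x * G x)"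
      by (simp only: mult.assoc hom[OF r fm])
    also have "... = lint k (\<lambda>x. ennreal (1 / r) * (f x * G x))"
      by (rule nn_integral_cmult[symmetric]) measurable
    also have "... = lint k (\<lambda>x. g x r)"
      unfolding g_def f_def using r by (intro nn_integral_cong) (simp add: mult_ac)
    finally show ?thesis .
  qed (simp add: h_def g_def)
  have "lint k (\<lambda>x. G x * shell x * (lint1 (\<lambda>r. indicator {0<..} r * (ennreal (r ^ s) * P (r *\<^sub>R x))))) =
    lint k (\<lambda>x. lint1 (\<lambda>r. h x r))"
    unfolding h_def by (intro nn_integral_cong nn_integral_cmult[symmetric]) (unfold measurable_lborel2, measurable)
  also have "... = (\<integral>\<^sup>+r. \<integral>\<^sup>+x. h x r \<partial>leb k \<partial>lborel)"
    by (rule Rnborel.Fubini'[OF hm, symmetric])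
  also have "... = (\<integral>\<^sup>+r. \<integral>\<^sup>+x. g x r \<partial>leb k \<partial>lborel)"
    by (simp only: slice)
  also have "... = lint k (\<lambda>x. lint1 (\<lambda>r. g x r))"
    by (rule Rnborel.Fubini'[OF gm])
  also have "... = lint k (\<lambda>x. G x * P x)"
  proof (rule nn_integral_cong_AE, rule eventually_mono[OF AE_nz])
    fix x assume x: "nz x"
    have "(lint1 (\<lambda>r. g x r)) = G x * P x * (lint1 (\<lambda>r. indicator {0<..} r * (ennreal (1 / r) * shell ((1 / r) *\<^sub>R x))))"
      unfolding g_def by (rule nn_integral_cmult) (unfold measurable_lborel2, measurable)
    then show "(lint1 (\<lambda>r. g x r)) = G x * P x" by (simp add: nn_integral_shell[OF x])
  qed
  finally show ?thesis .
qed

lemma nn_integral_ray_ball_body: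
  assumes x: "nz x"
  shows "(lint1 (\<lambda>r. indicator {0<..} r * (ennreal (r ^ s) * indicator ball_body (r *\<^sub>R x)))) =
    ennreal (rho x ^ (s + 1) / real (s + 1))"
proof -
  have "(lint1 (\<lambda>r. indicator {0<..} r * (ennreal (r ^ s) * indicator ball_body (r *\<^sub>R x)))) =
    (lint1 (\<lambda>r. indicator {0<..} r * (ennreal (r ^ s) * indicator {0..rho x} r)))"
  proof (rule nn_integral_cong)
    fix r :: real
    show "indicator {0<..} r * (ennreal (r ^ s) * indicator ball_body (r *\<^sub>R x)) = indicator {0<..} r * (ennreal (r ^ s) * indicator {0..rho x} r)"
    proof (cases "r > 0")
      case True
      have "r *\<^sub>R x \<in> ball_body \<longleftrightarrow> r \<le> rho x"
        unfolding ball_body_iff_rho[OF nz_scaleR[OF x True]] rho_scaleR[OF x True] using True by (simp add: le_divide_eq)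
      then show ?thesis using True by (simp add: indicator_def)
    qed simp
  qed
  also have "... = ennreal (rho x ^ (s + 1) / real (s + 1))"
    by (rule nn_integral_power_Icc) (use rho(1)[OF x] in simp)
  finally show ?thesis .
qed

lemma radial_sec: "radial q x = (lint1 (\<lambda>r. indicator {0<..} r * (ennreal (r ^ q) * sec (r *\<^sub>R x))))"
  unfolding radial_def sec_eq ..

lemma ball_body_borel [measurable]: "ball_body \<in> sets borel"
  by (rule convex_body_borel[OF convex_body_ball_body])

text \<open>
  On every ray both integrals are multiples of \<open>radial (k + 1)\<close>; polar integration
  then gives the same proportion for the whole space.
\<close>

lemma ball_body_moment:
  assumes A: "linear_Rn k A" and [measurable]: "A \<in> borel_maps"
  shows "lint k (\<lambda>x. ennreal (dot k (A x) (A x)) * indicator ball_body x) =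
    ennreal (1 / real (k + 2)) * lint k (\<lambda>x. ennreal (dot k (A x) (A x)) * sec x)"
proof -
  define G :: "vec \<Rightarrow> ennreal" where "G x = ennreal (dot k (A x) (A x))" for x
  have Gm [measurable]: "G \<in> borel_maps" unfolding G_def by measurable
  have hom: "ennreal (r ^ Suc (k + 1)) * lint k (\<lambda>x. f (r *\<^sub>R x) * G x) = lint k (\<lambda>x. f x * G x)"
    if r: "r > 0" and fm [measurable]: "f \<in> borel_maps" for r :: real and f :: "vec \<Rightarrow> ennreal"
  proof -
    have "ennreal (r ^ Suc (k + 1)) * lint k (\<lambda>x. f (r *\<^sub>R x) * G x) =
      ennreal (r ^ k) * (ennreal (r\<^sup>2) * lint k (\<lambda>x. f (r *\<^sub>R x) * G x))"
    proof -
      have "ennreal (r ^ Suc (k + 1)) = ennreal (r ^ k) * ennreal (r\<^sup>2)"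
        using r by (subst ennreal_mult'[symmetric]) (simp_all add: power2_eq_square mult_ac)
      then show ?thesis by (simp only: mult.assoc)
    qed
    also have "ennreal (r\<^sup>2) * lint k (\<lambda>x. f (r *\<^sub>R x) * G x) = lint k (\<lambda>x. ennreal (r\<^sup>2) * (f (r *\<^sub>R x) * G x))"
      by (rule nn_integral_cmult[symmetric]) measurable
    also have "... = lint k (\<lambda>x. f (r *\<^sub>R x) * G (r *\<^sub>R x))"
    proof (rule nn_integral_Rn_cong)
      fix x :: vec assume x: "x \<in> Rn k"
      have "G (r *\<^sub>R x) = ennreal (r\<^sup>2) * G x"
        unfolding G_def linear_Rn_scaleR[OF A x] dot_simps
        by (subst ennreal_mult'[symmetric]) (auto simp: power2_eq_square mult.assoc)
      then show "ennreal (r\<^sup>2) * (f (r *\<^sub>R x) * G x) = f (r *\<^sub>R x) * G (r *\<^sub>R x)" by (simp add: mult_ac)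
    qed
    also have "ennreal (r ^ k) * ... = lint k (\<lambda>x. f x * G x)"
      by (rule nn_integral_Rn_scaleR[of "\<lambda>x. f x * G x", OF _ r]) measurable
    finally show ?thesis .
  qed
  have "lint k (\<lambda>x. G x * indicator ball_body x) =
    lint k (\<lambda>x. G x * shell x * (lint1 (\<lambda>r. indicator {0<..} r * (ennreal (r ^ (k + 1)) * indicator ball_body (r *\<^sub>R x)))))"
    by (rule polar_integration[symmetric, OF _ Gm hom]) measurable
  also have "... = lint k (\<lambda>x. ennreal (1 / real (k + 2)) * (G x * shell x * radial (k + 1) x))"
  proof (rule nn_integral_cong_AE, rule eventually_mono[OF AE_nz])
    fix x assume x: "nz x"
    have "ennreal (rho x ^ (k + 1 + 1) / real (k + 1 + 1)) = ennreal (1 / real (k + 2)) * radial (k + 1) x"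
      unfolding rho(2)[OF x] by (subst ennreal_mult'[symmetric]) auto
    then show "G x * shell x * (lint1 (\<lambda>r. indicator {0<..} r * (ennreal (r ^ (k + 1)) * indicator ball_body (r *\<^sub>R x)))) =
      ennreal (1 / real (k + 2)) * (G x * shell x * radial (k + 1) x)"
      unfolding nn_integral_ray_ball_body[OF x] by (simp only: mult_ac)
  qed
  also have "... = ennreal (1 / real (k + 2)) * lint k (\<lambda>x. G x * shell x * radial (k + 1) x)"
    by (rule nn_integral_cmult) measurable
  also have "lint k (\<lambda>x. G x * shell x * radial (k + 1) x) = lint k (\<lambda>x. G x * sec x)"
    unfolding radial_sec by (rule polar_integration[OF _ Gm hom]) measurable
  finally show ?thesis unfolding G_def .
qed

lemma p_ray_antimono:
  assumes x: "x \<in> Rn k" and r: "0 < r" "r \<le> s"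
  shows "p (s *\<^sub>R x) \<le> p (r *\<^sub>R x)"
proof (cases "r = s \<or> p (s *\<^sub>R x) = 0")
  case False
  have sx: "s *\<^sub>R x \<in> Rn k" using x by (rule Rn_scaleR)
  have ps: "p (s *\<^sub>R x) > 0" using False p_nonneg[of "s *\<^sub>R x"] by linarith
  have t: "0 < r / s" "r / s < 1" using r False by auto
  have "p (s *\<^sub>R x) = p (s *\<^sub>R x) powr (r / s) * p (s *\<^sub>R x) powr (1 - r / s)"
    using ps by (simp add: powr_add[symmetric])
  also have "... \<le> p (s *\<^sub>R x) powr (r / s) * p 0 powr (1 - r / s)"
    using t ps p_le_p0[OF sx] by (intro mult_left_mono powr_mono2) auto
  also have "... \<le> p ((r / s) *\<^sub>R s *\<^sub>R x + (1 - r / s) *\<^sub>R 0)"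
    by (rule p_log_concave[OF sx Rn_zero t])
  also have "(r / s) *\<^sub>R s *\<^sub>R x + (1 - r / s) *\<^sub>R 0 = r *\<^sub>R x" using r by simp
  finally show ?thesis .
qed (auto simp: p_nonneg)

lemma p_ray_decay:
  assumes x: "x \<in> Rn k" and r: "0 < s" "s \<le> r" and q: "0 < q" "p (s *\<^sub>R x) \<le> q * p 0"
  shows "p (r *\<^sub>R x) \<le> q powr (r / s) * p 0"
proof (cases "r = s \<or> p (r *\<^sub>R x) = 0")
  case False
  have rx: "r *\<^sub>R x \<in> Rn k" using x by (rule Rn_scaleR)
  have pr: "p (r *\<^sub>R x) > 0" using False p_nonneg[of "r *\<^sub>R x"] by linarith
  have t: "0 < s / r" "s / r < 1" using r False by auto
  have "p (r *\<^sub>R x) powr (s / r) * p 0 powr (1 - s / r) \<le> p ((s / r) *\<^sub>R r *\<^sub>R x + (1 - s / r) *\<^sub>R 0)"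
    by (rule p_log_concave[OF rx Rn_zero t])
  also have "(s / r) *\<^sub>R r *\<^sub>R x + (1 - s / r) *\<^sub>R 0 = s *\<^sub>R x" using r by simp
  also have "p (s *\<^sub>R x) \<le> q * p 0" by (rule q)
  finally have 1: "p (r *\<^sub>R x) powr (s / r) * p 0 powr (1 - s / r) \<le> q * p 0" .
  have 2: "p 0 = p 0 powr (s / r) * p 0 powr (1 - s / r)" using p0_pos by (simp add: powr_add[symmetric])
  have "p (r *\<^sub>R x) powr (s / r) * p 0 powr (1 - s / r) \<le> (q * p 0 powr (s / r)) * p 0 powr (1 - s / r)"
    using 1 2 by (simp add: mult.assoc)
  then have "p (r *\<^sub>R x) powr (s / r) \<le> q * p 0 powr (s / r)" using p0_pos by (simp add: mult_le_cancel_right)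
  then have "(p (r *\<^sub>R x) powr (s / r)) powr (r / s) \<le> (q * p 0 powr (s / r)) powr (r / s)"
    using r by (intro powr_mono2) auto
  then show ?thesis using r q p0_pos pr by (simp add: powr_powr powr_mult)
qed (use q p0_pos r in \<open>auto simp: powr_one\<close>)

end

context sym_body
begin

lemma nn_integral_exp_tail:
  fixes s c :: real
  assumes s: "s > 0" and c: "c > 0"
  shows "(lint1 (\<lambda>r. ennreal (exp (- c * (r / s - 1))) * indicator {s..} r)) = ennreal (s / c)"
proof -
  have "((\<lambda>r. - (s / c) * exp (- c * (r / s - 1))) \<longlongrightarrow> - (s / c) * 0) at_top"
  proof (intro tendsto_mult tendsto_const filterlim_compose[OF exp_at_bot])
    have "filterlim (\<lambda>r. - c + (c / s) * r) at_top at_top"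
      using s c by (intro filterlim_tendsto_add_at_top[OF tendsto_const] filterlim_tendsto_pos_mult_at_top[OF tendsto_const _ filterlim_ident]) auto
    then show "filterlim (\<lambda>r. - c * (r / s - 1)) at_bot at_top"
      by (simp add: filterlim_uminus_at_bot algebra_simps)
  qed
  then have lim: "((\<lambda>r. - (s / c) * exp (- c * (r / s - 1))) \<longlongrightarrow> 0) at_top" by simp
  have "(lint1 (\<lambda>r. ennreal (exp (- c * (r / s - 1))) * indicator {s..} r)) =
    ennreal (0 - (- (s / c) * exp (- c * (s / s - 1))))"
  proof (rule nn_integral_FTC_atLeast[OF _ _ _ lim])
    show "((\<lambda>r. - (s / c) * exp (- c * (r / s - 1))) has_real_derivative exp (- c * (x / s - 1))) (at x)" for x
      using s c by (auto intro!: derivative_eq_intros)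
  qed auto
  then show ?thesis using s by simp
qed

text \<open>
  Rays carry almost all of their mass at bounded multiples of one scale \<open>T\<close>, by which all
  moments along a ray are comparable (a Berwald type inequality, with an inessential constant).
\<close>

lemma radial_berwald:
  assumes x: "nz x" and I: "radial (k - 1) x = ennreal I" "I > 0" and T: "T > 0" "p 0 * T ^ k = I"
  shows "rho x ^ (k + 2) \<le> 2 * exp 8 * p 0 * T ^ (k + 2)"
proof -
  have xR: "x \<in> Rn k" using x by (simp add: nz_def)
  have k0: "real k > 0" "real k \<ge> 1" using k by auto
  \<comment> \<open>Beyond \<open>s\<close> the decay of \<open>p\<close> along the ray absorbs the growth of the power of \<open>r\<close>.\<close>
  define s where "s = exp 4 * T"
  define q where "q = real k * exp (- 4 * real k)"
  have s: "s > 0" and q: "q > 0" using T k0 by (auto simp: s_def q_def)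
  have sk: "s ^ j = exp (4 * real j) * T ^ j" for j
    by (simp add: s_def power_mult_distrib exp_of_nat_mult[symmetric] mult.commute)
  have pq: "p (s *\<^sub>R x) \<le> q * p 0"
  proof -
    have "ennreal (s ^ (k - 1 + 1) / real (k - 1 + 1)) * ennreal (p (s *\<^sub>R x)) =
      (lint1 (\<lambda>r. (indicator {0<..} r * (ennreal (r ^ (k - 1)) * indicator {0..s} r)) * ennreal (p (s *\<^sub>R x))))"
      using s by (subst nn_integral_multc) (auto simp: nn_integral_power_Icc)
    also have "... \<le> radial (k - 1) x"
      unfolding radial_def
    proof (rule nn_integral_mono)
      fix r :: real
      show "(indicator {0<..} r * (ennreal (r ^ (k - 1)) * indicator {0..s} r)) * ennreal (p (s *\<^sub>R x)) \<le>
        indicator {0<..} r * (ennreal (r ^ (k - 1)) * ennreal (p (r *\<^sub>R x)))"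
        using p_ray_antimono[OF xR, of r s] by (auto simp: indicator_def intro!: mult_left_mono ennreal_leI)
    qed
    finally have "ennreal (s ^ k / real k * p (s *\<^sub>R x)) \<le> ennreal I"
      unfolding I(1) using k s by (simp add: ennreal_mult'[symmetric])
    then have "s ^ k / real k * p (s *\<^sub>R x) \<le> I" using I(2) by (simp add: ennreal_le_iff)
    then have "s ^ k * p (s *\<^sub>R x) \<le> real k * (p 0 * T ^ k)" using k0 T(2) by (simp add: field_simps)
    then have "(exp (4 * real k) * p (s *\<^sub>R x)) * T ^ k \<le> (real k * p 0) * T ^ k" by (simp add: sk mult_ac)
    then have "exp (4 * real k) * p (s *\<^sub>R x) \<le> real k * p 0" using T(1) by (simp add: mult_le_cancel_right)
    then have "exp (- 4 * real k) * (exp (4 * real k) * p (s *\<^sub>R x)) \<le> exp (- 4 * real k) * (real k * p 0)"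
      by (rule mult_left_mono) simp
    moreover have "exp (- 4 * real k) * (exp (4 * real k) * z) = z" for z :: real
    proof -
      have "exp (- 4 * real k) * exp (4 * real k) = 1" by (simp add: exp_add[symmetric])
      then show ?thesis by (simp only: mult.assoc[symmetric] mult_1)
    qed
    ultimately show ?thesis unfolding q_def by (simp only: mult_ac)
  qed
  have q3: "q \<le> exp (- 3 * real k)"
  proof -
    have "real k \<le> exp (real k)" using exp_ge_add_one_self[of "real k"] by linarith
    then have "q \<le> exp (real k) * exp (- 4 * real k)" unfolding q_def by (rule mult_right_mono) simp
    then show ?thesis by (simp add: exp_add[symmetric])
  qed
  have tail: "r ^ (k + 1) * p (r *\<^sub>R x) \<le> s ^ (k + 1) * p 0 * q * exp (- real k * (r / s - 1))" if r: "s \<le> r" for r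
  proof -
    define u where "u = r / s"
    have u: "u \<ge> 1" "r = s * u" using r s by (auto simp: u_def)
    have "u ^ (k + 1) \<le> exp (u - 1) ^ (k + 1)"
      using u exp_ge_add_one_self[of "u - 1"] by (intro power_mono) auto
    then have 1: "u ^ (k + 1) \<le> exp (real (k + 1) * (u - 1))" by (simp only: exp_of_nat_mult)
    have "q powr u = q * q powr (u - 1)" using q by (simp add: powr_mult_base)
    moreover have "q powr (u - 1) \<le> exp (- 3 * real k) powr (u - 1)" using q q3 u by (intro powr_mono2) auto
    moreover have "exp (- 3 * real k) powr (u - 1) = exp (- 3 * real k * (u - 1))" by (simp add: powr_def mult.commute)
    ultimately have 2: "q powr u \<le> q * exp (- 3 * real k * (u - 1))" using q by (simp add: mult_left_mono)
    have 3: "p (r *\<^sub>R x) \<le> q powr u * p 0" unfolding u_def by (rule p_ray_decay[OF xR s r q pq])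
    have 4: "p (r *\<^sub>R x) \<le> q * exp (- 3 * real k * (u - 1)) * p 0"
      using 3 mult_right_mono[OF 2, of "p 0"] p0_pos by linarith
    have "u ^ (k + 1) * p (r *\<^sub>R x) \<le> exp (real (k + 1) * (u - 1)) * (q * exp (- 3 * real k * (u - 1)) * p 0)"
      using 1 4 p_nonneg by (intro mult_mono) auto
    also have "... = (p 0 * q) * exp (real (k + 1) * (u - 1) + - 3 * real k * (u - 1))"
      by (simp only: exp_add mult_ac)
    also have "... \<le> (p 0 * q) * exp (- real k * (u - 1))"
    proof -
      have "(real (k + 1) + - 3 * real k) * (u - 1) \<le> (- real k) * (u - 1)"
        using u k0 by (intro mult_right_mono) auto
      then have "real (k + 1) * (u - 1) + - 3 * real k * (u - 1) \<le> - real k * (u - 1)"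
        by (simp only: distrib_right)
      then show ?thesis using p0_pos q by (intro mult_left_mono) auto
    qed
    finally have "u ^ (k + 1) * p (r *\<^sub>R x) \<le> (p 0 * q) * exp (- real k * (u - 1))" .
    then have "s ^ (k + 1) * (u ^ (k + 1) * p (r *\<^sub>R x)) \<le> s ^ (k + 1) * ((p 0 * q) * exp (- real k * (u - 1)))"
      using s by (intro mult_left_mono) auto
    then show ?thesis unfolding u_def[symmetric] using u(2) by (simp only: power_mult_distrib mult_ac)
  qed
  define Z where "Z = s ^ (k + 1) * p 0 * q"
  have Z: "Z \<ge> 0" using s p0_pos q by (simp add: Z_def)
  have "radial (k + 1) x \<le> (lint1 (\<lambda>r. ennreal (s\<^sup>2) * (indicator {0<..} r * (ennreal (r ^ (k - 1)) * ennreal (p (r *\<^sub>R x)))) +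
      ennreal Z * (ennreal (exp (- real k * (r / s - 1))) * indicator {s..} r)))"
    unfolding radial_def
  proof (rule nn_integral_mono)
    fix r :: real
    show "indicator {0<..} r * (ennreal (r ^ (k + 1)) * ennreal (p (r *\<^sub>R x))) \<le>
      ennreal (s\<^sup>2) * (indicator {0<..} r * (ennreal (r ^ (k - 1)) * ennreal (p (r *\<^sub>R x)))) +
      ennreal Z * (ennreal (exp (- real k * (r / s - 1))) * indicator {s..} r)"
    proof (cases "0 < r")
      case r: True
      show ?thesis
      proof (cases "s \<le> r")
        case True
        have "ennreal (r ^ (k + 1)) * ennreal (p (r *\<^sub>R x)) = ennreal (r ^ (k + 1) * p (r *\<^sub>R x))"
          using r by (simp add: ennreal_mult')
        also have "... \<le> ennreal (Z * exp (- real k * (r / s - 1)))"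
          unfolding Z_def by (rule ennreal_leI[OF tail[OF True]])
        also have "... = ennreal Z * ennreal (exp (- real k * (r / s - 1)))" by (rule ennreal_mult'[OF Z])
        finally show ?thesis using r True by (simp add: add_increasing)
      next
        case False
        have "r ^ (k + 1) = r\<^sup>2 * r ^ (k - 1)" using k by (simp add: power_add[symmetric])
        also have "... \<le> s\<^sup>2 * r ^ (k - 1)" using r False by (intro mult_right_mono power_mono) auto
        finally have "ennreal (r ^ (k + 1)) \<le> ennreal (s\<^sup>2) * ennreal (r ^ (k - 1))"
          by (subst ennreal_mult'[symmetric]) (auto intro: ennreal_leI)
        then have "ennreal (r ^ (k + 1)) * ennreal (p (r *\<^sub>R x)) \<le> ennreal (s\<^sup>2) * ennreal (r ^ (k - 1)) * ennreal (p (r *\<^sub>R x))"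
          by (rule mult_right_mono) simp
        then show ?thesis using r False by (simp add: mult.assoc)
      qed
    qed (use s in simp)
  qed
  also have "... = ennreal (s\<^sup>2) * radial (k - 1) x + ennreal Z * ennreal (s / real k)"
    unfolding radial_def nn_integral_exp_tail[OF s k0(1), symmetric]
    by (subst nn_integral_add, (unfold measurable_lborel2, measurable)[2], subst (1 2) nn_integral_cmult, (unfold measurable_lborel2, measurable)[2]) simp
  also have "... = ennreal (s\<^sup>2 * I + Z * (s / real k))"
  proof -
    have "ennreal (s\<^sup>2) * ennreal I = ennreal (s\<^sup>2 * I)" by (rule ennreal_mult'[symmetric]) simp
    moreover have "ennreal Z * ennreal (s / real k) = ennreal (Z * (s / real k))" by (rule ennreal_mult'[OF Z, symmetric])
    moreover have "0 \<le> s\<^sup>2 * I" "0 \<le> Z * (s / real k)" using I(2) Z s by auto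
    ultimately show ?thesis unfolding I(1) by (simp only: ennreal_plus)
  qed
  finally have "ennreal (rho x ^ (k + 2)) \<le> ennreal (s\<^sup>2 * I + Z * (s / real k))" unfolding rho(2)[OF x] .
  moreover have "0 \<le> s\<^sup>2 * I + Z * (s / real k)" using I Z s by simp
  ultimately have "rho x ^ (k + 2) \<le> s\<^sup>2 * I + Z * (s / real k)" by (simp only: ennreal_le_iff)
  moreover have "s\<^sup>2 * I = exp 8 * p 0 * T ^ (k + 2)"
  proof -
    have "s\<^sup>2 = exp 8 * T\<^sup>2" using sk[of 2] by simp
    then show ?thesis unfolding T(2)[symmetric] by (simp only: power_add mult_ac)
  qed
  moreover have "Z * (s / real k) = exp 8 * p 0 * T ^ (k + 2)"
  proof -
    have "Z * (s / real k) = s ^ (k + 2) * p 0 * exp (- 4 * real k)" using k0 by (simp add: Z_def q_def)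
    also have "... = (exp (4 * real (k + 2)) * exp (- 4 * real k)) * p 0 * T ^ (k + 2)" unfolding sk by (simp only: mult_ac)
    also have "exp (4 * real (k + 2)) * exp (- 4 * real k) = exp 8" by (simp add: exp_add[symmetric])
    finally show ?thesis .
  qed
  ultimately show ?thesis by linarith
qed

text \<open>
  The constant in the comparison of the volumes of the body of Ball and of \<open>K\<close>: by
  \<open>radial_berwald\<close>, \<open>rho x ^ k\<close> is at most this multiple of
  \<open>radial (k - 1) x\<close>.
\<close>

definition berwald_bound :: real where
  "berwald_bound = (2 * exp 8 * p 0) powr (real k / real (k + 2)) / p 0"

lemma rho_le_radial:
  assumes x: "nz x"
  shows "ennreal (rho x ^ k) \<le> ennreal berwald_bound * radial (k - 1) x"
proof -
  obtain I where I: "I > 0" "radial (k - 1) x = ennreal I" by (rule radial_positive_finite[OF x])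
  define T where "T = (I / p 0) powr (1 / real k)"
  define D where "D = 2 * exp 8 * p 0"
  define a where "a = real k / real (k + 2)"
  have k0: "real k > 0" using k by auto
  have D: "D > 0" using p0_pos by (simp add: D_def)
  have T0: "T > 0" using I p0_pos by (simp add: T_def)
  have "T ^ k = T powr real k" using T0 by (rule powr_realpow[symmetric])
  also have "T powr real k = I / p 0" unfolding T_def powr_powr using k0 I p0_pos by simp
  finally have Tk: "T ^ k = I / p 0" .
  have a: "a > 0" "real (k + 2) * a = real k" using k0 by (auto simp: a_def)
  have ka: "(y ^ (k + 2)) powr a = y ^ k" if "y > 0" for y :: real
  proof -
    have "(y ^ (k + 2)) powr a = (y powr real (k + 2)) powr a" by (simp only: powr_realpow[OF that])
    also have "(y powr real (k + 2)) powr a = y powr real k" by (simp only: powr_powr a(2))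
    also have "y powr real k = y ^ k" by (rule powr_realpow[OF that])
    finally show ?thesis .
  qed
  have "rho x ^ (k + 2) \<le> D * T ^ (k + 2)"
    unfolding D_def by (rule radial_berwald[OF x I(2,1) T0]) (use Tk p0_pos in simp)
  then have "(rho x ^ (k + 2)) powr a \<le> (D * T ^ (k + 2)) powr a"
    using a rho(1)[OF x] by (intro powr_mono2) auto
  then have "rho x ^ k \<le> D powr a * T ^ k" using D T0 by (simp only: ka[OF rho(1)[OF x]] powr_mult ka[OF T0])
  then have "rho x ^ k \<le> berwald_bound * I" unfolding Tk berwald_bound_def D_def a_def by simp
  then have "ennreal (rho x ^ k) \<le> ennreal (berwald_bound * I)" by (rule ennreal_leI)
  also have "... = ennreal berwald_bound * radial (k - 1) x"
    unfolding I(2) using I(1) by (intro ennreal_mult'') simp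
  finally show ?thesis .
qed

lemma nn_integral_sec: "lint k (\<lambda>x. sec x) = emeasure (leb (k + d)) K"
  unfolding sec_def by (subst nn_integral_Rn_join[symmetric]) (auto simp: nn_integral_indicator)

lemma ball_body_volume:
  "ennreal (real k) * emeasure (leb k) ball_body \<le> ennreal berwald_bound * emeasure (leb (k + d)) K"
proof -
  have hom: "ennreal (r ^ Suc (k - 1)) * lint k (\<lambda>x. f (r *\<^sub>R x) * 1) = lint k (\<lambda>x. f x * 1)"
    if "r > 0" "f \<in> borel_maps" for r :: real and f :: "vec \<Rightarrow> ennreal"
    using nn_integral_Rn_scaleR[OF that(2,1), of k] k by simp
  have "emeasure (leb k) ball_body = lint k (\<lambda>x. 1 * indicator ball_body x)" by simp
  also have "... = lint k (\<lambda>x. 1 * shell x * (lint1 (\<lambda>r. indicator {0<..} r * (ennreal (r ^ (k - 1)) * indicator ball_body (r *\<^sub>R x)))))"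
    by (rule polar_integration[symmetric, OF _ _ hom]) auto
  finally have "ennreal (real k) * emeasure (leb k) ball_body =
    lint k (\<lambda>x. ennreal (real k) * (1 * shell x * (lint1 (\<lambda>r. indicator {0<..} r * (ennreal (r ^ (k - 1)) * indicator ball_body (r *\<^sub>R x))))))"
    by (simp only:) (rule nn_integral_cmult[symmetric], measurable)
  also have "... \<le> lint k (\<lambda>x. ennreal berwald_bound * (1 * shell x * radial (k - 1) x))"
  proof (rule nn_integral_mono_AE, rule eventually_mono[OF AE_nz])
    fix x assume x: "nz x"
    have "ennreal (real k) * ennreal (rho x ^ (k - 1 + 1) / real (k - 1 + 1)) = ennreal (rho x ^ k)"
      using k by (subst ennreal_mult'[symmetric]) auto
    moreover have "shell x * ennreal (rho x ^ k) \<le> shell x * (ennreal berwald_bound * radial (k - 1) x)"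
      by (rule mult_left_mono[OF rho_le_radial[OF x]]) simp
    moreover have "ennreal (real k) * (shell x * z) = shell x * (ennreal (real k) * z)" for z by (simp only: mult_ac)
    moreover have "shell x * (ennreal berwald_bound * z) = ennreal berwald_bound * (shell x * z)" for z by (simp only: mult_ac)
    ultimately show "ennreal (real k) * (1 * shell x * (lint1 (\<lambda>r. indicator {0<..} r * (ennreal (r ^ (k - 1)) * indicator ball_body (r *\<^sub>R x)))))
      \<le> ennreal berwald_bound * (1 * shell x * radial (k - 1) x)"
      unfolding nn_integral_ray_ball_body[OF x] mult_1 by (simp only:)
  qed
  also have "... = ennreal berwald_bound * lint k (\<lambda>x. 1 * shell x * radial (k - 1) x)"
    by (rule nn_integral_cmult) measurable
  also have "lint k (\<lambda>x. 1 * shell x * radial (k - 1) x) = lint k (\<lambda>x. 1 * sec x)"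
    unfolding radial_sec by (rule polar_integration[OF _ _ hom]) auto
  finally show ?thesis by (simp add: nn_integral_sec)
qed

text \<open>
  The body of Ball inherits isotropy from \<open>K\<close>, so its volume alone bounds its isotropy constant
  from below (\<open>isotropy_constant_ge\<close>), and \<open>ball_body_volume\<close> bounds that volume by \<open>p 0\<close> and the volume
  of \<open>K\<close>.
\<close>

lemma central_section_le:
  assumes v: "v > 0" "emeasure (leb (k + d)) K = ennreal v"
    and iso: "\<And>\<theta>. lint (k + d) (\<lambda>x. ennreal ((dot (k + d) \<theta> x)\<^sup>2) * indicator K x) = ennreal (v * dot (k + d) \<theta> \<theta>)"
    and L: "isotropy_constant k ball_body \<le> L"
  shows "p 0 \<le> (200 * L) ^ k * v"
proof -
  have k0: "real k > 0" "real k \<ge> 1" using k by auto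
  obtain R' where R': "R' > 0" "ball_body \<subseteq> cube k R'" by (rule ball_body_bounded)
  obtain \<epsilon> where \<epsilon>: "\<epsilon> > 0" "cube k \<epsilon> \<inter> Rn k \<subseteq> ball_body" by (rule ball_body_cube)
  define m where "m = enn2real (emeasure (leb k) ball_body)"
  have "emeasure (leb k) ball_body \<le> emeasure (leb k) (cube k R')"
    using R'(2) by (intro emeasure_mono) auto
  then have em: "emeasure (leb k) ball_body = ennreal m"
    using R'(1) unfolding m_def by (intro ennreal_enn2real[symmetric]) (simp add: emeasure_cube le_less_trans)
  have "ennreal ((2 * \<epsilon>) ^ k) = emeasure (leb k) (cube k \<epsilon>)" using \<epsilon> by (simp add: emeasure_cube)
  also have "... \<le> emeasure (leb k) ball_body"
    by (rule emeasure_mono_AE, rule eventually_mono[OF AE_Rn]) (use \<epsilon>(2) in auto)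
  finally have "(2 * \<epsilon>) ^ k \<le> m" unfolding em using \<epsilon>(1) by (simp add: m_def ennreal_le_iff)
  then have m: "m > 0" using \<epsilon>(1) by (smt (verit) zero_less_power)
  have isok: "lint k (\<lambda>x. ennreal ((dot k \<theta> x)\<^sup>2) * sec x) = ennreal (v * dot k \<theta> \<theta>)" for \<theta>
  proof -
    have dj: "dot (k + d) (join k \<theta> 0) (join k x z) = dot k \<theta> x" for x z by (simp add: dot_join)
    have "ennreal (v * dot k \<theta> \<theta>) = ennreal (v * dot (k + d) (join k \<theta> 0) (join k \<theta> 0))" by (simp add: dj)
    also have "... = lint (k + d) (\<lambda>x. ennreal ((dot (k + d) (join k \<theta> 0) x)\<^sup>2) * indicator K x)"
      by (rule iso[symmetric])
    also have "... = lint k (\<lambda>x. lint d (\<lambda>z. ennreal ((dot (k + d) (join k \<theta> 0) (join k x z))\<^sup>2) * indicator K (join k x z)))"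
      by (rule nn_integral_Rn_join) measurable
    also have "... = lint k (\<lambda>x. ennreal ((dot k \<theta> x)\<^sup>2) * sec x)"
      unfolding dj sec_def by (intro nn_integral_cong nn_integral_cmult) measurable
    finally show ?thesis by simp
  qed
  define \<kappa> where "\<kappa> = v / real (k + 2)"
  have "sqrt (\<kappa> / m powr (1 + 2 / real k)) \<le> isotropy_constant k ball_body"
  proof (rule isotropy_constant_ge[OF k ball_body_borel _ R'(2) ball_body_uminus m em])
    fix A assume A: "linear_Rn k A" and [measurable]: "A \<in> borel_maps"
    have "lint k (\<lambda>x. ennreal (dot k (A x) (A x)) * indicator ball_body x) = ennreal (1 / real (k + 2)) * ennreal (v * frob k A)"
      unfolding ball_body_moment[OF A \<open>A \<in> borel_maps\<close>]
      using nn_integral_quadratic[OF A sec_measurable less_imp_le[OF v(1)] isok] by simp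
    also have "... = ennreal (\<kappa> * frob k A)"
      unfolding \<kappa>_def by (subst ennreal_mult'[symmetric]) auto
    finally show "ennreal (\<kappa> * frob k A) \<le> lint k (\<lambda>x. ennreal (dot k (A x) (A x)) * indicator ball_body x)" by simp
  qed (use v in \<open>auto simp: \<kappa>_def ball_body_def\<close>)
  then have sL: "sqrt (\<kappa> / m powr (1 + 2 / real k)) \<le> L" using L by linarith
  have mle: "real k * m \<le> berwald_bound * v"
  proof -
    have bb: "berwald_bound \<ge> 0" using p0_pos by (simp add: berwald_bound_def)
    have "ennreal (real k * m) \<le> ennreal (berwald_bound * v)"
      using ball_body_volume unfolding em v(2) using bb v(1) by (simp add: ennreal_mult'[symmetric])
    then show ?thesis using bb v(1) by (simp add: ennreal_le_iff)
  qed
  define a where "a = 1 + 2 / real k"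
  define D where "D = 2 * exp 8 * p 0"
  have D: "D > 0" using p0_pos by (simp add: D_def)
  have ak: "real k / real (k + 2) * a = 1"
  proof -
    have "a = real (k + 2) / real k" using k0 by (simp add: a_def field_simps)
    then show ?thesis using k0 by simp
  qed
  have bw: "berwald_bound powr a = D / p 0 powr a"
  proof -
    have "berwald_bound powr a = (D powr (real k / real (k + 2))) powr a / p 0 powr a"
      unfolding berwald_bound_def D_def by (rule powr_divide)
    also have "(D powr (real k / real (k + 2))) powr a = D" unfolding powr_powr ak using D by simp
    finally show ?thesis .
  qed
  have "(real k * m) powr a \<le> (berwald_bound * v) powr a"
    using mle k0 m by (intro powr_mono2) (auto simp: a_def)
  then have pa: "real k powr a * m powr a \<le> D / p 0 powr a * v powr a"
    unfolding powr_mult bw .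
  define w where "w = (p 0 / v) powr (2 / real k)"
  have w: "w > 0" using p0_pos v by (simp add: w_def)
  have pw: "p 0 powr a = p 0 * v powr a / v * w"
  proof -
    have "p 0 powr a = p 0 * p 0 powr (2 / real k)" "v powr a = v * v powr (2 / real k)"
      using p0_pos v by (auto simp: a_def powr_add)
    then show ?thesis using v p0_pos by (simp add: w_def powr_divide)
  qed
  have ma: "m powr a > 0" and va: "v powr a > 0" using m v by auto
  have ka: "real k \<le> real k powr a" using powr_mono[of 1 a "real k"] k0 by (simp add: a_def)
  have e8: "exp (8 :: real) \<le> 3 ^ 8"
  proof -
    have "exp (8 :: real) = exp 1 ^ 8" by (simp add: exp_of_nat_mult[symmetric])
    also have "... \<le> 3 ^ 8" by (intro power_mono exp_le) simp
    finally show ?thesis .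
  qed
  have "real k * m powr a * (p 0 powr a) \<le> D * v powr a"
  proof -
    have "real k * m powr a \<le> real k powr a * m powr a" using ka ma by simp
    also note pa
    finally have "real k * m powr a \<le> D * v powr a / p 0 powr a" by simp
    then show ?thesis using p0_pos by (simp add: pos_le_divide_eq)
  qed
  then have "(real k * m powr a * w / v) * (p 0 * v powr a) \<le> (2 * exp 8) * (p 0 * v powr a)"
    unfolding pw D_def by (simp add: mult_ac)
  then have "real k * m powr a * w / v \<le> 2 * exp 8"
    by (rule mult_right_le_imp_le) (use p0_pos va in simp)
  then have kw: "real k * m powr a * w \<le> 2 * exp 8 * v" using v by (simp add: pos_divide_le_eq)
  have "real (k + 2) * m powr a * w \<le> 3 * (real k * m powr a * w)"
  proof -
    have "real (k + 2) * (m powr a * w) \<le> (3 * real k) * (m powr a * w)"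
      using k0 ma w by (intro mult_right_mono) auto
    then show ?thesis by (simp only: mult.assoc)
  qed
  then have "real (k + 2) * m powr a * w \<le> 40000 * v"
  proof -
    have "exp 8 * v \<le> 6561 * v" using e8 v by simp
    then show ?thesis using kw \<open>real (k + 2) * m powr a * w \<le> _\<close> v(1) by linarith
  qed
  then have wle: "w \<le> 40000 * (\<kappa> / m powr a)"
  proof -
    have "0 < real (k + 2) * m powr a" using ma by simp
    moreover have "w * (real (k + 2) * m powr a) \<le> 40000 * v"
      using \<open>real (k + 2) * m powr a * w \<le> 40000 * v\<close> by (simp only: mult_ac)
    ultimately have "w \<le> 40000 * v / (real (k + 2) * m powr a)" by (simp only: pos_le_divide_eq)
    then show ?thesis unfolding \<kappa>_def by (simp only: times_divide_eq_right divide_divide_eq_left)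
  qed
  have kap: "\<kappa> / m powr a > 0" using v ma by (simp add: \<kappa>_def)
  have L0: "L > 0" using sL kap unfolding a_def[symmetric] by (smt (verit) real_sqrt_gt_0_iff)
  have "(sqrt (\<kappa> / m powr a))\<^sup>2 \<le> L\<^sup>2" using sL kap unfolding a_def[symmetric] by (intro power_mono) auto
  then have "\<kappa> / m powr a \<le> L\<^sup>2" using kap by simp
  then have "w \<le> (200 * L)\<^sup>2" using wle by (simp add: power_mult_distrib)
  then have "w powr (real k / 2) \<le> ((200 * L)\<^sup>2) powr (real k / 2)" using w k0 by (intro powr_mono2) auto
  moreover have "w powr (real k / 2) = p 0 / v"
    unfolding w_def powr_powr using k0 p0_pos v by simp
  moreover have "((200 * L)\<^sup>2) powr (real k / 2) = (200 * L) ^ k"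
  proof -
    have "((200 * L)\<^sup>2) powr (real k / 2) = ((200 * L) powr real 2) powr (real k / 2)"
      using powr_realpow[of "200 * L" 2] L0 by simp
    also have "... = (200 * L) powr (real k)" unfolding powr_powr by simp
    also have "... = (200 * L) ^ k" using L0 by (intro powr_realpow) simp
    finally show ?thesis .
  qed
  ultimately show ?thesis using v by (simp add: pos_divide_le_eq)
qed

end

section \<open>Inner products and orthonormal bases\<close>

locale inner_form =
  fixes n :: nat and Q :: "vec \<Rightarrow> vec \<Rightarrow> real"
  assumes Q_sym: "Q x y = Q y x" and Q_add: "Q (x + y) z = Q x z + Q y z"
    and Q_scale: "Q (c *\<^sub>R x) z = c * Q x z" and Q_pos: "x \<in> Rn n \<Longrightarrow> x \<noteq> 0 \<Longrightarrow> Q x x > 0"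
begin

lemma Q_zero: "Q 0 z = 0"
  using Q_scale[of 0 0 z] by simp

lemma Q_sum: "Q (\<Sum>i\<in>I. f i) z = (\<Sum>i\<in>I. Q (f i) z)"
proof (induction I rule: infinite_finite_induct)
  case (insert i I)
  then show ?case by (simp only: sum.insert Q_add not_False_eq_True)
qed (simp_all only: sum.infinite sum.empty Q_zero not_False_eq_True)

lemma Q_diff: "Q (x - y) z = Q x z - Q y z"
  using Q_add[of "x - y" y z] by simp

lemma Q_add_right: "Q z (x + y) = Q z x + Q z y"
  using Q_add[of x y z] by (simp add: Q_sym)

definition orthonormal :: "(nat \<Rightarrow> vec) \<Rightarrow> nat \<Rightarrow> bool" where
  "orthonormal \<theta> N \<longleftrightarrow> (\<forall>i<N. \<theta> i \<in> Rn n) \<and> (\<forall>i<N. \<forall>j<N. Q (\<theta> i) (\<theta> j) = (if i = j then 1 else 0))"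

lemma orthonormal_in: "orthonormal \<theta> N \<Longrightarrow> i < N \<Longrightarrow> \<theta> i \<in> Rn n"
  and orthonormal_Q: "orthonormal \<theta> N \<Longrightarrow> i < N \<Longrightarrow> j < N \<Longrightarrow> Q (\<theta> i) (\<theta> j) = (if i = j then 1 else 0)"
  by (auto simp: orthonormal_def)

lemma orthonormal_inj: "orthonormal \<theta> N \<Longrightarrow> inj_on \<theta> {..<N}"
  unfolding inj_on_def orthonormal_def by (metis lessThan_iff zero_neq_one)

lemma Q_combination:
  assumes \<theta>: "orthonormal \<theta> N" and i: "i < N"
  shows "Q (\<Sum>j<N. a j *\<^sub>R \<theta> j) (\<theta> i) = a i"
proof -
  have "Q (\<Sum>j<N. a j *\<^sub>R \<theta> j) (\<theta> i) = (\<Sum>j<N. if j = i then a j else 0)"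
    unfolding Q_sum Q_scale by (rule sum.cong) (use orthonormal_Q[OF \<theta> _ i] in auto)
  then show ?thesis using i by simp
qed

lemma orthonormal_independent:
  assumes \<theta>: "orthonormal \<theta> N"
  shows "independent (\<theta> ` {..<N})"
proof (rule independent_if_scalars_zero)
  fix f y assume 0: "(\<Sum>y\<in>\<theta> ` {..<N}. f y *\<^sub>R y) = 0" and y: "y \<in> \<theta> ` {..<N}"
  obtain i where i: "i < N" "y = \<theta> i" using y by auto
  have "(\<Sum>j<N. f (\<theta> j) *\<^sub>R \<theta> j) = 0" using 0 by (simp add: sum.reindex[OF orthonormal_inj[OF \<theta>]])
  then show "f y = 0" using Q_combination[OF \<theta> i(1), of "\<lambda>j. f (\<theta> j)"] i(2) by (simp add: Q_zero)
qed simp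

lemma orthonormal_card: "orthonormal \<theta> N \<Longrightarrow> card (\<theta> ` {..<N}) = N"
  by (simp add: card_image orthonormal_inj)

lemma Rn_span_unit: "Rn n \<subseteq> span (unit_vec ` {..<n})"
proof
  fix x assume "x \<in> Rn n"
  then have "x = (\<Sum>i<n. x i *\<^sub>R unit_vec i)" by (rule Rn_expand)
  also have "... \<in> span (unit_vec ` {..<n})" by (intro span_sum span_scale span_base) auto
  finally show "x \<in> span (unit_vec ` {..<n})" .
qed

lemma orthonormal_bound:
  assumes \<theta>: "orthonormal \<theta> N"
  shows "N \<le> n"
proof -
  have "card (\<theta> ` {..<N}) \<le> card (unit_vec ` {..<n})"
    using independent_span_bound[OF _ orthonormal_independent[OF \<theta>], of "unit_vec ` {..<n}"] Rn_span_unit orthonormal_in[OF \<theta>]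
    by auto
  also have "... \<le> n" using card_image_le[of "{..<n}" unit_vec] by simp
  finally show ?thesis by (simp add: orthonormal_card[OF \<theta>])
qed

lemma orthonormal_extend:
  assumes \<theta>: "orthonormal \<theta> N" and r: "r \<in> Rn n" "r \<noteq> 0" "\<And>i. i < N \<Longrightarrow> Q r (\<theta> i) = 0"
  shows "orthonormal (\<theta>(N := (1 / sqrt (Q r r)) *\<^sub>R r)) (Suc N)"
proof -
  have p: "Q r r > 0" by (rule Q_pos[OF r(1,2)])
  define e where "e = (1 / sqrt (Q r r)) *\<^sub>R r"
  have eR: "e \<in> Rn n" unfolding e_def by (rule Rn_scaleR[OF r(1)])
  have e0: "Q e (\<theta> i) = 0" "Q (\<theta> i) e = 0" if "i < N" for i
    using r(3)[OF that] by (simp_all add: e_def Q_scale Q_sym[of "\<theta> i"])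
  have ee: "Q e e = 1"
  proof -
    have "Q e e = (1 / sqrt (Q r r)) * ((1 / sqrt (Q r r)) * Q r r)"
      unfolding e_def Q_scale Q_sym[of r "_ *\<^sub>R r"] ..
    also have "... = Q r r / (sqrt (Q r r) * sqrt (Q r r))" by simp
    also have "... = 1" using p by (simp only: real_sqrt_mult_self) simp
    finally show ?thesis .
  qed
  show ?thesis
    unfolding e_def[symmetric] orthonormal_def
    using \<theta> eR e0 ee by (auto simp: less_Suc_eq orthonormal_def)
qed

lemma residual_orthogonal:
  assumes \<theta>: "orthonormal \<theta> N" and i: "i < N"
  shows "Q (x - (\<Sum>j<N. Q x (\<theta> j) *\<^sub>R \<theta> j)) (\<theta> i) = 0"
  by (simp add: Q_diff Q_combination[OF \<theta> i])

lemma orthonormal_basis_exists: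
  assumes S: "subspace S" "S \<subseteq> Rn n"
  obtains \<theta> where "\<And>j. j < dim S \<Longrightarrow> \<theta> j \<in> S" "orthonormal \<theta> (dim S)"
    "\<And>x. x \<in> S \<Longrightarrow> x = (\<Sum>j<dim S. Q x (\<theta> j) *\<^sub>R \<theta> j)"
proof -
  define P where "P N \<longleftrightarrow> (\<exists>\<theta>. (\<forall>j<N. \<theta> j \<in> S) \<and> orthonormal \<theta> N)" for N
  have "P 0" by (auto simp: P_def orthonormal_def)
  moreover have "\<forall>N. P N \<longrightarrow> N \<le> n" using orthonormal_bound by (auto simp: P_def)
  ultimately obtain N where N: "P N" and max: "\<And>M. P M \<Longrightarrow> M \<le> N"
    using ex_has_greatest_nat[of P 0 "\<lambda>N. N" "Suc n"] by (auto simp: less_Suc_eq_le)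
  obtain \<theta> where \<theta>S: "\<And>j. j < N \<Longrightarrow> \<theta> j \<in> S" and \<theta>: "orthonormal \<theta> N" using N by (auto simp: P_def)
  have expand: "x = (\<Sum>j<N. Q x (\<theta> j) *\<^sub>R \<theta> j)" if x: "x \<in> S" for x
  proof (rule ccontr)
    assume ne: "x \<noteq> (\<Sum>j<N. Q x (\<theta> j) *\<^sub>R \<theta> j)"
    define r where "r = x - (\<Sum>j<N. Q x (\<theta> j) *\<^sub>R \<theta> j)"
    have rS: "r \<in> S" unfolding r_def
      by (intro subspace_diff[OF S(1)] subspace_sum[OF S(1)] subspace_scale[OF S(1)] x \<theta>S) auto
    have r0: "r \<noteq> 0" using ne by (simp add: r_def)
    have "orthonormal (\<theta>(N := (1 / sqrt (Q r r)) *\<^sub>R r)) (Suc N)"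
      using orthonormal_extend[OF \<theta>, of r] rS S(2) r0 residual_orthogonal[OF \<theta>, of _ x] by (auto simp: r_def)
    moreover have "\<forall>j<Suc N. (\<theta>(N := (1 / sqrt (Q r r)) *\<^sub>R r)) j \<in> S"
      using \<theta>S subspace_scale[OF S(1) rS] by (auto simp: less_Suc_eq)
    ultimately have "P (Suc N)" unfolding P_def by blast
    then show False using max by fastforce
  qed
  have "dim S = N"
  proof (rule dim_unique[OF _ _ orthonormal_independent[OF \<theta>] orthonormal_card[OF \<theta>]])
    show "\<theta> ` {..<N} \<subseteq> S" using \<theta>S by auto
    show "S \<subseteq> span (\<theta> ` {..<N})"
    proof
      fix x assume "x \<in> S"
      then have "x = (\<Sum>j<N. Q x (\<theta> j) *\<^sub>R \<theta> j)" by (rule expand)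
      also have "... \<in> span (\<theta> ` {..<N})" by (intro span_sum span_scale span_base) auto
      finally show "x \<in> span (\<theta> ` {..<N})" .
    qed
  qed
  then show ?thesis using that \<theta>S \<theta> expand by blast
qed

lemma orthonormal_expand:
  assumes \<theta>: "orthonormal \<theta> n" and x: "x \<in> Rn n"
  shows "x = (\<Sum>j<n. Q x (\<theta> j) *\<^sub>R \<theta> j)"
proof (rule ccontr)
  assume ne: "x \<noteq> (\<Sum>j<n. Q x (\<theta> j) *\<^sub>R \<theta> j)"
  define r where "r = x - (\<Sum>j<n. Q x (\<theta> j) *\<^sub>R \<theta> j)"
  have rS: "r \<in> Rn n" unfolding r_def
    by (intro Rn_diff Rn_sum Rn_scaleR x orthonormal_in[OF \<theta>]) auto
  have r0: "r \<noteq> 0" using ne by (simp add: r_def)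
  have "orthonormal (\<theta>(n := (1 / sqrt (Q r r)) *\<^sub>R r)) (Suc n)"
    using orthonormal_extend[OF \<theta> rS r0] residual_orthogonal[OF \<theta>, of _ x] by (auto simp: r_def)
  then show False using orthonormal_bound by fastforce
qed

lemma parseval:
  assumes \<theta>: "orthonormal \<theta> n" and x: "x \<in> Rn n"
  shows "Q x x = (\<Sum>j<n. (Q x (\<theta> j))\<^sup>2)"
proof -
  have "Q x x = Q (\<Sum>j<n. Q x (\<theta> j) *\<^sub>R \<theta> j) x"
    using arg_cong[OF orthonormal_expand[OF \<theta> x], of "\<lambda>y. Q y x"] .
  also have "... = (\<Sum>j<n. (Q x (\<theta> j))\<^sup>2)"
    unfolding Q_sum Q_scale by (simp add: Q_sym[of _ x] power2_eq_square)
  finally show ?thesis .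
qed

end

lemma inner_form_dot: "inner_form n (dot n)"
proof
  show "x \<in> Rn n \<Longrightarrow> x \<noteq> 0 \<Longrightarrow> dot n x x > 0" for x :: vec
    using dot_eq_0_iff[of x n] dot_nonneg[of n x] by linarith
qed (auto simp: dot_simps dot_commute)

interpretation dotf: inner_form n "dot n" for n
  by (rule inner_form_dot)

lemma dim_Rn: "dim (Rn n) = n"
proof -
  have o: "dotf.orthonormal n unit_vec n"
    unfolding dotf.orthonormal_def using unit_vec_in_Rn[of _ n] dot_unit_vec[of _ n] by (auto simp: unit_vec_def)
  show ?thesis
    by (rule dim_unique[OF _ dotf.Rn_span_unit dotf.orthonormal_independent[OF o] dotf.orthonormal_card[OF o]])
       (use unit_vec_in_Rn in auto)
qed

definition coords :: "nat \<Rightarrow> (nat \<Rightarrow> vec) \<Rightarrow> vec \<Rightarrow> vec" where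
  "coords n \<theta> w = (\<lambda>j. if j < n then dot n (\<theta> j) w else 0)"

lemma coords_measurable [measurable]: "coords n \<theta> \<in> borel_maps"
  unfolding coords_def by (rule measurable_vecI) simp

lemma linear_coords: "linear_Rn n (coords n \<theta>)"
proof -
  have "(c *\<^sub>R f) j = c * f j" for c and f :: vec and j by (simp add: scaleR_fun_def)
  then show ?thesis by (auto simp: linear_Rn_def coords_def Rn_iff fun_eq_iff dot_simps)
qed

lemma dot_coords: "dot n u (coords n \<theta> w) = dot n (\<Sum>j<n. u j *\<^sub>R \<theta> j) w"
  by (simp add: dot_def[of n u] coords_def dot_sum_left dot_simps)

context inner_form
begin

lemma split_basis:
  assumes S1: "subspace S1" "S1 \<subseteq> Rn n" and S2: "subspace S2" "S2 \<subseteq> Rn n"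
    and orth: "\<And>x y. x \<in> S1 \<Longrightarrow> y \<in> S2 \<Longrightarrow> Q x y = 0"
    and dec: "\<And>x. x \<in> Rn n \<Longrightarrow> \<exists>a\<in>S1. \<exists>b\<in>S2. x = a + b"
  obtains \<theta> where "orthonormal \<theta> n" "dim S1 + dim S2 = n" "\<And>j. j < dim S1 \<Longrightarrow> \<theta> j \<in> S1"
    "\<And>j. dim S1 \<le> j \<Longrightarrow> j < n \<Longrightarrow> \<theta> j \<in> S2"
proof -
  obtain a where a: "\<And>j. j < dim S1 \<Longrightarrow> a j \<in> S1" "orthonormal a (dim S1)"
    "\<And>x. x \<in> S1 \<Longrightarrow> x = (\<Sum>j<dim S1. Q x (a j) *\<^sub>R a j)"
    using orthonormal_basis_exists[OF S1] by metis
  obtain b where b: "\<And>j. j < dim S2 \<Longrightarrow> b j \<in> S2" "orthonormal b (dim S2)"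
    "\<And>x. x \<in> S2 \<Longrightarrow> x = (\<Sum>j<dim S2. Q x (b j) *\<^sub>R b j)"
    using orthonormal_basis_exists[OF S2] by metis
  define N where "N = dim S1 + dim S2"
  define \<theta> where "\<theta> j = (if j < dim S1 then a j else b (j - dim S1))" for j
  have \<theta>: "orthonormal \<theta> N"
    unfolding orthonormal_def
  proof (intro conjI allI impI)
    fix i assume i: "i < N"
    show "\<theta> i \<in> Rn n" using i orthonormal_in[OF a(2)] orthonormal_in[OF b(2)] by (auto simp: \<theta>_def N_def)
    fix j assume j: "j < N"
    consider "i < dim S1" "j < dim S1" | "i < dim S1" "\<not> j < dim S1" | "\<not> i < dim S1" "j < dim S1" | "\<not> i < dim S1" "\<not> j < dim S1"
      by blast
    then show "Q (\<theta> i) (\<theta> j) = (if i = j then 1 else 0)"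
    proof cases
      case 1
      then show ?thesis using orthonormal_Q[OF a(2)] by (simp add: \<theta>_def)
    next
      case 2
      then show ?thesis using orth[OF a(1) b(1), of i "j - dim S1"] j by (auto simp: \<theta>_def N_def)
    next
      case 3
      then show ?thesis using orth[OF a(1) b(1), of j "i - dim S1"] i by (auto simp: \<theta>_def N_def Q_sym[of "b _"])
    next
      case 4
      then show ?thesis using orthonormal_Q[OF b(2), of "i - dim S1" "j - dim S1"] i j by (auto simp: \<theta>_def N_def)
    qed
  qed
  have "dim (Rn n) = N"
  proof (rule dim_unique[OF _ _ orthonormal_independent[OF \<theta>] orthonormal_card[OF \<theta>]])
    show "\<theta> ` {..<N} \<subseteq> Rn n" using orthonormal_in[OF \<theta>] by auto
    have aspan: "a j \<in> span (\<theta> ` {..<N})" if "j < dim S1" for j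
      using that by (intro span_base) (auto simp: \<theta>_def N_def intro!: image_eqI[of _ _ j])
    have bspan: "b j \<in> span (\<theta> ` {..<N})" if "j < dim S2" for j
      using that by (intro span_base) (auto simp: \<theta>_def N_def intro!: image_eqI[of _ _ "dim S1 + j"])
    show "Rn n \<subseteq> span (\<theta> ` {..<N})"
    proof
      fix x assume "x \<in> Rn n"
      then obtain y z where yz: "y \<in> S1" "z \<in> S2" "x = y + z" using dec by blast
      have "(\<Sum>j<dim S1. Q y (a j) *\<^sub>R a j) \<in> span (\<theta> ` {..<N})" by (intro span_sum span_scale aspan) auto
      then have "y \<in> span (\<theta> ` {..<N})" using a(3)[OF yz(1)] by simp
      moreover have "(\<Sum>j<dim S2. Q z (b j) *\<^sub>R b j) \<in> span (\<theta> ` {..<N})" by (intro span_sum span_scale bspan) auto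
      then have "z \<in> span (\<theta> ` {..<N})" using b(3)[OF yz(2)] by simp
      ultimately show "x \<in> span (\<theta> ` {..<N})" unfolding yz(3) by (rule span_add)
    qed
  qed
  then have Nn: "N = n" by (simp add: dim_Rn)
  show ?thesis
  proof (rule that[of \<theta>])
    show "orthonormal \<theta> n" using \<theta> Nn by simp
    show "dim S1 + dim S2 = n" using Nn by (simp add: N_def)
    show "\<theta> j \<in> S1" if "j < dim S1" for j using that a(1) by (simp add: \<theta>_def)
    show "\<theta> j \<in> S2" if "dim S1 \<le> j" "j < n" for j
      using that b(1)[of "j - dim S1"] Nn by (simp add: \<theta>_def N_def)
  qed
qed

text \<open>Riesz representation of the functional \<open>dot n w\<close> by the inner product \<open>Q\<close>.\<close>

lemma representer:
  assumes \<theta>: "orthonormal \<theta> n"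
  obtains x where "x \<in> Rn n" "\<And>y. y \<in> Rn n \<Longrightarrow> Q x y = dot n y w"
proof
  show "(\<Sum>j<n. dot n (\<theta> j) w *\<^sub>R \<theta> j) \<in> Rn n"
    by (intro Rn_sum Rn_scaleR orthonormal_in[OF \<theta>]) auto
  fix y assume y: "y \<in> Rn n"
  have "dot n y w = dot n (\<Sum>j<n. Q y (\<theta> j) *\<^sub>R \<theta> j) w"
    using arg_cong[OF orthonormal_expand[OF \<theta> y], of "\<lambda>y. dot n y w"] .
  then show "Q (\<Sum>j<n. dot n (\<theta> j) w *\<^sub>R \<theta> j) y = dot n y w"
    by (simp add: Q_sum Q_scale dot_sum_left dot_simps Q_sym[of y] mult.commute)
qed

text \<open>
  The norm is that of the vector representing \<open>w\<close> and thus the same for all bases: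
  two such coordinate systems differ by an orthogonal map.
\<close>

lemma coords_norm:
  assumes \<theta>: "orthonormal \<theta> n" and x: "x \<in> Rn n" "\<And>y. y \<in> Rn n \<Longrightarrow> Q x y = dot n y w"
  shows "dot n (coords n \<theta> w) (coords n \<theta> w) = Q x x"
  unfolding dot_def[of n "coords n \<theta> w"] parseval[OF \<theta> x(1)]
  using x(2)[OF orthonormal_in[OF \<theta>]] by (simp add: coords_def power2_eq_square)

lemma coords_partial_norm:
  assumes \<theta>: "orthonormal \<theta> n" and x: "x \<in> Rn n" "\<And>y. y \<in> Rn n \<Longrightarrow> Q x y = dot n y w"
    and S: "S1 \<subseteq> Rn n" "\<And>x y. x \<in> S1 \<Longrightarrow> y \<in> S2 \<Longrightarrow> Q x y = 0"
    and k: "k \<le> n" "\<And>j. j < k \<Longrightarrow> \<theta> j \<in> S1" "\<And>j. k \<le> j \<Longrightarrow> j < n \<Longrightarrow> \<theta> j \<in> S2"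
    and ab: "a \<in> S1" "b \<in> S2" "x = a + b"
  shows "dot k (coords n \<theta> w) (coords n \<theta> w) = Q a x"
proof -
  have "Q a x = Q a a + Q a b" unfolding ab(3) by (rule Q_add_right)
  also have "Q a b = 0" by (rule S(2)[OF ab(1,2)])
  also have "Q a a = (\<Sum>j<n. (Q a (\<theta> j))\<^sup>2)" by (rule parseval[OF \<theta>]) (use ab(1) S(1) in auto)
  also have "... = (\<Sum>j<k. (Q a (\<theta> j))\<^sup>2)"
    by (rule sum.mono_neutral_right) (use k(1) S(2)[OF ab(1) k(3)] in auto)
  also have "... = (\<Sum>j<k. (dot n (\<theta> j) w)\<^sup>2)"
  proof (rule sum.cong)
    fix j assume "j \<in> {..<k}"
    then have j: "j < k" "j < n" using k(1) by auto
    have "Q b (\<theta> j) = 0" using S(2)[OF k(2)[OF j(1)] ab(2)] by (simp add: Q_sym)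
    then have "Q a (\<theta> j) = Q x (\<theta> j)" unfolding ab(3) Q_add by simp
    then show "(Q a (\<theta> j))\<^sup>2 = (dot n (\<theta> j) w)\<^sup>2" using x(2)[OF orthonormal_in[OF \<theta> j(2)]] by simp
  qed simp
  also have "... = dot k (coords n \<theta> w) (coords n \<theta> w)"
    unfolding dot_def[of k] by (rule sum.cong) (use k(1) in \<open>auto simp: coords_def power2_eq_square\<close>)
  finally show ?thesis by simp
qed

lemma coords_bij:
  assumes \<theta>: "orthonormal \<theta> n"
  shows "bij_betw (coords n \<theta>) (Rn n) (Rn n)"
proof (rule linear_Rn_bij[OF linear_coords])
  fix w assume w: "w \<in> Rn n" and 0: "coords n \<theta> w = 0"
  obtain x where x: "x \<in> Rn n" "\<And>y. y \<in> Rn n \<Longrightarrow> Q x y = dot n y w" using representer[OF \<theta>] by blast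
  have "Q x x = 0" using coords_norm[OF \<theta> x] 0 by simp
  then have "x = 0" using Q_pos[OF x(1)] by fastforce
  then have "dot n w w = 0" using x(2)[OF w] by (simp add: Q_zero)
  then show "w = 0" using dot_eq_0_iff[OF w] by simp
qed

lemma Q_combination_norm:
  assumes \<theta>: "orthonormal \<theta> n"
  shows "Q (\<Sum>j<n. u j *\<^sub>R \<theta> j) (\<Sum>j<n. u j *\<^sub>R \<theta> j) = dot n u u"
proof -
  have "(\<Sum>j<n. u j *\<^sub>R \<theta> j) \<in> Rn n"
    by (intro Rn_sum Rn_scaleR orthonormal_in[OF \<theta>]) auto
  from parseval[OF \<theta> this] show ?thesis
    using Q_combination[OF \<theta>, of _ u] by (simp add: dot_def power2_eq_square)
qed

end

section \<open>Orthogonal projections and fixed spaces\<close>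

lemma subspace_orth_complement: "subspace (orth_complement n S)"
  by (auto simp: subspace_def orth_complement_def dot_simps Rn_zero
      intro: Rn_add Rn_scaleR)

lemma orthogonal_decomposition:
  assumes S: "subspace S" "S \<subseteq> Rn n" and x: "x \<in> Rn n"
  obtains a b where "a \<in> S" "b \<in> orth_complement n S" "x = a + b"
proof -
  obtain \<theta> where \<theta>: "\<And>j. j < dim S \<Longrightarrow> \<theta> j \<in> S" "dotf.orthonormal n \<theta> (dim S)"
    "\<And>x. x \<in> S \<Longrightarrow> x = (\<Sum>j<dim S. dot n x (\<theta> j) *\<^sub>R \<theta> j)"
    using dotf.orthonormal_basis_exists[OF S] by metis
  define a where "a = (\<Sum>j<dim S. dot n x (\<theta> j) *\<^sub>R \<theta> j)"
  have a: "a \<in> S" unfolding a_def by (intro subspace_sum[OF S(1)] subspace_scale[OF S(1)] \<theta>(1)) auto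
  have xa: "x - a \<in> Rn n" using x a S(2) by (intro Rn_diff) auto
  have "dot n (x - a) y = 0" if y: "y \<in> S" for y
  proof -
    have "dot n (x - a) y = dot n (x - a) (\<Sum>j<dim S. dot n y (\<theta> j) *\<^sub>R \<theta> j)"
      using arg_cong[OF \<theta>(3)[OF y], of "\<lambda>y. dot n (x - a) y"] .
    also have "... = 0"
      unfolding dot_sum_right dot_scaleR_right a_def using dotf.residual_orthogonal[OF \<theta>(2), of _ x] by simp
    finally show ?thesis .
  qed
  then have "x - a \<in> orth_complement n S" using xa by (simp add: orth_complement_def)
  then show ?thesis using that[OF a] by simp
qed

lemma orth_proj_eq:
  assumes S: "subspace S" "S \<subseteq> Rn n" and a: "a \<in> S" and b: "b \<in> orth_complement n S"
  shows "orth_proj n S (a + b) = a"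
  unfolding orth_proj_def
proof (rule the_equality)
  fix y assume y: "y \<in> S \<and> a + b - y \<in> orth_complement n S"
  have ya: "y - a \<in> S" using y a by (intro subspace_diff[OF S(1)]) auto
  have "dot n (a + b - y) (y - a) = 0" "dot n b (y - a) = 0" using y b ya by (auto simp: orth_complement_def)
  then have "dot n (y - a) (y - a) = 0" by (simp add: dot_simps)
  then show "y = a" using dot_eq_0_iff[of "y - a" n] ya S(2) by auto
qed (use a b in auto)

lemma orth_projD:
  assumes S: "subspace S" "S \<subseteq> Rn n" and x: "x \<in> Rn n"
  shows "orth_proj n S x \<in> S" "x - orth_proj n S x \<in> orth_complement n S"
proof -
  obtain a b where "a \<in> S" "b \<in> orth_complement n S" "x = a + b" by (rule orthogonal_decomposition[OF S x])
  then show "orth_proj n S x \<in> S" "x - orth_proj n S x \<in> orth_complement n S"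
    using orth_proj_eq[OF S] by auto
qed

lemma orth_complement_twice:
  assumes S: "subspace S" "S \<subseteq> Rn n"
  shows "orth_complement n (orth_complement n S) = S"
proof
  show "S \<subseteq> orth_complement n (orth_complement n S)"
    using S(2) by (auto simp: orth_complement_def dot_commute)
  show "orth_complement n (orth_complement n S) \<subseteq> S"
  proof
    fix x assume x: "x \<in> orth_complement n (orth_complement n S)"
    then have xR: "x \<in> Rn n" by (simp add: orth_complement_def)
    obtain a b where ab: "a \<in> S" "b \<in> orth_complement n S" "x = a + b" by (rule orthogonal_decomposition[OF S xR])
    have "dot n x b = 0" using x ab(2) by (simp add: orth_complement_def)
    moreover have "dot n a b = 0" using ab by (simp add: orth_complement_def dot_commute)
    ultimately have "dot n b b = 0" unfolding ab(3) by (simp add: dot_simps)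
    then have "b = 0" using dot_eq_0_iff[of b n] ab(2) by (simp add: orth_complement_def)
    then show "x \<in> S" using ab by simp
  qed
qed

lemma trace_orth_proj:
  assumes S: "subspace S" "S \<subseteq> Rn n"
  shows "(\<Sum>l<n. dot n (orth_proj n S (unit_vec l)) (unit_vec l)) = real (dim S)"
proof -
  obtain \<theta> where \<theta>: "\<And>j. j < dim S \<Longrightarrow> \<theta> j \<in> S" "dotf.orthonormal n \<theta> (dim S)"
    "\<And>x. x \<in> S \<Longrightarrow> x = (\<Sum>j<dim S. dot n x (\<theta> j) *\<^sub>R \<theta> j)"
    using dotf.orthonormal_basis_exists[OF S] by metis
  have "dot n (orth_proj n S (unit_vec l)) (unit_vec l) = (\<Sum>j<dim S. \<theta> j l * \<theta> j l)" if l: "l < n" for l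
  proof -
    have u: "unit_vec l \<in> Rn n" by (rule unit_vec_in_Rn[OF l])
    define y where "y = orth_proj n S (unit_vec l)"
    have y: "y \<in> S" "unit_vec l - y \<in> orth_complement n S" unfolding y_def using orth_projD[OF S u] by auto
    have yt: "dot n y (\<theta> j) = \<theta> j l" if "j < dim S" for j
    proof -
      have "dot n (unit_vec l - y) (\<theta> j) = 0" using y(2) \<theta>(1)[OF that] by (simp add: orth_complement_def)
      then show ?thesis using dot_unit_vec(2)[OF l, of "\<theta> j"] by (simp add: dot_simps)
    qed
    have "dot n y (unit_vec l) = dot n (\<Sum>j<dim S. dot n y (\<theta> j) *\<^sub>R \<theta> j) (unit_vec l)"
      using arg_cong[OF \<theta>(3)[OF y(1)], of "\<lambda>y. dot n y (unit_vec l)"] .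
    also have "... = (\<Sum>j<dim S. \<theta> j l * \<theta> j l)"
      unfolding dot_sum_left dot_scaleR_left using yt dot_unit_vec(1)[OF l] by simp
    finally show ?thesis unfolding y_def .
  qed
  then have "(\<Sum>l<n. dot n (orth_proj n S (unit_vec l)) (unit_vec l)) = (\<Sum>l<n. \<Sum>j<dim S. \<theta> j l * \<theta> j l)" by simp
  also have "... = (\<Sum>j<dim S. dot n (\<theta> j) (\<theta> j))" unfolding dot_def by (rule sum.swap)
  also have "... = real (dim S)" using dotf.orthonormal_Q[OF \<theta>(2)] by simp
  finally show ?thesis .
qed

lemma subspace_Fix: "U \<in> orthogonal_group n \<Longrightarrow> subspace (Fix n U)"
  using orthogonal_group_linear[of U n]
  by (auto simp: subspace_def Fix_def Rn_zero linear_Rn_zero linear_Rn_add linear_Rn_scaleR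
      intro: Rn_add Rn_scaleR)

lemma nearest_point:
  fixes z :: vec
  assumes K: "convex K" "compact K" "K \<noteq> {}"
  obtains y where "y \<in> K" "\<And>x. x \<in> K \<Longrightarrow> dot n (z - y) (x - y) \<le> 0"
proof -
  have "continuous_on K (\<lambda>y. dot n (z - y) (z - y))"
  proof -
    have [continuous_intros]: "continuous_on K (\<lambda>y :: nat \<Rightarrow> real. y i)" for i
      by (rule continuous_on_subset[of UNIV]) (auto intro: continuous_on_product_coordinates)
    show ?thesis unfolding dot_def minus_apply by (intro continuous_intros)
  qed
  from continuous_attains_inf[OF K(2,3) this]
  obtain y where y: "y \<in> K" and min: "\<And>x. x \<in> K \<Longrightarrow> dot n (z - y) (z - y) \<le> dot n (z - x) (z - x)" by blast
  have "dot n (z - y) (x - y) \<le> 0" if x: "x \<in> K" for x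
  proof (rule ccontr)
    assume "\<not> dot n (z - y) (x - y) \<le> 0"
    then have g: "dot n (z - y) (x - y) > 0" by simp
    define g where "g = dot n (z - y) (x - y)"
    define h where "h = dot n (x - y) (x - y)"
    define t where "t = min 1 (g / (h + 1))"
    have h: "h \<ge> 0" by (simp add: h_def)
    have t: "0 < t" "t \<le> 1" "t * (h + 1) \<le> g"
      using g h by (auto simp: t_def g_def[symmetric] min_def divide_le_eq le_divide_eq split: if_splits)
    have "(1 - t) *\<^sub>R y + t *\<^sub>R x \<in> K" using K(1) y x t by (intro convexD) auto
    from min[OF this] have "dot n (z - y) (z - y) \<le> dot n (z - y - t *\<^sub>R (x - y)) (z - y - t *\<^sub>R (x - y))"
      by (simp add: algebra_simps)
    then have "0 \<le> - 2 * t * g + t * t * h"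
      by (simp add: g_def h_def dot_diff_left[of n "z - y" "t *\<^sub>R (x - y)"] dot_diff_right[of n _ "z - y" "t *\<^sub>R (x - y)"]
          dot_scaleR_left dot_scaleR_right dot_commute[of n "x - y" "z - y"]) (simp add: algebra_simps)
    then have "0 \<le> t * (- 2 * g + t * h)" by (simp add: algebra_simps)
    then have "0 \<le> - 2 * g + t * h" using t(1) by (simp add: zero_le_mult_iff)
    moreover have "t * h \<le> t * (h + 1)" using t(1) by simp
    ultimately show False using t(3) g unfolding g_def[symmetric] by linarith
  qed
  then show ?thesis using that y by blast
qed

text \<open>
  The point of \<open>K\<close> nearest to the fixed part of \<open>x\<close> is unique, hence fixed as well; seen from
  \<open>x\<close>, the obtuse angle criterion then forces it to be the fixed part itself.
\<close>

lemma fixed_part_in_body: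
  assumes U: "U \<in> isometry_group n K" and K: "convex K" "compact K" "K \<subseteq> Rn n"
    and x: "x \<in> K" "x = f + e" "f \<in> Fix n U" "e \<in> orth_complement n (Fix n U)"
  shows "f \<in> K"
proof -
  have Ug: "U \<in> orthogonal_group n" and UK: "U ` K = K" using U by (auto simp: isometry_group_def)
  obtain y where y: "y \<in> K" "\<And>x. x \<in> K \<Longrightarrow> dot n (f - y) (x - y) \<le> 0"
    using nearest_point[OF K(1,2)] x(1) by blast
  have fR: "f \<in> Rn n" "U f = f" and yR: "y \<in> Rn n" using x(3) y(1) K(3) by (auto simp: Fix_def)
  have Uy: "U y \<in> K" "U y \<in> Rn n" using UK y(1) K(3) by auto
  have dR: "y - f \<in> Rn n" by (rule Rn_diff[OF yR fR(1)])
  have "dot n (U y - f) (U y - f) = dot n (y - f) (y - f)"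
    using orthogonal_group_norm[OF Ug dR] linear_Rn_diff[OF orthogonal_group_linear[OF Ug] yR fR(1)] fR(2) by simp
  moreover have "dot n (f - y) (U y - y) \<le> 0" by (rule y(2)[OF Uy(1)])
  ultimately have "dot n (U y - y) (U y - y) \<le> 0"
    by (simp add: dot_simps dot_commute[of n f y] dot_commute[of n f "U y"] dot_commute[of n y "U y"])
  then have "U y - y = 0"
    using dot_eq_0_iff[OF Rn_diff[OF Uy(2) yR]] dot_nonneg[of n "U y - y"] by linarith
  then have yF: "y \<in> Fix n U" using yR by (simp add: Fix_def)
  have "dot n (f - y) (x - y) \<le> 0" by (rule y(2)[OF x(1)])
  moreover have "dot n (f - y) e = 0"
    using x(4) subspace_diff[OF subspace_Fix[OF Ug] x(3) yF] by (simp add: orth_complement_def dot_commute[of n "f - y" e])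
  moreover have "x - y = (f - y) + e" using x(2) by simp
  ultimately have "dot n (f - y) (f - y) \<le> 0" by (simp add: dot_add_right)
  then have "f - y = 0"
    using dot_eq_0_iff[OF Rn_diff[OF fR(1) yR]] dot_nonneg[of n "f - y"] by linarith
  then show ?thesis using y(1) by simp
qed

section \<open>Isotropic position\<close>

definition sym_convex :: "nat \<Rightarrow> vec set \<Rightarrow> bool" where
  "sym_convex n K \<longleftrightarrow> K \<in> sets borel \<and> K \<subseteq> Rn n \<and> convex K \<and> (\<forall>x\<in>K. - x \<in> K) \<and>
    (\<exists>R>0. K \<subseteq> cube n R) \<and> (\<exists>\<delta>>0. cube n \<delta> \<inter> Rn n \<subseteq> K)"

lemma sym_convexD:
  assumes "sym_convex n K"
  shows sym_convex_borel: "K \<in> sets borel" and sym_convex_Rn: "K \<subseteq> Rn n"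
    and sym_convex_convex: "convex K" and sym_convex_uminus: "x \<in> K \<Longrightarrow> - x \<in> K"
  using assms by (auto simp: sym_convex_def)

lemma sym_convex_body:
  assumes K: "convex_body n K" "uminus ` K = K"
  shows "sym_convex n K"
proof -
  from K(1) have c: "convex K" "compact K" "K \<subseteq> Rn n"
    and "\<exists>x0\<in>Rn n. \<exists>e>0. \<forall>y\<in>Rn n. (\<forall>i<n. \<bar>y i - x0 i\<bar> < e) \<longrightarrow> y \<in> K"
    by (auto simp: convex_body_iff)
  then obtain x0 e where x0: "x0 \<in> Rn n" and e: "e > 0" "\<And>y. y \<in> Rn n \<Longrightarrow> (\<And>i. i < n \<Longrightarrow> \<bar>y i - x0 i\<bar> < e) \<Longrightarrow> y \<in> K"
    by blast
  obtain R where R: "R > 0" "K \<subseteq> cube n R" by (rule compact_Rn_bounded[OF c(2,3)])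
  have sym: "- x \<in> K" if "x \<in> K" for x using K(2) that by blast
  have "cube n (e / 2) \<inter> Rn n \<subseteq> K"
  proof
    fix y assume y: "y \<in> cube n (e / 2) \<inter> Rn n"
    have ye: "\<bar>y i\<bar> < e" if "i < n" for i
    proof -
      have "\<bar>y i\<bar> \<le> e / 2" using y that by (simp add: cube_def)
      then show ?thesis using e(1) by linarith
    qed
    have 1: "x0 + y \<in> K" using y x0 ye by (intro e(2) Rn_add) auto
    have "x0 - y \<in> K" using y x0 ye by (intro e(2) Rn_diff) auto
    then have 2: "- (x0 - y) \<in> K" by (rule sym)
    have "(1 / 2) *\<^sub>R (x0 + y) + (1 / 2) *\<^sub>R (- (x0 - y)) \<in> K"
      by (rule convexD[OF c(1) 1 2]) auto
    moreover have "(1 / 2) *\<^sub>R (x0 + y) + (1 / 2) *\<^sub>R (- (x0 - y)) = y"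
      by (rule HOL.ext) (simp add: scaleR_fun_def field_simps)
    ultimately show "y \<in> K" by simp
  qed
  then show ?thesis
    unfolding sym_convex_def using c R e(1) sym convex_body_borel[OF K(1)] by (metis half_gt_zero)
qed

lemma sym_convex_sym_body:
  assumes "sym_convex (k + d) K" "k \<ge> 1"
  obtains R \<delta> where "sym_body k d K R \<delta>"
  using assms unfolding sym_convex_def sym_body_def by blast

lemma sym_convex_volume:
  assumes K: "sym_convex n K"
  obtains v where "v > 0" "emeasure (leb n) K = ennreal v"
proof -
  obtain R \<delta> where R: "R > 0" "K \<subseteq> cube n R" and \<delta>: "\<delta> > 0" "cube n \<delta> \<inter> Rn n \<subseteq> K" and b [measurable]: "K \<in> sets borel"
    using K by (auto simp: sym_convex_def)
  have up: "emeasure (leb n) K \<le> emeasure (leb n) (cube n R)"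
    using R(2) by (intro emeasure_mono) auto
  define v where "v = enn2real (emeasure (leb n) K)"
  have v: "emeasure (leb n) K = ennreal v"
    unfolding v_def using up R(1) by (intro ennreal_enn2real[symmetric]) (simp add: emeasure_cube le_less_trans)
  have "ennreal ((2 * \<delta>) ^ n) = emeasure (leb n) (cube n \<delta>)" using \<delta> by (simp add: emeasure_cube)
  also have "... \<le> ennreal v" unfolding v[symmetric]
    by (rule emeasure_mono_AE, rule eventually_mono[OF AE_Rn]) (use \<delta>(2) in auto)
  finally have "(2 * \<delta>) ^ n \<le> v" using \<delta>(1) by (simp add: v_def ennreal_le_iff)
  then have "v > 0" using \<delta>(1) by (smt (verit) zero_less_power)
  then show ?thesis using that v by blast
qed

lemma cube_linear_bound:
  assumes B: "linear_Rn n B" and x: "x \<in> cube n R" "x \<in> Rn n" and R: "R \<ge> 0"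
  shows "B x \<in> cube n (R * (\<Sum>i<n. \<Sum>j<n. \<bar>B (unit_vec j) i\<bar>))"
  unfolding cube_def mem_Collect_eq
proof (intro allI impI)
  fix i assume i: "i < n"
  have "\<bar>B x i\<bar> \<le> (\<Sum>j<n. \<bar>B (unit_vec j) i * x j\<bar>)"
    unfolding linear_Rn_coord[OF B x(2)] dot_def row_def by (rule sum_abs)
  also have "... \<le> (\<Sum>j<n. \<bar>B (unit_vec j) i\<bar> * R)"
    using x by (intro sum_mono) (auto simp: abs_mult cube_def intro!: mult_left_mono)
  also have "... = R * (\<Sum>j<n. \<bar>B (unit_vec j) i\<bar>)" by (simp add: sum_distrib_left mult.commute)
  also have "... \<le> R * (\<Sum>i<n. \<Sum>j<n. \<bar>B (unit_vec j) i\<bar>)"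
    using i R by (intro mult_left_mono member_le_sum[of i "{..<n}" "\<lambda>i. \<Sum>j<n. \<bar>B (unit_vec j) i\<bar>"]) (auto intro: sum_nonneg)
  finally show "\<bar>B x i\<bar> \<le> R * (\<Sum>i<n. \<Sum>j<n. \<bar>B (unit_vec j) i\<bar>)" .
qed

lemma sym_convex_image:
  assumes K: "sym_convex n K" and T: "linear_Rn n T" "bij_betw T (Rn n) (Rn n)"
  shows "sym_convex n (T ` K)"
proof -
  obtain R \<delta> where R: "R > 0" "K \<subseteq> cube n R" and \<delta>: "\<delta> > 0" "cube n \<delta> \<inter> Rn n \<subseteq> K"
    using K by (auto simp: sym_convex_def)
  note KR = sym_convex_Rn[OF K]
  have [measurable]: "K \<in> sets borel" by (rule sym_convex_borel[OF K])
  obtain B where B: "linear_Rn n B" "\<And>x. x \<in> Rn n \<Longrightarrow> B (T x) = x" "\<And>x. x \<in> Rn n \<Longrightarrow> T (B x) = x" "B \<in> borel_maps"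
    using linear_Rn_inv[OF T] by metis
  note [measurable] = B(4)
  have iff: "y \<in> T ` K \<longleftrightarrow> y \<in> Rn n \<and> B y \<in> K" for y
  proof
    assume "y \<in> T ` K"
    then obtain x where "x \<in> K" "y = T x" by auto
    then show "y \<in> Rn n \<and> B y \<in> K" using B(2)[of x] linear_Rn_in[OF T(1), of x] KR by auto
  next
    assume "y \<in> Rn n \<and> B y \<in> K"
    then show "y \<in> T ` K" using B(3)[of y] by (metis imageI)
  qed
  show ?thesis
    unfolding sym_convex_def
  proof (intro conjI)
    have "T ` K = Rn n \<inter> {y \<in> space borel. B y \<in> K}" by (rule set_eqI) (simp only: iff Int_iff mem_Collect_eq space_borel UNIV_I simp_thms)
    also have "... \<in> sets borel" by measurable
    finally show "T ` K \<in> sets borel" .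
    show "T ` K \<subseteq> Rn n" using iff by blast
    show "convex (T ` K)"
    proof (rule convexI)
      fix x y :: vec and u v :: real assume x: "x \<in> T ` K" and y: "y \<in> T ` K" and uv: "0 \<le> u" "0 \<le> v" "u + v = 1"
      have R: "u *\<^sub>R x \<in> Rn n" "v *\<^sub>R y \<in> Rn n" using x y iff by (auto intro: Rn_scaleR)
      have "B (u *\<^sub>R x + v *\<^sub>R y) = u *\<^sub>R B x + v *\<^sub>R B y"
        using linear_Rn_add[OF B(1) R] x y iff by (simp add: linear_Rn_scaleR[OF B(1)])
      also have "... \<in> K" using x y iff uv by (intro convexD[OF sym_convex_convex[OF K]]) auto
      finally show "u *\<^sub>R x + v *\<^sub>R y \<in> T ` K" unfolding iff using Rn_add[OF R] by blast
    qed
    show "\<forall>x\<in>T ` K. - x \<in> T ` K"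
    proof
      fix x assume "x \<in> T ` K"
      then have x: "x \<in> Rn n" "B x \<in> K" unfolding iff by blast+
      show "- x \<in> T ` K"
        unfolding iff linear_Rn_uminus[OF B(1) x(1)] using sym_convex_uminus[OF K x(2)] Rn_uminus[OF x(1)] by blast
    qed
    show "\<exists>R>0. T ` K \<subseteq> cube n R"
    proof (intro exI conjI subsetI)
      let ?R = "R * (\<Sum>i<n. \<Sum>j<n. \<bar>T (unit_vec j) i\<bar>) + 1"
      show "?R > 0" using R(1) by (intro add_nonneg_pos mult_nonneg_nonneg sum_nonneg) auto
      fix y assume "y \<in> T ` K"
      then obtain x where x: "x \<in> K" "y = T x" by auto
      have "y \<in> cube n (R * (\<Sum>i<n. \<Sum>j<n. \<bar>T (unit_vec j) i\<bar>))"
        unfolding x(2) using x(1) R KR by (intro cube_linear_bound[OF T(1)]) auto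
      then show "y \<in> cube n ?R" by (fastforce simp: cube_def)
    qed
    show "\<exists>\<delta>>0. cube n \<delta> \<inter> Rn n \<subseteq> T ` K"
    proof (intro exI conjI subsetI)
      define M where "M = (\<Sum>i<n. \<Sum>j<n. \<bar>B (unit_vec j) i\<bar>)"
      have M: "M \<ge> 0" unfolding M_def by (intro sum_nonneg) auto
      show "\<delta> / (M + 1) > 0" using \<delta>(1) M by simp
      fix y assume y: "y \<in> cube n (\<delta> / (M + 1)) \<inter> Rn n"
      have By: "B y \<in> cube n (\<delta> / (M + 1) * M)"
        unfolding M_def by (rule cube_linear_bound[OF B(1)]) (use y \<delta>(1) M in \<open>auto simp: M_def\<close>)
      have "\<delta> / (M + 1) * M \<le> \<delta>" using \<delta>(1) M by (simp add: pos_divide_le_eq algebra_simps)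
      then have "B y \<in> cube n \<delta>" using By by (fastforce simp: cube_def)
      moreover have "B y \<in> Rn n" using y by (intro linear_Rn_in[OF B(1)]) simp
      ultimately show "y \<in> T ` K" unfolding iff using y \<delta>(2) by blast
    qed
  qed
qed

definition cov :: "nat \<Rightarrow> vec set \<Rightarrow> vec \<Rightarrow> vec \<Rightarrow> real" where
  "cov n K \<theta> \<eta> = (\<integral>w. indicator K w *\<^sub>R (dot n \<theta> w * dot n \<eta> w) \<partial>leb n) / measure (leb n) K"

lemma integrable_cov:
  assumes K: "sym_convex n K"
  shows "integrable (leb n) (\<lambda>w. indicator K w *\<^sub>R (dot n \<theta> w * dot n \<eta> w))"
proof -
  obtain v where v: "emeasure (leb n) K = ennreal v" by (rule sym_convex_volume[OF K])
  obtain R where R: "R > 0" "K \<subseteq> cube n R" using K by (auto simp: sym_convex_def)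
  have b: "\<bar>dot n \<theta> w\<bar> \<le> (\<Sum>i<n. \<bar>\<theta> i\<bar> * R)" if "w \<in> K" for w \<theta>
    unfolding dot_def using that R by (intro order_trans[OF sum_abs] sum_mono) (auto simp: abs_mult cube_def intro!: mult_left_mono)
  show ?thesis
  proof (rule integrableI_bounded_set_indicator)
    show "AE w in leb n. w \<in> K \<longrightarrow> norm (dot n \<theta> w * dot n \<eta> w) \<le> (\<Sum>i<n. \<bar>\<theta> i\<bar> * R) * (\<Sum>i<n. \<bar>\<eta> i\<bar> * R)"
      using b R(1) by (auto simp: abs_mult intro!: mult_mono sum_nonneg)
  qed (use v sym_convex_borel[OF K] in auto)
qed

lemma nn_integral_cov:
  assumes K: "sym_convex n K" and v: "v > 0" "emeasure (leb n) K = ennreal v"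
  shows "lint n (\<lambda>w. ennreal ((dot n \<theta> w)\<^sup>2) * indicator K w) = ennreal (v * cov n K \<theta> \<theta>)"
proof -
  have "lint n (\<lambda>w. ennreal ((dot n \<theta> w)\<^sup>2) * indicator K w) = lint n (\<lambda>w. ennreal (indicator K w *\<^sub>R (dot n \<theta> w * dot n \<theta> w)))"
    by (intro nn_integral_cong) (auto simp: indicator_def power2_eq_square)
  also have "... = ennreal (\<integral>w. indicator K w *\<^sub>R (dot n \<theta> w * dot n \<theta> w) \<partial>leb n)"
    by (rule nn_integral_eq_integral[OF integrable_cov[OF K]]) auto
  also have "(\<integral>w. indicator K w *\<^sub>R (dot n \<theta> w * dot n \<theta> w) \<partial>leb n) = v * cov n K \<theta> \<theta>"
    using v by (simp add: cov_def measure_def)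
  finally show ?thesis .
qed

lemma inner_form_cov:
  assumes K: "sym_convex n K"
  shows "inner_form n (cov n K)"
proof
  fix x y z :: vec and c :: real
  show "cov n K x y = cov n K y x" by (simp add: cov_def mult.commute)
  show "cov n K (x + y) z = cov n K x z + cov n K y z"
    unfolding cov_def dot_simps distrib_right scaleR_add_right
    using integrable_cov[OF K] by (simp add: add_divide_distrib)
  show "cov n K (c *\<^sub>R x) z = c * cov n K x z"
  proof -
    have "(\<lambda>w. indicator K w *\<^sub>R (dot n (c *\<^sub>R x) w * dot n z w)) = (\<lambda>w. c * (indicator K w *\<^sub>R (dot n x w * dot n z w)))"
      by (rule HOL.ext) (simp add: dot_simps)
    then show ?thesis by (simp add: cov_def)
  qed
  assume x: "x \<in> Rn n" "x \<noteq> 0"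
  have dx: "dot n x x > 0" using x dot_eq_0_iff[OF x(1)] dot_nonneg[of n x] by linarith
  obtain v where v: "v > 0" "emeasure (leb n) K = ennreal v" by (rule sym_convex_volume[OF K])
  obtain \<delta> where \<delta>: "\<delta> > 0" "cube n \<delta> \<inter> Rn n \<subseteq> K" using K by (auto simp: sym_convex_def)
  define f :: "vec \<Rightarrow> ennreal" where "f w = ennreal ((dot n x w)\<^sup>2) * indicator (cube n \<delta>) w" for w
  have fm [measurable]: "f \<in> borel_maps" unfolding f_def by measurable
  have "0 < ennreal (\<delta> ^ n * (\<delta>\<^sup>2 * (2 ^ n / 3 * dot n x x)))" using \<delta>(1) dx by simp
  also have "... = ennreal (\<delta> ^ n) * (ennreal (\<delta>\<^sup>2) * ennreal (2 ^ n / 3 * dot n x x))"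
    using \<delta>(1) by (subst ennreal_mult', simp, subst ennreal_mult') auto
  also have "... = ennreal (\<delta> ^ n) * (ennreal (\<delta>\<^sup>2) * lint n (\<lambda>w. ennreal ((dot n x w)\<^sup>2) * indicator (cube n 1) w))"
    by (simp only: cube_second_moment)
  also have "ennreal (\<delta>\<^sup>2) * lint n (\<lambda>w. ennreal ((dot n x w)\<^sup>2) * indicator (cube n 1) w) =
    lint n (\<lambda>w. ennreal (\<delta>\<^sup>2) * (ennreal ((dot n x w)\<^sup>2) * indicator (cube n 1) w))"
    by (rule nn_integral_cmult[symmetric]) measurable
  also have "... = lint n (\<lambda>w. f (\<delta> *\<^sub>R w))"
  proof (rule nn_integral_cong)
    fix w :: vec
    have "\<delta> *\<^sub>R w \<in> cube n \<delta> \<longleftrightarrow> w \<in> cube n 1" using \<delta>(1) by (auto simp: cube_def scaleR_fun_def abs_mult)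
    then show "ennreal (\<delta>\<^sup>2) * (ennreal ((dot n x w)\<^sup>2) * indicator (cube n 1) w) = f (\<delta> *\<^sub>R w)"
      by (auto simp: f_def indicator_def dot_simps power_mult_distrib ennreal_mult')
  qed
  also have "ennreal (\<delta> ^ n) * ... = lint n (\<lambda>w. f w)"
    by (rule nn_integral_Rn_scaleR[OF fm \<delta>(1)])
  also have "... \<le> lint n (\<lambda>w. ennreal ((dot n x w)\<^sup>2) * indicator K w)"
    by (rule nn_integral_mono_AE, rule eventually_mono[OF AE_Rn]) (use \<delta>(2) in \<open>auto simp: f_def indicator_def\<close>)
  also have "... = ennreal (v * cov n K x x)" by (rule nn_integral_cov[OF K v])
  finally have "0 < v * cov n K x x" by simp
  then show "0 < cov n K x x" using v(1) by (simp add: zero_less_mult_iff)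
qed

lemma cov_isometry:
  assumes K: "sym_convex n K" and U: "U \<in> isometry_group n K" and xy: "x \<in> Rn n" "y \<in> Rn n"
  shows "cov n K (U x) (U y) = cov n K x y"
proof -
  interpret inner_form n "cov n K" by (rule inner_form_cov[OF K])
  obtain v where v: "v > 0" "emeasure (leb n) K = ennreal v" by (rule sym_convex_volume[OF K])
  have Ug: "U \<in> orthogonal_group n" and UK: "U ` K = K" using U by (auto simp: isometry_group_def)
  note Ul = orthogonal_group_linear[OF Ug]
  define W where "W = ext n U"
  have WU: "W w = U w" if "w \<in> Rn n" for w unfolding W_def by (rule ext_eq[OF Ul that])
  have Wl: "linear_Rn n W" unfolding W_def by (rule linear_Rn_ext[OF Ul])
  have Wg: "W \<in> orthogonal_group n" using Wl WU orthogonal_group_norm[OF Ug] by (auto simp: orthogonal_group_def)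
  have Wm [measurable]: "W \<in> borel_maps" unfolding W_def by measurable
  have [measurable]: "K \<in> sets borel" by (rule sym_convex_borel[OF K])
  have memK: "W w \<in> K \<longleftrightarrow> w \<in> K" if w: "w \<in> Rn n" for w
  proof
    assume "W w \<in> K"
    then obtain w' where w': "w' \<in> K" "U w = U w'" using UK WU[OF w] by (metis imageE)
    have "inj_on U (Rn n)" using orthogonal_group_bij[OF Ug] by (rule bij_betw_imp_inj_on)
    then show "w \<in> K" using w' w sym_convex_Rn[OF K] by (metis inj_onD subsetD)
  next
    assume "w \<in> K"
    then show "W w \<in> K" using UK WU[OF w] by auto
  qed
  have quad: "cov n K (U z) (U z) = cov n K z z" if z: "z \<in> Rn n" for z
  proof -
    have "ennreal (v * cov n K (U z) (U z)) = lint n (\<lambda>w. ennreal ((dot n (U z) w)\<^sup>2) * indicator K w)"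
      by (rule nn_integral_cov[OF K v, symmetric])
    also have "... = lint n (\<lambda>w. ennreal ((dot n (U z) (W w))\<^sup>2) * indicator K (W w))"
      by (rule nn_integral_Rn_orthogonal[OF Wg Wm, of "\<lambda>w. ennreal ((dot n (U z) w)\<^sup>2) * indicator K w", symmetric]) measurable
    also have "... = lint n (\<lambda>w. ennreal ((dot n z w)\<^sup>2) * indicator K w)"
    proof (rule nn_integral_Rn_cong)
      fix w :: vec assume w: "w \<in> Rn n"
      have 1: "indicator K (W w) = (indicator K w :: ennreal)" using memK[OF w] by (simp add: indicator_def)
      have 2: "dot n (U z) (W w) = dot n z w" unfolding WU[OF w] by (rule orthogonal_group_dot[OF Ug z w])
      show "ennreal ((dot n (U z) (W w))\<^sup>2) * indicator K (W w) = ennreal ((dot n z w)\<^sup>2) * indicator K w"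
        unfolding 1 2 ..
    qed
    also have "... = ennreal (v * cov n K z z)" by (rule nn_integral_cov[OF K v])
    finally have "ennreal (v * cov n K (U z) (U z)) = ennreal (v * cov n K z z)" .
    moreover have "cov n K z z \<ge> 0" for z
      unfolding cov_def by (intro divide_nonneg_nonneg Bochner_Integration.integral_nonneg) auto
    ultimately have "v * cov n K (U z) (U z) = v * cov n K z z" using v(1) by (simp only: ennreal_inj mult_nonneg_nonneg less_imp_le)
    then show ?thesis using v(1) by simp
  qed
  have polar: "2 * cov n K a b = cov n K (a + b) (a + b) - cov n K a a - cov n K b b" for a b
    by (simp add: Q_add Q_add_right Q_sym[of b a])
  have "2 * cov n K (U x) (U y) = 2 * cov n K x y"
    unfolding polar linear_Rn_add[OF Ul xy, symmetric] quad[OF xy(1)] quad[OF xy(2)] quad[OF Rn_add[OF xy]] ..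
  then show ?thesis by simp
qed

text \<open>
  The functional \<open>\<lambda>y. cov n K y f\<close> is represented by a vector
  \<open>g\<close>. As \<open>cov\<close> and \<open>f\<close> are invariant under
  \<open>U\<close>, so is \<open>g\<close>, whence it is orthogonal to the complement of the fixed
  space.
\<close>

lemma cov_Fix_orthogonal:
  assumes K: "sym_convex n K" and U: "U \<in> isometry_group n K"
    and e: "e \<in> orth_complement n (Fix n U)" and f: "f \<in> Fix n U"
  shows "cov n K e f = 0"
proof -
  interpret inner_form n "cov n K" by (rule inner_form_cov[OF K])
  have Ug: "U \<in> orthogonal_group n" using U by (auto simp: isometry_group_def)
  note Ul = orthogonal_group_linear[OF Ug]
  define g :: vec where "g = (\<Sum>l<n. cov n K (unit_vec l) f *\<^sub>R unit_vec l)"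
  have gR: "g \<in> Rn n" unfolding g_def by (intro Rn_sum Rn_scaleR unit_vec_in_Rn) auto
  have rep: "dot n y g = cov n K y f" if y: "y \<in> Rn n" for y
  proof -
    have "cov n K y f = cov n K (\<Sum>l<n. y l *\<^sub>R unit_vec l) f" using arg_cong[OF Rn_expand[OF y], of "\<lambda>y. cov n K y f"] .
    also have "... = (\<Sum>l<n. y l * cov n K (unit_vec l) f)" by (simp add: Q_sum Q_scale)
    also have "... = dot n y g" unfolding g_def dot_sum_right dot_scaleR_right by (rule sum.cong) (auto simp: dot_unit_vec)
    finally show ?thesis by simp
  qed
  have UgR: "U g \<in> Rn n" by (rule linear_Rn_in[OF Ul gR])
  have fF: "f \<in> Rn n" "U f = f" using f by (auto simp: Fix_def)
  have "dot n (U g) g = cov n K (U g) (U f)" using rep[OF UgR] fF by simp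
  also have "... = dot n g g" using cov_isometry[OF K U gR fF(1)] rep[OF gR] by simp
  finally have "dot n (U g - g) (U g - g) = 0"
    using orthogonal_group_norm[OF Ug gR] by (simp add: dot_simps dot_commute[of n g "U g"])
  then have "U g = g" using dot_eq_0_iff[OF Rn_diff[OF UgR gR]] by simp
  then have "g \<in> Fix n U" using gR by (simp add: Fix_def)
  then show ?thesis using e rep[of e] by (simp add: orth_complement_def)
qed

definition isotropic :: "nat \<Rightarrow> real \<Rightarrow> vec set \<Rightarrow> bool" where
  "isotropic n v K \<longleftrightarrow> sym_convex n K \<and> v > 0 \<and> emeasure (leb n) K = ennreal v \<and>
    (\<forall>u. lint n (\<lambda>x. ennreal ((dot n u x)\<^sup>2) * indicator K x) = ennreal (v * dot n u u))"

lemma isotropic_coords: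
  assumes K: "sym_convex n K" and \<theta>: "inner_form.orthonormal n (cov n K) \<theta> n"
  obtains v where "isotropic n v (coords n \<theta> ` K)"
proof -
  interpret inner_form n "cov n K" by (rule inner_form_cov[OF K])
  obtain w where w: "w > 0" "emeasure (leb n) K = ennreal w" by (rule sym_convex_volume[OF K])
  let ?T = "coords n \<theta>"
  note bij = coords_bij[OF \<theta>]
  have S: "sym_convex n (?T ` K)" by (rule sym_convex_image[OF K linear_coords bij])
  note [measurable] = sym_convex_borel[OF S] sym_convex_borel[OF K]
  obtain c where c: "c > 0" "\<And>h :: vec \<Rightarrow> ennreal. h \<in> borel_maps \<Longrightarrow>
      lint n (\<lambda>y. h y) = ennreal c * lint n (\<lambda>x. h (?T x))"
    using nn_integral_Rn_linear[OF linear_coords coords_measurable bij] by metis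
  have mem: "?T x \<in> ?T ` K \<longleftrightarrow> x \<in> K" if "x \<in> Rn n" for x
    using inj_on_image_mem_iff[OF bij_betw_imp_inj_on[OF bij] that sym_convex_Rn[OF K]] .
  have cv: "lint n (\<lambda>y. h y * indicator (?T ` K) y) = ennreal c * lint n (\<lambda>x. h (?T x) * indicator K x)"
    if [measurable]: "h \<in> borel_maps" for h :: "vec \<Rightarrow> ennreal"
  proof -
    have "lint n (\<lambda>y. h y * indicator (?T ` K) y) = ennreal c * lint n (\<lambda>x. h (?T x) * indicator (?T ` K) (?T x))"
      by (rule c(2)) measurable
    also have "lint n (\<lambda>x. h (?T x) * indicator (?T ` K) (?T x)) = lint n (\<lambda>x. h (?T x) * indicator K x)"
      by (rule nn_integral_Rn_cong) (simp add: mem indicator_def)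
    finally show ?thesis .
  qed
  have "isotropic n (c * w) (?T ` K)"
    unfolding isotropic_def
  proof (intro conjI allI S)
    show "c * w > 0" using c(1) w(1) by simp
    show "emeasure (leb n) (?T ` K) = ennreal (c * w)"
      using cv[of "\<lambda>_. 1"] c(1) w by (simp add: ennreal_mult)
    fix u
    let ?x = "\<Sum>j<n. u j *\<^sub>R \<theta> j"
    have "lint n (\<lambda>x. ennreal ((dot n u x)\<^sup>2) * indicator (?T ` K) x) =
      ennreal c * lint n (\<lambda>x. ennreal ((dot n u (?T x))\<^sup>2) * indicator K x)"
      by (rule cv) measurable
    also have "... = ennreal c * ennreal (w * dot n u u)"
      unfolding dot_coords nn_integral_cov[OF K w] Q_combination_norm[OF \<theta>] ..
    also have "... = ennreal (c * w * dot n u u)"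
      using c(1) by (simp add: ennreal_mult'[symmetric] mult.assoc)
    finally show "lint n (\<lambda>x. ennreal ((dot n u x)\<^sup>2) * indicator (?T ` K) x) = ennreal (c * w * dot n u u)" .
  qed
  then show ?thesis by (rule that)
qed

lemma isotropic_section:
  assumes K: "isotropic n v K" and k: "k \<le> n" and L: "max_isotropy k \<le> ereal \<Lambda>"
  obtains V where "V \<ge> 0" "emeasure (leb (n - k)) {z. join k 0 z \<in> K} = ennreal V" "V \<le> (200 * \<Lambda>) ^ k * v"
    "{z. join k 0 z \<in> K} \<in> sets borel"
proof -
  have S: "sym_convex n K" and v: "v > 0" "emeasure (leb n) K = ennreal v"
    and iso: "\<And>u. lint n (\<lambda>x. ennreal ((dot n u x)\<^sup>2) * indicator K x) = ennreal (v * dot n u u)"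
    using K by (auto simp: isotropic_def)
  have [measurable]: "K \<in> sets borel" by (rule sym_convex_borel[OF S])
  have Zm: "{z. join k 0 z \<in> K} \<in> sets borel"
  proof -
    have "{z \<in> space borel. join k 0 z \<in> K} \<in> sets borel" by measurable
    then show ?thesis by simp
  qed
  show ?thesis
  proof (cases "k = 0")
    case True
    then have "{z. join k 0 z \<in> K} = K" by (simp add: join_def)
    then show ?thesis using that[of v] v True Zm by simp
  next
    case False
    define d where "d = n - k"
    have n: "n = k + d" using k by (simp add: d_def)
    obtain R \<delta> where "sym_body k d K R \<delta>"
      using sym_convex_sym_body[of k d K] S False unfolding n by auto
    then interpret sym_body k d K R \<delta> .
    have "ereal (isotropy_constant k ball_body) \<le> max_isotropy k"
      unfolding max_isotropy_def using False convex_body_ball_body by (auto intro!: SUP_upper)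
    then have "ereal (isotropy_constant k ball_body) \<le> ereal \<Lambda>" using L by (rule order_trans)
    then have "isotropy_constant k ball_body \<le> \<Lambda>" by simp
    then have "p 0 \<le> (200 * \<Lambda>) ^ k * v"
      by (intro central_section_le) (use v iso in \<open>auto simp: n\<close>)
    moreover have "emeasure (leb d) {z. join k 0 z \<in> K} = ennreal (p 0)"
    proof -
      have "emeasure (leb d) {z. join k 0 z \<in> K} = lint d (\<lambda>z. indicator {z. join k 0 z \<in> K} z)"
        using Zm by simp
      also have "... = sec 0" unfolding sec_def by (intro nn_integral_cong) (simp add: indicator_def)
      finally show ?thesis by (simp add: sec_eq)
    qed
    ultimately show ?thesis using that[of "p 0"] p_nonneg Zm by (simp add: d_def)
  qed
qed

text \<open>
  A point outside the body is separated from it by a slab, and the variance in a direction cannot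
  exceed that of the slab.
\<close>

lemma isotropic_unit_ball:
  assumes K: "isotropic n v K" and comp: "compact K" and x: "x \<in> Rn n" "dot n x x \<le> 1"
  shows "x \<in> K"
proof (rule ccontr)
  assume xK: "x \<notin> K"
  have S: "sym_convex n K" and v: "v > 0" "emeasure (leb n) K = ennreal v"
    and iso: "\<And>u. lint n (\<lambda>x. ennreal ((dot n u x)\<^sup>2) * indicator K x) = ennreal (v * dot n u u)"
    using K by (auto simp: isotropic_def)
  have [measurable]: "K \<in> sets borel" by (rule sym_convex_borel[OF S])
  have ne: "K \<noteq> {}" using v by auto
  obtain y where y: "y \<in> K" "\<And>z. z \<in> K \<Longrightarrow> dot n (x - y) (z - y) \<le> 0"
    using nearest_point[OF sym_convex_convex[OF S] comp ne] by blast
  define \<theta> where "\<theta> = x - y"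
  have \<theta>R: "\<theta> \<in> Rn n" unfolding \<theta>_def using x(1) y(1) sym_convex_Rn[OF S] by (intro Rn_diff) auto
  have \<theta>0: "dot n \<theta> \<theta> > 0"
  proof -
    have "\<theta> \<noteq> 0" using xK y(1) by (auto simp: \<theta>_def)
    then show ?thesis using dot_eq_0_iff[OF \<theta>R] dot_nonneg[of n \<theta>] by linarith
  qed
  define h where "h = dot n \<theta> y"
  have hz: "dot n \<theta> z \<le> h" if "z \<in> K" for z using y(2)[OF that] by (simp add: h_def \<theta>_def[symmetric] dot_diff_right)
  have hz2: "\<bar>dot n \<theta> z\<bar> \<le> h" if "z \<in> K" for z
    using hz[OF that] hz[OF sym_convex_uminus[OF S that]] by (simp add: dot_uminus_right abs_le_iff)
  have h0: "h \<ge> 0" using hz2[OF y(1)] by linarith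
  have hlt: "h < sqrt (dot n \<theta> \<theta>)"
  proof -
    have "h = dot n \<theta> x - dot n \<theta> \<theta>" unfolding h_def \<theta>_def by (simp add: dot_simps)
    moreover have "dot n \<theta> x \<le> sqrt (dot n \<theta> \<theta>)"
    proof (rule real_le_rsqrt)
      have "(dot n \<theta> x)\<^sup>2 \<le> dot n \<theta> \<theta> * dot n x x" by (rule dot_Cauchy_Schwarz)
      also have "... \<le> dot n \<theta> \<theta> * 1" using x(2) \<theta>0 by (intro mult_left_mono) auto
      finally show "(dot n \<theta> x)\<^sup>2 \<le> dot n \<theta> \<theta>" by simp
    qed
    ultimately show ?thesis using \<theta>0 by linarith
  qed
  have "ennreal (v * dot n \<theta> \<theta>) = lint n (\<lambda>z. ennreal ((dot n \<theta> z)\<^sup>2) * indicator K z)" by (rule iso[symmetric])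
  also have "... \<le> lint n (\<lambda>z. ennreal (h\<^sup>2) * indicator K z)"
  proof (rule nn_integral_mono)
    fix z
    show "ennreal ((dot n \<theta> z)\<^sup>2) * indicator K z \<le> ennreal (h\<^sup>2) * indicator K z"
    proof (cases "z \<in> K")
      case True
      have "\<bar>dot n \<theta> z\<bar>\<^sup>2 \<le> h\<^sup>2" by (rule power_mono[OF hz2[OF True]]) simp
      then show ?thesis using True by (simp add: ennreal_leI)
    qed simp
  qed
  also have "... = ennreal (h\<^sup>2 * v)"
    by (subst nn_integral_cmult_indicator) (use v in \<open>auto simp: ennreal_mult'\<close>)
  finally have "v * dot n \<theta> \<theta> \<le> h\<^sup>2 * v" using v(1) by (simp add: ennreal_le_iff)
  then have "dot n \<theta> \<theta> \<le> h\<^sup>2" using v(1) by (simp add: mult.commute[of v])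
  then have "sqrt (dot n \<theta> \<theta>) \<le> h" using h0 by (simp add: real_le_lsqrt)
  then show False using hlt by linarith
qed

text \<open>
  By convexity, shrinking a point of \<open>K\<close> by the factor \<open>1 - 1 / n\<close>
  leaves room for \<open>1 / n\<close> times the unit ball around it, hence for a cube with half-
  side \<open>n powr (- 3 / 2)\<close> in the first \<open>d\<close> coordinates. So the fibres
  over a slightly smaller copy of the projection are not small, and the shrinking costs at most a
  factor \<open>9\<close>.
\<close>

lemma isotropic_projection:
  assumes K: "isotropic n v K" and comp: "compact K" and d: "d \<le> n" and n: "n \<ge> 2"
  obtains V where "V \<ge> 0" "emeasure (leb (n - d)) (shift d ` K) = ennreal V"
    "V \<le> 9 * (real n * sqrt (real n)) ^ d * v" "shift d ` K \<in> sets borel"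
proof -
  have S: "sym_convex n K" and v: "v > 0" "emeasure (leb n) K = ennreal v"
    using K by (auto simp: isotropic_def)
  have Km [measurable]: "K \<in> sets borel" by (rule sym_convex_borel[OF S])
  obtain R where R: "R > 0" "K \<subseteq> cube n R" using S by (auto simp: sym_convex_def)
  define W where "W = shift d ` K"
  have Wm [measurable]: "W \<in> sets borel"
  proof -
    have "continuous_on K (shift d)"
      unfolding shift_def
      by (rule continuous_on_coordinatewise_then_product, rule continuous_on_subset[of UNIV]) (auto intro: continuous_on_product_coordinates)
    then have "compact W" unfolding W_def using comp by (rule compact_continuous_image)
    then show ?thesis by (intro borel_closed compact_imp_closed)
  qed
  have "W \<subseteq> cube (n - d) R" using R(2) by (auto simp: W_def cube_def shift_def)
  then have "emeasure (leb (n - d)) W \<le> emeasure (leb (n - d)) (cube (n - d) R)" by (intro emeasure_mono) auto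
  then have "emeasure (leb (n - d)) W < \<infinity>" using R(1) by (simp add: emeasure_cube le_less_trans)
  then obtain V where V: "V \<ge> 0" "emeasure (leb (n - d)) W = ennreal V" by (cases "emeasure (leb (n - d)) W") auto
  define c where "c = 1 - 1 / real n"
  have n0: "real n > 0" "real n \<ge> 2" using n by auto
  have c: "c > 0" "c \<le> 1" using n0 by (auto simp: c_def)
  define r where "r = 1 / (real n * sqrt (real n))"
  have r: "r > 0" using n0 by (simp add: r_def)
  have fib: "ennreal (r ^ d) * indicator W ((1 / c) *\<^sub>R z) \<le> lint d (\<lambda>x. indicator K (join d x z))" for z
  proof (cases "(1 / c) *\<^sub>R z \<in> W")
    case True
    then obtain y where y: "y \<in> K" "(1 / c) *\<^sub>R z = shift d y" by (auto simp: W_def)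
    have z: "z = c *\<^sub>R shift d y" unfolding y(2)[symmetric] using c(1) by simp
    define b where "b = c *\<^sub>R pad d y"
    have bR: "b \<in> Rn d" unfolding b_def by (rule Rn_scaleR[OF pad_in_Rn])
    have inK: "join d (x + b) z \<in> K" if x: "x \<in> Rn d" "x \<in> cube d r" for x
    proof -
      define q where "q = join d (real n *\<^sub>R x) 0"
      have qR: "q \<in> Rn n" using x(1) d by (auto simp: q_def join_def Rn_iff scaleR_fun_def)
      have "dot n q q = (\<Sum>i<d. (real n * x i) * (real n * x i))"
        unfolding dot_split[OF d, of q q] by (simp add: q_def join_def dot_def shift_def scaleR_fun_def)
      also have "... \<le> (\<Sum>i<d. 1 / real n)"
      proof (rule sum_mono)
        fix i assume "i \<in> {..<d}"
        then have "\<bar>x i\<bar> \<le> r" using x(2) by (simp add: cube_def)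
        then have "\<bar>real n * x i\<bar> \<le> real n * r" using n0 by (simp add: abs_mult)
        also have "real n * r = 1 / sqrt (real n)" using n0 by (simp add: r_def)
        finally have "\<bar>real n * x i\<bar>\<^sup>2 \<le> (1 / sqrt (real n))\<^sup>2" by (rule power_mono) simp
        then show "(real n * x i) * (real n * x i) \<le> 1 / real n" using n0 by (simp add: power2_eq_square power_divide)
      qed
      also have "... \<le> 1" using d n0 by (simp add: pos_divide_le_eq)
      finally have "q \<in> K" by (rule isotropic_unit_ball[OF K comp qR])
      then have "c *\<^sub>R y + (1 / real n) *\<^sub>R q \<in> K"
        using y(1) c n0 by (intro convexD[OF sym_convex_convex[OF S]]) (auto simp: c_def)
      moreover have "c *\<^sub>R y + (1 / real n) *\<^sub>R q = join d (x + b) z"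
        using n0 by (intro HOL.ext) (simp add: q_def z b_def join_def scaleR_fun_def shift_def pad_def)
      ultimately show ?thesis by simp
    qed
    have "ennreal (r ^ d) \<le> ennreal ((2 * r) ^ d)" using r by (intro ennreal_leI power_mono) auto
    also have "... = lint d (\<lambda>x. indicator (cube d r) x)" using r by (simp add: emeasure_cube)
    also have "... \<le> lint d (\<lambda>x. indicator K (join d (x + b) z))"
      by (rule nn_integral_mono_AE, rule eventually_mono[OF AE_Rn]) (use inK in \<open>auto simp: indicator_def\<close>)
    also have "... = lint d (\<lambda>x. indicator K (join d x z))"
      by (rule nn_integral_Rn_translate[of "\<lambda>x. indicator K (join d x z)", OF _ bR]) measurable
    finally show ?thesis using True by simp
  qed simp
  have "ennreal (r ^ d) * (ennreal (c ^ (n - d)) * ennreal V) = ennreal (r ^ d) * (ennreal (c ^ (n - d)) * lint (n - d) (\<lambda>z. indicator W ((1 / c) *\<^sub>R (c *\<^sub>R z))))"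
    using c(1) V Wm by simp
  also have "ennreal (c ^ (n - d)) * lint (n - d) (\<lambda>z. indicator W ((1 / c) *\<^sub>R (c *\<^sub>R z))) = lint (n - d) (\<lambda>z. indicator W ((1 / c) *\<^sub>R z))"
    by (rule nn_integral_Rn_scaleR[of "\<lambda>z. indicator W ((1 / c) *\<^sub>R z)", OF _ c(1)]) measurable
  also have "ennreal (r ^ d) * ... = lint (n - d) (\<lambda>z. ennreal (r ^ d) * indicator W ((1 / c) *\<^sub>R z))"
    by (rule nn_integral_cmult[symmetric]) measurable
  also have "... \<le> lint (n - d) (\<lambda>z. lint d (\<lambda>x. indicator K (join d x z)))"
    by (intro nn_integral_mono fib)
  also have "... = lint d (\<lambda>x. lint (n - d) (\<lambda>z. indicator K (join d x z)))"
    by (rule RnRn.Fubini') measurable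
  also have "... = (\<integral>\<^sup>+x. indicator K x \<partial>leb (d + (n - d)))"
    by (rule nn_integral_Rn_join[symmetric]) measurable
  also have "... = ennreal v" using d v by simp
  finally have "ennreal (r ^ d * (c ^ (n - d) * V)) \<le> ennreal v"
    using r c by (simp add: ennreal_mult'[symmetric])
  then have le: "r ^ d * (c ^ (n - d) * V) \<le> v" using v by (simp add: ennreal_le_iff)
  have c9: "1 / 9 \<le> c ^ (n - d)"
  proof -
    have "- (1 / real n) - 2 * (1 / real n)\<^sup>2 \<le> ln (1 - 1 / real n)"
      by (rule ln_one_minus_pos_lower_bound) (use n0 in auto)
    then have "real n * (- (1 / real n) - 2 * (1 / real n)\<^sup>2) \<le> real n * ln c" unfolding c_def using n0 by (intro mult_left_mono) auto
    moreover have "real n * (- (1 / real n) - 2 * (1 / real n)\<^sup>2) = - 1 - 2 / real n" using n0 by (simp add: field_simps power2_eq_square)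
    moreover have "2 / real n \<le> 1" using n0 by simp
    ultimately have "- 2 \<le> real n * ln c" by linarith
    then have "exp (- 2) \<le> exp (real n * ln c)" by simp
    also have "... = c ^ n" using c(1) by (simp add: exp_of_nat_mult)
    also have "... \<le> c ^ (n - d)" using c by (intro power_decreasing) auto
    finally have 1: "exp (- 2) \<le> c ^ (n - d)" .
    have "exp (2 :: real) = exp 1 ^ 2" by (simp add: exp_of_nat_mult[symmetric])
    also have "... \<le> 3 ^ 2" by (intro power_mono exp_le) simp
    finally have "1 / 9 \<le> exp (- 2 :: real)" by (simp add: exp_minus inverse_eq_divide le_divide_eq)
    then show ?thesis using 1 by linarith
  qed
  have "r ^ d * (1 / 9 * V) \<le> r ^ d * (c ^ (n - d) * V)" using c9 V r by (intro mult_left_mono mult_right_mono) auto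
  then have "r ^ d * (1 / 9 * V) \<le> v" using le by linarith
  moreover have "r ^ d = 1 / (real n * sqrt (real n)) ^ d" by (simp add: r_def power_one_over)
  ultimately have "V \<le> 9 * (real n * sqrt (real n)) ^ d * v" using n0 by (simp add: pos_divide_le_eq mult_ac)
  then show ?thesis using that[of V] V Wm by (simp add: W_def)
qed

section \<open>The isotropy constant of a symmetric body\<close>

lemma linear_Rn_id: "linear_Rn n (\<lambda>x. x)"
  by (auto simp: linear_Rn_def)

lemma isotropy_constant_le:
  assumes n: "n \<ge> 1" and iso: "isotropic n v (coords n \<theta> ` K)" and bij: "bij_betw (coords n \<theta>) (Rn n) (Rn n)"
  shows "isotropy_constant n K \<le> v powr (- 1 / real n)"
proof -
  let ?T = "coords n \<theta>"
  define S where "S = ?T ` K"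
  have S: "sym_convex n S" and v: "v > 0" "emeasure (leb n) S = ennreal v"
    and m2: "\<And>u. lint n (\<lambda>x. ennreal ((dot n u x)\<^sup>2) * indicator S x) = ennreal (v * dot n u u)"
    using iso by (auto simp: isotropic_def S_def)
  have Sm [measurable]: "S \<in> sets borel" by (rule sym_convex_borel[OF S])
  have n0: "real n > 0" using n by simp
  have "frob n (\<lambda>x. x) = (\<Sum>i<n. 1)"
    unfolding frob_def by (rule sum.cong) (auto simp: dot_unit_vec, simp add: unit_vec_def)
  then have fr: "frob n (\<lambda>x. x) = real n" by simp
  have "lint n (\<lambda>x. ennreal (dot n x x) * indicator S x) = ennreal (v * frob n (\<lambda>x. x))"
    by (rule nn_integral_quadratic[OF linear_Rn_id _ less_imp_le[OF v(1)] m2]) measurable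
  then have mom: "lint n (\<lambda>x. ennreal (dot n x x) * indicator S x) = ennreal (v * real n)" by (simp only: fr)
  have "(LINT x:S|leb n. dot n x x / real n) = enn2real (lint n (\<lambda>x. ennreal (1 / real n) * (ennreal (dot n x x) * indicator S x)))"
  proof -
    have "(LINT x:S|leb n. dot n x x / real n) = enn2real (lint n (\<lambda>x. ennreal (indicator S x *\<^sub>R (dot n x x / real n))))"
      unfolding set_lebesgue_integral_def by (rule integral_eq_nn_integral) auto
    also have "lint n (\<lambda>x. ennreal (indicator S x *\<^sub>R (dot n x x / real n))) =
      lint n (\<lambda>x. ennreal (1 / real n) * (ennreal (dot n x x) * indicator S x))"
      by (intro nn_integral_cong) (auto simp: indicator_def ennreal_mult'[symmetric])
    finally show ?thesis .
  qed
  also have "lint n (\<lambda>x. ennreal (1 / real n) * (ennreal (dot n x x) * indicator S x)) = ennreal (1 / real n) * ennreal (v * real n)"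
    unfolding mom[symmetric] by (rule nn_integral_cmult) measurable
  also have "... = ennreal (1 / real n * (v * real n))" by (rule ennreal_mult'[symmetric]) simp
  also have "1 / real n * (v * real n) = v" using n0 by simp
  finally have LINT: "(LINT x:S|leb n. dot n x x / real n) = v" using v(1) by simp
  have vol: "measure (leb n) S = v" using v by (simp add: measure_def)
  define g where "g T = 1 / measure (leb n) (T ` K) powr (1 + 2 / real n) *
       (LINT x:T ` K|leb n. dot n x x / real n)" for T
  have inv: "invertible_affine_Rn n ?T"
    unfolding invertible_affine_Rn_def
    by (intro exI[of _ ?T] bexI[of _ 0]) (auto simp: linear_coords bij Rn_zero)
  have "(INF T\<in>{T. invertible_affine_Rn n T}. g T) \<le> g ?T"
  proof (rule cINF_lower)
    have "0 \<le> g T" for T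
      unfolding g_def set_lebesgue_integral_def
      by (intro mult_nonneg_nonneg Bochner_Integration.integral_nonneg scaleR_nonneg_nonneg divide_nonneg_nonneg) auto
    then show "bdd_below (g ` {T. invertible_affine_Rn n T})" by (intro bdd_belowI[of _ 0]) auto
  qed (use inv in simp)
  also have "g ?T = 1 / v powr (1 + 2 / real n) * v" unfolding g_def S_def[symmetric] LINT vol ..
  also have "... = v powr (- (2 / real n))" using v(1) by (simp add: powr_add powr_minus field_simps)
  finally have "isotropy_constant n K \<le> sqrt (v powr (- (2 / real n)))"
    unfolding isotropy_constant_def g_def by (rule real_sqrt_le_mono)
  also have "sqrt (v powr (- (2 / real n))) = v powr (- 1 / real n)"
    using v(1) by (simp add: powr_half_sqrt[symmetric] powr_powr)
  finally show ?thesis .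
qed

definition split_frame :: "nat \<Rightarrow> vec set \<Rightarrow> vec set \<Rightarrow> vec set \<Rightarrow> (nat \<Rightarrow> vec) \<Rightarrow> bool" where
  "split_frame n K S1 S2 \<theta> \<longleftrightarrow> inner_form.orthonormal n (cov n K) \<theta> n \<and> dim S1 + dim S2 = n \<and>
    (\<forall>j<dim S1. \<theta> j \<in> S1) \<and> (\<forall>j. dim S1 \<le> j \<longrightarrow> j < n \<longrightarrow> \<theta> j \<in> S2)"

text \<open>
  Index \<open>0\<close> stands for the splitting into the complement of \<open>F\<close> and
  \<open>F\<close>, the indices \<open>1, \<dots>, m\<close> for those into \<open>E i\<close> and
  the fixed space of \<open>U i\<close>. The complement of \<open>F\<close> is the intersection of
  the fixed spaces, which makes the splitting at index \<open>0\<close> orthogonal for the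
  covariance form as well.
\<close>

lemma symmetric_body_isotropy:
  fixes n m :: nat and K F :: "vec set" and E :: "nat \<Rightarrow> vec set" and c :: vec
    and U :: "nat \<Rightarrow> vec \<Rightarrow> vec"
  assumes n: "n \<ge> 2" and body: "convex_body n K" and sym: "uminus ` K = K" and m: "m \<ge> 1"
    and U: "\<And>i. i \<in> {1..m} \<Longrightarrow> U i \<in> isometry_group n K" and c: "\<And>i. i \<in> {1..m} \<Longrightarrow> c i > 0"
    and E: "\<And>i. i \<in> {1..m} \<Longrightarrow> E i = orth_complement n (Fix n (U i))"
    and F: "subspace F" "F \<subseteq> Rn n"
    and proj: "\<And>x. x \<in> Rn n \<Longrightarrow> (\<Sum>i=1..m. c i *\<^sub>R orth_proj n (E i) x) = orth_proj n F x"
    and L: "\<And>i. i \<in> {1..m} \<Longrightarrow> max_isotropy (dim (E i)) \<le> ereal \<Lambda>"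
  shows "isotropy_constant n K \<le> (9 * (real n * sqrt (real n)) ^ (n - dim F)) powr (1 / real n) * (200 * \<Lambda>)"
proof -
  let ?I = "{1..m}"
  have K: "sym_convex n K" by (rule sym_convex_body[OF body sym])
  note KR = sym_convex_Rn[OF K]
  have Kc: "convex K" "compact K" using body by (auto simp: convex_body_iff)
  interpret inner_form n "cov n K" by (rule inner_form_cov[OF K])
  have G1: "200 * \<Lambda> \<ge> 1"
  proof -
    have "ereal (1 / sqrt 12) \<le> ereal \<Lambda>" using max_isotropy_ge L[of 1] m order_trans by (metis atLeastAtMost_iff le_refl)
    moreover have "sqrt 12 \<le> 200" by (rule real_le_lsqrt) auto
    then have le: "1 / 200 \<le> 1 / sqrt (12 :: real)" by (intro divide_left_mono) auto
    ultimately have "1 / sqrt 12 \<le> \<Lambda>" by simp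
    with le have "1 / 200 \<le> \<Lambda>" by (rule order_trans)
    then show ?thesis by linarith
  qed
  have Ug: "U i \<in> orthogonal_group n" if "i \<in> ?I" for i using U[OF that] by (simp add: isometry_group_def)
  have FixR: "Fix n (U i) \<subseteq> Rn n" for i by (auto simp: Fix_def)
  have Esub: "subspace (E i)" "E i \<subseteq> Rn n" if "i \<in> ?I" for i
    unfolding E[OF that] by (rule subspace_orth_complement) (auto simp: orth_complement_def)
  have Ecomp: "orth_complement n (E i) = Fix n (U i)" if "i \<in> ?I" for i
    unfolding E[OF that] by (rule orth_complement_twice[OF subspace_Fix[OF Ug[OF that]] FixR])
  define P where "P i x = orth_proj n (E i) x" for i and x :: vec
  have P: "P i x \<in> E i" "x - P i x \<in> Fix n (U i)" if "i \<in> ?I" "x \<in> Rn n" for i x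
    using orth_projD[OF Esub[OF that(1)] that(2)] by (auto simp: P_def Ecomp[OF that(1)])
  have EFix: "dot n e f = 0" if "i \<in> ?I" "e \<in> E i" "f \<in> Fix n (U i)" for i e f
    using that(2,3) unfolding E[OF that(1)] by (simp add: orth_complement_def)
  have covEFix: "cov n K e f = 0" if "i \<in> ?I" "e \<in> E i" "f \<in> Fix n (U i)" for i e f
    using cov_Fix_orthogonal[OF K U[OF that(1)]] that(2,3) unfolding E[OF that(1)] by blast
  define F' where "F' = orth_complement n F"
  have F': "subspace F'" "F' \<subseteq> Rn n" unfolding F'_def by (rule subspace_orth_complement) (auto simp: orth_complement_def)
  have F'Fix: "x \<in> Fix n (U i)" if x: "x \<in> F'" and i: "i \<in> ?I" for x i
  proof -
    have xR: "x \<in> Rn n" using x F'(2) by auto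
    have dP: "dot n x (P i x) = dot n (P i x) (P i x)" if "i \<in> ?I" for i
      using EFix[OF that P(1)[OF that xR] P(2)[OF that xR]] by (simp add: dot_diff_right dot_commute[of n x])
    have "orth_proj n F (0 + x) = 0"
      by (rule orth_proj_eq[OF F]) (use x subspace_0[OF F(1)] in \<open>auto simp: F'_def\<close>)
    then have "(\<Sum>i\<in>?I. c i *\<^sub>R P i x) = 0" using proj[OF xR] by (simp add: P_def)
    then have "dot n x (\<Sum>i\<in>?I. c i *\<^sub>R P i x) = 0" by (simp only: dot_zero)
    then have "(\<Sum>i\<in>?I. c i * dot n (P i x) (P i x)) = 0" using dP by (simp add: dot_sum_right dot_scaleR_right)
    then have "\<forall>i\<in>?I. c i * dot n (P i x) (P i x) = 0"
      by (subst (asm) sum_nonneg_eq_0_iff) (auto intro!: mult_nonneg_nonneg less_imp_le[OF c])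
    then have "c i * dot n (P i x) (P i x) = 0" using i by (rule bspec)
    then have "dot n (P i x) (P i x) = 0" using c[OF i] by simp
    then have "P i x = 0" using dot_eq_0_iff[of "P i x" n] P(1)[OF i xR] Esub(2)[OF i] by auto
    then show ?thesis using P(2)[OF i xR] by simp
  qed
  have covF: "cov n K x y = 0" if x: "x \<in> F'" and y: "y \<in> F" for x y
  proof -
    have yR: "y \<in> Rn n" using y F(2) by auto
    have "orth_proj n F (y + 0) = y"
      by (rule orth_proj_eq[OF F y]) (simp add: subspace_0[OF subspace_orth_complement])
    then have "y = (\<Sum>i\<in>?I. c i *\<^sub>R P i y)" using proj[OF yR] by (simp add: P_def)
    then have e: "cov n K y x = cov n K (\<Sum>i\<in>?I. c i *\<^sub>R P i y) x" by (rule arg_cong)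
    have "cov n K y x = (\<Sum>i\<in>?I. c i * cov n K (P i y) x)"
      unfolding e by (simp add: Q_sum Q_scale)
    also have "... = 0" using covEFix P(1)[OF _ yR] F'Fix[OF x] by (intro sum.neutral) auto
    finally show ?thesis by (simp add: Q_sym)
  qed
  define S1 where "S1 j = (if j \<in> ?I then E j else F')" for j
  define S2 where "S2 j = (if j \<in> ?I then Fix n (U j) else F)" for j
  define part where "part j x = (if j \<in> ?I then P j x else x - orth_proj n F x)" for j and x :: vec
  have S1: "subspace (S1 j)" "S1 j \<subseteq> Rn n" for j using Esub F' by (auto simp: S1_def)
  have S2: "subspace (S2 j)" "S2 j \<subseteq> Rn n" for j using subspace_Fix Ug FixR F by (auto simp: S2_def)
  have orth: "cov n K x y = 0" if "x \<in> S1 j" "y \<in> S2 j" for x y j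
    using that covEFix[of j x y] covF[of x y] by (auto simp: S1_def S2_def split: if_splits)
  have part: "part j x \<in> S1 j" "x - part j x \<in> S2 j" if "x \<in> Rn n" for j x
    using P[OF _ that] orth_projD[OF F that] by (auto simp: part_def S1_def S2_def F'_def)
  have "\<exists>\<theta>. split_frame n K (S1 j) (S2 j) \<theta>" for j
  proof -
    have "\<exists>a\<in>S1 j. \<exists>b\<in>S2 j. x = a + b" if "x \<in> Rn n" for x
      using part[OF that, of j] by (intro bexI[of _ "part j x"] bexI[of _ "x - part j x"]) auto
    then obtain \<theta> where "orthonormal \<theta> n" "dim (S1 j) + dim (S2 j) = n" "\<And>i. i < dim (S1 j) \<Longrightarrow> \<theta> i \<in> S1 j"
      "\<And>i. dim (S1 j) \<le> i \<Longrightarrow> i < n \<Longrightarrow> \<theta> i \<in> S2 j"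
      using split_basis[OF S1[of j] S2[of j] orth[of _ j]] by metis
    then show ?thesis unfolding split_frame_def by blast
  qed
  then obtain \<theta> where \<theta>f: "\<And>j. split_frame n K (S1 j) (S2 j) (\<theta> j)" by metis
  define k where "k j = dim (S1 j)" for j
  have \<theta>: "orthonormal (\<theta> j) n" and ks: "k j + dim (S2 j) = n" and \<theta>1: "i < k j \<Longrightarrow> \<theta> j i \<in> S1 j"
    and \<theta>2: "k j \<le> i \<Longrightarrow> i < n \<Longrightarrow> \<theta> j i \<in> S2 j" for i j
    using \<theta>f[of j] by (auto simp: split_frame_def k_def)
  have kn: "k j \<le> n" for j using ks[of j] by simp
  have k0: "k 0 = n - dim F" using ks[of 0] by (simp add: S2_def)
  define T where "T j = coords n (\<theta> j)" for j
  have Tl: "linear_Rn n (T j)" for j unfolding T_def by (rule linear_coords)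
  have Tb: "bij_betw (T j) (Rn n) (Rn n)" for j unfolding T_def by (rule coords_bij[OF \<theta>])
  obtain B where B: "linear_Rn n B" "\<And>x. x \<in> Rn n \<Longrightarrow> B (T 0 x) = x" "\<And>x. x \<in> Rn n \<Longrightarrow> T 0 (B x) = x" "B \<in> borel_maps"
    using linear_Rn_inv[OF Tl[of 0] Tb[of 0]] by metis
  have BR: "B x \<in> Rn n" if "x \<in> Rn n" for x by (rule linear_Rn_in[OF B(1) that])
  define Or where "Or j x = T j (B x)" for j and x :: vec
  have Orm: "Or j \<in> borel_maps" for j
    unfolding Or_def T_def by (rule measurable_compose[OF B(4) coords_measurable])
  have norms: "\<exists>y. y \<in> Rn n \<and> cov n K y y = dot n x x \<and> (\<forall>j. dot n (Or j x) (Or j x) = cov n K y y) \<and>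
      (\<forall>j. dot (k j) (Or j x) (Or j x) = cov n K (part j y) y)" if x: "x \<in> Rn n" for x
  proof -
    obtain y where y: "y \<in> Rn n" "\<And>z. z \<in> Rn n \<Longrightarrow> cov n K y z = dot n z (B x)" using representer[OF \<theta>[of 0], of "B x"] by metis
    have 1: "dot n (Or j x) (Or j x) = cov n K y y" for j
      unfolding Or_def T_def by (rule coords_norm[OF \<theta> y])
    have "Or 0 x = x" unfolding Or_def by (rule B(3)[OF x])
    then have 2: "cov n K y y = dot n x x" using 1[of 0] by simp
    have 3: "dot (k j) (Or j x) (Or j x) = cov n K (part j y) y" for j
      unfolding Or_def T_def
      by (rule coords_partial_norm[OF \<theta> y S1(2) orth kn \<theta>1 \<theta>2 part[OF y(1)]]) simp_all
    show ?thesis using y(1) 1 2 3 by blast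
  qed
  have Org: "Or j \<in> orthogonal_group n" for j
  proof -
    have "linear_Rn n (Or j)"
      unfolding linear_Rn_def Or_def using BR linear_Rn_in[OF Tl] linear_Rn_add[OF B(1)] linear_Rn_add[OF Tl] linear_Rn_scaleR[OF B(1)] linear_Rn_scaleR[OF Tl]
      by auto
    moreover have "dot n (Or j x) (Or j x) = dot n x x" if "x \<in> Rn n" for x using norms[OF that] by metis
    ultimately show ?thesis by (simp add: orthogonal_group_def)
  qed
  define K' where "K' = T 0 ` K"
  obtain v where iso: "isotropic n v K'" unfolding K'_def T_def by (rule isotropic_coords[OF K \<theta>])
  have v: "v > 0" "emeasure (leb n) K' = ennreal v" and SK': "sym_convex n K'" using iso by (auto simp: isotropic_def)
  have K'c: "compact K'"
  proof -
    have "K' = ext n (T 0) ` K" unfolding K'_def using ext_eq[OF Tl] KR by (intro image_cong) auto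
    then show ?thesis using compact_continuous_image[OF continuous_ext Kc(2)] by simp
  qed
  have memK': "x \<in> K' \<longleftrightarrow> B x \<in> K" if x: "x \<in> Rn n" for x
  proof
    assume "x \<in> K'"
    then obtain w where w: "w \<in> K" "x = T 0 w" by (auto simp: K'_def)
    then show "B x \<in> K" using B(2)[of w] KR by auto
  next
    assume "B x \<in> K"
    then show "x \<in> K'" unfolding K'_def using B(3)[OF x] by (metis imageI)
  qed
  have isoj: "isotropic n v (T j ` K)" for j
  proof -
    obtain v' where v': "isotropic n v' (T j ` K)" unfolding T_def by (rule isotropic_coords[OF K \<theta>])
    then have e': "v' > 0" "emeasure (leb n) (T j ` K) = ennreal v'" and b [measurable]: "T j ` K \<in> sets borel"
      using sym_convex_borel by (auto simp: isotropic_def)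
    have [measurable]: "K' \<in> sets borel" by (rule sym_convex_borel[OF SK'])
    have "ennreal v' = lint n (\<lambda>x. indicator (T j ` K) x)" using e' by simp
    also have "... = lint n (\<lambda>x. indicator (T j ` K) (Or j x))"
      by (rule nn_integral_Rn_orthogonal[OF Org Orm, of "\<lambda>x. indicator (T j ` K) x", symmetric]) measurable
    also have "... = lint n (\<lambda>x. indicator K' x)"
    proof (rule nn_integral_Rn_cong)
      fix x :: vec assume x: "x \<in> Rn n"
      have "Or j x \<in> T j ` K \<longleftrightarrow> B x \<in> K"
        unfolding Or_def by (rule inj_on_image_mem_iff[OF bij_betw_imp_inj_on[OF Tb] BR[OF x] KR])
      then show "indicator (T j ` K) (Or j x) = (indicator K' x :: ennreal)" using memK'[OF x] by (simp add: indicator_def)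
    qed
    also have "... = ennreal v" using v by simp
    finally have "v' = v" using e'(1) v(1) by simp
    then show ?thesis using v' by simp
  qed
  define D where "D = 9 * (real n * sqrt (real n)) ^ (n - dim F)"
  define G where "G = 200 * \<Lambda>"
  define W where "W j = (if j \<in> ?I then {z. join (k j) 0 z \<in> T j ` K} else shift (n - dim F) ` K')" for j
  have "\<exists>V. V \<ge> 0 \<and> emeasure (leb (n - k j)) (W j) = ennreal V \<and> W j \<in> sets borel \<and>
      (j \<in> ?I \<longrightarrow> V \<le> G ^ k j * v) \<and> (j \<notin> ?I \<longrightarrow> V \<le> D * v)" for j
  proof (cases "j \<in> ?I")
    case True
    then have "k j = dim (E j)" by (simp add: k_def S1_def)
    then have "max_isotropy (k j) \<le> ereal \<Lambda>" using L[OF True] by simp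
    then obtain V where "V \<ge> 0" "emeasure (leb (n - k j)) {z. join (k j) 0 z \<in> T j ` K} = ennreal V"
      "V \<le> (200 * \<Lambda>) ^ k j * v" "{z. join (k j) 0 z \<in> T j ` K} \<in> sets borel"
      by (rule isotropic_section[OF isoj[of j] kn[of j]])
    then show ?thesis using True unfolding W_def G_def by (intro exI[of _ V]) simp
  next
    case False
    have "S1 j = F'" unfolding S1_def by (rule if_not_P[OF False])
    moreover have "S1 0 = F'" by (simp add: S1_def)
    ultimately have "k j = k 0" by (simp add: k_def)
    then have kj: "k j = n - dim F" using k0 by simp
    obtain V where "V \<ge> 0" "emeasure (leb (n - (n - dim F))) (shift (n - dim F) ` K') = ennreal V"
      "V \<le> 9 * (real n * sqrt (real n)) ^ (n - dim F) * v" "shift (n - dim F) ` K' \<in> sets borel"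
      by (rule isotropic_projection[OF iso K'c diff_le_self n])
    moreover have "W j = shift (n - dim F) ` K'" unfolding W_def by (rule if_not_P[OF False])
    ultimately show ?thesis using False unfolding D_def kj by (intro exI[of _ V]) (simp only: simp_thms)
  qed
  then obtain V where VV: "\<And>j. V j \<ge> 0 \<and> emeasure (leb (n - k j)) (W j) = ennreal (V j) \<and> W j \<in> sets borel \<and>
      (j \<in> ?I \<longrightarrow> V j \<le> G ^ k j * v) \<and> (j \<notin> ?I \<longrightarrow> V j \<le> D * v)"
    by metis
  then have V: "V j \<ge> 0" "emeasure (leb (n - k j)) (W j) = ennreal (V j)" "W j \<in> sets borel"
    "j \<in> ?I \<Longrightarrow> V j \<le> G ^ k j * v" "j \<notin> ?I \<Longrightarrow> V j \<le> D * v" for j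
    by blast+
  define \<sigma> where "\<sigma> = (\<Sum>i\<in>?I. c i)"
  have \<sigma>: "\<sigma> > 0" unfolding \<sigma>_def using c m by (intro sum_pos) auto
  \<comment> \<open>The weights are normalised by \<open>\<sigma>\<close> for the frame to sum up to the identity.\<close>
  define a where "a j = (if j \<in> ?I then c j / \<sigma> else 1 / \<sigma>)" for j
  let ?J = "insert 0 ?I"
  have a0: "a j > 0" for j using c \<sigma> by (auto simp: a_def)
  have shiftW: "shift (k j) (Or j x) \<in> W j" if j: "j \<in> ?J" and x: "x \<in> K'" for j x
  proof -
    have xR: "x \<in> Rn n" using x sym_convex_Rn[OF SK'] by auto
    define w where "w = B x"
    have w: "w \<in> K" "w \<in> Rn n" using memK'[OF xR] x BR[OF xR] by (auto simp: w_def)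
    show ?thesis
    proof (cases "j \<in> ?I")
      case True
      define f where "f = w - P j w"
      have ff: "f \<in> Fix n (U j)" and ee: "P j w \<in> E j" using P[OF True w(2)] by (auto simp: f_def)
      have fK: "f \<in> K"
        by (rule fixed_part_in_body[OF U[OF True] Kc KR w(1) _ ff ee[unfolded E[OF True]]]) (simp add: f_def)
      have "join (k j) 0 (shift (k j) (T j w)) = T j f"
      proof
        fix i
        consider "i < k j" | "k j \<le> i" "i < n" | "n \<le> i" by linarith
        then show "join (k j) 0 (shift (k j) (T j w)) i = T j f i"
        proof cases
          case 1
          then have "\<theta> j i \<in> E j" using \<theta>1[of i j] True by (simp add: S1_def)
          then have "dot n (\<theta> j i) f = 0" by (rule EFix[OF True _ ff])
          then show ?thesis using 1 by (simp add: join_def T_def coords_def)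
        next
          case 2
          then have "\<theta> j i \<in> Fix n (U j)" using \<theta>2[of j i] True by (simp add: S2_def)
          then have "dot n (P j w) (\<theta> j i) = 0" by (rule EFix[OF True ee])
          then have "dot n (\<theta> j i) (P j w) = 0" by (simp add: dot_commute[of n "\<theta> j i"])
          then show ?thesis using 2 by (simp add: join_def T_def coords_def shift_def f_def dot_diff_right)
        next
          case 3
          then show ?thesis using kn[of j] by (simp add: join_def T_def coords_def shift_def)
        qed
      qed
      then show ?thesis using True fK by (simp add: W_def Or_def w_def[symmetric])
    next
      case False
      then have "j = 0" using j by blast
      then have "Or j x = x" using B(3)[OF xR] by (simp add: Or_def)
      then show ?thesis using False x k0 \<open>j = 0\<close> by (auto simp: W_def)
    qed
  qed
  have frame: "(\<Sum>j\<in>?J. a j * dot (n - k j) (shift (k j) (Or j x)) (shift (k j) (Or j x))) = dot n x x" if x: "x \<in> Rn n" for x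
  proof -
    obtain y where y: "y \<in> Rn n" "cov n K y y = dot n x x" "\<And>j. dot n (Or j x) (Or j x) = cov n K y y"
      "\<And>j. dot (k j) (Or j x) (Or j x) = cov n K (part j y) y"
      using norms[OF x] by blast
    have sh: "dot (n - k j) (shift (k j) (Or j x)) (shift (k j) (Or j x)) = cov n K y y - cov n K (part j y) y" for j
      using dot_split[OF kn, of "Or j x" "Or j x" j] y(3,4)[of j] by (simp add: dot_def[of "k j"])
    have "(\<Sum>j\<in>?I. c j * (cov n K y y - cov n K (part j y) y)) = \<sigma> * cov n K y y - (\<Sum>j\<in>?I. c j * cov n K (P j y) y)"
      unfolding \<sigma>_def by (simp add: right_diff_distrib sum_subtractf sum_distrib_right part_def)
    also have "(\<Sum>j\<in>?I. c j * cov n K (P j y) y) = cov n K (orth_proj n F y) y"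
      unfolding proj[OF y(1), symmetric] by (simp add: Q_sum Q_scale P_def)
    finally have s1: "(\<Sum>j\<in>?I. c j * (cov n K y y - cov n K (part j y) y)) = \<sigma> * cov n K y y - cov n K (orth_proj n F y) y" .
    have s0: "cov n K y y - cov n K (part 0 y) y = cov n K (orth_proj n F y) y" by (simp add: part_def Q_diff)
    have "(\<Sum>j\<in>?J. a j * (cov n K y y - cov n K (part j y) y)) =
      a 0 * (cov n K y y - cov n K (part 0 y) y) + (\<Sum>j\<in>?I. a j * (cov n K y y - cov n K (part j y) y))"
      by (subst sum.insert) auto
    also have "(\<Sum>j\<in>?I. a j * (cov n K y y - cov n K (part j y) y)) = (\<Sum>j\<in>?I. c j * (cov n K y y - cov n K (part j y) y)) / \<sigma>"
      unfolding sum_divide_distrib by (rule sum.cong) (auto simp: a_def)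
    also have "a 0 * (cov n K y y - cov n K (part 0 y) y) + ... = cov n K y y"
      unfolding s1 s0 using \<sigma> by (simp add: a_def field_simps)
    finally show ?thesis unfolding sh y(2) .
  qed
  obtain R where R: "R > 0" "K' \<subseteq> cube n R" using SK' by (auto simp: sym_convex_def)
  have "v \<le> (\<Prod>j\<in>?J. V j powr a j)"
  proof (rule geometric_brascamp_lieb[where K=K' and n=n and k=k and Or=Or and W=W and r=1 and \<rho>="real n * R\<^sup>2"])
    fix x assume x: "x \<in> K'"
    have "dot n x x \<le> (\<Sum>i<n. R\<^sup>2)"
      unfolding dot_def
    proof (rule sum_mono)
      fix i assume "i \<in> {..<n}"
      then have "\<bar>x i\<bar> \<le> R" using x R(2) by (auto simp: cube_def)
      then have "\<bar>x i\<bar>\<^sup>2 \<le> R\<^sup>2" by (rule power_mono) simp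
      then show "x i * x i \<le> R\<^sup>2" by (simp add: power2_eq_square)
    qed
    then show "dot n x x \<le> real n * R\<^sup>2" by simp
  next
    fix x assume "x \<in> Rn n" "dot n x x \<le> 1\<^sup>2"
    then show "x \<in> K'" using isotropic_unit_ball[OF iso K'c] by simp
  qed (use a0 Org Orm kn frame V shiftW v sym_convexD[OF SK'] in auto)
  also have "(\<Prod>j\<in>?J. V j powr a j) \<le> (\<Prod>j\<in>?J. (if j \<in> ?I then G ^ k j * v else D * v) powr a j)"
    using V a0 by (intro prod_mono) (auto intro!: powr_mono2 less_imp_le[OF a0])
  also have "... = (D * v) powr (1 / \<sigma>) * (\<Prod>j\<in>?I. (G ^ k j * v) powr (c j / \<sigma>))"
    by (subst prod.insert) (auto simp: a_def intro!: prod.cong)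
  also have "(\<Prod>j\<in>?I. (G ^ k j * v) powr (c j / \<sigma>)) = (\<Prod>j\<in>?I. G powr (real (k j) * c j / \<sigma>)) * (\<Prod>j\<in>?I. v powr (c j / \<sigma>))"
  proof -
    have "(G ^ k j * v) powr (c j / \<sigma>) = G powr (real (k j) * c j / \<sigma>) * v powr (c j / \<sigma>)" for j
    proof -
      have "G > 0" using G1 by (simp add: G_def)
      then have "G ^ k j = G powr real (k j)" by (simp add: powr_realpow)
      then show ?thesis by (simp add: powr_mult powr_powr)
    qed
    then show ?thesis by (simp add: prod.distrib)
  qed
  also have "(\<Prod>j\<in>?I. v powr (c j / \<sigma>)) = v powr (\<Sum>j\<in>?I. c j / \<sigma>)" using v(1) by (intro powr_sum[symmetric]) auto
  also have "(\<Sum>j\<in>?I. c j / \<sigma>) = 1" unfolding sum_divide_distrib[symmetric] \<sigma>_def[symmetric] using \<sigma> by simp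
  also have "(\<Prod>j\<in>?I. G powr (real (k j) * c j / \<sigma>)) = G powr (\<Sum>j\<in>?I. real (k j) * c j / \<sigma>)"
    using G1 by (intro powr_sum[symmetric]) (auto simp: G_def)
  finally have main: "v \<le> (D * v) powr (1 / \<sigma>) * (G powr (\<Sum>j\<in>?I. real (k j) * c j / \<sigma>) * v powr 1)" .
  have trace: "(\<Sum>j\<in>?I. real (k j) * c j) = real (dim F)"
  proof -
    have "(\<Sum>j\<in>?I. real (k j) * c j) = (\<Sum>j\<in>?I. c j * (\<Sum>l<n. dot n (P j (unit_vec l)) (unit_vec l)))"
      by (rule sum.cong) (auto simp: P_def trace_orth_proj[OF Esub] k_def S1_def)
    also have "... = (\<Sum>l<n. \<Sum>j\<in>?I. c j * dot n (P j (unit_vec l)) (unit_vec l))"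
      unfolding sum_distrib_left by (rule sum.swap)
    also have "... = (\<Sum>l<n. dot n (orth_proj n F (unit_vec l)) (unit_vec l))"
    proof (rule sum.cong)
      fix l assume "l \<in> {..<n}"
      then have "unit_vec l \<in> Rn n" by (intro unit_vec_in_Rn) simp
      from proj[OF this, symmetric] show "(\<Sum>j\<in>?I. c j * dot n (P j (unit_vec l)) (unit_vec l)) = dot n (orth_proj n F (unit_vec l)) (unit_vec l)"
        by (simp only: dot_sum_left dot_scaleR_left P_def)
    qed simp
    also have "... = real (dim F)" by (rule trace_orth_proj[OF F])
    finally show ?thesis .
  qed
  have dF: "dim F \<le> n" using ks[of 0] by (simp add: S2_def)
  have G1': "G \<ge> 1" using G1 by (simp add: G_def)
  have n0: "real n > 0" using n by simp
  have D0: "D > 0" using n0 by (simp add: D_def)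
  have "1 * v \<le> ((D * v) powr (1 / \<sigma>) * G powr (\<Sum>j\<in>?I. real (k j) * c j / \<sigma>)) * v" using main v(1) by (simp add: mult.assoc)
  then have "1 \<le> (D * v) powr (1 / \<sigma>) * G powr (\<Sum>j\<in>?I. real (k j) * c j / \<sigma>)" using v(1) by (rule mult_right_le_imp_le)
  then have "1 powr \<sigma> \<le> ((D * v) powr (1 / \<sigma>) * G powr (\<Sum>j\<in>?I. real (k j) * c j / \<sigma>)) powr \<sigma>" using \<sigma> by (intro powr_mono2) auto
  also have "... = ((D * v) powr (1 / \<sigma>)) powr \<sigma> * (G powr (\<Sum>j\<in>?I. real (k j) * c j / \<sigma>)) powr \<sigma>" by (rule powr_mult)
  also have "((D * v) powr (1 / \<sigma>)) powr \<sigma> = D * v" using \<sigma> D0 v(1) by (simp add: powr_powr)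
  also have "(G powr (\<Sum>j\<in>?I. real (k j) * c j / \<sigma>)) powr \<sigma> = G powr (real (dim F))"
    unfolding powr_powr sum_divide_distrib[symmetric] trace using \<sigma> by simp
  also have "D * v * G powr (real (dim F)) \<le> D * v * G powr (real n)"
    using D0 v(1) G1' dF by (intro mult_left_mono powr_mono) auto
  finally have "1 \<le> D * v * G powr real n" by simp
  then have "1 / v \<le> D * G powr real n" using v(1) by (simp add: pos_divide_le_eq mult_ac)
  then have "(1 / v) powr (1 / real n) \<le> (D * G powr real n) powr (1 / real n)" using v(1) n0 by (intro powr_mono2) auto
  also have "... = D powr (1 / real n) * (G powr real n) powr (1 / real n)" by (rule powr_mult)
  also have "(G powr real n) powr (1 / real n) = G" using n0 G1' by (simp add: powr_powr)
  finally have fin: "(1 / v) powr (1 / real n) \<le> D powr (1 / real n) * G" .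
  have "isotropy_constant n K \<le> v powr (- 1 / real n)"
    by (rule isotropy_constant_le[of n v "\<theta> 0"]) (use n isoj[of 0] Tb[of 0] in \<open>auto simp: T_def\<close>)
  also have "v powr (- 1 / real n) = (1 / v) powr (1 / real n)" using v(1) by (simp add: powr_minus_divide powr_divide)
  finally show ?thesis using fin unfolding D_def G_def by linarith
qed

text \<open>
  The only place where the bound on the codimension enters.
\<close>

lemma codimension_factor:
  assumes n: "n \<ge> 2" and d: "real d \<le> \<alpha> * real n / ln (real n)"
  shows "(9 * (real n * sqrt (real n)) ^ d) powr (1 / real n) \<le> 3 * exp (3 / 2 * \<alpha>)"
proof -
  have n0: "real n \<ge> 2" using n by simp
  have ln0: "ln (real n) > 0" using n0 by simp
  have q: "real n * sqrt (real n) = real n powr (3 / 2)"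
  proof -
    have "real n powr (3 / 2) = real n powr (1 + 1 / 2)" by simp
    also have "... = real n powr 1 * real n powr (1 / 2)" by (rule powr_add)
    finally show ?thesis using n0 by (simp add: powr_half_sqrt)
  qed
  have "(9 * (real n * sqrt (real n)) ^ d) powr (1 / real n) = 9 powr (1 / real n) * ((real n * sqrt (real n)) ^ d) powr (1 / real n)"
    by (rule powr_mult)
  moreover have "9 powr (1 / real n) \<le> (3 :: real)"
  proof -
    have "9 powr (1 / real n) \<le> (9 :: real) powr (1 / 2)" using n0 by (intro powr_mono) (auto simp: divide_le_eq)
    also have "(9 :: real) powr (1 / 2) = 3" by (simp add: powr_half_sqrt real_sqrt_unique)
    finally show ?thesis .
  qed
  moreover have "((real n * sqrt (real n)) ^ d) powr (1 / real n) \<le> exp (3 / 2 * \<alpha>)"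
  proof -
    have "(real n * sqrt (real n)) ^ d = (real n powr (3 / 2)) powr real d"
      unfolding q using n0 by (intro powr_realpow[symmetric]) simp
    then have "((real n * sqrt (real n)) ^ d) powr (1 / real n) = real n powr (3 / 2 * real d * (1 / real n))"
      by (simp only: powr_powr)
    also have "... = exp (3 / 2 * real d * (1 / real n) * ln (real n))" using n0 by (simp add: powr_def)
    also have "... \<le> exp (3 / 2 * \<alpha>)"
    proof -
      have "real d * ln (real n) \<le> \<alpha> * real n" using d ln0 by (simp add: pos_le_divide_eq)
      then have "real d * ln (real n) / real n \<le> \<alpha>" using n0 by (simp add: pos_divide_le_eq)
      then have "3 / 2 * (real d * ln (real n) / real n) \<le> 3 / 2 * \<alpha>" by simp
      then show ?thesis by simp
    qed
    finally show ?thesis .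
  qed
  ultimately show ?thesis by (simp add: mult_mono)
qed

theorem theorem24:
  fixes \<alpha> :: real
  assumes "\<alpha> > 0"
  shows "\<exists>C::real. \<forall>(n::nat) (K :: (nat \<Rightarrow> real) set) (m::nat)
      (U :: nat \<Rightarrow> (nat \<Rightarrow> real) \<Rightarrow> nat \<Rightarrow> real) (c :: nat \<Rightarrow> real)
      (E :: nat \<Rightarrow> (nat \<Rightarrow> real) set) (F :: (nat \<Rightarrow> real) set) (d::nat).
      n \<ge> 2 \<longrightarrow>
      convex_body n K \<longrightarrow>
      uminus ` K = K \<longrightarrow>
      m \<ge> 1 \<longrightarrow>
      (\<forall>i\<in>{1..m}. U i \<in> isometry_group n K \<and> c i > 0 \<and> E i = orth_complement n (Fix n (U i))) \<longrightarrow>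
      subspace F \<longrightarrow> F \<subseteq> Rn n \<longrightarrow>
      (\<forall>x\<in>Rn n. (\<Sum>i=1..m. c i *\<^sub>R orth_proj n (E i) x) = orth_proj n F x) \<longrightarrow>
      d = n - dim F \<longrightarrow>
      real d \<le> \<alpha> * real n / ln (real n) \<longrightarrow>
      ereal (isotropy_constant n K) \<le> ereal C * (MAX i\<in>{1..m}. max_isotropy (dim (E i)))"
proof (intro exI[of _ "600 * exp (3 / 2 * \<alpha>)"] allI impI)
  fix n :: nat and K :: "(nat \<Rightarrow> real) set" and m :: nat and U :: "nat \<Rightarrow> (nat \<Rightarrow> real) \<Rightarrow> nat \<Rightarrow> real"
    and c :: "nat \<Rightarrow> real" and E :: "nat \<Rightarrow> (nat \<Rightarrow> real) set" and F :: "(nat \<Rightarrow> real) set" and d :: nat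
  assume n: "n \<ge> 2" and body: "convex_body n K" "uminus ` K = K" and m: "m \<ge> 1"
    and U: "\<forall>i\<in>{1..m}. U i \<in> isometry_group n K \<and> c i > 0 \<and> E i = orth_complement n (Fix n (U i))"
    and F: "subspace F" "F \<subseteq> Rn n"
    and proj: "\<forall>x\<in>Rn n. (\<Sum>i=1..m. c i *\<^sub>R orth_proj n (E i) x) = orth_proj n F x"
    and d: "d = n - dim F" "real d \<le> \<alpha> * real n / ln (real n)"
  define M where "M = (MAX i\<in>{1..m}. max_isotropy (dim (E i)))"
  have le: "max_isotropy (dim (E i)) \<le> M" if "i \<in> {1..m}" for i
    unfolding M_def by (rule Max_ge) (use that in auto)
  have low: "ereal (1 / sqrt 12) \<le> M" using max_isotropy_ge[of "dim (E 1)"] le[of 1] m by (meson atLeastAtMost_iff le_refl order_trans)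
  show "ereal (isotropy_constant n K) \<le> ereal (600 * exp (3 / 2 * \<alpha>)) * (MAX i\<in>{1..m}. max_isotropy (dim (E i)))"
    unfolding M_def[symmetric]
  proof (cases M)
    case (real \<Lambda>)
    have "1 / sqrt 12 \<le> \<Lambda>" using low real by simp
    then have \<Lambda>: "\<Lambda> \<ge> 0" by (rule order_trans[rotated]) simp
    have "isotropy_constant n K \<le> (9 * (real n * sqrt (real n)) ^ (n - dim F)) powr (1 / real n) * (200 * \<Lambda>)"
      by (rule symmetric_body_isotropy[where U=U and c=c and E=E and m=m]) (use n body m U F proj le real in auto)
    also have "\<dots> \<le> (3 * exp (3 / 2 * \<alpha>)) * (200 * \<Lambda>)"
      using codimension_factor[OF n d(2)] \<Lambda> unfolding d(1) by (intro mult_right_mono) auto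
    finally show "ereal (isotropy_constant n K) \<le> ereal (600 * exp (3 / 2 * \<alpha>)) * M" unfolding real by simp
  next
    case PInf
    then show "ereal (isotropy_constant n K) \<le> ereal (600 * exp (3 / 2 * \<alpha>)) * M" by simp
  next
    case MInf
    then show "ereal (isotropy_constant n K) \<le> ereal (600 * exp (3 / 2 * \<alpha>)) * M" using low by simp
  qed
qed

end
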